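(* Let $\varphi$ be an inner function and let $k^\varphi$ be the reproducing kernel for the model space $\mathcal{H}(\varphi)$. Then $$M(k^\varphi)=\mathrm{Iso}(\varphi).$$ Moreover, for every $\mu$ in this set and every $f\in\mathcal{H}(\varphi)$, $$\lim_{r\to1^-}\|\Phi(f)-f_r\|_{L^2(\mathbb{T},\mu)}=0,$$ where $\Phi:\mathcal{H}(\varphi)\to L^2(\mathbb{T},\mu)$ is the isometry which extends the boundary restriction map $g\mapsto g|_{\mathbb{T}}$ defined on $\mathcal{A}(\varphi)$.
   Context: $\mathbb{D}$ is the open unit disc, $\mathbb{T}$ the unit circle, $m$ the normalized Lebesgue measure on $\mathbb{T}$. $H^2$ is the Hardy space of the disc, identified with a closed subspace of $L^2(\mathbb{T},m)$ via non-tangential boundary values. A function $\varphi\in H^2$ is inner if its boundary values satisfy $|\varphi|=1$ $m$-a.e. on $\mathbb{T}$. The model space is $\mathcal{H}(\varphi)=H^2\ominus\varphi H^2$; it is a reproducing kernel Hilbert space with kernel $k^\varphi_z(w)=\frac{1-\overline{\varphi(z)}\varphi(w)}{1-\overline{z}w}$, $z,w\in\mathbb{D}$. For $f:\mathbb{D}\to\mathbb{C}$ and $r\in(0,1)$, $f_r(\omega)=f(r\omega)$ for $\omega\in\mathbb{T}$. Given a finite positive Borel measure $\mu$ on $\mathbb{T}$, $f^*\in L^2(\mathbb{T},\mu)$ is an extension of $f$ (with respect to $\mu$) if $\lim_{r\to1^-}\|f^*-f_r\|_{L^2(\mathbb{T},\mu)}=0$. For a positive definite kernel $k:\mathbb{D}\times\mathbb{D}\to\mathbb{C}$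 write $k_z=k(\cdot,z)$. $M(k)$ is the set of all finite positive Borel measures $\mu$ on $\mathbb{T}$ such that every $k_z$, $z\in\mathbb{D}$, admits an extension $k_z^*\in L^2(\mathbb{T},\mu)$ and $k_z(w)=\int_{\mathbb{T}}k_z^*(\zeta)\overline{k_w^*(\zeta)}\,d\mu(\zeta)$ for all $z,w\in\mathbb{D}$ ("$k$ reproduces itself with respect to $\mu$"). $\mathcal{A}(\varphi)=A\cap\mathcal{H}(\varphi)$, where $A$ is the disc algebra (functions continuous on $\overline{\mathbb{D}}$ and analytic on $\mathbb{D}$); it is dense in $\mathcal{H}(\varphi)$. $\mathrm{Iso}(\varphi)$ is the set of finite positive Borel measures $\mu$ on $\mathbb{T}$ such that $\int_{\mathbb{T}}|g|^2\,d\mu=\|g\|_{H^2}^2$ for every $g\in\mathcal{A}(\varphi)$. For $\mu\in\mathrm{Iso}(\varphi)$ the restriction map $g\mapsto g|_{\mathbb{T}}$ on $\mathcal{A}(\varphi)$ therefore extends by density to an isometry $\Phi:\mathcal{H}(\varphi)\to L^2(\mathbb{T},\mu)$. (By a theorem of Aleksandrov, $\Phi(f)(\omega)=\lim_{\angle z\to\omega}f(z)$, the non-tangential limit, for $\mu$-a.e. $\omega\in\mathbb{T}$.) *)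

theory Defs
  imports "HOL-Analysis.Analysis"
begin

text \<open>A function on the open unit disc is a total function of type
  \<^typ>\<open>complex \<Rightarrow> complex\<close> whose values off the disc are irrelevant, and an element of
  \<open>L\<^sup>2(\<mu>)\<close> is given by a representative, so that equality there means equality almost everywhere.\<close>

definition is_circle_measure :: "complex measure \<Rightarrow> bool" where
  "is_circle_measure \<mu> \<longleftrightarrow>
     finite_measure \<mu> \<and> sets \<mu> = sets (restrict_space borel (sphere 0 1))"

text \<open>Normalized Lebesgue measure on the circle, completed so that functions given only almost
  everywhere, such as boundary values, are measurable.\<close>

definition circle_lebesgue :: "complex measure" where
  "circle_lebesgue =
     completion (distr (uniform_measure lborel {0..<2 * pi}) (restrict_space borel (sphere 0 1)) cis)"

definition L2_space :: "complex measure \<Rightarrow> (complex \<Rightarrow> complex) set" where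
  "L2_space \<mu> = {F \<in> borel_measurable \<mu>. integrable \<mu> (\<lambda>\<omega>. (cmod (F \<omega>))\<^sup>2)}"

definition L2_norm :: "complex measure \<Rightarrow> (complex \<Rightarrow> complex) \<Rightarrow> real" where
  "L2_norm \<mu> F = sqrt (\<integral>\<omega>. (cmod (F \<omega>))\<^sup>2 \<partial>\<mu>)"

definition dilate :: "(complex \<Rightarrow> complex) \<Rightarrow> real \<Rightarrow> complex \<Rightarrow> complex" where
  "dilate f r = (\<lambda>\<omega>. f (of_real r * \<omega>))"

text \<open>Convergence along this filter is convergence within every Stolz region with vertex \<open>\<omega>\<close>.\<close>

definition nontangential :: "complex \<Rightarrow> complex filter" where
  "nontangential \<omega> =
     (SUP c\<in>{1::real<..}. at \<omega> within {z \<in> ball 0 1. dist z \<omega> < c * (1 - cmod z)})"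

definition boundary_value :: "(complex \<Rightarrow> complex) \<Rightarrow> complex \<Rightarrow> complex" where
  "boundary_value f \<omega> = Lim (nontangential \<omega>) f"

definition hardy2 :: "(complex \<Rightarrow> complex) set" where
  "hardy2 = {f. f holomorphic_on ball 0 1 \<and>
     bdd_above ((\<lambda>r. L2_norm circle_lebesgue (dilate f r)) ` {0<..<1})}"

definition hardy2_inner :: "(complex \<Rightarrow> complex) \<Rightarrow> (complex \<Rightarrow> complex) \<Rightarrow> complex" where
  "hardy2_inner f g =
     (\<integral>\<omega>. boundary_value f \<omega> * cnj (boundary_value g \<omega>) \<partial>circle_lebesgue)"

definition hardy2_norm :: "(complex \<Rightarrow> complex) \<Rightarrow> real" where
  "hardy2_norm f = L2_norm circle_lebesgue (boundary_value f)"

definition inner_function :: "(complex \<Rightarrow> complex) \<Rightarrow> bool" where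
  "inner_function \<phi> \<longleftrightarrow>
     \<phi> \<in> hardy2 \<and> (AE \<omega> in circle_lebesgue. cmod (boundary_value \<phi> \<omega>) = 1)"

definition model_space :: "(complex \<Rightarrow> complex) \<Rightarrow> (complex \<Rightarrow> complex) set" where
  "model_space \<phi> = {f \<in> hardy2. \<forall>g\<in>hardy2. hardy2_inner f (\<lambda>z. \<phi> z * g z) = 0}"

text \<open>For a kernel \<open>k\<close>, the function \<open>k\<^sub>z\<close> is \<open>\<lambda>w. k w z\<close>.\<close>

definition model_kernel :: "(complex \<Rightarrow> complex) \<Rightarrow> complex \<Rightarrow> complex \<Rightarrow> complex" where
  "model_kernel \<phi> w z = (1 - cnj (\<phi> z) * \<phi> w) / (1 - cnj z * w)"

definition is_extension ::
    "complex measure \<Rightarrow> (complex \<Rightarrow> complex) \<Rightarrow> (complex \<Rightarrow> complex) \<Rightarrow> bool" where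
  "is_extension \<mu> f F \<longleftrightarrow>
     F \<in> L2_space \<mu> \<and>
     (\<forall>\<^sub>F r in at_left 1. dilate f r \<in> L2_space \<mu>) \<and>
     ((\<lambda>r. L2_norm \<mu> (\<lambda>\<omega>. F \<omega> - dilate f r \<omega>)) \<longlongrightarrow> 0) (at_left 1)"

definition reproducing_measures :: "(complex \<Rightarrow> complex \<Rightarrow> complex) \<Rightarrow> complex measure set" where
  "reproducing_measures k = {\<mu>. is_circle_measure \<mu> \<and>
     (\<exists>K. (\<forall>z\<in>ball 0 1. is_extension \<mu> (\<lambda>w. k w z) (K z)) \<and>
          (\<forall>z\<in>ball 0 1. \<forall>w\<in>ball 0 1. k w z = (\<integral>\<zeta>. K z \<zeta> * cnj (K w \<zeta>) \<partial>\<mu>)))}"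

definition disc_algebra :: "(complex \<Rightarrow> complex) set" where
  "disc_algebra = {g. continuous_on (cball 0 1) g \<and> g holomorphic_on ball 0 1}"

definition model_disc_algebra :: "(complex \<Rightarrow> complex) \<Rightarrow> (complex \<Rightarrow> complex) set" where
  "model_disc_algebra \<phi> = disc_algebra \<inter> model_space \<phi>"

definition isometric_measures :: "(complex \<Rightarrow> complex) \<Rightarrow> complex measure set" where
  "isometric_measures \<phi> = {\<mu>. is_circle_measure \<mu> \<and>
     (\<forall>g\<in>model_disc_algebra \<phi>. (\<integral>\<omega>. (cmod (g \<omega>))\<^sup>2 \<partial>\<mu>) = (hardy2_norm g)\<^sup>2)}"

text \<open>Linear isometries from the model space into \<open>L\<^sup>2(\<mu>)\<close> that extend the restriction map
  \<open>g \<mapsto> g|\<^sub>T\<close> from the disc algebra part of the model space.\<close>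

definition is_isometric_extension ::
    "(complex \<Rightarrow> complex) \<Rightarrow> complex measure \<Rightarrow>
     ((complex \<Rightarrow> complex) \<Rightarrow> complex \<Rightarrow> complex) \<Rightarrow> bool" where
  "is_isometric_extension \<phi> \<mu> \<Phi> \<longleftrightarrow>
     (\<forall>f\<in>model_space \<phi>. \<Phi> f \<in> L2_space \<mu> \<and> L2_norm \<mu> (\<Phi> f) = hardy2_norm f) \<and>
     (\<forall>f\<in>model_space \<phi>. \<forall>g\<in>model_space \<phi>. \<forall>a b.
        AE \<omega> in \<mu>. \<Phi> (\<lambda>z. a * f z + b * g z) \<omega> = a * \<Phi> f \<omega> + b * \<Phi> g \<omega>) \<and>
     (\<forall>g\<in>model_disc_algebra \<phi>. AE \<omega> in \<mu>. \<Phi> g \<omega> = g \<omega>)"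

end

theory Submission
  imports Defs "HOL-Complex_Analysis.Complex_Analysis"
begin

text \<open>
Functions in the Hardy space are represented by their Taylor coefficients: \<open>fn a\<close> is the function with
the square-summable coefficients \<open>a\<close>.  For an inner function \<open>\<phi> = fn p\<close> the model space is then a closed
subspace \<open>K\<close> of the sequence space with reproducing kernels \<open>ker z\<close>, and \<open>ext a F\<close> says that the
dilates of \<open>fn a\<close> converge to \<open>F\<close> in \<open>L2(\<mu>)\<close>.  Both sets of measures in the theorem
are shown to consist of the \<open>\<mu>\<close> for which every \<open>a\<close> in \<open>K\<close> has such an \<open>F\<close> with
\<open>L2_norm \<mu> F = norm a\<close> (the predicate \<open>isometric\<close>).

The difficulty is to pass from a dense subset \<open>D\<close> of \<open>K\<close>, on which the radial limits exist and preserve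
norms, to all of \<open>K\<close>: dilates of functions in \<open>K\<close> lie outside \<open>K\<close>, so there is no a priori bound for
them in \<open>L2(\<mu>)\<close>.  The way out is the backward shift \<open>B f = (f - f 0) / z\<close>, which maps \<open>K\<close> to itself.
If \<open>F\<close> is the image of \<open>f\<close> under the isometry obtained by density, then the image of \<open>B f\<close> is
\<open>cnj \<omega> * (F - f 0)\<close>; iterating, \<open>F\<close> differs from the Taylor polynomial of \<open>f\<close> of degree less than \<open>N\<close>
by \<open>\<omega>^N\<close> times the image of the \<open>N\<close>-fold backward shift, whose norm is that of a tail of the Taylor series.
So the Taylor series converges to \<open>F\<close> in \<open>L2(\<mu>)\<close>, and by Abel's theorem so do the dilates
(\<open>ext_of_closure\<close>).  The argument needs \<open>D\<close> to be mapped by \<open>B\<close> into the domain of the closure of the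
extension map, with \<open>cnj \<omega> * (F - f 0)\<close> as the value of this closure.

For \<open>\<mu>\<close> isometric on the disc algebra part of the model space, \<open>D\<close> is this part, which is invariant
under \<open>B\<close>.  Its density is a theorem of Aleksandrov (\<open>disc_algebra_dense\<close>), proved by duality.  Given
\<open>f\<close> in \<open>K\<close>, \<open>f \<noteq> 0\<close>, one looks for an absolutely convergent combination of dilated functions that is
orthogonal to \<open>\<phi> H2\<close> but not to \<open>f\<close>.  The Krein--Smulian construction supplies it from the coset of \<open>f\<close>
modulo \<open>\<phi>\<close> times functions of Smirnov type: this coset meets the bounded sets of Cauchy transforms in compact sets,
and it does not contain 0, because a quotient of Smirnov type of a Hardy space function by \<open>\<phi>\<close> is again in the Hardy
space (\<open>smirnov_quotient_hardy\<close>).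

For \<open>\<mu>\<close> reproducing the kernel, \<open>D\<close> is the span of the kernels, where norms are preserved by sesquilinearity.
This span is invariant under \<open>B\<close> only modulo \<open>q = B \<phi>\<close>.  The kernel combinations that vanish at 0
give, since multiplication by \<open>\<omega>\<close> is unitary on \<open>L2(\<mu>)\<close>, equations for the inner products with the
extension \<open>U\<close> of \<open>q\<close>: they are the right ones up to a factor \<open>\<sigma>\<close>, and the norm of \<open>U\<close> satisfies
\<open>(L2_norm \<mu> U)^2 = (norm q)^2 * (2 * Re \<sigma> - 1)\<close>.  As the norm of \<open>U\<close> is at least
\<open>cmod \<sigma> * norm q\<close>, this forces \<open>\<sigma> = 1\<close> (\<open>defect_q\<close>), so \<open>U\<close> is the
value of the closed extension map at \<open>q\<close>.

Boundary values of Hardy space functions, on which the norm of the Hardy space is based, come from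
Fatou's theorem on nontangential limits (\<open>fatou_nontangential\<close>).
\<close>

section \<open>Square-integrable functions\<close>

definition L2_inner :: "complex measure \<Rightarrow> (complex \<Rightarrow> complex) \<Rightarrow> (complex \<Rightarrow> complex) \<Rightarrow> complex" where
  "L2_inner \<mu> F G = (\<integral>\<omega>. F \<omega> * cnj (G \<omega>) \<partial>\<mu>)"

lemma L2_space_measurable [measurable_dest]: "F \<in> L2_space \<mu> \<Longrightarrow> F \<in> borel_measurable \<mu>"
  by (simp add: L2_space_def)

lemma L2_norm_nonneg [simp]: "0 \<le> L2_norm \<mu> F"
  by (simp add: L2_norm_def)

lemma L2_norm_power2: "(L2_norm \<mu> F)\<^sup>2 = (\<integral>\<omega>. (cmod (F \<omega>))\<^sup>2 \<partial>\<mu>)"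
  by (simp add: L2_norm_def)

lemma borel_measurable_cnj [measurable (raw)]:
  "F \<in> borel_measurable M \<Longrightarrow> (\<lambda>x. cnj (F x)) \<in> borel_measurable M"
  by (rule measurable_compose[where g = cnj]) (auto intro: borel_measurable_continuous_onI continuous_on_cnj continuous_on_id)

lemma L2_product_integrable:
  assumes "F \<in> L2_space \<mu>" "G \<in> L2_space \<mu>"
  shows "integrable \<mu> (\<lambda>\<omega>. F \<omega> * cnj (G \<omega>))"
proof (rule Bochner_Integration.integrable_bound)
  show "integrable \<mu> (\<lambda>\<omega>. (cmod (F \<omega>))\<^sup>2 + (cmod (G \<omega>))\<^sup>2)"
    using assms by (simp add: L2_space_def)
  show "(\<lambda>\<omega>. F \<omega> * cnj (G \<omega>)) \<in> borel_measurable \<mu>"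
    using assms by (auto simp: L2_space_def)
  have "cmod (F \<omega>) * cmod (G \<omega>) \<le> (cmod (F \<omega>))\<^sup>2 + (cmod (G \<omega>))\<^sup>2" for \<omega>
    using sum_squares_bound[of "cmod (F \<omega>)" "cmod (G \<omega>)"]
      mult_nonneg_nonneg[OF norm_ge_zero[of "F \<omega>"] norm_ge_zero[of "G \<omega>"]]
    by linarith
  then show "AE \<omega> in \<mu>. norm (F \<omega> * cnj (G \<omega>)) \<le> norm ((cmod (F \<omega>))\<^sup>2 + (cmod (G \<omega>))\<^sup>2)"
    by (intro AE_I2) (simp add: norm_mult)
qed

lemma L2_space_scale: "F \<in> L2_space \<mu> \<Longrightarrow> (\<lambda>\<omega>. c * F \<omega>) \<in> L2_space \<mu>"
  by (auto simp: L2_space_def norm_mult power_mult_distrib)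

lemma L2_space_zero [simp]: "(\<lambda>\<omega>. 0) \<in> L2_space \<mu>"
  by (simp add: L2_space_def)

lemma cmod_power2_eq_Re: "(cmod z)\<^sup>2 = Re (z * cnj z)"
  by (simp add: complex_mult_cnj cmod_power2)

lemma L2_space_add:
  assumes F: "F \<in> L2_space \<mu>" and G: "G \<in> L2_space \<mu>"
  shows "(\<lambda>\<omega>. F \<omega> + G \<omega>) \<in> L2_space \<mu>"
proof -
  have "(\<lambda>\<omega>. (cmod (F \<omega> + G \<omega>))\<^sup>2) =
      (\<lambda>\<omega>. (cmod (F \<omega>))\<^sup>2 + (cmod (G \<omega>))\<^sup>2 + 2 * Re (F \<omega> * cnj (G \<omega>)))"
    unfolding cmod_power2 by (simp add: fun_eq_iff power2_eq_square algebra_simps)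
  moreover have "integrable \<mu> (\<lambda>\<omega>. (cmod (F \<omega>))\<^sup>2 + (cmod (G \<omega>))\<^sup>2 + 2 * Re (F \<omega> * cnj (G \<omega>)))"
    using F G L2_product_integrable[OF F G]
    by (intro Bochner_Integration.integrable_add integrable_mult_right integrable_Re) (auto simp: L2_space_def)
  ultimately show ?thesis
    using F G by (auto simp: L2_space_def)
qed

lemma L2_space_diff:
  assumes F: "F \<in> L2_space \<mu>" and G: "G \<in> L2_space \<mu>"
  shows "(\<lambda>\<omega>. F \<omega> - G \<omega>) \<in> L2_space \<mu>"
  using L2_space_add[OF F L2_space_scale[OF G, of "-1"]] by simp

lemma L2_space_mult_unimodular:
  assumes "F \<in> L2_space \<mu>" "u \<in> borel_measurable \<mu>" "\<And>\<omega>. \<omega> \<in> space \<mu> \<Longrightarrow> cmod (u \<omega>) = 1"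
  shows "(\<lambda>\<omega>. u \<omega> * F \<omega>) \<in> L2_space \<mu>"
proof -
  have "integrable \<mu> (\<lambda>\<omega>. (cmod (u \<omega> * F \<omega>))\<^sup>2) \<longleftrightarrow> integrable \<mu> (\<lambda>\<omega>. (cmod (F \<omega>))\<^sup>2)"
    by (rule Bochner_Integration.integrable_cong) (use assms in \<open>auto simp: norm_mult\<close>)
  then show ?thesis
    using assms by (auto simp: L2_space_def)
qed

lemma L2_norm_cong: "(\<And>\<omega>. \<omega> \<in> space \<mu> \<Longrightarrow> cmod (F \<omega>) = cmod (G \<omega>)) \<Longrightarrow> L2_norm \<mu> F = L2_norm \<mu> G"
  unfolding L2_norm_def by (metis (mono_tags, lifting) Bochner_Integration.integral_cong)

lemma L2_norm_cong_AE:
  assumes "F \<in> borel_measurable \<mu>" "G \<in> borel_measurable \<mu>" "AE \<omega> in \<mu>. F \<omega> = G \<omega>"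
  shows "L2_norm \<mu> F = L2_norm \<mu> G"
proof -
  have "(\<integral>\<omega>. (cmod (F \<omega>))\<^sup>2 \<partial>\<mu>) = (\<integral>\<omega>. (cmod (G \<omega>))\<^sup>2 \<partial>\<mu>)"
    by (rule integral_cong_AE) (use assms in auto)
  then show ?thesis by (simp add: L2_norm_def)
qed

lemma L2_space_cong_AE:
  assumes "F \<in> borel_measurable \<mu>" "AE \<omega> in \<mu>. F \<omega> = G \<omega>" "G \<in> L2_space \<mu>"
  shows "F \<in> L2_space \<mu>"
proof -
  have "integrable \<mu> (\<lambda>\<omega>. (cmod (F \<omega>))\<^sup>2) \<longleftrightarrow> integrable \<mu> (\<lambda>\<omega>. (cmod (G \<omega>))\<^sup>2)"
    by (rule integrable_cong_AE) (use assms in \<open>auto simp: L2_space_def\<close>)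
  then show ?thesis using assms by (simp add: L2_space_def)
qed

lemma L2_norm_scale: "L2_norm \<mu> (\<lambda>\<omega>. c * F \<omega>) = cmod c * L2_norm \<mu> F"
  by (simp add: L2_norm_def norm_mult power_mult_distrib real_sqrt_mult)

lemma L2_norm_minus_commute: "L2_norm \<mu> (\<lambda>\<omega>. F \<omega> - G \<omega>) = L2_norm \<mu> (\<lambda>\<omega>. G \<omega> - F \<omega>)"
  by (rule L2_norm_cong) (simp add: norm_minus_commute)

lemma L2_inner_self: "L2_inner \<mu> F F = of_real ((L2_norm \<mu> F)\<^sup>2)"
proof -
  have "L2_inner \<mu> F F = (\<integral>\<omega>. complex_of_real ((cmod (F \<omega>))\<^sup>2) \<partial>\<mu>)"
    unfolding L2_inner_def
    by (rule Bochner_Integration.integral_cong) (simp_all flip: complex_norm_square)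
  also have "\<dots> = of_real (\<integral>\<omega>. (cmod (F \<omega>))\<^sup>2 \<partial>\<mu>)"
    by (rule integral_complex_of_real)
  finally show ?thesis by (simp add: L2_norm_power2)
qed

lemma L2_inner_commute: "L2_inner \<mu> F G = cnj (L2_inner \<mu> G F)"
  unfolding L2_inner_def by (simp add: mult.commute flip: Bochner_Integration.integral_cnj)

lemma L2_inner_add_left:
  assumes "F \<in> L2_space \<mu>" "G \<in> L2_space \<mu>" "H \<in> L2_space \<mu>"
  shows "L2_inner \<mu> (\<lambda>\<omega>. F \<omega> + G \<omega>) H = L2_inner \<mu> F H + L2_inner \<mu> G H"
  using L2_product_integrable[OF assms(1,3)] L2_product_integrable[OF assms(2,3)]
  by (simp add: L2_inner_def distrib_right)

lemma L2_inner_scale_left: "L2_inner \<mu> (\<lambda>\<omega>. c * F \<omega>) G = c * L2_inner \<mu> F G"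
  by (simp add: L2_inner_def mult.assoc)

lemma L2_inner_scale_right: "L2_inner \<mu> F (\<lambda>\<omega>. c * G \<omega>) = cnj c * L2_inner \<mu> F G"
  by (metis L2_inner_commute L2_inner_scale_left complex_cnj_mult)

lemma L2_inner_add_right:
  assumes "F \<in> L2_space \<mu>" "G \<in> L2_space \<mu>" "H \<in> L2_space \<mu>"
  shows "L2_inner \<mu> H (\<lambda>\<omega>. F \<omega> + G \<omega>) = L2_inner \<mu> H F + L2_inner \<mu> H G"
  by (metis (no_types, lifting) L2_inner_add_left[OF assms] L2_inner_commute complex_cnj_add)

lemma L2_inner_diff_left:
  assumes "F \<in> L2_space \<mu>" "G \<in> L2_space \<mu>" "H \<in> L2_space \<mu>"
  shows "L2_inner \<mu> (\<lambda>\<omega>. F \<omega> - G \<omega>) H = L2_inner \<mu> F H - L2_inner \<mu> G H"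
  using L2_product_integrable[OF assms(1,3)] L2_product_integrable[OF assms(2,3)]
  by (simp add: L2_inner_def left_diff_distrib)

lemma L2_inner_diff_right:
  assumes "F \<in> L2_space \<mu>" "G \<in> L2_space \<mu>" "H \<in> L2_space \<mu>"
  shows "L2_inner \<mu> H (\<lambda>\<omega>. F \<omega> - G \<omega>) = L2_inner \<mu> H F - L2_inner \<mu> H G"
  by (metis (no_types, lifting) L2_inner_diff_left[OF assms] L2_inner_commute complex_cnj_diff)

lemma L2_norm_add_power2:
  assumes "F \<in> L2_space \<mu>" "G \<in> L2_space \<mu>"
  shows "(L2_norm \<mu> (\<lambda>\<omega>. F \<omega> + G \<omega>))\<^sup>2 =
      (L2_norm \<mu> F)\<^sup>2 + 2 * Re (L2_inner \<mu> F G) + (L2_norm \<mu> G)\<^sup>2"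
proof -
  have FG: "(\<lambda>\<omega>. F \<omega> + G \<omega>) \<in> L2_space \<mu>" by (intro L2_space_add assms)
  have "complex_of_real ((L2_norm \<mu> (\<lambda>\<omega>. F \<omega> + G \<omega>))\<^sup>2) =
      L2_inner \<mu> F F + L2_inner \<mu> F G + cnj (L2_inner \<mu> F G) + L2_inner \<mu> G G"
    unfolding L2_inner_self[symmetric] L2_inner_commute[of \<mu> G F, symmetric]
    by (simp add: L2_inner_add_left[OF assms FG] L2_inner_add_right[OF assms assms(1)]
      L2_inner_add_right[OF assms assms(2)])
  then have "Re (complex_of_real ((L2_norm \<mu> (\<lambda>\<omega>. F \<omega> + G \<omega>))\<^sup>2)) =
      Re (L2_inner \<mu> F F + L2_inner \<mu> F G + cnj (L2_inner \<mu> F G) + L2_inner \<mu> G G)"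
    by simp
  then show ?thesis by (simp add: L2_inner_self flip: of_real_power)
qed

lemma L2_cauchy_schwarz:
  assumes F: "F \<in> L2_space \<mu>" and G: "G \<in> L2_space \<mu>"
  shows "cmod (L2_inner \<mu> F G) \<le> L2_norm \<mu> F * L2_norm \<mu> G"
proof -
  define c where "c = L2_inner \<mu> F G"
  have quad: "0 \<le> (L2_norm \<mu> F)\<^sup>2 + 2 * t * (cmod c)\<^sup>2 + t\<^sup>2 * (cmod c)\<^sup>2 * (L2_norm \<mu> G)\<^sup>2" for t :: real
  proof -
    have "0 \<le> (L2_norm \<mu> (\<lambda>\<omega>. F \<omega> + (of_real t * c) * G \<omega>))\<^sup>2" by simp
    also have "\<dots> = (L2_norm \<mu> F)\<^sup>2 + 2 * Re (cnj (of_real t * c) * c)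
        + (cmod (of_real t * c) * L2_norm \<mu> G)\<^sup>2"
      by (subst L2_norm_add_power2[OF F L2_space_scale[OF G]])
        (simp add: L2_inner_scale_right L2_norm_scale c_def)
    also have "Re (cnj (of_real t * c) * c) = t * (cmod c)\<^sup>2"
      unfolding cmod_power2 by (simp add: power2_eq_square algebra_simps)
    finally show ?thesis by (simp add: norm_mult power_mult_distrib algebra_simps)
  qed
  have "(cmod c)\<^sup>2 \<le> (L2_norm \<mu> F)\<^sup>2 * (L2_norm \<mu> G)\<^sup>2"
  proof (cases "L2_norm \<mu> G = 0 \<or> c = 0")
    case True
    have "c = 0" if "L2_norm \<mu> G = 0"
    proof (rule ccontr)
      assume "c \<noteq> 0"
      then have "0 < (cmod c)\<^sup>2" by simp
      then show False
        using quad[of "- ((L2_norm \<mu> F)\<^sup>2 + 1) / (2 * (cmod c)\<^sup>2)"] that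
        by (simp add: divide_simps split: if_splits)
    qed
    then show ?thesis using True by auto
  next
    case False
    then have g: "0 < (L2_norm \<mu> G)\<^sup>2" by auto
    have "0 \<le> (L2_norm \<mu> F)\<^sup>2 + 2 * (- 1 / g) * k + (- 1 / g)\<^sup>2 * k * g \<Longrightarrow> k \<le> (L2_norm \<mu> F)\<^sup>2 * g"
      if "0 < g" for g k :: real
      using that by (simp add: field_simps power2_eq_square)
    from this[OF g quad] show ?thesis .
  qed
  then show ?thesis
    unfolding c_def by (simp flip: power_mult_distrib)
qed

lemma L2_norm_triangle:
  assumes F: "F \<in> L2_space \<mu>" and G: "G \<in> L2_space \<mu>"
  shows "L2_norm \<mu> (\<lambda>\<omega>. F \<omega> + G \<omega>) \<le> L2_norm \<mu> F + L2_norm \<mu> G"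
proof (rule power2_le_imp_le)
  have "Re (L2_inner \<mu> F G) \<le> L2_norm \<mu> F * L2_norm \<mu> G"
    using L2_cauchy_schwarz[OF F G] complex_Re_le_cmod order_trans by blast
  then show "(L2_norm \<mu> (\<lambda>\<omega>. F \<omega> + G \<omega>))\<^sup>2 \<le> (L2_norm \<mu> F + L2_norm \<mu> G)\<^sup>2"
    by (simp add: L2_norm_add_power2[OF F G] power2_sum)
qed simp

lemma L2_norm_triangle_diff:
  assumes "F \<in> L2_space \<mu>" "G \<in> L2_space \<mu>" "H \<in> L2_space \<mu>"
  shows "L2_norm \<mu> (\<lambda>\<omega>. F \<omega> - H \<omega>) \<le> L2_norm \<mu> (\<lambda>\<omega>. F \<omega> - G \<omega>) + L2_norm \<mu> (\<lambda>\<omega>. G \<omega> - H \<omega>)"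
  using L2_norm_triangle[OF L2_space_diff[OF assms(1,2)] L2_space_diff[OF assms(2,3)]] by simp

lemma L2_norm_triangle_minus:
  assumes F: "F \<in> L2_space \<mu>" and G: "G \<in> L2_space \<mu>"
  shows "\<bar>L2_norm \<mu> F - L2_norm \<mu> G\<bar> \<le> L2_norm \<mu> (\<lambda>\<omega>. F \<omega> - G \<omega>)"
  using L2_norm_triangle[OF G L2_space_diff[OF F G]] L2_norm_triangle[OF F L2_space_diff[OF G F]]
    L2_norm_minus_commute[of \<mu> F G]
  by (simp add: abs_le_iff)

lemma L2_norm_eq_0_AE:
  assumes "F \<in> L2_space \<mu>" "L2_norm \<mu> F = 0"
  shows "AE \<omega> in \<mu>. F \<omega> = 0"
proof -
  have "integrable \<mu> (\<lambda>\<omega>. (cmod (F \<omega>))\<^sup>2)" "(\<integral>\<omega>. (cmod (F \<omega>))\<^sup>2 \<partial>\<mu>) = 0"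
    using assms by (auto simp: L2_space_def L2_norm_def)
  then have "AE \<omega> in \<mu>. (cmod (F \<omega>))\<^sup>2 = 0"
    by (subst (asm) integral_nonneg_eq_0_iff_AE) auto
  then show ?thesis by simp
qed

lemma L2_space_bounded:
  assumes "finite_measure \<mu>" "F \<in> borel_measurable \<mu>" "\<And>\<omega>. \<omega> \<in> space \<mu> \<Longrightarrow> cmod (F \<omega>) \<le> B"
  shows "F \<in> L2_space \<mu>"
proof -
  interpret finite_measure \<mu> by fact
  have "integrable \<mu> (\<lambda>\<omega>. (cmod (F \<omega>))\<^sup>2)"
    by (rule integrable_const_bound[where B = "B\<^sup>2"])
      (use assms in \<open>auto intro!: AE_I2 power_mono\<close>)
  then show ?thesis using assms by (simp add: L2_space_def)
qed

lemma L2_norm_bounded: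
  assumes "finite_measure \<mu>" "F \<in> L2_space \<mu>" "0 \<le> B" "\<And>\<omega>. \<omega> \<in> space \<mu> \<Longrightarrow> cmod (F \<omega>) \<le> B"
  shows "L2_norm \<mu> F \<le> B * sqrt (measure \<mu> (space \<mu>))"
proof -
  interpret finite_measure \<mu> by fact
  have "(\<integral>\<omega>. (cmod (F \<omega>))\<^sup>2 \<partial>\<mu>) \<le> (\<integral>\<omega>. B\<^sup>2 \<partial>\<mu>)"
    by (rule integral_mono) (use assms in \<open>auto simp: L2_space_def intro!: power_mono\<close>)
  also have "\<dots> = B\<^sup>2 * measure \<mu> (space \<mu>)" by simp
  finally have "L2_norm \<mu> F \<le> sqrt (B\<^sup>2 * measure \<mu> (space \<mu>))"
    by (simp add: L2_norm_def)
  then show ?thesis using assms by (simp add: real_sqrt_mult)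
qed

lemma L2_integrable:
  assumes "finite_measure \<mu>" "F \<in> L2_space \<mu>"
  shows "integrable \<mu> F" "(\<integral>\<omega>. cmod (F \<omega>) \<partial>\<mu>) \<le> L2_norm \<mu> F * sqrt (measure \<mu> (space \<mu>))"
proof -
  interpret finite_measure \<mu> by fact
  have one: "(\<lambda>\<omega>. 1) \<in> L2_space \<mu>"
    by (rule L2_space_bounded[OF assms(1), of _ 1]) auto
  show "integrable \<mu> F" using L2_product_integrable[OF assms(2) one] by simp
  have abs: "(\<lambda>\<omega>. complex_of_real (cmod (F \<omega>))) \<in> L2_space \<mu>"
    using assms by (auto simp: L2_space_def)
  have "L2_inner \<mu> (\<lambda>\<omega>. complex_of_real (cmod (F \<omega>))) (\<lambda>\<omega>. 1) = of_real (\<integral>\<omega>. cmod (F \<omega>) \<partial>\<mu>)"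
    unfolding L2_inner_def using integral_complex_of_real[of \<mu> "\<lambda>\<omega>. cmod (F \<omega>)"] by simp
  then have "(\<integral>\<omega>. cmod (F \<omega>) \<partial>\<mu>) \<le> L2_norm \<mu> (\<lambda>\<omega>. complex_of_real (cmod (F \<omega>))) * L2_norm \<mu> (\<lambda>\<omega>. 1)"
    using L2_cauchy_schwarz[OF abs one] by simp
  then show "(\<integral>\<omega>. cmod (F \<omega>) \<partial>\<mu>) \<le> L2_norm \<mu> F * sqrt (measure \<mu> (space \<mu>))"
    by (simp add: L2_norm_def)
qed

text \<open>Fatou's lemma for norms: it gives norm bounds for pointwise limits.\<close>

lemma L2_norm_le_liminf:
  assumes X: "\<And>n. X n \<in> L2_space \<mu>" and F: "F \<in> borel_measurable \<mu>"
    and lim: "AE \<omega> in \<mu>. (\<lambda>n. X n \<omega>) \<longlonglongrightarrow> F \<omega>" and bd: "\<And>n. L2_norm \<mu> (X n) \<le> C"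
  shows "F \<in> L2_space \<mu>" "L2_norm \<mu> F \<le> C"
proof -
  have C: "0 \<le> C" using bd[of 0] L2_norm_nonneg[of \<mu> "X 0"] by linarith
  have meas: "X n \<in> borel_measurable \<mu>" for n using X by (simp add: L2_space_def)
  have nn: "(\<integral>\<^sup>+ \<omega>. ennreal ((cmod (F \<omega>))\<^sup>2) \<partial>\<mu>) \<le> ennreal (C\<^sup>2)"
  proof -
    have "(\<integral>\<^sup>+ \<omega>. ennreal ((cmod (F \<omega>))\<^sup>2) \<partial>\<mu>) = (\<integral>\<^sup>+ \<omega>. liminf (\<lambda>n. ennreal ((cmod (X n \<omega>))\<^sup>2)) \<partial>\<mu>)"
    proof (rule nn_integral_cong_AE)
      show "AE \<omega> in \<mu>. ennreal ((cmod (F \<omega>))\<^sup>2) = liminf (\<lambda>n. ennreal ((cmod (X n \<omega>))\<^sup>2))"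
        using lim
      proof eventually_elim
        case (elim \<omega>)
        have "(\<lambda>n. ennreal ((cmod (X n \<omega>))\<^sup>2)) \<longlonglongrightarrow> ennreal ((cmod (F \<omega>))\<^sup>2)"
          by (intro tendsto_ennrealI tendsto_power tendsto_norm elim)
        then show ?case by (rule lim_imp_Liminf[OF sequentially_bot, symmetric])
      qed
    qed
    also have "\<dots> \<le> liminf (\<lambda>n. \<integral>\<^sup>+ \<omega>. ennreal ((cmod (X n \<omega>))\<^sup>2) \<partial>\<mu>)"
      by (rule nn_integral_liminf) (use meas in measurable)
    also have "\<dots> = liminf (\<lambda>n. ennreal ((L2_norm \<mu> (X n))\<^sup>2))"
      using X by (simp add: nn_integral_eq_integral L2_space_def L2_norm_power2)
    also have "\<dots> \<le> ennreal (C\<^sup>2)"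
      by (intro Liminf_le) (use bd in \<open>auto intro!: eventuallyI ennreal_leI power_mono\<close>)
    finally show ?thesis .
  qed
  have int: "integrable \<mu> (\<lambda>\<omega>. (cmod (F \<omega>))\<^sup>2)"
    by (rule integrableI_bounded) (use F nn in \<open>auto intro: le_less_trans\<close>)
  then show "F \<in> L2_space \<mu>" using F by (simp add: L2_space_def)
  have "ennreal (\<integral>\<omega>. (cmod (F \<omega>))\<^sup>2 \<partial>\<mu>) \<le> ennreal (C\<^sup>2)"
    using nn int by (simp add: nn_integral_eq_integral)
  then have "(L2_norm \<mu> F)\<^sup>2 \<le> C\<^sup>2" by (simp add: L2_norm_power2)
  then show "L2_norm \<mu> F \<le> C" using C power2_le_imp_le by blast
qed

text \<open>Completeness: along a subsequence whose steps have norms at most \<open>(1/2)^k\<close> the telescoping series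
  converges absolutely almost everywhere, and Fatou's lemma turns this pointwise limit into a limit in norm.\<close>

lemma L2_complete:
  assumes fin: "finite_measure \<mu>" and X: "\<And>n. X n \<in> L2_space \<mu>"
    and cauchy: "\<And>e. e > 0 \<Longrightarrow> \<exists>N. \<forall>m\<ge>N. \<forall>n\<ge>N. L2_norm \<mu> (\<lambda>\<omega>. X m \<omega> - X n \<omega>) < e"
  shows "\<exists>F \<in> L2_space \<mu>. (\<lambda>n. L2_norm \<mu> (\<lambda>\<omega>. F \<omega> - X n \<omega>)) \<longlonglongrightarrow> 0"
proof -
  interpret finite_measure \<mu> by fact
  have "\<exists>N. \<forall>m\<ge>N. \<forall>n\<ge>N. L2_norm \<mu> (\<lambda>\<omega>. X m \<omega> - X n \<omega>) < (1/2)^k" for k :: nat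
    by (rule cauchy) simp
  then obtain N where N: "\<And>k m n. m \<ge> N k \<Longrightarrow> n \<ge> N k \<Longrightarrow> L2_norm \<mu> (\<lambda>\<omega>. X m \<omega> - X n \<omega>) < (1/2)^k"
    by metis
  define s where "s k = (\<Sum>j\<le>k. N j) + k" for k
  have sN: "s k \<ge> N k" for k
    using member_le_sum[of k "{..k}" N] by (simp add: s_def trans_le_add1)
  have s_mono: "s k \<le> s (Suc k)" for k by (simp add: s_def)
  define D where "D k \<omega> = X (s (Suc k)) \<omega> - X (s k) \<omega>" for k \<omega>
  have D: "D k \<in> L2_space \<mu>" "L2_norm \<mu> (D k) \<le> (1/2)^k" for k
    unfolding D_def using N[of k "s (Suc k)" "s k"] sN[of k] s_mono[of k] X
    by (auto intro!: L2_space_diff)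
  have [measurable]: "D k \<in> borel_measurable \<mu>" for k
    using D(1)[of k] by (simp add: L2_space_def)
  have "(\<integral>\<^sup>+ \<omega>. (\<Sum>k. ennreal (cmod (D k \<omega>))) \<partial>\<mu>) = (\<Sum>k. \<integral>\<^sup>+ \<omega>. ennreal (cmod (D k \<omega>)) \<partial>\<mu>)"
    by (rule nn_integral_suminf) measurable
  also have "\<dots> \<le> (\<Sum>k. ennreal ((1/2)^k * sqrt (measure \<mu> (space \<mu>))))"
  proof (intro suminf_le allI)
    fix k
    have "(\<integral>\<^sup>+ \<omega>. ennreal (cmod (D k \<omega>)) \<partial>\<mu>) = ennreal (\<integral>\<omega>. cmod (D k \<omega>) \<partial>\<mu>)"
      by (rule nn_integral_eq_integral) (use L2_integrable(1)[OF fin D(1)] in auto)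
    also have "\<dots> \<le> ennreal ((1/2)^k * sqrt (measure \<mu> (space \<mu>)))"
      using L2_integrable(2)[OF fin D(1), of k] D(2)[of k]
      by (intro ennreal_leI) (meson order_trans mult_right_mono real_sqrt_ge_zero measure_nonneg)
    finally show "(\<integral>\<^sup>+ \<omega>. ennreal (cmod (D k \<omega>)) \<partial>\<mu>) \<le> ennreal ((1/2)^k * sqrt (measure \<mu> (space \<mu>)))" .
  qed auto
  also have "\<dots> < \<infinity>"
    by (subst suminf_ennreal2) (auto intro!: summable_mult2 summable_geometric)
  finally have "(\<integral>\<^sup>+ \<omega>. (\<Sum>k. ennreal (cmod (D k \<omega>))) \<partial>\<mu>) \<noteq> \<infinity>" by simp
  then have "AE \<omega> in \<mu>. (\<Sum>k. ennreal (cmod (D k \<omega>))) \<noteq> \<infinity>"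
    by (intro nn_integral_PInf_AE) measurable
  then have conv: "AE \<omega> in \<mu>. convergent (\<lambda>k. X (s k) \<omega>)"
  proof eventually_elim
    case (elim \<omega>)
    have "summable (\<lambda>k. cmod (D k \<omega>))"
      by (rule summable_suminf_not_top) (use elim in auto)
    then have "summable (\<lambda>k. D k \<omega>)" by (rule summable_norm_cancel)
    then have "convergent (\<lambda>n. (\<Sum>k<n. D k \<omega>) + X (s 0) \<omega>)"
      by (intro convergent_add convergent_const) (simp add: summable_iff_convergent)
    moreover have "(\<Sum>k<n. D k \<omega>) + X (s 0) \<omega> = X (s n) \<omega>" for n
      unfolding D_def using sum_lessThan_telescope[of "\<lambda>k. X (s k) \<omega>" n] by simp
    ultimately show ?case by simp
  qed
  define F where "F \<omega> = lim (\<lambda>k. X (s k) \<omega>)" for \<omega>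
  have Xm: "X n \<in> borel_measurable \<mu>" for n using X by (simp add: L2_space_def)
  have Fm: "F \<in> borel_measurable \<mu>"
    unfolding F_def using Xm by (intro borel_measurable_lim_metric) auto
  have tail: "L2_norm \<mu> (\<lambda>\<omega>. F \<omega> - X n \<omega>) \<le> (1/2)^k \<and> (\<lambda>\<omega>. F \<omega> - X n \<omega>) \<in> L2_space \<mu>"
    if n: "n \<ge> N k" for n k
  proof -
    let ?Y = "\<lambda>j \<omega>. X (s (j + k)) \<omega> - X n \<omega>"
    have 1: "?Y j \<in> L2_space \<mu>" for j using X by (intro L2_space_diff)
    have 2: "(\<lambda>\<omega>. F \<omega> - X n \<omega>) \<in> borel_measurable \<mu>" using Fm Xm by measurable
    have 3: "AE \<omega> in \<mu>. (\<lambda>j. ?Y j \<omega>) \<longlonglongrightarrow> F \<omega> - X n \<omega>"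
      using conv
    proof eventually_elim
      case (elim \<omega>)
      then have "(\<lambda>j. X (s j) \<omega>) \<longlonglongrightarrow> F \<omega>" by (simp add: F_def convergent_LIMSEQ_iff)
      then have "(\<lambda>j. X (s (j + k)) \<omega>) \<longlonglongrightarrow> F \<omega>" by (rule LIMSEQ_ignore_initial_segment)
      then show ?case by (intro tendsto_diff tendsto_const)
    qed
    have 4: "L2_norm \<mu> (?Y j) \<le> (1/2)^k" for j
    proof -
      have "s (j + k) \<ge> s k" by (rule lift_Suc_mono_le[of s]) (use s_mono in auto)
      then have "s (j + k) \<ge> N k" using sN[of k] by linarith
      then show ?thesis using N[of k "s (j + k)" n] n by (simp add: less_imp_le)
    qed
    show ?thesis
      using L2_norm_le_liminf[OF 1 2 3 4] by blast
  qed
  have F: "F \<in> L2_space \<mu>"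
    using L2_space_add[of "\<lambda>\<omega>. F \<omega> - X (N 0) \<omega>" \<mu> "X (N 0)"] tail[of 0 "N 0"] X by simp
  moreover have "(\<lambda>n. L2_norm \<mu> (\<lambda>\<omega>. F \<omega> - X n \<omega>)) \<longlonglongrightarrow> 0"
  proof (rule LIMSEQ_I)
    fix e :: real assume "0 < e"
    then obtain k where k: "(1/2::real)^k < e" using real_arch_pow_inv[of e "1/2"] by auto
    have "norm (L2_norm \<mu> (\<lambda>\<omega>. F \<omega> - X n \<omega>) - 0) < e" if "n \<ge> N k" for n
      using tail[OF that] k by simp
    then show "\<exists>no. \<forall>n\<ge>no. norm (L2_norm \<mu> (\<lambda>\<omega>. F \<omega> - X n \<omega>) - 0) < e" by blast
  qed
  ultimately show ?thesis by blast
qed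

section \<open>The Hilbert space of square-summable sequences\<close>

typedef ell2 = "{a :: nat \<Rightarrow> complex. summable (\<lambda>n. (cmod (a n))\<^sup>2)}"
  morphisms coef Abs_ell2
  by (rule exI[of _ "\<lambda>_. 0"]) simp

setup_lifting type_definition_ell2

lemma ell2_eqI: "(\<And>n. coef a n = coef b n) \<Longrightarrow> a = b"
  by (metis coef_inject ext)

lemma summable_coef: "summable (\<lambda>n. (cmod (coef a n))\<^sup>2)"
  using coef[of a] by simp

lemma cmod_add_power2_le: "(cmod (x + y))\<^sup>2 \<le> 2 * (cmod x)\<^sup>2 + 2 * (cmod y)\<^sup>2"
proof -
  have "(cmod (x + y))\<^sup>2 \<le> (cmod x + cmod y)\<^sup>2"
    by (intro power_mono norm_triangle_ineq) simp
  also have "\<dots> \<le> 2 * (cmod x)\<^sup>2 + 2 * (cmod y)\<^sup>2"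
    using sum_squares_bound[of "cmod x" "cmod y"] by (simp add: power2_sum)
  finally show ?thesis .
qed

lemma summable_square_add:
  assumes "summable (\<lambda>n. (cmod (a n))\<^sup>2)" "summable (\<lambda>n. (cmod (b n))\<^sup>2)"
  shows "summable (\<lambda>n. (cmod (a n + b n))\<^sup>2)"
  by (rule summable_comparison_test'[where N = 0 and g = "\<lambda>n. 2 * (cmod (a n))\<^sup>2 + 2 * (cmod (b n))\<^sup>2"])
    (use assms cmod_add_power2_le in \<open>auto intro!: summable_add summable_mult\<close>)

lemma summable_square_scale:
  assumes "summable (\<lambda>n. (cmod (a n))\<^sup>2)"
  shows "summable (\<lambda>n. (cmod (c * a n))\<^sup>2)"
  using summable_mult[OF assms, of "(cmod c)\<^sup>2"] by (simp add: norm_mult power_mult_distrib)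

lemma summable_square_product:
  assumes "summable (\<lambda>n. (cmod (a n))\<^sup>2)" "summable (\<lambda>n. (cmod (b n))\<^sup>2)"
  shows "summable (\<lambda>n. a n * cnj (b n))"
proof (rule summable_comparison_test'[where N = 0 and g = "\<lambda>n. (cmod (a n))\<^sup>2 + (cmod (b n))\<^sup>2"])
  show "norm (a n * cnj (b n)) \<le> (cmod (a n))\<^sup>2 + (cmod (b n))\<^sup>2" for n
    using sum_squares_bound[of "cmod (a n)" "cmod (b n)"]
      mult_nonneg_nonneg[OF norm_ge_zero[of "a n"] norm_ge_zero[of "b n"]]
    unfolding norm_mult complex_mod_cnj by linarith
qed (use assms in \<open>auto intro!: summable_add\<close>)

instantiation ell2 :: real_inner
begin

lift_definition zero_ell2 :: ell2 is "\<lambda>_. 0" by simp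

lift_definition plus_ell2 :: "ell2 \<Rightarrow> ell2 \<Rightarrow> ell2" is "\<lambda>a b n. a n + b n"
  by (rule summable_square_add)

lift_definition uminus_ell2 :: "ell2 \<Rightarrow> ell2" is "\<lambda>a n. - a n" by simp

lift_definition minus_ell2 :: "ell2 \<Rightarrow> ell2 \<Rightarrow> ell2" is "\<lambda>a b n. a n - b n"
proof -
  fix a b :: "nat \<Rightarrow> complex"
  assume "summable (\<lambda>n. (cmod (a n))\<^sup>2)" "summable (\<lambda>n. (cmod (b n))\<^sup>2)"
  then show "summable (\<lambda>n. (cmod (a n - b n))\<^sup>2)"
    using summable_square_add[of a "\<lambda>n. - b n"] by simp
qed

lift_definition scaleR_ell2 :: "real \<Rightarrow> ell2 \<Rightarrow> ell2" is "\<lambda>r a n. of_real r * a n"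
  by (rule summable_square_scale)

lift_definition inner_ell2 :: "ell2 \<Rightarrow> ell2 \<Rightarrow> real" is "\<lambda>a b. Re (\<Sum>n. a n * cnj (b n))" .

definition norm_ell2 :: "ell2 \<Rightarrow> real" where "norm_ell2 a = sqrt (inner a a)"

definition dist_ell2 :: "ell2 \<Rightarrow> ell2 \<Rightarrow> real" where "dist_ell2 a b = norm (a - b)"

definition sgn_ell2 :: "ell2 \<Rightarrow> ell2" where "sgn_ell2 a = inverse (norm a) *\<^sub>R a"

definition uniformity_ell2 :: "(ell2 \<times> ell2) filter" where
  "uniformity_ell2 = (INF e\<in>{0 <..}. principal {(x, y). dist x y < e})"

definition open_ell2 :: "ell2 set \<Rightarrow> bool" where
  "open_ell2 U \<longleftrightarrow> (\<forall>x\<in>U. \<forall>\<^sub>F (x', y) in uniformity. x' = x \<longrightarrow> y \<in> U)"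

instance
proof
  fix a b c :: ell2 and r s :: real
  show "a + b + c = a + (b + c)" "a + b = b + a" "0 + a = a" "- a + a = 0" "a - b = a + - b"
    "r *\<^sub>R (a + b) = r *\<^sub>R a + r *\<^sub>R b" "(r + s) *\<^sub>R a = r *\<^sub>R a + s *\<^sub>R a"
    "r *\<^sub>R s *\<^sub>R a = (r * s) *\<^sub>R a" "1 *\<^sub>R a = a"
    by (transfer; simp add: fun_eq_iff algebra_simps)+
  show "dist a b = norm (a - b)" by (rule dist_ell2_def)
  show "sgn a = inverse (norm a) *\<^sub>R a" by (rule sgn_ell2_def)
  show "(uniformity :: (ell2 \<times> ell2) filter) = (INF e\<in>{0 <..}. principal {(x, y). dist x y < e})"
    by (rule uniformity_ell2_def)
  show "open U \<longleftrightarrow> (\<forall>x\<in>U. \<forall>\<^sub>F (x', y) in uniformity. x' = x \<longrightarrow> y \<in> U)" for U :: "ell2 set"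
    by (rule open_ell2_def)
  show "norm a = sqrt (inner a a)" by (rule norm_ell2_def)
  show "inner a b = inner b a"
  proof transfer
    fix a b :: "nat \<Rightarrow> complex"
    assume ab: "summable (\<lambda>n. (cmod (a n))\<^sup>2)" "summable (\<lambda>n. (cmod (b n))\<^sup>2)"
    have "(\<Sum>n. Re (a n * cnj (b n))) = (\<Sum>n. Re (b n * cnj (a n)))"
      by (simp add: algebra_simps)
    then show "Re (\<Sum>n. a n * cnj (b n)) = Re (\<Sum>n. b n * cnj (a n))"
      using Re_suminf[OF summable_square_product[OF ab]]
        Re_suminf[OF summable_square_product[OF ab(2,1)]] by simp
  qed
  show "inner (a + b) c = inner a c + inner b c"
    by transfer (simp add: distrib_right suminf_add[symmetric] summable_square_product)
  show "inner (r *\<^sub>R a) b = r * inner a b"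
  proof transfer
    fix r :: real and a b :: "nat \<Rightarrow> complex"
    assume ab: "summable (\<lambda>n. (cmod (a n))\<^sup>2)" "summable (\<lambda>n. (cmod (b n))\<^sup>2)"
    then show "Re (\<Sum>n. complex_of_real r * a n * cnj (b n)) = r * Re (\<Sum>n. a n * cnj (b n))"
      using suminf_mult[OF summable_square_product[OF ab], of "of_real r"] by (simp add: mult.assoc)
  qed
  have sq: "inner a a = (\<Sum>n. (cmod (coef a n))\<^sup>2)"
  proof transfer
    fix a :: "nat \<Rightarrow> complex"
    assume a: "summable (\<lambda>n. (cmod (a n))\<^sup>2)"
    show "Re (\<Sum>n. a n * cnj (a n)) = (\<Sum>n. (cmod (a n))\<^sup>2)"
      using Re_suminf[OF summable_square_product[OF a a]] by (simp add: cmod_power2_eq_Re del: times_complex.simps)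
  qed
  then show "0 \<le> inner a a" by (simp add: suminf_nonneg summable_coef)
  show "inner a a = 0 \<longleftrightarrow> a = 0"
  proof
    assume "inner a a = 0"
    then have "coef a n = 0" for n
      using suminf_eq_zero_iff[OF summable_coef[of a]] sq by simp
    then show "a = 0" by (intro ell2_eqI) (simp add: zero_ell2.rep_eq)
  qed (simp add: inner_ell2.rep_eq zero_ell2.rep_eq)
qed

end

lemmas coef_simps [simp] = zero_ell2.rep_eq plus_ell2.rep_eq uminus_ell2.rep_eq
  minus_ell2.rep_eq scaleR_ell2.rep_eq

definition cinner :: "ell2 \<Rightarrow> ell2 \<Rightarrow> complex" where
  "cinner a b = (\<Sum>n. coef a n * cnj (coef b n))"

lift_definition cscale :: "complex \<Rightarrow> ell2 \<Rightarrow> ell2" is "\<lambda>c a n. c * a n"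
  by (rule summable_square_scale)

declare cscale.rep_eq [simp]

lemma summable_cinner: "summable (\<lambda>n. coef a n * cnj (coef b n))"
  by (rule summable_square_product) (rule summable_coef)+

lemma Re_cinner: "Re (cinner a b) = inner a b"
  by (simp add: cinner_def inner_ell2.rep_eq)

lemma scaleR_eq_cscale: "r *\<^sub>R a = cscale (of_real r) a"
  by (rule ell2_eqI) simp

lemma cscale_simps: "cscale 1 a = a" "cscale 0 a = 0" "cscale c 0 = 0"
  "cscale c (a + b) = cscale c a + cscale c b" "cscale c (a - b) = cscale c a - cscale c b"
  "cscale c (cscale d a) = cscale (c * d) a" "cscale c (- a) = - cscale c a"
  by (auto intro!: ell2_eqI simp: algebra_simps)

lemma cinner_scale_left: "cinner (cscale c a) b = c * cinner a b"
  using suminf_mult[OF summable_cinner[of a b], of c] by (simp add: cinner_def mult.assoc)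

lemma cinner_commute: "cinner a b = cnj (cinner b a)"
proof -
  have "(\<lambda>n. cnj (coef b n * cnj (coef a n))) sums cnj (cinner b a)"
    unfolding cinner_def by (subst sums_cnj) (rule summable_sums[OF summable_cinner])
  then show ?thesis unfolding cinner_def by (simp add: sums_iff mult.commute)
qed

lemma cinner_scale_right: "cinner a (cscale c b) = cnj c * cinner a b"
  by (metis cinner_commute cinner_scale_left complex_cnj_mult)

lemma cinner_add_left: "cinner (a + b) c = cinner a c + cinner b c"
  by (simp add: cinner_def distrib_right suminf_add[OF summable_cinner summable_cinner])

lemma cinner_diff_left: "cinner (a - b) c = cinner a c - cinner b c"
  by (simp add: cinner_def left_diff_distrib suminf_diff[OF summable_cinner summable_cinner])

lemma cinner_diff_right: "cinner a (b - c) = cinner a b - cinner a c"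
  by (metis cinner_diff_left cinner_commute complex_cnj_diff)

lemma cinner_zero [simp]: "cinner 0 a = 0" "cinner a 0 = 0"
  by (simp_all add: cinner_def)

lemma cinner_self: "cinner a a = of_real ((norm a)\<^sup>2)"
proof (rule complex_eqI)
  show "Re (cinner a a) = Re (of_real ((norm a)\<^sup>2))"
    by (simp add: Re_cinner power2_norm_eq_inner del: of_real_power)
  show "Im (cinner a a) = Im (of_real ((norm a)\<^sup>2))"
    using arg_cong[OF cinner_commute[of a a], of Im] by (simp del: of_real_power)
qed

lemma norm_ell2_power2: "(norm a)\<^sup>2 = (\<Sum>n. (cmod (coef a n))\<^sup>2)"
proof -
  have "(norm a)\<^sup>2 = Re (\<Sum>n. coef a n * cnj (coef a n))"
    by (simp add: power2_norm_eq_inner flip: Re_cinner cinner_def)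
  also have "\<dots> = (\<Sum>n. (cmod (coef a n))\<^sup>2)"
    using Re_suminf[OF summable_cinner[of a a]] by (simp add: cmod_power2_eq_Re del: times_complex.simps)
  finally show ?thesis .
qed

lemma norm_cscale: "norm (cscale c a) = cmod c * norm a"
proof (rule power2_eq_imp_eq)
  show "(norm (cscale c a))\<^sup>2 = (cmod c * norm a)\<^sup>2"
    using suminf_mult[OF summable_coef[of a], of "(cmod c)\<^sup>2"]
    by (simp add: norm_ell2_power2 norm_mult power_mult_distrib)
qed auto

lemma inner_cscale_i: "inner (cscale \<i> a) b = - Im (cinner a b)"
  by (simp add: cinner_scale_left flip: Re_cinner)

lemma cinner_eq_0_iff_inner: "cinner a b = 0 \<longleftrightarrow> inner a b = 0 \<and> inner (cscale \<i> a) b = 0"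
  by (auto simp: inner_cscale_i complex_eq_iff Re_cinner)

lemma cmod_cinner_le: "cmod (cinner a b) \<le> norm a * norm b"
proof -
  define c where "c = cnj (sgn (cinner a b))"
  have "cnj (sgn z) * z = of_real (cmod z)" for z :: complex
    by (cases "z = 0") (auto simp: sgn_eq complex_norm_square[symmetric] power2_eq_square mult.commute[of "cnj z"])
  then have "of_real (cmod (cinner a b)) = c * cinner a b" by (simp add: c_def)
  then have "cmod (cinner a b) = inner (cscale c a) b"
    by (metis Re_cinner Re_complex_of_real cinner_scale_left)
  also have "\<dots> \<le> norm (cscale c a) * norm b" by (rule norm_cauchy_schwarz)
  also have "\<dots> \<le> norm a * norm b"
    by (intro mult_right_mono) (auto simp: norm_cscale c_def norm_sgn)
  finally show ?thesis .
qed

lemma cmod_coef_le: "cmod (coef a n) \<le> norm a"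
proof (rule power2_le_imp_le)
  show "(cmod (coef a n))\<^sup>2 \<le> (norm a)\<^sup>2"
    using sum_le_suminf[OF summable_coef, of "{n}" a] by (simp add: norm_ell2_power2)
qed simp

lemma sum_coef_le: "finite I \<Longrightarrow> (\<Sum>n\<in>I. (cmod (coef a n))\<^sup>2) \<le> (norm a)\<^sup>2"
  using sum_le_suminf[OF summable_coef] by (simp add: norm_ell2_power2)

lemma Abs_ell2_bounded:
  assumes "\<And>N. (\<Sum>n<N. (cmod (a n))\<^sup>2) \<le> C\<^sup>2" "0 \<le> C"
  shows "coef (Abs_ell2 a) = a" "norm (Abs_ell2 a) \<le> C"
proof -
  have s: "summable (\<lambda>n. (cmod (a n))\<^sup>2)"
    using assms(1) by (intro bounded_imp_summable[where B = "C\<^sup>2"])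
      (auto simp: lessThan_Suc_atMost[symmetric] simp del: sum.lessThan_Suc)
  show *: "coef (Abs_ell2 a) = a" by (rule Abs_ell2_inverse) (simp add: s)
  have "(norm (Abs_ell2 a))\<^sup>2 \<le> C\<^sup>2"
    unfolding norm_ell2_power2 * by (rule suminf_le_const[OF s]) (rule assms)
  then show "norm (Abs_ell2 a) \<le> C" using assms(2) power2_le_imp_le by blast
qed

instance ell2 :: complete_space
proof
  fix X :: "nat \<Rightarrow> ell2"
  assume X: "Cauchy X"
  have "Cauchy (\<lambda>k. coef (X k) n)" for n
  proof (rule metric_CauchyI)
    fix e :: real assume "0 < e"
    then obtain M where "\<And>m k. m \<ge> M \<Longrightarrow> k \<ge> M \<Longrightarrow> dist (X m) (X k) < e"
      using X unfolding Cauchy_def by blast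
    moreover have "dist (coef (X m) n) (coef (X k) n) \<le> dist (X m) (X k)" for m k
      using cmod_coef_le[of "X m - X k" n] by (simp add: dist_norm)
    ultimately show "\<exists>M. \<forall>m\<ge>M. \<forall>k\<ge>M. dist (coef (X m) n) (coef (X k) n) < e"
      by (meson le_less_trans)
  qed
  then obtain a where a: "\<And>n. (\<lambda>k. coef (X k) n) \<longlonglongrightarrow> a n"
    using choice[of "\<lambda>n l. (\<lambda>k. coef (X k) n) \<longlonglongrightarrow> l"] Cauchy_convergent
    unfolding convergent_def by blast
  have tail: "\<exists>M. \<forall>k\<ge>M. \<forall>N. (\<Sum>n<N. (cmod (a n - coef (X k) n))\<^sup>2) \<le> e\<^sup>2" if e: "0 < e" for e
  proof -
    obtain M where M: "\<And>m k. m \<ge> M \<Longrightarrow> k \<ge> M \<Longrightarrow> dist (X m) (X k) < e"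
      using X e unfolding Cauchy_def by blast
    have "(\<Sum>n<N. (cmod (a n - coef (X k) n))\<^sup>2) \<le> e\<^sup>2" if k: "k \<ge> M" for k N
    proof (rule tendsto_upperbound)
      show "(\<lambda>m. \<Sum>n<N. (cmod (coef (X m) n - coef (X k) n))\<^sup>2)
          \<longlonglongrightarrow> (\<Sum>n<N. (cmod (a n - coef (X k) n))\<^sup>2)"
        by (intro tendsto_intros a)
      have "(\<Sum>n<N. (cmod (coef (X m) n - coef (X k) n))\<^sup>2) \<le> e\<^sup>2" if "m \<ge> M" for m
      proof -
        have "(\<Sum>n<N. (cmod (coef (X m) n - coef (X k) n))\<^sup>2) \<le> (norm (X m - X k))\<^sup>2"
          using sum_coef_le[of "{..<N}" "X m - X k"] by simp
        also have "\<dots> \<le> e\<^sup>2"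
          using M[OF that k] by (intro power_mono) (auto simp: dist_norm)
        finally show ?thesis .
      qed
      then show "\<forall>\<^sub>F m in sequentially. (\<Sum>n<N. (cmod (coef (X m) n - coef (X k) n))\<^sup>2) \<le> e\<^sup>2"
        using eventually_at_top_linorder by blast
    qed auto
    then show ?thesis by blast
  qed
  obtain M1 where M1: "\<And>k N. k \<ge> M1 \<Longrightarrow> (\<Sum>n<N. (cmod (a n - coef (X k) n))\<^sup>2) \<le> 1\<^sup>2"
    using tail[of 1] by auto
  have "coef (Abs_ell2 (\<lambda>n. a n - coef (X M1) n)) = (\<lambda>n. a n - coef (X M1) n)"
    by (rule Abs_ell2_bounded(1)[of _ 1]) (use M1 in auto)
  then have "summable (\<lambda>n. (cmod (a n - coef (X M1) n))\<^sup>2)"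
    by (metis summable_coef)
  from summable_square_add[OF this summable_coef[of "X M1"]]
  have s: "coef (Abs_ell2 a) = a" by (simp add: Abs_ell2_inverse)
  have "X \<longlonglongrightarrow> Abs_ell2 a"
  proof (rule metric_LIMSEQ_I)
    fix e :: real assume e: "0 < e"
    obtain M where M: "\<And>k N. k \<ge> M \<Longrightarrow> (\<Sum>n<N. (cmod (a n - coef (X k) n))\<^sup>2) \<le> (e/2)\<^sup>2"
      using tail[of "e/2"] e by auto
    have "dist (X k) (Abs_ell2 a) < e" if "k \<ge> M" for k
    proof -
      have "Abs_ell2 (\<lambda>n. a n - coef (X k) n) = Abs_ell2 a - X k"
        using Abs_ell2_bounded(1)[of "\<lambda>n. a n - coef (X k) n" "e/2"] M[OF that] e s
        by (intro ell2_eqI) auto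
      then have "norm (Abs_ell2 a - X k) \<le> e/2"
        using Abs_ell2_bounded(2)[of "\<lambda>n. a n - coef (X k) n" "e/2"] M[OF that] e by auto
      then show ?thesis using e by (simp add: dist_norm norm_minus_commute)
    qed
    then show "\<exists>M. \<forall>k\<ge>M. dist (X k) (Abs_ell2 a) < e" by blast
  qed
  then show "convergent X" unfolding convergent_def by blast
qed

text \<open>The parallelogram law makes a minimizing sequence for the distance to a convex set a Cauchy
  sequence.\<close>

lemma nearest_point_exists:
  fixes S :: "'a::{real_inner,complete_space} set"
  assumes S: "convex S" "closed S" "S \<noteq> {}"
  shows "\<exists>p\<in>S. \<forall>y\<in>S. dist x p \<le> dist x y"
proof -
  define d where "d = Inf (dist x ` S)"
  have d_le: "d \<le> dist x y" if "y \<in> S" for y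
    unfolding d_def using that by (intro cINF_lower bdd_belowI[of _ 0]) auto
  have d0: "0 \<le> d" unfolding d_def using S(3) by (intro cINF_greatest) auto
  have "\<exists>y\<in>S. dist x y < d + 1 / Suc n" for n
    unfolding d_def using cInf_lessD[of "dist x ` S" "Inf (dist x ` S) + 1 / Suc n"] S(3) by auto
  then obtain y where y: "\<And>n. y n \<in> S" "\<And>n. dist x (y n) < d + 1 / Suc n" by metis
  have key: "(dist (y m) (y n))\<^sup>2 \<le> (8 * d + 4) / Suc N" if mn: "m \<ge> N" "n \<ge> N" for m n N
  proof -
    have mid: "(1/2) *\<^sub>R (y m + y n) \<in> S"
      using convexD[OF S(1) y(1)[of m] y(1)[of n], of "1/2" "1/2"] by (simp add: scaleR_right_distrib)
    have "d\<^sup>2 \<le> (dist x ((1/2) *\<^sub>R (y m + y n)))\<^sup>2" using d_le[OF mid] d0 by (intro power_mono) auto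
    then have m1: "4 * d\<^sup>2 \<le> (norm ((x - y m) + (x - y n)))\<^sup>2"
    proof -
      have "(x - y m) + (x - y n) = 2 *\<^sub>R (x - (1/2) *\<^sub>R (y m + y n))"
        by (simp add: algebra_simps scaleR_2)
      then show ?thesis
        using \<open>d\<^sup>2 \<le> _\<close> by (simp add: dist_norm power_mult_distrib)
    qed
    have small: "(norm (x - y k))\<^sup>2 \<le> d\<^sup>2 + (2 * d + 1) / Suc N" if "k \<ge> N" for k
    proof -
      have "1 / Suc k \<le> 1 / Suc N" using that by (simp add: frac_le)
      then have "norm (x - y k) \<le> d + 1 / Suc N" using y(2)[of k] by (simp add: dist_norm)
      then have "(norm (x - y k))\<^sup>2 \<le> (d + 1 / Suc N)\<^sup>2" by (intro power_mono) auto
      also have "\<dots> = d\<^sup>2 + 2 * d / Suc N + (1 / Suc N)\<^sup>2" by (simp add: power2_sum)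
      also have "(1 / real (Suc N))\<^sup>2 \<le> 1 / Suc N" by (simp add: power2_eq_square divide_simps)
      finally show ?thesis by (simp add: add_divide_distrib)
    qed
    have par: "(norm (u - v))\<^sup>2 = 2 * (norm u)\<^sup>2 + 2 * (norm v)\<^sup>2 - (norm (u + v))\<^sup>2" for u v :: 'a
      by (simp add: power2_norm_eq_inner inner_commute algebra_simps)
    have "(dist (y m) (y n))\<^sup>2 = (norm ((x - y m) - (x - y n)))\<^sup>2"
      by (simp add: dist_norm norm_minus_commute)
    also have "\<dots> \<le> 4 * ((2 * d + 1) / Suc N)"
      unfolding par[of "x - y m" "x - y n"] using m1 small[OF mn(1)] small[OF mn(2)] by linarith
    finally show ?thesis by (simp add: algebra_simps add_divide_distrib)
  qed
  have "Cauchy y"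
  proof (rule metric_CauchyI)
    fix e :: real assume e: "0 < e"
    obtain N :: nat where "(8 * d + 4) / e\<^sup>2 < N" using reals_Archimedean2 by blast
    then have "(8 * d + 4) / e\<^sup>2 < Suc N" by simp
    then have N: "(8 * d + 4) / Suc N < e\<^sup>2" using e by (simp add: field_simps)
    have "dist (y m) (y n) < e" if "m \<ge> N" "n \<ge> N" for m n
      using key[OF that] N e by (meson le_less_trans less_imp_le power2_less_imp_less)
    then show "\<exists>N. \<forall>m\<ge>N. \<forall>n\<ge>N. dist (y m) (y n) < e" by blast
  qed
  then obtain p where p: "y \<longlonglongrightarrow> p" using Cauchy_convergent convergent_def by blast
  have "p \<in> S" using S(2) y(1) p closed_sequentially by blast
  moreover have "dist x p \<le> d"
  proof (rule tendsto_le[OF sequentially_bot])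
    show "(\<lambda>n. d + 1 / Suc n) \<longlonglongrightarrow> d"
      using tendsto_add[OF tendsto_const[of d] LIMSEQ_Suc[OF lim_1_over_n]] by simp
    show "(\<lambda>n. dist x (y n)) \<longlonglongrightarrow> dist x p" by (intro tendsto_intros p)
  qed (use y(2) in \<open>auto intro!: always_eventually less_imp_le\<close>)
  ultimately show ?thesis using d_le by force
qed

text \<open>The functional is the difference of the point and its nearest point in the convex set.\<close>

lemma hilbert_separation:
  fixes S :: "'a::{real_inner,complete_space} set"
  assumes "convex S" "closed S" "S \<noteq> {}" "x \<notin> S"
  shows "\<exists>u s. (\<forall>y\<in>S. inner y u \<le> s) \<and> s < inner x u"
proof -
  obtain p where p: "p \<in> S" "\<forall>y\<in>S. dist x p \<le> dist x y"
    using nearest_point_exists[OF assms(1-3)] by blast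
  have "inner y (x - p) \<le> inner p (x - p)" if "y \<in> S" for y
    using any_closest_point_dot[OF assms(1,2) p(1) that p(2)]
    by (simp add: inner_diff_right inner_commute)
  moreover have "inner p (x - p) < inner x (x - p)"
    using inner_gt_zero_iff[of "x - p"] p(1) assms(4) by (auto simp: inner_diff_left)
  ultimately show ?thesis by blast
qed

lemma subspace_closure_normed:
  fixes S :: "'a::real_normed_vector set"
  assumes "subspace S"
  shows "subspace (closure S)"
proof (rule subspaceI)
  show "0 \<in> closure S" using subspace_0[OF assms] closure_subset by blast
  fix x y assume "x \<in> closure S" "y \<in> closure S"
  then obtain f g where fg: "\<And>n. f n \<in> S" "f \<longlonglongrightarrow> x" "\<And>n. g n \<in> S" "g \<longlonglongrightarrow> y"
    unfolding closure_sequential by metis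
  show "x + y \<in> closure S"
    unfolding closure_sequential
    using fg subspace_add[OF assms] tendsto_add[OF fg(2,4)] by (intro exI[of _ "\<lambda>n. f n + g n"]) auto
next
  fix c :: real and x assume "x \<in> closure S"
  then obtain f where f: "\<And>n. f n \<in> S" "f \<longlonglongrightarrow> x"
    unfolding closure_sequential by metis
  show "c *\<^sub>R x \<in> closure S"
    unfolding closure_sequential
    using f subspace_mul[OF assms] by (intro exI[of _ "\<lambda>n. c *\<^sub>R f n"]) (auto intro!: tendsto_intros)
qed

lemma dense_if_no_orthogonal:
  fixes S M :: "'a::{real_inner,complete_space} set"
  assumes S: "subspace S" "S \<subseteq> M" and M: "subspace M" "closed M"
    and orth: "\<And>x. x \<in> M \<Longrightarrow> (\<And>y. y \<in> S \<Longrightarrow> inner x y = 0) \<Longrightarrow> x = 0"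
  shows "M \<subseteq> closure S"
proof
  fix x assume x: "x \<in> M"
  have sub: "subspace (closure S)" by (rule subspace_closure_normed[OF S(1)])
  have "closure S \<noteq> {}" using subspace_0[OF sub] by (metis empty_iff)
  from nearest_point_exists[OF subspace_imp_convex[OF sub] closed_closure this, of x]
  obtain p where p: "p \<in> closure S" "\<forall>y\<in>closure S. dist x p \<le> dist x y" by blast
  have dot: "inner (x - p) (y - p) \<le> 0" if "y \<in> closure S" for y
    using any_closest_point_dot[OF subspace_imp_convex[OF sub] closed_closure p(1) that p(2)] .
  have pM: "p \<in> M" using p(1) closure_minimal[OF S(2) M(2)] by blast
  have "x - p = 0"
  proof (rule orth)
    show "x - p \<in> M" using subspace_diff[OF M(1) x pM] .
    fix y assume "y \<in> S"
    then have "y \<in> closure S" using closure_subset by blast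
    then show "inner (x - p) y = 0"
      using dot[of "p + y"] dot[of "p - y"] subspace_add[OF sub p(1)] subspace_diff[OF sub p(1)]
      by fastforce
  qed
  then show "x \<in> closure S" using p(1) by simp
qed

section \<open>Lebesgue measure on the circle\<close>

abbreviation circle_borel :: "complex measure" where
  "circle_borel \<equiv> restrict_space borel (sphere 0 1)"

definition circle_arc :: "complex measure" where
  "circle_arc = distr (uniform_measure lborel {0..<2 * pi}) circle_borel cis"

lemma circle_lebesgue_eq: "circle_lebesgue = completion circle_arc"
  by (simp add: circle_lebesgue_def circle_arc_def)

lemma space_circle_borel [simp]: "space circle_borel = sphere 0 1"
  by (simp add: space_restrict_space)

lemma space_circle_arc [simp]: "space circle_arc = sphere 0 1"
  by (simp add: circle_arc_def)

lemma sets_circle_arc: "sets circle_arc = sets circle_borel"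
  by (simp add: circle_arc_def)

lemma measurable_circle_arc: "borel_measurable circle_arc = borel_measurable circle_borel"
  by (intro measurable_cong_sets sets_circle_arc refl)

lemma space_circle_lebesgue [simp]: "space circle_lebesgue = sphere 0 1"
  by (simp add: circle_lebesgue_eq)

lemma space_circle_measure: "is_circle_measure \<mu> \<Longrightarrow> space \<mu> = sphere 0 1"
  unfolding is_circle_measure_def by (metis sets_eq_imp_space_eq space_circle_borel)

lemma measurable_circle_measure: "is_circle_measure \<mu> \<Longrightarrow> borel_measurable \<mu> = borel_measurable circle_borel"
  by (intro measurable_cong_sets) (auto simp: is_circle_measure_def)

lemma cis_measurable [measurable]: "cis \<in> lborel \<rightarrow>\<^sub>M circle_borel"
proof (rule measurable_restrict_space2)
  show "cis \<in> lborel \<rightarrow>\<^sub>M borel"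
    by (simp add: borel_measurable_continuous_onI continuous_on_cis continuous_on_id)
qed auto

lemma uniform_interval_eq_density:
  "uniform_measure lborel {0..<2 * pi} = density lborel (\<lambda>t. ennreal (indicator {0..<2 * pi} t / (2 * pi)))"
proof -
  have "(indicator {0..<2 * pi} t / emeasure lborel {0..<2 * pi} :: ennreal) =
      ennreal (indicator {0..<2 * pi} t / (2 * pi))" for t :: real
    by (auto simp: indicator_def divide_ennreal[symmetric])
  then show ?thesis unfolding uniform_measure_def by simp
qed

lemma circle_arc_integral:
  fixes F :: "complex \<Rightarrow> 'b::{banach, second_countable_topology}"
  assumes F: "F \<in> borel_measurable circle_borel"
  shows "integral\<^sup>L circle_arc F = (\<integral>t. (indicator {0..<2 * pi} t / (2 * pi)) *\<^sub>R F (cis t) \<partial>lborel)"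
    and "integrable circle_arc F \<longleftrightarrow>
      integrable lborel (\<lambda>t. (indicator {0..<2 * pi} t / (2 * pi)) *\<^sub>R F (cis t))"
proof -
  have m: "(\<lambda>t. F (cis t)) \<in> borel_measurable lborel"
    using measurable_compose[OF cis_measurable F] .
  have cis: "cis \<in> uniform_measure lborel {0..<2 * pi} \<rightarrow>\<^sub>M circle_borel"
    using cis_measurable by (simp add: measurable_def)
  have g: "(\<lambda>t. indicator {0..<2 * pi} t / (2 * pi) :: real) \<in> borel_measurable lborel" by measurable
  show "integral\<^sup>L circle_arc F = (\<integral>t. (indicator {0..<2 * pi} t / (2 * pi)) *\<^sub>R F (cis t) \<partial>lborel)"
    unfolding circle_arc_def integral_distr[OF cis F]
    by (subst uniform_interval_eq_density, rule integral_density) (use m g in auto)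
  show "integrable circle_arc F \<longleftrightarrow>
      integrable lborel (\<lambda>t. (indicator {0..<2 * pi} t / (2 * pi)) *\<^sub>R F (cis t))"
    unfolding circle_arc_def integrable_distr_eq[OF cis F]
    by (subst uniform_interval_eq_density, rule integrable_density) (use m g in auto)
qed

lemma finite_measure_circle_arc: "finite_measure circle_arc" "measure circle_arc (sphere 0 1) = 1"
proof -
  have cis: "cis \<in> uniform_measure lborel {0..<2 * pi} \<rightarrow>\<^sub>M circle_borel"
    using cis_measurable by (simp add: measurable_def)
  have "emeasure circle_arc (space circle_arc) = emeasure (uniform_measure lborel {0..<2 * pi}) UNIV"
    unfolding circle_arc_def
    using emeasure_distr[OF cis, of "space circle_borel"] sets.top[of circle_borel]
    by (simp add: vimage_def)
  also have "\<dots> = 1"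
    by (simp add: ennreal_divide_self)
  finally have 1: "emeasure circle_arc (space circle_arc) = 1" .
  then show "finite_measure circle_arc" by (intro finite_measureI) simp
  show "measure circle_arc (sphere 0 1) = 1" using 1 by (simp add: measure_def)
qed

lemma finite_measure_circle [simp]: "finite_measure circle_lebesgue"
proof (rule finite_measureI)
  interpret finite_measure circle_arc by (rule finite_measure_circle_arc)
  have "emeasure circle_lebesgue (space circle_arc) = emeasure circle_arc (space circle_arc)"
    unfolding circle_lebesgue_eq using sets.top[of circle_arc] by (simp del: space_circle_arc)
  then show "emeasure circle_lebesgue (space circle_lebesgue) \<noteq> \<infinity>"
    using emeasure_finite[of "space circle_arc"] by (simp add: circle_lebesgue_eq)
qed

lemma measure_circle [simp]: "measure circle_lebesgue (sphere 0 1) = 1"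
  using finite_measure_circle_arc(2) sets.top[of circle_arc]
  by (simp add: circle_lebesgue_eq measure_completion)

lemma circle_measurable_continuous: "continuous_on (sphere 0 1) F \<Longrightarrow> F \<in> borel_measurable circle_borel"
  for F :: "complex \<Rightarrow> complex"
  by (rule borel_measurable_continuous_on_restrict)

lemma measurable_circle_lebesgue:
  "F \<in> borel_measurable circle_borel \<Longrightarrow> F \<in> borel_measurable circle_lebesgue"
  using measurable_circle_arc by (auto simp: circle_lebesgue_eq intro: measurable_completion)

lemma L2_space_continuous:
  assumes "is_circle_measure \<mu> \<or> \<mu> = circle_lebesgue \<or> \<mu> = circle_arc" "continuous_on (sphere 0 1) F"
  shows "F \<in> L2_space \<mu>"
proof -
  have "compact (F ` sphere 0 1)" by (intro compact_continuous_image assms) auto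
  then obtain B where B: "\<And>\<omega>. \<omega> \<in> sphere 0 1 \<Longrightarrow> cmod (F \<omega>) \<le> B"
    using bounded_iff compact_imp_bounded by (metis image_eqI)
  have "finite_measure \<mu>" "space \<mu> = sphere 0 1"
    using assms(1) finite_measure_circle_arc by (auto simp: is_circle_measure_def space_circle_measure)
  moreover have "F \<in> borel_measurable \<mu>"
    using circle_measurable_continuous[OF assms(2)] assms(1) measurable_circle_measure
      measurable_circle_lebesgue measurable_circle_arc by auto
  ultimately show ?thesis using B by (intro L2_space_bounded[where B = B]) auto
qed

lemma L2_norm_circle_arc: "F \<in> borel_measurable circle_arc \<Longrightarrow> L2_norm circle_lebesgue F = L2_norm circle_arc F"
  unfolding L2_norm_def circle_lebesgue_eq by (subst integral_completion) auto

lemma L2_space_circle_arc: "F \<in> L2_space circle_arc \<Longrightarrow> F \<in> L2_space circle_lebesgue"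
  unfolding L2_space_def circle_lebesgue_eq
  by (auto intro!: measurable_completion simp: integrable_completion)

text \<open>Orthonormality of the monomials is the source of all norm formulas on the circle.\<close>

lemma circle_orthonormal:
  "L2_inner circle_lebesgue (\<lambda>\<omega>. \<omega> ^ m) (\<lambda>\<omega>. \<omega> ^ n) = (if m = n then 1 else 0)"
proof -
  define k where "k = int m - int n"
  have pw: "cis t ^ m * cnj (cis t ^ n) = cis (of_int k * t)" for t
    by (simp add: Complex.DeMoivre cis_cnj cis_mult k_def algebra_simps)
  have m: "(\<lambda>\<omega>::complex. \<omega> ^ m * cnj (\<omega> ^ n)) \<in> borel_measurable circle_borel"
    by (intro circle_measurable_continuous continuous_intros)
  have "L2_inner circle_lebesgue (\<lambda>\<omega>. \<omega> ^ m) (\<lambda>\<omega>. \<omega> ^ n) =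
      integral\<^sup>L circle_arc (\<lambda>\<omega>. \<omega> ^ m * cnj (\<omega> ^ n))"
    unfolding L2_inner_def circle_lebesgue_eq
    by (rule integral_completion) (use m measurable_circle_arc in auto)
  also have "\<dots> = (\<integral>t. (indicator {0..<2 * pi} t / (2 * pi)) *\<^sub>R cis (of_int k * t) \<partial>lborel)"
    unfolding circle_arc_integral(1)[OF m] pw ..
  also have "\<dots> = (\<integral>t. indicator {0..2 * pi} t *\<^sub>R (cis (of_int k * t) / (2 * pi)) \<partial>lborel)"
  proof (rule integral_cong_AE)
    show "AE t in lborel. (indicator {0..<2 * pi} t / (2 * pi)) *\<^sub>R cis (of_int k * t)
        = indicator {0..2 * pi} t *\<^sub>R (cis (of_int k * t) / (2 * pi))"
      using AE_lborel_singleton[of "2 * pi"]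
      by eventually_elim (auto simp: indicator_def scaleR_conv_of_real)
    have [measurable]: "(\<lambda>t. cis (of_int k * t)) \<in> borel_measurable lborel"
      by (simp add: borel_measurable_continuous_onI continuous_intros)
    show "(\<lambda>t. (indicator {0..<2 * pi} t / (2 * pi)) *\<^sub>R cis (of_int k * t)) \<in> borel_measurable lborel"
      "(\<lambda>t. indicator {0..2 * pi} t *\<^sub>R (cis (of_int k * t) / (2 * pi))) \<in> borel_measurable lborel"
      by measurable
  qed
  also have "\<dots> = (if m = n then 1 else 0)"
  proof (cases "m = n")
    case True
    have "(\<integral>t. indicator {0..2 * pi} t *\<^sub>R (cis (of_int k * t) / (2 * pi)) \<partial>lborel)
        = complex_of_real (2 * pi) / (2 * pi) - complex_of_real 0 / (2 * pi)"
      by (rule integral_FTC_atLeastAtMost)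
        (use True in \<open>auto simp: k_def intro!: derivative_eq_intros continuous_intros\<close>)
    then show ?thesis using True by simp
  next
    case False
    then have k: "k \<noteq> 0" by (simp add: k_def)
    define h where "h t = cis (of_int k * t) / (\<i> * of_int k * (2 * pi))" for t :: real
    have hd: "(h has_vector_derivative cis (of_int k * t) / (2 * pi)) (at t within {0..2*pi})" for t
      unfolding h_def cis_conv_exp using k
      by (auto intro!: derivative_eq_intros has_vector_derivative_real_field simp: field_simps)
    have "(\<integral>t. indicator {0..2 * pi} t *\<^sub>R (cis (of_int k * t) / (2 * pi)) \<partial>lborel) = h (2 * pi) - h 0"
      by (rule integral_FTC_atLeastAtMost) (use hd in \<open>auto intro!: continuous_intros\<close>)
    also have "\<dots> = 0"
      unfolding h_def using cis_multiple_2pi[of "of_int k"] by (simp add: mult.commute mult.left_commute)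
    finally show ?thesis using False by simp
  qed
  finally show ?thesis .
qed

lemma L2_norm_trig_sum:
  "(L2_norm circle_lebesgue (\<lambda>\<omega>. \<Sum>n<N. c n * \<omega> ^ n))\<^sup>2 = (\<Sum>n<N. (cmod (c n))\<^sup>2)"
proof (induction N)
  case 0
  then show ?case by (simp add: L2_norm_def)
next
  case (Suc N)
  have p: "(\<lambda>\<omega>. \<Sum>n<k. c n * \<omega> ^ n) \<in> L2_space circle_lebesgue" for k
    by (intro L2_space_continuous continuous_intros) auto
  have q: "(\<lambda>\<omega>. d * \<omega> ^ k) \<in> L2_space circle_lebesgue" for d k
    by (intro L2_space_continuous continuous_intros) auto
  have orth: "L2_inner circle_lebesgue (\<lambda>\<omega>. \<Sum>n<k. c n * \<omega> ^ n) (\<lambda>\<omega>. \<omega> ^ N) = 0" if "k \<le> N" for k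
    using that
  proof (induction k)
    case 0
    then show ?case by (simp add: L2_inner_def)
  next
    case (Suc k)
    then show ?case
      using L2_inner_add_left[OF p q[of "c k" k] q[of 1 N], of k]
      by (simp add: L2_inner_scale_left circle_orthonormal)
  qed
  have "L2_norm circle_lebesgue (\<lambda>\<omega>. \<omega> ^ N) = 1"
    using L2_inner_self[of circle_lebesgue "\<lambda>\<omega>. \<omega> ^ N"] circle_orthonormal[of N N]
    by (metis L2_norm_nonneg of_real_eq_1_iff power2_eq_1_iff order.trans not_one_le_zero neg_0_le_iff_le zero_neq_one le_minus_one_simps(3))
  then show ?case
    using L2_norm_add_power2[OF p q[of "c N" N], of N] Suc orth[of N]
    by (simp add: L2_inner_scale_right L2_norm_scale)
qed

text \<open>Parseval's identity for an absolutely convergent power series.\<close>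

lemma L2_norm_power_series:
  assumes c: "summable (\<lambda>n. cmod (c n))"
  shows "(\<lambda>n. (cmod (c n))\<^sup>2) sums (L2_norm circle_lebesgue (\<lambda>\<omega>. \<Sum>n. c n * \<omega> ^ n))\<^sup>2"
    "continuous_on (sphere 0 1) (\<lambda>\<omega>. \<Sum>n. c n * \<omega> ^ n)"
proof -
  let ?F = "\<lambda>\<omega>. \<Sum>n. c n * \<omega> ^ n"
  let ?s = "\<lambda>N \<omega>. \<Sum>n<N. c n * \<omega> ^ n"
  have ul: "uniform_limit (sphere 0 1) ?s ?F sequentially"
    by (rule Weierstrass_m_test[where M = "\<lambda>n. cmod (c n)"]) (use c in \<open>auto simp: norm_mult norm_power\<close>)
  show cont: "continuous_on (sphere 0 1) ?F"
    by (rule uniform_limit_theorem[OF _ ul]) (auto intro!: always_eventually continuous_intros)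
  have F: "?F \<in> L2_space circle_lebesgue" by (intro L2_space_continuous cont) auto
  have s: "?s N \<in> L2_space circle_lebesgue" for N by (intro L2_space_continuous continuous_intros) auto
  have "(\<lambda>N. L2_norm circle_lebesgue (?s N)) \<longlonglongrightarrow> L2_norm circle_lebesgue ?F"
  proof (rule LIMSEQ_I)
    fix e :: real assume e: "0 < e"
    have "0 < e/2" using e by simp
    from uniform_limitD[OF ul this] obtain N0
      where N0: "\<And>N \<omega>. N \<ge> N0 \<Longrightarrow> \<omega> \<in> sphere 0 1 \<Longrightarrow> dist (?s N \<omega>) (?F \<omega>) < e/2"
      unfolding eventually_sequentially by blast
    have "norm (L2_norm circle_lebesgue (?s N) - L2_norm circle_lebesgue ?F) < e" if "N \<ge> N0" for N
    proof -
      have "L2_norm circle_lebesgue (\<lambda>\<omega>. ?s N \<omega> - ?F \<omega>) \<le> e/2 * sqrt (measure circle_lebesgue (space circle_lebesgue))"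
        by (rule L2_norm_bounded[OF finite_measure_circle L2_space_diff[OF s F]])
          (use N0[OF that] e in \<open>auto simp: dist_norm intro: less_imp_le\<close>)
      then show ?thesis using L2_norm_triangle_minus[OF s[of N] F] e by simp
    qed
    then show "\<exists>no. \<forall>N\<ge>no. norm (L2_norm circle_lebesgue (?s N) - L2_norm circle_lebesgue ?F) < e" by blast
  qed
  then have "(\<lambda>N. (L2_norm circle_lebesgue (?s N))\<^sup>2) \<longlonglongrightarrow> (L2_norm circle_lebesgue ?F)\<^sup>2"
    by (intro tendsto_power)
  then show "(\<lambda>n. (cmod (c n))\<^sup>2) sums (L2_norm circle_lebesgue ?F)\<^sup>2"
    by (simp add: sums_def L2_norm_trig_sum)
qed

section \<open>The Hardy space as a sequence space\<close>

definition fn :: "ell2 \<Rightarrow> complex \<Rightarrow> complex" where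
  "fn a z = (\<Sum>n. coef a n * z ^ n)"

lemma summable_coef_power:
  assumes "cmod z < 1"
  shows "summable (\<lambda>n. cmod (coef a n * z ^ n))"
proof (rule summable_comparison_test')
  show "summable (\<lambda>n. norm a * cmod z ^ n)" using assms by (intro summable_mult summable_geometric) simp
  show "norm (cmod (coef a n * z ^ n)) \<le> norm a * cmod z ^ n" for n
    using cmod_coef_le[of a n] by (simp add: norm_mult norm_power mult_right_mono)
qed

lemma fn_sums: "cmod z < 1 \<Longrightarrow> (\<lambda>n. coef a n * z ^ n) sums fn a z"
  unfolding fn_def by (intro summable_sums summable_norm_cancel[OF summable_coef_power])

lemma fn_holomorphic: "fn a holomorphic_on ball 0 1"
  by (rule power_series_holomorphic[where a = "coef a"]) (simp add: fn_sums)

lemma fn_continuous: "continuous_on (ball 0 1) (fn a)"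
  by (rule holomorphic_on_imp_continuous_on[OF fn_holomorphic])

lemma fn_add: "cmod z < 1 \<Longrightarrow> fn (a + b) z = fn a z + fn b z"
  using sums_add[OF fn_sums[of z a] fn_sums[of z b]] by (simp add: fn_def sums_iff distrib_right)

lemma fn_diff: "cmod z < 1 \<Longrightarrow> fn (a - b) z = fn a z - fn b z"
  using sums_diff[OF fn_sums[of z a] fn_sums[of z b]] by (simp add: fn_def sums_iff left_diff_distrib)

lemma fn_cscale: "cmod z < 1 \<Longrightarrow> fn (cscale c a) z = c * fn a z"
  using sums_mult[OF fn_sums[of z a], of c] by (simp add: fn_def sums_iff mult.assoc)

lemma fn_zero [simp]: "fn 0 z = 0"
  by (simp add: fn_def)

lemma fn_0: "fn a 0 = coef a 0"
proof -
  have "(\<lambda>n. coef a n * 0 ^ n) sums coef a 0" by (rule powser_sums_zero)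
  then show ?thesis by (simp add: fn_def sums_iff)
qed

lemma power_less_one_ell2: "cmod z < 1 \<Longrightarrow> summable (\<lambda>n. (cmod (z ^ n))\<^sup>2)"
proof -
  assume "cmod z < 1"
  then have "summable (\<lambda>n. ((cmod z)\<^sup>2) ^ n)" by (intro summable_geometric) (simp add: abs_square_less_1)
  then show ?thesis by (simp add: norm_power power_mult[symmetric] mult.commute)
qed

text \<open>Dilation acts on coefficients.  Outside \<open>\<bar>r\<bar> \<le> 1\<close>, where the sequence may fail to be square-summable,
  the value is an arbitrary default.\<close>

lift_definition dil :: "real \<Rightarrow> ell2 \<Rightarrow> ell2" is "\<lambda>r a n. if \<bar>r\<bar> \<le> 1 then of_real r ^ n * a n else 0"
proof -
  fix r :: real and a :: "nat \<Rightarrow> complex"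
  assume a: "summable (\<lambda>n. (cmod (a n))\<^sup>2)"
  show "summable (\<lambda>n. (cmod (if \<bar>r\<bar> \<le> 1 then of_real r ^ n * a n else 0))\<^sup>2)"
  proof (cases "\<bar>r\<bar> \<le> 1")
    case True
    have "(cmod (of_real r ^ n * a n))\<^sup>2 \<le> (cmod (a n))\<^sup>2" for n
      using True power_le_one[of "\<bar>r\<bar>" n] by (auto simp: norm_mult norm_power intro!: power_mono mult_left_le_one_le)
    then show ?thesis
      using True by (auto intro!: summable_comparison_test'[OF a, where N = 0])
  qed simp
qed

lemma coef_dil: "0 < r \<Longrightarrow> r < 1 \<Longrightarrow> coef (dil r a) n = of_real r ^ n * coef a n"
  by (simp add: dil.rep_eq)

lemma fn_dil: "0 < r \<Longrightarrow> r < 1 \<Longrightarrow> fn (dil r a) z = fn a (of_real r * z)"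
  by (simp add: fn_def coef_dil power_mult_distrib mult.commute mult.left_commute)

lemma norm_dil_le:
  assumes "0 < r" "r < 1"
  shows "norm (dil r a) \<le> norm a"
proof (rule power2_le_imp_le)
  have "(cmod (of_real r ^ n * coef a n))\<^sup>2 \<le> (cmod (coef a n))\<^sup>2" for n
    using assms power_le_one[of r n] by (auto simp: norm_mult norm_power intro!: power_mono mult_left_le_one_le)
  then show "(norm (dil r a))\<^sup>2 \<le> (norm a)\<^sup>2"
    using assms summable_coef[of "dil r a"] unfolding norm_ell2_power2
    by (intro suminf_le summable_coef) (auto simp: coef_dil)
qed simp

lemma eventually_at_left_1: "\<forall>\<^sub>F r in at_left (1::real). 0 < r \<and> r < 1"
  using eventually_at_left_real[of 0 "1::real"] by simp

lemma dil_tendsto: "((\<lambda>r. dil r a) \<longlongrightarrow> a) (at_left 1)"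
proof -
  note ev = eventually_at_left_1
  have "((\<lambda>r. \<Sum>n. (1 - r ^ n)\<^sup>2 * (cmod (coef a n))\<^sup>2) \<longlongrightarrow> (\<Sum>n. 0::real)) (at_left 1)"
  proof (rule tannerys_theorem[THEN conjunct2, THEN conjunct2])
    show "((\<lambda>r. (1 - r ^ k)\<^sup>2 * (cmod (coef a k))\<^sup>2) \<longlongrightarrow> 0) (at_left 1)" for k
      by (auto intro!: tendsto_eq_intros)
    have "norm ((1 - r ^ k)\<^sup>2 * (cmod (coef a k))\<^sup>2) \<le> (cmod (coef a k))\<^sup>2" if "0 < r" "r < 1" for k and r :: real
    proof -
      have "0 \<le> 1 - r ^ k" "1 - r ^ k \<le> 1" using that power_le_one[of r k] by auto
      then have "(1 - r ^ k)\<^sup>2 \<le> 1\<^sup>2" by (intro power_mono) auto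
      then show ?thesis by (simp add: abs_mult mult_left_le_one_le)
    qed
    then show "\<forall>\<^sub>F (k, r) in sequentially \<times>\<^sub>F at_left 1.
        norm ((1 - r ^ k)\<^sup>2 * (cmod (coef a k))\<^sup>2) \<le> (cmod (coef a k))\<^sup>2"
      unfolding eventually_prod_filter
      by (intro exI[of _ "\<lambda>_. True"] exI[of _ "\<lambda>r. 0 < r \<and> r < 1"]) (use ev in auto)
    show "summable (\<lambda>n. (cmod (coef a n))\<^sup>2)" by (rule summable_coef)
  qed simp
  moreover have "\<forall>\<^sub>F r in at_left 1. (\<Sum>n. (1 - r ^ n)\<^sup>2 * (cmod (coef a n))\<^sup>2) = (norm (dil r a - a))\<^sup>2"
    using ev
  proof eventually_elim
    case (elim r)
    have "cmod (of_real r ^ n * coef a n - coef a n) = \<bar>1 - r ^ n\<bar> * cmod (coef a n)" for n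
    proof -
      have "of_real r ^ n * coef a n - coef a n = of_real (r ^ n - 1) * coef a n" by (simp add: algebra_simps)
      then show ?thesis by (metis abs_minus_commute norm_mult norm_of_real)
    qed
    then show ?case
      using elim by (simp add: norm_ell2_power2 coef_dil power_mult_distrib)
  qed
  ultimately have "((\<lambda>r. (norm (dil r a - a))\<^sup>2) \<longlongrightarrow> 0) (at_left 1)"
    by (simp add: tendsto_cong)
  then have "((\<lambda>r. sqrt ((norm (dil r a - a))\<^sup>2)) \<longlongrightarrow> sqrt 0) (at_left 1)" by (rule tendsto_real_sqrt)
  then show ?thesis by (simp add: LIM_zero_iff tendsto_norm_zero_iff)
qed

lemma dilate_fn_eq: "0 < r \<Longrightarrow> r < 1 \<Longrightarrow> dilate (fn a) r \<omega> = (\<Sum>n. (of_real r ^ n * coef a n) * \<omega> ^ n)"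
  by (simp add: dilate_def fn_def power_mult_distrib mult.commute mult.left_commute)

lemma continuous_on_dilate:
  assumes "continuous_on (ball 0 1) f" "0 < r" "r < 1"
  shows "continuous_on (sphere 0 1) (dilate f r)"
  unfolding dilate_def
  by (rule continuous_on_compose2[OF assms(1)]) (use assms in \<open>auto intro!: continuous_intros simp: norm_mult\<close>)

lemma L2_norm_dilate_diff:
  assumes "0 < r" "r < 1" "0 < s" "s < 1"
  shows "L2_norm circle_lebesgue (\<lambda>\<omega>. dilate (fn a) r \<omega> - dilate (fn b) s \<omega>) = norm (dil r a - dil s b)"
proof -
  have sm: "summable (\<lambda>n. cmod (of_real t ^ n * coef a n))" if "0 < t" "t < 1" for t a
    using summable_coef_power[of "of_real t" a] that by (simp add: mult.commute)
  let ?c = "\<lambda>n. of_real r ^ n * coef a n - of_real s ^ n * coef b n"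
  have c: "summable (\<lambda>n. cmod (?c n))"
    by (rule summable_comparison_test'[OF summable_add[OF sm[OF assms(1,2), of a] sm[OF assms(3,4), of b]], where N = 0])
      (simp add: norm_triangle_ineq4)
  have "dilate (fn a) r \<omega> - dilate (fn b) s \<omega> = (\<Sum>n. ?c n * \<omega> ^ n)" if "cmod \<omega> = 1" for \<omega>
  proof -
    have "summable (\<lambda>n. of_real t ^ n * coef a n * \<omega> ^ n)" if "0 < t" "t < 1" for t a
      by (rule summable_norm_cancel) (use sm[OF that, of a] \<open>cmod \<omega> = 1\<close> in \<open>simp add: norm_mult norm_power\<close>)
    then show ?thesis
      using assms by (simp add: dilate_fn_eq suminf_diff left_diff_distrib)
  qed
  then have "L2_norm circle_lebesgue (\<lambda>\<omega>. dilate (fn a) r \<omega> - dilate (fn b) s \<omega>)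
      = L2_norm circle_lebesgue (\<lambda>\<omega>. \<Sum>n. ?c n * \<omega> ^ n)"
    by (intro L2_norm_cong) simp
  moreover have "(norm (dil r a - dil s b))\<^sup>2 = (L2_norm circle_lebesgue (\<lambda>\<omega>. \<Sum>n. ?c n * \<omega> ^ n))\<^sup>2"
    using L2_norm_power_series(1)[OF c] assms by (simp add: norm_ell2_power2 coef_dil sums_iff)
  ultimately show ?thesis
    using power2_eq_imp_eq[OF _ L2_norm_nonneg norm_ge_zero] by simp
qed

lemma L2_norm_dilate:
  assumes "0 < r" "r < 1"
  shows "L2_norm circle_lebesgue (dilate (fn a) r) = norm (dil r a)"
proof -
  have "dil r 0 = 0" using assms by (intro ell2_eqI) (simp add: coef_dil)
  moreover have "dilate (fn 0) r \<omega> = 0" for \<omega> by (simp add: dilate_def)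
  ultimately show ?thesis using L2_norm_dilate_diff[OF assms assms, of a 0] by simp
qed

lemma fn_in_hardy2: "fn a \<in> hardy2"
  unfolding hardy2_def
  by (auto intro!: fn_holomorphic bdd_aboveI[of _ "norm a"] simp: L2_norm_dilate norm_dil_le)

text \<open>A uniform bound for the means on circles bounds all partial sums of the squared Taylor coefficients,
  by Parseval's identity and \<open>r \<rightarrow> 1\<close>.\<close>

lemma hardy2_bounded_imp_fn:
  assumes hol: "f holomorphic_on ball 0 1"
    and bd: "\<And>r. 0 < r \<Longrightarrow> r < 1 \<Longrightarrow> L2_norm circle_lebesgue (dilate f r) \<le> C"
  shows "\<exists>a. (\<forall>z\<in>ball 0 1. f z = fn a z) \<and> norm a \<le> C"
proof -
  define c where "c n = (deriv ^^ n) f 0 / fact n" for n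
  have sums: "(\<lambda>n. c n * z ^ n) sums f z" if "cmod z < 1" for z
    using holomorphic_power_series[OF hol, of z] that by (simp add: c_def)
  have abs: "summable (\<lambda>n. cmod (of_real r ^ n * c n))" if r: "0 < r" "r < 1" for r :: real
  proof -
    have "summable (\<lambda>n. c n * of_real ((r + 1) / 2) ^ n)"
      using sums[of "of_real ((r + 1) / 2)"] r by (simp add: sums_iff del: of_real_divide of_real_add)
    from powser_insidea[OF this, of "of_real r"] show ?thesis
      using r by (simp add: mult.commute del: of_real_divide of_real_add)
  qed
  have C: "0 \<le> C" using bd[of "1/2"] L2_norm_nonneg[of circle_lebesgue "dilate f (1/2)"] by linarith
  have part: "(\<Sum>n<N. (cmod (of_real r ^ n * c n))\<^sup>2) \<le> C\<^sup>2" if r: "0 < r" "r < 1" for r :: real and N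
  proof -
    have "L2_norm circle_lebesgue (dilate f r) = L2_norm circle_lebesgue (\<lambda>\<omega>. \<Sum>n. (of_real r ^ n * c n) * \<omega> ^ n)"
    proof (rule L2_norm_cong)
      fix \<omega> assume "\<omega> \<in> space circle_lebesgue"
      then have "cmod (of_real r * \<omega>) < 1" using r by (simp add: norm_mult)
      from sums[OF this] show "cmod (dilate f r \<omega>) = cmod (\<Sum>n. (of_real r ^ n * c n) * \<omega> ^ n)"
        by (simp add: dilate_def sums_iff power_mult_distrib mult.commute mult.left_commute)
    qed
    then have "(\<lambda>n. (cmod (of_real r ^ n * c n))\<^sup>2) sums (L2_norm circle_lebesgue (dilate f r))\<^sup>2"
      using L2_norm_power_series(1)[OF abs[OF r]] by simp
    from sum_le_suminf[OF sums_summable[OF this], of "{..<N}"] sums_unique[OF this]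
    have "(\<Sum>n<N. (cmod (of_real r ^ n * c n))\<^sup>2) \<le> (L2_norm circle_lebesgue (dilate f r))\<^sup>2"
      by simp
    also have "\<dots> \<le> C\<^sup>2" using bd[OF r] by (intro power_mono) auto
    finally show ?thesis .
  qed
  have "(\<Sum>n<N. (cmod (c n))\<^sup>2) \<le> C\<^sup>2" for N
  proof (rule tendsto_upperbound)
    show "((\<lambda>r. \<Sum>n<N. (cmod (of_real r ^ n * c n))\<^sup>2) \<longlongrightarrow> (\<Sum>n<N. (cmod (c n))\<^sup>2)) (at_left (1::real))"
      by (intro tendsto_sum tendsto_power tendsto_norm) (auto intro!: tendsto_eq_intros)
    show "\<forall>\<^sub>F r in at_left (1::real). (\<Sum>n<N. (cmod (of_real r ^ n * c n))\<^sup>2) \<le> C\<^sup>2"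
      using eventually_at_left_1 by eventually_elim (use part in auto)
  qed simp
  from Abs_ell2_bounded[OF this C] have a: "coef (Abs_ell2 c) = c" "norm (Abs_ell2 c) \<le> C" by auto
  have "f z = fn (Abs_ell2 c) z" if "z \<in> ball 0 1" for z
    using sums[of z] that by (simp add: fn_def a sums_iff)
  then show ?thesis using a(2) by blast
qed

lemma hardy2_imp_fn:
  assumes "f \<in> hardy2"
  shows "\<exists>a. \<forall>z\<in>ball 0 1. f z = fn a z"
proof -
  obtain C where "\<And>r. r \<in> {0<..<1} \<Longrightarrow> L2_norm circle_lebesgue (dilate f r) \<le> C"
    using assms unfolding hardy2_def bdd_above_def by blast
  then show ?thesis using hardy2_bounded_imp_fn[of f C] assms by (auto simp: hardy2_def)
qed

lemma fn_eq_imp_eq: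
  assumes "\<And>z. cmod z < 1 \<Longrightarrow> fn a z = fn b z"
  shows "a = b"
proof (rule ell2_eqI)
  fix n
  have "dil (1/2) (a - b) = 0"
  proof -
    have "norm (dil (1/2) (a - b)) = L2_norm circle_lebesgue (dilate (fn (a - b)) (1/2))"
      by (simp add: L2_norm_dilate)
    also have "\<dots> = L2_norm circle_lebesgue (\<lambda>_. 0)"
      by (rule L2_norm_cong) (simp add: dilate_def fn_diff norm_mult assms)
    also have "\<dots> = 0" by (simp add: L2_norm_def)
    finally show ?thesis by simp
  qed
  then have "coef (dil (1/2) (a - b)) n = 0" by simp
  then show "coef a n = coef b n" by (simp add: coef_dil)
qed

lemma hardy2_eq: "f \<in> hardy2 \<longleftrightarrow> (\<exists>a. \<forall>z\<in>ball 0 1. f z = fn a z)"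
proof
  assume "\<exists>a. \<forall>z\<in>ball 0 1. f z = fn a z"
  then obtain a where a: "\<And>z. z \<in> ball 0 1 \<Longrightarrow> f z = fn a z" by blast
  have "L2_norm circle_lebesgue (dilate f r) = L2_norm circle_lebesgue (dilate (fn a) r)" if "r \<in> {0<..<1}" for r
    by (rule L2_norm_cong) (use that a in \<open>simp add: dilate_def norm_mult\<close>)
  moreover have "f holomorphic_on ball 0 1"
    using holomorphic_transform[OF fn_holomorphic[of a]] a by simp
  ultimately show "f \<in> hardy2"
    using fn_in_hardy2[of a] by (simp add: hardy2_def cong: image_cong_simp)
qed (rule hardy2_imp_fn)

section \<open>Boundary values\<close>

text \<open>The Hardy--Littlewood weak-type inequality.  Vitali's covering lemma selects disjoint balls whose five-fold
  enlargements cover the exceptional set; on each of them the measure exceeds \<open>\<alpha>\<close> times the radius.\<close>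

lemma maximal_weak_type:
  fixes g :: "real \<Rightarrow> ennreal"
  assumes g [measurable]: "g \<in> borel_measurable borel" and \<alpha>: "0 < \<alpha>"
  shows "\<exists>U\<in>sets borel. {x. \<exists>r>0. ennreal (\<alpha> * r) < emeasure (density lborel g) (cball x r)} \<subseteq> U \<and>
    emeasure lborel U \<le> ennreal (10 / \<alpha>) * (\<integral>\<^sup>+x. g x \<partial>lborel)"
proof (cases "(\<integral>\<^sup>+x. g x \<partial>lborel) = \<infinity>")
  case True
  then show ?thesis using \<alpha> by (intro bexI[of _ UNIV]) (auto simp: ennreal_mult_top)
next
  case False
  define \<nu> where "\<nu> = density lborel g"
  define I where "I = (\<integral>\<^sup>+x. g x \<partial>lborel)"
  have \<nu>I: "emeasure \<nu> A \<le> I" for A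
  proof (cases "A \<in> sets lborel")
    case True
    then have "emeasure \<nu> A = (\<integral>\<^sup>+x. g x * indicator A x \<partial>lborel)"
      unfolding \<nu>_def by (subst emeasure_density) auto
    also have "\<dots> \<le> I" unfolding I_def by (intro nn_integral_mono) (auto simp: indicator_def)
    finally show ?thesis .
  qed (simp add: \<nu>_def emeasure_notin_sets)
  define E where "E = {x. \<exists>r>0. ennreal (\<alpha> * r) < emeasure \<nu> (cball x r)}"
  then have "\<forall>x\<in>E. \<exists>r. 0 < r \<and> ennreal (\<alpha> * r) < emeasure \<nu> (cball x r)" by auto
  from bchoice[OF this] obtain r where r: "\<And>x. x \<in> E \<Longrightarrow> 0 < r x \<and> ennreal (\<alpha> * r x) < emeasure \<nu> (cball x (r x))"
    by blast
  have rb: "r x \<le> enn2real I / \<alpha>" if "x \<in> E" for x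
  proof -
    have "ennreal (\<alpha> * r x) \<le> I" using r[OF that] \<nu>I by (meson less_imp_le order_trans)
    then have "\<alpha> * r x \<le> enn2real I"
      using False \<alpha> r[OF that] by (metis I_def enn2real_ennreal enn2real_mono infinity_ennreal_def less_imp_le mult_nonneg_nonneg top.not_eq_extremum)
    then show ?thesis using \<alpha> by (simp add: field_simps)
  qed
  have cover: "E \<subseteq> (\<Union>i\<in>E. cball i (r i))"
    using r by (force intro: less_imp_le)
  obtain C where C: "countable C" "C \<subseteq> E" "pairwise (\<lambda>i j. disjnt (cball i (r i)) (cball j (r j))) C"
      "E \<subseteq> (\<Union>i\<in>C. cball i (5 * r i))"
    by (rule Vitali_covering_lemma_cballs[OF cover, of "enn2real I / \<alpha>"]) (use r rb in auto)
  define J where "J = to_nat_on C ` C"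
  define p where "p = from_nat_into C"
  have pJ: "p n \<in> C" "to_nat_on C (p n) = n" if "n \<in> J" for n
    using that C(1) by (auto simp: J_def p_def)
  have Cp: "\<exists>n\<in>J. x = p n" if "x \<in> C" for x
    using that C(1) by (auto simp: J_def p_def)
  define A where "A n = (if n \<in> J then cball (p n) (r (p n)) else {})" for n
  define B where "B n = (if n \<in> J then cball (p n) (5 * r (p n)) else {})" for n
  have disj: "disjoint_family A"
    unfolding disjoint_family_on_def
  proof (intro ballI impI)
    fix m n :: nat assume "m \<noteq> n"
    then show "A m \<inter> A n = {}"
      using C(3) pJ unfolding A_def pairwise_def disjnt_def by (metis inf_bot_left inf_bot_right)
  qed
  have BA: "emeasure lborel (B n) \<le> ennreal (10 / \<alpha>) * emeasure \<nu> (A n)" for n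
  proof (cases "n \<in> J")
    case True
    then have x: "p n \<in> E" using pJ C(2) by blast
    have "emeasure lborel (B n) = ennreal (10 * r (p n))"
      using True r[OF x] by (simp add: B_def cball_eq_atLeastAtMost)
    also have "\<dots> = ennreal (10 / \<alpha>) * ennreal (\<alpha> * r (p n))"
      using \<alpha> r[OF x] by (simp add: ennreal_mult[symmetric])
    also have "\<dots> \<le> ennreal (10 / \<alpha>) * emeasure \<nu> (A n)"
      using True r[OF x] by (intro mult_left_mono) (auto simp: A_def)
    finally show ?thesis .
  qed (simp add: B_def)
  have meas: "range A \<subseteq> sets \<nu>" "range B \<subseteq> sets lborel"
    by (auto simp: A_def B_def \<nu>_def)
  have "emeasure lborel (\<Union>n. B n) \<le> (\<Sum>n. emeasure lborel (B n))"
    by (rule emeasure_subadditive_countably[OF meas(2)])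
  also have "\<dots> \<le> (\<Sum>n. ennreal (10 / \<alpha>) * emeasure \<nu> (A n))"
    by (intro suminf_le BA) auto
  also have "\<dots> = ennreal (10 / \<alpha>) * emeasure \<nu> (\<Union>n. A n)"
    unfolding ennreal_suminf_cmult suminf_emeasure[OF meas(1) disj] ..
  also have "\<dots> \<le> ennreal (10 / \<alpha>) * I"
    by (intro mult_left_mono \<nu>I) auto
  finally have "emeasure lborel (\<Union>n. B n) \<le> ennreal (10 / \<alpha>) * I" .
  moreover have "E \<subseteq> (\<Union>n. B n)"
  proof
    fix x assume "x \<in> E"
    then obtain i where "i \<in> C" "x \<in> cball i (5 * r i)" using C(4) by blast
    then show "x \<in> (\<Union>n. B n)" using Cp[of i] by (auto simp: B_def)
  qed
  ultimately show ?thesis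
    using meas(2) unfolding E_def \<nu>_def I_def by (intro bexI[of _ "\<Union>n. B n"]) auto
qed

text \<open>The weak-type inequality makes the exceptional sets of \<open>h k\<close> arbitrarily small, so that almost every point
  escapes one of them; Markov's inequality does the same for the values at the point itself.\<close>

lemma AE_small_averages:
  fixes h :: "nat \<Rightarrow> real \<Rightarrow> ennreal"
  assumes h [measurable]: "\<And>k. h k \<in> borel_measurable borel"
    and lim: "(\<lambda>k. \<integral>\<^sup>+x. h k x \<partial>lborel) \<longlonglongrightarrow> 0"
  shows "AE x in lborel. \<forall>\<epsilon>>0. \<exists>k. (\<forall>r>0. emeasure (density lborel (h k)) (cball x r) \<le> ennreal (\<epsilon> * r)) \<and>
    h k x \<le> ennreal \<epsilon>"
proof -
  let ?good = "\<lambda>\<epsilon> x k. (\<forall>r>0. emeasure (density lborel (h k)) (cball x r) \<le> ennreal (\<epsilon> * r)) \<and> h k x \<le> ennreal \<epsilon>"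
  have one: "AE x in lborel. \<exists>k. ?good \<epsilon> x k" if \<epsilon>: "0 < \<epsilon>" for \<epsilon>
  proof -
    have "\<forall>k. \<exists>U. U \<in> sets borel \<and> {x. \<exists>r>0. ennreal (\<epsilon> * r) < emeasure (density lborel (h k)) (cball x r)} \<subseteq> U \<and>
      emeasure lborel U \<le> ennreal (10 / \<epsilon>) * (\<integral>\<^sup>+x. h k x \<partial>lborel)"
      using maximal_weak_type[OF h \<epsilon>] by blast
    from choice[OF this] obtain U where U: "\<And>k. U k \<in> sets borel"
      "\<And>k. {x. \<exists>r>0. ennreal (\<epsilon> * r) < emeasure (density lborel (h k)) (cball x r)} \<subseteq> U k"
      "\<And>k. emeasure lborel (U k) \<le> ennreal (10 / \<epsilon>) * (\<integral>\<^sup>+x. h k x \<partial>lborel)" by blast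
    define W where "W k = U k \<union> {x. 1 \<le> ennreal (1/\<epsilon>) * h k x}" for k
    have W [measurable]: "W k \<in> sets borel" for k
      unfolding W_def using U(1) by measurable
    have Wm: "emeasure lborel (W k) \<le> ennreal (11 / \<epsilon>) * (\<integral>\<^sup>+x. h k x \<partial>lborel)" for k
    proof -
      have "emeasure lborel {x. 1 \<le> ennreal (1/\<epsilon>) * h k x} \<le> ennreal (1/\<epsilon>) * (\<integral>\<^sup>+x. h k x * indicator UNIV x \<partial>lborel)"
        using nn_integral_Markov_inequality[where M = lborel and u = "h k" and c = "ennreal (1/\<epsilon>)" and A = UNIV] by simp
      moreover have "emeasure lborel (W k) \<le> emeasure lborel (U k) + emeasure lborel {x. 1 \<le> ennreal (1/\<epsilon>) * h k x}"
        unfolding W_def by (intro emeasure_subadditive) (use U in auto)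
      ultimately have "emeasure lborel (W k) \<le> ennreal (10 / \<epsilon>) * (\<integral>\<^sup>+x. h k x \<partial>lborel) + ennreal (1/\<epsilon>) * (\<integral>\<^sup>+x. h k x \<partial>lborel)"
        using U(3)[of k] by (simp add: order_trans[OF _ add_mono])
      also have "\<dots> = ennreal (11 / \<epsilon>) * (\<integral>\<^sup>+x. h k x \<partial>lborel)"
        using \<epsilon> by (simp add: distrib_right[symmetric] ennreal_plus[symmetric] add_divide_distrib[symmetric] del: ennreal_plus)
      finally show ?thesis .
    qed
    have "emeasure lborel (\<Inter>k. W k) \<le> 0"
    proof (rule LIMSEQ_le_const)
      show "(\<lambda>k. ennreal (11 / \<epsilon>) * (\<integral>\<^sup>+x. h k x \<partial>lborel)) \<longlonglongrightarrow> 0"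
        using ennreal_tendsto_cmult[OF _ lim, of "ennreal (11/\<epsilon>)"] by simp
      show "\<exists>N. \<forall>k\<ge>N. emeasure lborel (\<Inter>k. W k) \<le> ennreal (11 / \<epsilon>) * (\<integral>\<^sup>+x. h k x \<partial>lborel)"
        using order_trans[OF emeasure_mono[of "\<Inter>k. W k" "W _" lborel] Wm] W by auto
    qed
    then have "(\<Inter>k. W k) \<in> null_sets lborel"
      using W by (auto simp: null_sets_def)
    moreover have "{x \<in> space lborel. \<not> (\<exists>k. ?good \<epsilon> x k)} \<subseteq> (\<Inter>k. W k)"
    proof
      fix x assume "x \<in> {x \<in> space lborel. \<not> (\<exists>k. ?good \<epsilon> x k)}"
      then have nk: "\<not> ?good \<epsilon> x k" for k by simp
      have "x \<in> W k" for k
      proof (cases "\<exists>r>0. ennreal (\<epsilon> * r) < emeasure (density lborel (h k)) (cball x r)")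
        case True
        then show ?thesis using U(2)[of k] by (auto simp: W_def)
      next
        case False
        then have "\<forall>r>0. emeasure (density lborel (h k)) (cball x r) \<le> ennreal (\<epsilon> * r)"
          by (meson not_less)
        then have "ennreal \<epsilon> < h k x" using nk[of k] by (meson not_le)
        then have "ennreal (1/\<epsilon>) * ennreal \<epsilon> \<le> ennreal (1/\<epsilon>) * h k x"
          by (intro mult_left_mono) auto
        then have "1 \<le> ennreal (1/\<epsilon>) * h k x" using \<epsilon> by (simp add: ennreal_mult[symmetric])
        then show ?thesis by (simp add: W_def)
      qed
      then show "x \<in> (\<Inter>k. W k)" by blast
    qed
    ultimately show ?thesis by (rule AE_I')
  qed
  have "AE x in lborel. \<forall>m::nat. \<exists>k. ?good (1 / Suc m) x k"
    unfolding AE_all_countable by (intro allI one) simp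
  then show ?thesis
  proof eventually_elim
    case (elim x)
    show ?case
    proof (intro allI impI)
      fix \<epsilon> :: real assume "0 < \<epsilon>"
      then obtain m where m: "1 / Suc m < \<epsilon>" using nat_approx_posE by blast
      obtain k where k: "?good (1 / Suc m) x k" using elim by blast
      have "emeasure (density lborel (h k)) (cball x r) \<le> ennreal (\<epsilon> * r)" if "r > 0" for r
      proof -
        have "ennreal (1 / Suc m * r) \<le> ennreal (\<epsilon> * r)"
          using m that by (intro ennreal_leI mult_right_mono) auto
        then show ?thesis using k that by (meson order_trans)
      qed
      moreover have "h k x \<le> ennreal \<epsilon>" using k m by (meson ennreal_leI less_imp_le order_trans)
      ultimately show "\<exists>k. ?good \<epsilon> x k" by blast
    qed
  qed
qed

text \<open>Lebesgue's differentiation theorem for a function that is a pointwise limit of primitives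
  \<open>G\<^sub>k\<close> of functions \<open>\<psi>\<^sub>k\<close> converging to \<open>\<Psi>\<close> in mean: near a point at which the averages of
  \<open>|\<Psi> - \<psi>\<^sub>k|\<close> are small, \<open>G\<close> inherits the difference quotients of \<open>G\<^sub>k\<close> up to a small error.\<close>

lemma AE_differentiable_limit:
  fixes G \<Psi> :: "real \<Rightarrow> complex" and Gk \<psi> :: "nat \<Rightarrow> real \<Rightarrow> complex"
  assumes ab: "a < b" and \<Psi> [measurable]: "\<Psi> \<in> borel_measurable borel"
    and \<psi>: "\<And>k. continuous_on UNIV (\<psi> k)"
    and deriv: "\<And>k t. (Gk k has_vector_derivative \<psi> k t) (at t)"
    and G: "\<And>t. (\<lambda>k. Gk k t) \<longlonglongrightarrow> G t"
    and mean: "(\<lambda>k. \<integral>\<^sup>+t. ennreal (indicator {a..b} t * cmod (\<Psi> t - \<psi> k t)) \<partial>lborel) \<longlonglongrightarrow> 0"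
  shows "AE t in lborel. t \<in> {a<..<b} \<longrightarrow> (G has_vector_derivative \<Psi> t) (at t)"
proof -
  have [measurable]: "\<psi> k \<in> borel_measurable borel" for k
    using \<psi> by (rule borel_measurable_continuous_onI)
  define h where "h k t = ennreal (indicator {a..b} t * cmod (\<Psi> t - \<psi> k t))" for k t
  have h [measurable]: "h k \<in> borel_measurable borel" for k unfolding h_def by measurable
  have incr: "ennreal (cmod ((G s - Gk k s) - (G t - Gk k t))) \<le> emeasure (density lborel (h k)) (cball t \<bar>s - t\<bar>)"
    if st: "s \<in> {a<..<b}" "t \<in> {a<..<b}" for s t k
  proof -
    let ?u = "min s t" and ?v = "max s t"
    have cb [measurable]: "cball t \<bar>s - t\<bar> \<in> sets borel" by simp
    have sub: "{?u..?v} \<subseteq> cball t \<bar>s - t\<bar>" by (auto simp: dist_real_def)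
    have step: "ennreal (cmod ((Gk m s - Gk k s) - (Gk m t - Gk k t)))
        \<le> (\<integral>\<^sup>+x. h m x \<partial>lborel) + emeasure (density lborel (h k)) (cball t \<bar>s - t\<bar>)" for m
    proof -
      let ?D = "\<lambda>x. indicator {?u..?v} x *\<^sub>R (\<psi> m x - \<psi> k x)"
      have c: "continuous_on {?u..?v} (\<lambda>x. \<psi> m x - \<psi> k x)"
        by (intro continuous_intros continuous_on_subset[OF \<psi>]) auto
      have "integral\<^sup>L lborel ?D = (Gk m ?v - Gk k ?v) - (Gk m ?u - Gk k ?u)"
        by (rule integral_FTC_atLeastAtMost[where F = "\<lambda>x. Gk m x - Gk k x", OF _ _ c])
          (auto intro!: has_vector_derivative_diff has_vector_derivative_at_within[OF deriv])
      then have "cmod ((Gk m s - Gk k s) - (Gk m t - Gk k t)) = cmod (integral\<^sup>L lborel ?D)"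
        by (cases "s \<le> t") (auto simp: min_def max_def norm_minus_commute)
      then have "ennreal (cmod ((Gk m s - Gk k s) - (Gk m t - Gk k t))) = ennreal (cmod (integral\<^sup>L lborel ?D))"
        by simp
      also have "\<dots> \<le> (\<integral>\<^sup>+x. ennreal (cmod (?D x)) \<partial>lborel)"
        by (intro integral_norm_bound_ennreal borel_integrable_compact c) auto
      also have "\<dots> \<le> (\<integral>\<^sup>+x. h m x + h k x * indicator (cball t \<bar>s - t\<bar>) x \<partial>lborel)"
      proof (rule nn_integral_mono)
        fix x
        show "ennreal (cmod (?D x)) \<le> h m x + h k x * indicator (cball t \<bar>s - t\<bar>) x"
        proof (cases "x \<in> {?u..?v}")
          case True
          then have x: "x \<in> {a..b}" "x \<in> cball t \<bar>s - t\<bar>" using st sub by (auto simp: min_def max_def split: if_splits)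
          have "cmod (\<psi> m x - \<psi> k x) \<le> cmod (\<Psi> x - \<psi> m x) + cmod (\<Psi> x - \<psi> k x)"
            using norm_triangle_ineq4[of "\<Psi> x - \<psi> k x" "\<Psi> x - \<psi> m x"] by (simp add: norm_minus_commute)
          then show ?thesis using True x by (simp add: h_def ennreal_plus[symmetric] ennreal_leI del: ennreal_plus)
        qed simp
      qed
      also have "\<dots> = (\<integral>\<^sup>+x. h m x \<partial>lborel) + emeasure (density lborel (h k)) (cball t \<bar>s - t\<bar>)"
        by (subst nn_integral_add) (auto simp: emeasure_density)
      finally show ?thesis .
    qed
    have "(\<lambda>m. ennreal (cmod ((Gk m s - Gk k s) - (Gk m t - Gk k t)))) \<longlonglongrightarrow>
        ennreal (cmod ((G s - Gk k s) - (G t - Gk k t)))"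
      by (intro tendsto_ennrealI tendsto_norm tendsto_diff tendsto_const G)
    moreover have "(\<lambda>m. (\<integral>\<^sup>+x. h m x \<partial>lborel) + emeasure (density lborel (h k)) (cball t \<bar>s - t\<bar>))
        \<longlonglongrightarrow> 0 + emeasure (density lborel (h k)) (cball t \<bar>s - t\<bar>)"
      by (intro tendsto_add tendsto_const) (use mean in \<open>simp add: h_def\<close>)
    ultimately show ?thesis using step by (intro LIMSEQ_le[where X = "\<lambda>m. ennreal (cmod ((Gk m s - Gk k s) - (Gk m t - Gk k t)))"]) auto
  qed
  from mean have "(\<lambda>k. \<integral>\<^sup>+t. h k t \<partial>lborel) \<longlonglongrightarrow> 0" by (simp add: h_def)
  from AE_small_averages[OF h this]
  show ?thesis
  proof eventually_elim
    case (elim t)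
    show ?case
    proof
      assume t: "t \<in> {a<..<b}"
      show "(G has_vector_derivative \<Psi> t) (at t)"
        unfolding has_vector_derivative_def has_derivative_at_alt
      proof (intro conjI allI impI bounded_linear_scaleR_left)
        fix e :: real assume e: "0 < e"
        then obtain k where k: "\<And>r. r > 0 \<Longrightarrow> emeasure (density lborel (h k)) (cball t r) \<le> ennreal (e/3 * r)"
          "h k t \<le> ennreal (e/3)" using elim[rule_format, of "e/3"] by auto
        have kt: "cmod (\<Psi> t - \<psi> k t) \<le> e/3"
          using k(2) t e by (simp add: h_def)
        have "\<exists>d>0. \<forall>s. norm (s - t) < d \<longrightarrow> norm (Gk k s - Gk k t - (s - t) *\<^sub>R \<psi> k t) \<le> e/3 * norm (s - t)"
          using deriv[of k t] e unfolding has_vector_derivative_def has_derivative_at_alt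
          by (metis divide_pos_pos zero_less_numeral)
        then obtain d where d: "d > 0"
          "\<And>s. norm (s - t) < d \<Longrightarrow> norm (Gk k s - Gk k t - (s - t) *\<^sub>R \<psi> k t) \<le> e/3 * norm (s - t)"
          by blast
        define d' where "d' = min d (min (t - a) (b - t))"
        have "norm (G s - G t - (s - t) *\<^sub>R \<Psi> t) \<le> e * norm (s - t)" if s: "norm (s - t) < d'" for s
        proof (cases "s = t")
          case False
          have s': "s \<in> {a<..<b}" "norm (s - t) < d" using s by (auto simp: d'_def)
          have "ennreal (cmod ((G s - Gk k s) - (G t - Gk k t))) \<le> ennreal (e/3 * \<bar>s - t\<bar>)"
            using incr[OF s'(1) t, of k] k(1)[of "\<bar>s - t\<bar>"] False by (auto intro: order_trans)
          then have 1: "cmod ((G s - Gk k s) - (G t - Gk k t)) \<le> e/3 * \<bar>s - t\<bar>"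
            using e by (subst (asm) ennreal_le_iff) auto
          have 2: "cmod ((s - t) *\<^sub>R (\<psi> k t - \<Psi> t)) \<le> e/3 * \<bar>s - t\<bar>"
            using mult_left_mono[OF kt, of "\<bar>s - t\<bar>"] by (simp add: norm_minus_commute mult.commute)
          have "G s - G t - (s - t) *\<^sub>R \<Psi> t = ((G s - Gk k s) - (G t - Gk k t))
              + (Gk k s - Gk k t - (s - t) *\<^sub>R \<psi> k t) + (s - t) *\<^sub>R (\<psi> k t - \<Psi> t)"
            by (simp add: algebra_simps)
          also have "cmod \<dots> \<le> e/3 * \<bar>s - t\<bar> + e/3 * \<bar>s - t\<bar> + e/3 * \<bar>s - t\<bar>"
            using 1 2 d(2)[OF s'(2)] by (intro norm_triangle_le add_mono) auto
          finally show ?thesis by simp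
        qed simp
        moreover have "d' > 0" using d(1) t by (auto simp: d'_def)
        ultimately show "\<exists>d>0. \<forall>s. norm (s - t) < d \<longrightarrow> norm (G s - G t - (s - t) *\<^sub>R \<Psi> t) \<le> e * norm (s - t)"
          by blast
      qed
    qed
  qed
qed

lemma tendsto_nontangential_iff:
  "(f \<longlongrightarrow> l) (nontangential \<omega>) \<longleftrightarrow>
    (\<forall>c>1. (f \<longlongrightarrow> l) (at \<omega> within {z \<in> ball 0 1. dist z \<omega> < c * (1 - cmod z)}))"
  unfolding tendsto_def nontangential_def eventually_Sup by auto

text \<open>The radius with endpoint \<open>\<omega>\<close> lies in every Stolz region, so limits along the filter are unique.\<close>

lemma nontangential_nontrivial:
  assumes "cmod \<omega> = 1"
  shows "nontangential \<omega> \<noteq> bot"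
proof -
  have "\<omega> islimpt {z \<in> ball 0 1. dist z \<omega> < 2 * (1 - cmod z)}"
    unfolding islimpt_approachable
  proof (intro allI impI)
    fix e :: real assume e: "0 < e"
    define r where "r = max (1/2) (1 - e/2)"
    have r: "0 < r" "r < 1" "1 - r < e" using e by (auto simp: r_def)
    have "dist (of_real r * \<omega>) \<omega> = 1 - r"
    proof -
      have "of_real r * \<omega> - \<omega> = of_real (r - 1) * \<omega>" by (simp add: algebra_simps)
      then have "cmod (of_real r * \<omega> - \<omega>) = cmod (of_real (r - 1)) * cmod \<omega>" by (metis norm_mult)
      then show ?thesis using r assms by (simp add: dist_norm del: of_real_diff)
    qed
    moreover have "cmod (of_real r * \<omega>) = r" using r assms by (simp add: norm_mult)
    ultimately show "\<exists>x'\<in>{z \<in> ball 0 1. dist z \<omega> < 2 * (1 - cmod z)}. x' \<noteq> \<omega> \<and> dist x' \<omega> < e"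
      using r by (intro bexI[of _ "of_real r * \<omega>"]) auto
  qed
  then have "at \<omega> within {z \<in> ball 0 1. dist z \<omega> < 2 * (1 - cmod z)} \<noteq> bot"
    by (simp add: trivial_limit_within)
  moreover have "at \<omega> within {z \<in> ball 0 1. dist z \<omega> < 2 * (1 - cmod z)} \<le> nontangential \<omega>"
    unfolding nontangential_def by (rule SUP_upper) simp
  ultimately show ?thesis using bot.extremum_uniqueI by metis
qed

lemma boundary_valueI: "cmod \<omega> = 1 \<Longrightarrow> (f \<longlongrightarrow> l) (nontangential \<omega>) \<Longrightarrow> boundary_value f \<omega> = l"
  unfolding boundary_value_def by (rule tendsto_Lim[OF nontangential_nontrivial])

lemma tendsto_nontangential_cong:
  assumes "\<And>z. cmod z < 1 \<Longrightarrow> f z = g z"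
  shows "(f \<longlongrightarrow> l) (nontangential \<omega>) \<longleftrightarrow> (g \<longlongrightarrow> l) (nontangential \<omega>)"
proof -
  have "\<forall>\<^sub>F z in at \<omega> within {z \<in> ball 0 1. dist z \<omega> < c * (1 - cmod z)}. f z = g z" for c
    unfolding eventually_at_filter by (rule always_eventually) (use assms in auto)
  from tendsto_cong[OF this] show ?thesis unfolding tendsto_nontangential_iff by blast
qed

lemma boundary_value_cong:
  assumes "\<And>z. cmod z < 1 \<Longrightarrow> f z = g z"
  shows "boundary_value f \<omega> = boundary_value g \<omega>"
  unfolding boundary_value_def t2_space_class.Lim_def using tendsto_nontangential_cong[of f g, OF assms] by simp

text \<open>A Phragmen--Lindeloef argument: the difference quotient at \<open>\<omega>\<close> of a function continuous on the closed
  disc grows at most like \<open>1 / |z - \<omega>|\<close>, which the factor \<open>1 / (1 + \<epsilon> W)\<^sup>2\<close> with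
  \<open>W = (1 + u) / (1 - u)\<close>, \<open>u = z / \<omega>\<close>, \<open>Re W \<ge> 0\<close> compensates.  The factor
  \<open>((1 + u) / 2)^(2 * K)\<close> is small on the circle away from \<open>\<omega>\<close> and localizes the maximum principle.\<close>

lemma difference_quotient_tendsto:
  assumes cont: "continuous_on (cball 0 1) g" and hol: "g holomorphic_on ball 0 1"
    and \<omega>: "cmod \<omega> = 1"
    and lim: "((\<lambda>z. (g z - g \<omega>) / (z - \<omega>)) \<longlongrightarrow> D) (at \<omega> within sphere 0 1)"
  shows "((\<lambda>z. (g z - g \<omega>) / (z - \<omega>)) \<longlongrightarrow> D) (at \<omega> within ball 0 1)"
proof (rule tendstoI)
  fix e :: real assume e: "0 < e"
  define \<eta> where "\<eta> = e / 3"
  have \<eta>: "0 < \<eta>" using e by (simp add: \<eta>_def)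
  \<comment> \<open>the claim is that \<open>P z = o(z - \<omega>)\<close> inside the disc, which is known on the circle\<close>
  define P where "P z = g z - g \<omega> - D * (z - \<omega>)" for z
  define u where "u z = cnj \<omega> * z" for z
  have \<omega>0: "\<omega> \<noteq> 0" "cnj \<omega> \<noteq> 0" "\<omega> * cnj \<omega> = 1" "cnj \<omega> * \<omega> = 1"
    using \<omega> complex_norm_square[of \<omega>] by (auto simp: mult.commute)
  have unorm: "cmod (u z) = cmod z" for z by (simp add: u_def norm_mult \<omega>)
  have u1: "1 - u z = - cnj \<omega> * (z - \<omega>)" for z using \<omega>0 by (simp add: u_def algebra_simps)
  have u1n: "cmod (1 - u z) = cmod (z - \<omega>)" for z unfolding u1 by (simp add: norm_mult \<omega>)
  have h_eq: "(g z - g \<omega>) / (z - \<omega>) - D = P z / (z - \<omega>)" if "z \<noteq> \<omega>" for z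
    using that by (simp add: P_def diff_divide_distrib)
  obtain \<delta> where \<delta>: "\<delta> > 0"
    "\<And>z. z \<in> sphere 0 1 \<Longrightarrow> z \<noteq> \<omega> \<Longrightarrow> dist z \<omega> < \<delta> \<Longrightarrow> cmod ((g z - g \<omega>) / (z - \<omega>) - D) < \<eta>"
    using tendstoD[OF lim \<eta>] unfolding eventually_at dist_norm by auto
  have near: "cmod (P z) \<le> \<eta> * cmod (z - \<omega>)" if "z \<in> sphere 0 1" "dist z \<omega> < \<delta>" for z
  proof (cases "z = \<omega>")
    case False
    have "cmod (P z / (z - \<omega>)) < \<eta>" using \<delta>(2)[OF that(1) False that(2)] h_eq[OF False] by simp
    then show ?thesis using False by (simp add: norm_divide field_simps)
  qed (simp add: P_def)
  have contP: "continuous_on (cball 0 1) P" unfolding P_def by (intro continuous_intros cont)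
  obtain B0 where B0: "\<And>z. z \<in> cball 0 1 \<Longrightarrow> cmod (P z) \<le> B0"
    using compact_imp_bounded[OF compact_continuous_image[OF contP compact_cball]] bounded_iff
    by (metis image_eqI)
  have far: "cmod (P z) \<le> (B0 / \<delta>) * cmod (z - \<omega>)" if "z \<in> sphere 0 1" "\<not> dist z \<omega> < \<delta>" for z
  proof -
    have B00: "0 \<le> B0" using order_trans[OF norm_ge_zero B0[of 0]] by simp
    have "cmod (P z) \<le> B0" using B0 that by auto
    also have "B0 \<le> B0 * (cmod (z - \<omega>) / \<delta>)"
      using that(2) \<delta>(1) mult_left_mono[OF _ B00, of 1 "cmod (z - \<omega>) / \<delta>"] by (simp add: dist_norm not_less)
    finally show ?thesis by simp
  qed
  define q where "q = 1 - \<delta>\<^sup>2 / 4"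
  have half: "cmod ((1 + u z) / 2) ^ 2 = 1 - (cmod (z - \<omega>))\<^sup>2 / 4" if "z \<in> sphere 0 1" for z
  proof -
    have "(cmod (1 + u z))\<^sup>2 + (cmod (1 - u z))\<^sup>2 = 2 + 2 * (cmod (u z))\<^sup>2"
      unfolding cmod_power2 by (simp add: power2_eq_square algebra_simps)
    then have "(cmod (1 + u z))\<^sup>2 + (cmod (z - \<omega>))\<^sup>2 = 4" using that by (simp add: u1n unorm)
    then show ?thesis by (simp add: norm_divide power_divide)
  qed
  obtain K :: nat where K: "(B0 / \<delta>) * cmod ((1 + u z) / 2) ^ (2 * K) \<le> \<eta>"
    if "z \<in> sphere 0 1" "\<not> dist z \<omega> < \<delta>" for z
  proof -
    have B00: "0 \<le> B0 / \<delta>" using order_trans[OF norm_ge_zero B0[of 0]] \<delta>(1) by simp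
    have q1: "max q 0 < 1" "0 \<le> max q 0" using \<delta>(1) by (auto simp: q_def)
    have "(\<lambda>K. (B0 / \<delta>) * max q 0 ^ K) \<longlonglongrightarrow> (B0 / \<delta>) * 0"
      by (intro tendsto_mult tendsto_const LIMSEQ_realpow_zero q1)
    then have "\<forall>\<^sub>F K in sequentially. (B0 / \<delta>) * max q 0 ^ K < \<eta>"
      using \<eta> by (intro order_tendstoD(2)) auto
    then obtain K where K: "(B0 / \<delta>) * max q 0 ^ K < \<eta>"
      by (auto simp: eventually_sequentially)
    show ?thesis
    proof (rule that)
      fix z assume z: "z \<in> sphere 0 1" "\<not> dist z \<omega> < \<delta>"
      have "\<delta>\<^sup>2 \<le> (cmod (z - \<omega>))\<^sup>2" using z \<delta>(1) by (intro power_mono) (auto simp: dist_norm)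
      then have "cmod ((1 + u z) / 2) ^ 2 \<le> max q 0" unfolding half[OF z(1)] q_def by simp
      then have "(cmod ((1 + u z) / 2) ^ 2) ^ K \<le> max q 0 ^ K" by (intro power_mono) auto
      then show "(B0 / \<delta>) * cmod ((1 + u z) / 2) ^ (2 * K) \<le> \<eta>"
        using K mult_left_mono[OF _ B00] unfolding power_mult by (meson less_imp_le order_trans)
    qed
  qed
  have mod1: "cmod ((1 + u z) / 2) \<le> 1" if "cmod z \<le> 1" for z
    using norm_triangle_ineq[of 1 "u z"] that by (simp add: norm_divide unorm)
  have bound: "cmod (P z) * cmod ((1 + u z) / 2) ^ (2 * K) \<le> \<eta> * cmod (z - \<omega>)" if z: "z \<in> ball 0 1" for z
  proof -
    have eps: "cmod (P z) * cmod ((1 + u z) / 2) ^ (2 * K) * cmod (1 - u z)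
        \<le> \<eta> * (cmod ((1 - u z) + of_real \<epsilon> * (1 + u z)))\<^sup>2" if \<epsilon>: "0 < \<epsilon>" "\<epsilon> < 1" for \<epsilon>
    proof -
      define Q where "Q w = (1 - u w) + of_real \<epsilon> * (1 + u w)" for w
      have Q: "cmod (1 - u w) \<le> cmod (Q w)" if "cmod w \<le> 1" for w
      proof (rule power2_le_imp_le)
        have "(cmod (Q w))\<^sup>2 = (cmod (1 - u w))\<^sup>2 + \<epsilon>\<^sup>2 * (cmod (1 + u w))\<^sup>2 + 2 * \<epsilon> * (1 - (cmod (u w))\<^sup>2)"
          unfolding Q_def cmod_power2 by (simp add: power2_eq_square algebra_simps)
        moreover have "(cmod (u w))\<^sup>2 \<le> 1" using that by (simp add: unorm power_le_one)
        ultimately show "(cmod (1 - u w))\<^sup>2 \<le> (cmod (Q w))\<^sup>2" using \<epsilon> by simp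
      qed simp
      have Q0: "Q w \<noteq> 0" if "cmod w \<le> 1" for w
      proof
        assume "Q w = 0"
        then have "1 - u w = 0" using Q[OF that] by simp
        with \<open>Q w = 0\<close> show False using \<epsilon> by (simp add: Q_def)
      qed
      \<comment> \<open>\<open>H\<close> is the quotient \<open>P / (1 - u)\<close> times \<open>((1 + u) / 2)^(2 * K)\<close> times \<open>1 / (1 + \<epsilon> * W)^2\<close>\<close>
      define H where "H w = P w * ((1 + u w) / 2) ^ (2 * K) * (1 - u w) / (Q w)\<^sup>2" for w
      have H_le_iff: "cmod (H w) \<le> \<eta> \<longleftrightarrow>
          cmod (P w) * cmod ((1 + u w) / 2) ^ (2 * K) * cmod (1 - u w) \<le> \<eta> * (cmod (Q w))\<^sup>2"
        if "cmod w \<le> 1" for w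
        using Q0[OF that] unfolding H_def norm_mult[of _ "1 - u w"] norm_divide[of _ "(Q w)\<^sup>2"]
          norm_mult[of "P w"] norm_power by (subst pos_divide_le_eq) auto
      have "cmod (H z) \<le> \<eta>"
      proof (rule maximum_modulus_frontier[where S = "ball 0 1" and f = H and \<xi> = z])
        have "P holomorphic_on ball 0 1" unfolding P_def by (intro holomorphic_intros hol)
        then show "H holomorphic_on interior (ball 0 1)"
          unfolding H_def u_def Q_def[unfolded u_def] using Q0[unfolded Q_def u_def]
          by (auto intro!: holomorphic_intros)
        show "continuous_on (closure (ball 0 1)) H"
          unfolding H_def u_def Q_def[unfolded u_def] using Q0[unfolded Q_def u_def]
          by (auto intro!: continuous_intros contP)
        show "z \<in> ball 0 1" by (rule z)
        show "cmod (H w) \<le> \<eta>" if "w \<in> frontier (ball 0 1)" for w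
        proof -
          have w: "w \<in> sphere 0 1" "cmod w \<le> 1" using that by auto
          have "cmod (P w) * cmod ((1 + u w) / 2) ^ (2 * K) \<le> \<eta> * cmod (w - \<omega>)"
          proof (cases "dist w \<omega> < \<delta>")
            case True
            have "cmod (P w) * cmod ((1 + u w) / 2) ^ (2 * K) \<le> cmod (P w) * 1"
              using mod1[OF w(2)] by (intro mult_left_mono power_le_one) auto
            then show ?thesis using near[OF w(1) True] by simp
          next
            case False
            have "cmod (P w) * cmod ((1 + u w) / 2) ^ (2 * K) \<le> (B0 / \<delta>) * cmod (w - \<omega>) * cmod ((1 + u w) / 2) ^ (2 * K)"
              by (intro mult_right_mono far[OF w(1) False]) auto
            also have "\<dots> = ((B0 / \<delta>) * cmod ((1 + u w) / 2) ^ (2 * K)) * cmod (w - \<omega>)" by simp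
            also have "\<dots> \<le> \<eta> * cmod (w - \<omega>)" by (intro mult_right_mono K[OF w(1) False]) auto
            finally show ?thesis .
          qed
          then have "cmod (P w) * cmod ((1 + u w) / 2) ^ (2 * K) * cmod (1 - u w) \<le> \<eta> * (cmod (1 - u w))\<^sup>2"
            by (simp add: u1n power2_eq_square mult_right_mono mult.assoc[symmetric])
          also have "\<dots> \<le> \<eta> * (cmod (Q w))\<^sup>2" using Q[OF w(2)] \<eta> by (intro mult_left_mono power_mono) auto
          finally show ?thesis using H_le_iff[OF w(2)] by simp
        qed
      qed auto
      then show ?thesis using H_le_iff[of z] z by (simp add: Q_def)
    qed
    have "cmod (P z) * cmod ((1 + u z) / 2) ^ (2 * K) * cmod (1 - u z) \<le> \<eta> * (cmod ((1 - u z) + of_real 0 * (1 + u z)))\<^sup>2"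
    proof (rule tendsto_lowerbound)
      show "((\<lambda>\<epsilon>. \<eta> * (cmod ((1 - u z) + of_real \<epsilon> * (1 + u z)))\<^sup>2) \<longlongrightarrow>
          \<eta> * (cmod ((1 - u z) + of_real 0 * (1 + u z)))\<^sup>2) (at_right 0)"
        by (intro tendsto_intros)
      show "\<forall>\<^sub>F \<epsilon> in at_right 0. cmod (P z) * cmod ((1 + u z) / 2) ^ (2 * K) * cmod (1 - u z)
          \<le> \<eta> * (cmod ((1 - u z) + of_real \<epsilon> * (1 + u z)))\<^sup>2"
        using eventually_at_right_real[OF zero_less_one[where 'a = real]]
        by eventually_elim (use eps in auto)
    qed simp
    moreover have "z \<noteq> \<omega>" using z \<omega> by auto
    ultimately show ?thesis by (simp add: u1n power2_eq_square)
  qed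
  have "((\<lambda>z. cmod ((1 + u z) / 2) ^ (2 * K)) \<longlongrightarrow> cmod ((1 + u \<omega>) / 2) ^ (2 * K)) (at \<omega> within ball 0 1)"
    unfolding u_def by (intro tendsto_intros) auto
  then have "\<forall>\<^sub>F z in at \<omega> within ball 0 1. 1/2 < cmod ((1 + u z) / 2) ^ (2 * K)"
    by (intro order_tendstoD(1)) (auto simp: u_def \<omega>0)
  moreover have "\<forall>\<^sub>F z in at \<omega> within ball 0 1. z \<in> ball 0 1 \<and> z \<noteq> \<omega>"
    unfolding eventually_at_filter by (rule always_eventually) auto
  ultimately show "\<forall>\<^sub>F z in at \<omega> within ball 0 1. dist ((g z - g \<omega>) / (z - \<omega>)) D < e"
  proof eventually_elim
    case (elim z)
    have "cmod (P z) * (1/2) \<le> cmod (P z) * cmod ((1 + u z) / 2) ^ (2 * K)"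
      using elim by (intro mult_left_mono) auto
    then have "cmod (P z) \<le> 2 * \<eta> * cmod (z - \<omega>)" using bound[of z] elim by simp
    then have "cmod (P z / (z - \<omega>)) \<le> 2 * \<eta>" using elim by (simp add: norm_divide field_simps)
    then show ?case using elim h_eq[of z] e by (simp add: dist_norm \<eta>_def)
  qed
qed

text \<open>In a Stolz region the disc of radius \<open>(1 - |z|) / 2\<close> about \<open>z\<close> has size comparable to the distance from \<open>z\<close>
  to \<open>\<omega>\<close>, so Cauchy's estimate turns convergence of difference quotients into convergence of the derivative.\<close>

lemma deriv_tendsto_nontangential:
  assumes cont: "continuous_on (cball 0 1) g" and hol: "g holomorphic_on ball 0 1"
    and \<omega>: "cmod \<omega> = 1"
    and lim: "((\<lambda>z. (g z - g \<omega>) / (z - \<omega>)) \<longlongrightarrow> D) (at \<omega> within sphere 0 1)"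
  shows "(deriv g \<longlongrightarrow> D) (nontangential \<omega>)"
  unfolding tendsto_nontangential_iff
proof (intro allI impI tendstoI)
  fix c e :: real assume c: "1 < c" and e: "0 < e"
  define \<eta> where "\<eta> = e / (2 * (2 * c + 1))"
  have \<eta>: "0 < \<eta>" using e c by (simp add: \<eta>_def)
  from tendstoD[OF difference_quotient_tendsto[OF assms] \<eta>]
  obtain d where d: "d > 0"
    "\<And>z. z \<in> ball 0 1 \<Longrightarrow> z \<noteq> \<omega> \<Longrightarrow> dist z \<omega> < d \<Longrightarrow> cmod ((g z - g \<omega>) / (z - \<omega>) - D) < \<eta>"
    unfolding eventually_at dist_norm by auto
  have "dist (deriv g z) D < e"
    if z: "z \<in> ball 0 1" "dist z \<omega> < c * (1 - cmod z)" "dist z \<omega> < d / 2" for z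
  proof -
    define \<rho> where "\<rho> = (1 - cmod z) / 2"
    have \<rho>: "0 < \<rho>" using z by (simp add: \<rho>_def)
    have \<rho>le: "1 - cmod z \<le> dist z \<omega>" using norm_triangle_ineq2[of \<omega> z] \<omega> by (simp add: dist_norm norm_minus_commute)
    define P where "P w = g w - g \<omega> - D * (w - \<omega>)" for w
    have sub: "cball z \<rho> \<subseteq> ball 0 1"
    proof
      fix w assume "w \<in> cball z \<rho>"
      then have "cmod w \<le> cmod z + \<rho>" using norm_triangle_ineq2[of w z] by (simp add: dist_norm norm_minus_commute)
      then show "w \<in> ball 0 1" using z by (simp add: \<rho>_def field_simps)
    qed
    have holP: "P holomorphic_on ball 0 1" unfolding P_def by (intro holomorphic_intros hol)
    have P: "cmod (P w) \<le> \<eta> * ((2 * c + 1) * \<rho>)" if "cmod (z - w) = \<rho>" for w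
    proof -
      have w: "w \<in> ball 0 1" using sub that by (auto simp: dist_norm)
      then have w\<omega>: "w \<noteq> \<omega>" using \<omega> by auto
      have dw: "dist w \<omega> \<le> dist z \<omega> + \<rho>" using dist_triangle[of w \<omega> z] that by (simp add: dist_norm norm_minus_commute)
      moreover have "\<rho> \<le> dist z \<omega> / 2" using \<rho>le by (simp add: \<rho>_def)
      ultimately have "dist w \<omega> < d" using z(3) d(1) by linarith
      then have "cmod ((g w - g \<omega>) / (w - \<omega>) - D) < \<eta>" using d(2) w w\<omega> by blast
      moreover have "(g w - g \<omega>) / (w - \<omega>) - D = P w / (w - \<omega>)" using w\<omega> by (simp add: P_def diff_divide_distrib)
      ultimately have "cmod (P w) \<le> \<eta> * dist w \<omega>" using w\<omega> by (simp add: norm_divide dist_norm field_simps)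
      also have "\<dots> \<le> \<eta> * ((2 * c + 1) * \<rho>)"
      proof (rule mult_left_mono)
        have "c * (1 - cmod z) = 2 * c * \<rho>" by (simp add: \<rho>_def)
        then show "dist w \<omega> \<le> (2 * c + 1) * \<rho>" using dw z(2) unfolding distrib_right by linarith
      qed (use \<eta> in simp)
      finally show ?thesis .
    qed
    have "cmod ((deriv ^^ 1) P z) \<le> fact 1 * (\<eta> * ((2 * c + 1) * \<rho>)) / \<rho> ^ 1"
    proof (rule Cauchy_inequality)
      show "P holomorphic_on ball z \<rho>"
        using holomorphic_on_subset[OF holP] sub ball_subset_cball by blast
      show "continuous_on (cball z \<rho>) P"
        using holomorphic_on_imp_continuous_on[OF holomorphic_on_subset[OF holP sub]] .
    qed (use \<rho> P in auto)
    then have "cmod (deriv P z) \<le> \<eta> * (2 * c + 1)" using \<rho> by simp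
    also have "\<dots> = e / 2" using c by (simp add: \<eta>_def field_simps)
    finally have "cmod (deriv P z) \<le> e / 2" .
    moreover have "deriv P z = deriv g z - D"
    proof -
      have "(g has_field_derivative deriv g z) (at z)"
        using hol z(1) holomorphic_derivI open_ball by blast
      then show ?thesis unfolding P_def by (intro DERIV_imp_deriv) (auto intro!: derivative_eq_intros)
    qed
    ultimately show ?thesis using e by (simp add: dist_norm)
  qed
  then show "\<forall>\<^sub>F z in at \<omega> within {z \<in> ball 0 1. dist z \<omega> < c * (1 - cmod z)}. dist (deriv g z) D < e"
    unfolding eventually_at using d(1) by (intro exI[of _ "d/2"]) auto
qed

lemma Arg2pi_measurable [measurable]: "Arg2pi \<in> borel_measurable borel"
proof -
  have "(\<lambda>z. indicator (UNIV - \<real>\<^sub>\<ge>\<^sub>0) z *\<^sub>R Arg2pi z) \<in> borel_measurable borel"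
    by (intro borel_measurable_continuous_on_indicator)
      (auto intro!: continuous_at_imp_continuous_on continuous_at_Arg2pi borel_closed closed_nonneg_Reals_complex)
  moreover have "(\<lambda>z. indicator (UNIV - \<real>\<^sub>\<ge>\<^sub>0) z *\<^sub>R Arg2pi z) = Arg2pi"
  proof
    show "indicator (UNIV - \<real>\<^sub>\<ge>\<^sub>0) z *\<^sub>R Arg2pi z = Arg2pi z" for z
      using Arg2pi_eq_0[of z] by (auto simp: indicator_def complex_nonneg_Reals_iff complex_is_Real_iff)
  qed
  ultimately show ?thesis by simp
qed

lemma cis_Arg2pi: "cmod \<omega> = 1 \<Longrightarrow> cis (Arg2pi \<omega>) = \<omega>"
  by (simp add: cis_conv_exp complex_norm_eq_1_exp)

lemma Arg2pi_cis: "0 \<le> t \<Longrightarrow> t < 2 * pi \<Longrightarrow> Arg2pi (cis t) = t"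
  by (rule Arg2pi_unique[of 1]) (auto simp: cis_conv_exp)

text \<open>The endpoints of the parameter interval form a null set and may be ignored.\<close>

lemma AE_circle:
  assumes "AE t in lborel. t \<in> {0<..<2 * pi} \<longrightarrow> P (cis t)"
  shows "AE \<omega> in circle_lebesgue. P \<omega>"
proof -
  obtain N where N: "{t \<in> space lborel. \<not> (t \<in> {0<..<2 * pi} \<longrightarrow> P (cis t))} \<subseteq> N"
      "emeasure lborel N = 0" "N \<in> sets lborel"
    using AE_E[OF assms] by blast
  define N' where "N' = insert 0 N"
  have [measurable]: "N' \<in> sets borel" using N(3) by (simp add: N'_def)
  have N'0: "emeasure lborel N' = 0"
  proof -
    have "N \<in> null_sets lborel" "{0} \<in> null_sets lborel" using N by (auto simp: null_sets_def)
    from null_sets.Un[OF this(2,1)] show ?thesis by (simp add: N'_def null_setsD1)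
  qed
  define A where "A = (Arg2pi -` N') \<inter> sphere 0 1"
  have A: "A \<in> sets circle_arc"
    unfolding A_def sets_circle_arc sets_restrict_space
    using measurable_sets[OF Arg2pi_measurable \<open>N' \<in> sets borel\<close>] by (auto simp: Int_commute)
  have cis: "cis \<in> uniform_measure lborel {0..<2 * pi} \<rightarrow>\<^sub>M circle_borel"
    using cis_measurable by (simp add: measurable_def)
  have "emeasure circle_arc A = emeasure (uniform_measure lborel {0..<2 * pi}) (cis -` A \<inter> UNIV)"
    using A emeasure_distr[OF cis, of A] by (simp add: circle_arc_def)
  also have "\<dots> = emeasure lborel ({0..<2 * pi} \<inter> (cis -` A)) / emeasure lborel {0..<2 * pi}"
    using measurable_sets[OF cis_measurable, of A] A
    by (subst emeasure_uniform_measure) (auto simp: sets_circle_arc)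
  also have "{0..<2 * pi} \<inter> (cis -` A) \<subseteq> N'"
    by (auto simp: A_def Arg2pi_cis)
  then have "emeasure lborel ({0..<2 * pi} \<inter> (cis -` A)) = 0"
    using N'0 emeasure_mono[of "{0..<2 * pi} \<inter> (cis -` A)" N' lborel] by simp
  finally have "A \<in> null_sets circle_arc" using A by (auto simp: null_sets_def)
  moreover have "{\<omega> \<in> space circle_arc. \<not> P \<omega>} \<subseteq> A"
  proof
    fix \<omega> assume "\<omega> \<in> {\<omega> \<in> space circle_arc. \<not> P \<omega>}"
    then have \<omega>: "cmod \<omega> = 1" "\<not> P \<omega>" by auto
    have "Arg2pi \<omega> \<in> N'"
    proof (cases "Arg2pi \<omega> = 0")
      case False
      then have "Arg2pi \<omega> \<in> {0<..<2 * pi}" using Arg2pi_ge_0[of \<omega>] Arg2pi_lt_2pi[of \<omega>] by auto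
      then show ?thesis using N(1) \<omega> cis_Arg2pi[OF \<omega>(1)] by (auto simp: N'_def)
    qed (simp add: N'_def)
    then show "\<omega> \<in> A" using \<omega> by (simp add: A_def)
  qed
  ultimately show ?thesis
    unfolding circle_lebesgue_eq by (intro AE_completion AE_I')
qed

text \<open>The primitive of a Hardy space function is continuous up to the circle, since the Cauchy--Schwarz inequality
  makes its Taylor coefficients absolutely summable.\<close>

definition prim :: "ell2 \<Rightarrow> complex \<Rightarrow> complex" where
  "prim a z = (\<Sum>n. coef a n / of_nat (Suc n) * z ^ Suc n)"

lemma summable_prim: "summable (\<lambda>n. cmod (coef a n / of_nat (Suc n)))"
proof (rule summable_comparison_test')
  have "summable (\<lambda>n. (1 / real (Suc n))\<^sup>2)"
    using summable_Suc_iff[of "\<lambda>n. inverse (real n ^ 2)"] inverse_power_summable[of 2, where 'a = real]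
    by (simp add: power_divide inverse_eq_divide)
  then show "summable (\<lambda>n. (cmod (coef a n))\<^sup>2 + (1 / real (Suc n))\<^sup>2)"
    by (intro summable_add summable_coef)
  show "norm (cmod (coef a n / of_nat (Suc n))) \<le> (cmod (coef a n))\<^sup>2 + (1 / real (Suc n))\<^sup>2" if "n \<ge> 0" for n
  proof -
    have "2 * (cmod (coef a n) * (1 / real (Suc n))) \<le> (cmod (coef a n))\<^sup>2 + (1 / real (Suc n))\<^sup>2"
      using sum_squares_bound[of "cmod (coef a n)" "1 / real (Suc n)"] by simp
    moreover have "0 \<le> cmod (coef a n) * (1 / real (Suc n))" by simp
    moreover have "cmod (coef a n / of_nat (Suc n)) = cmod (coef a n) * (1 / real (Suc n))"
      by (simp add: norm_divide del: of_nat_Suc)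
    ultimately have "cmod (coef a n / of_nat (Suc n)) \<le> (cmod (coef a n))\<^sup>2 + (1 / real (Suc n))\<^sup>2"
      by linarith
    then show ?thesis by (simp only: real_norm_def abs_norm_cancel)
  qed
qed

lemma prim_continuous: "continuous_on (cball 0 1) (prim a)"
proof -
  have "uniform_limit (cball 0 1) (\<lambda>N z. \<Sum>n<N. coef a n / of_nat (Suc n) * z ^ Suc n) (prim a) sequentially"
    unfolding prim_def
  proof (rule Weierstrass_m_test[OF _ summable_prim[of a]])
    fix n and z :: complex assume "z \<in> cball 0 1"
    then have "cmod z ^ Suc n \<le> 1" by (intro power_le_one) auto
    then have "cmod (coef a n / of_nat (Suc n)) * cmod z ^ Suc n \<le> cmod (coef a n / of_nat (Suc n)) * 1"
      by (intro mult_left_mono) auto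
    then show "norm (coef a n / of_nat (Suc n) * z ^ Suc n) \<le> cmod (coef a n / of_nat (Suc n))"
      by (simp only: norm_mult norm_power mult_1_right)
  qed
  moreover have "\<forall>\<^sub>F N in sequentially. continuous_on (cball 0 1) (\<lambda>z. \<Sum>n<N. coef a n / of_nat (Suc n) * z ^ Suc n)"
    by (intro always_eventually allI continuous_intros)
  ultimately show ?thesis by (intro uniform_limit_theorem) auto
qed

lemma prim_has_derivative:
  assumes "cmod z < 1"
  shows "(prim a has_field_derivative fn a z) (at z)"
proof -
  define c where "c n = (case n of 0 \<Rightarrow> 0 | Suc k \<Rightarrow> coef a k / of_nat (Suc k))" for n
  have c: "c 0 = 0" "c (Suc n) = coef a n / of_nat (Suc n)" for n by (simp_all add: c_def)
  have sm: "summable (\<lambda>n. c n * w ^ n)" if "cmod w \<le> 1" for w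
  proof -
    have "summable (\<lambda>n. c (Suc n) * w ^ Suc n)"
    proof (rule summable_comparison_test'[OF summable_prim[of a]])
      fix n
      have "cmod w ^ Suc n \<le> 1" using that by (intro power_le_one) auto
      then have "cmod (coef a n / of_nat (Suc n)) * cmod w ^ Suc n \<le> cmod (coef a n / of_nat (Suc n)) * 1"
        by (intro mult_left_mono) auto
      then show "norm (c (Suc n) * w ^ Suc n) \<le> cmod (coef a n / of_nat (Suc n))"
        by (simp only: c norm_mult norm_power mult_1_right)
    qed
    then show ?thesis by (simp only: summable_Suc_iff[of "\<lambda>n. c n * w ^ n"])
  qed
  have eq: "prim a w = (\<Sum>n. c n * w ^ n)" if "cmod w \<le> 1" for w
    using suminf_split_head[OF sm[OF that]] by (simp add: prim_def c del: of_nat_Suc power_Suc)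
  have "DERIV (\<lambda>x. \<Sum>n. c n * x ^ n) z :> (\<Sum>n. diffs c n * z ^ n)"
    by (rule termdiffs_strong[of _ 1]) (use sm[of 1] assms in auto)
  moreover have "diffs c n = coef a n" for n by (simp add: diffs_def c del: of_nat_Suc)
  ultimately have "DERIV (\<lambda>x. \<Sum>n. c n * x ^ n) z :> fn a z" by (simp add: fn_def)
  then show ?thesis
    by (rule has_field_derivative_transform_within_open[of _ _ _ "ball 0 1"]) (use assms eq in auto)
qed

lemma prim_holomorphic: "prim a holomorphic_on ball 0 1"
  unfolding holomorphic_on_open[OF open_ball]
  by (intro ballI exI, rule prim_has_derivative) simp

text \<open>A concrete sequence of radii tending to 1, never equal to 0 or 1.\<close>

definition rad :: "nat \<Rightarrow> real" where "rad k = 1 - 1 / (real k + 2)"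

lemma rad_01: "0 < rad k" "rad k < 1"
  by (auto simp: rad_def field_simps)

lemma rad_tendsto: "rad \<longlonglongrightarrow> 1"
proof -
  have "(\<lambda>k. 1 / real (Suc (Suc k))) \<longlonglongrightarrow> 0"
    by (rule LIMSEQ_Suc[OF LIMSEQ_Suc[OF lim_1_over_n]])
  from tendsto_diff[OF tendsto_const[of 1] this] show ?thesis by (simp add: rad_def[abs_def] add.commute)
qed

lemma filterlim_rad: "filterlim rad (at_left 1) sequentially"
proof -
  have "rad k \<in> {..<1} \<and> rad k \<noteq> 1" for k using rad_01(2)[of k] by simp
  then show ?thesis using rad_tendsto by (simp add: filterlim_at)
qed

text \<open>The boundary function as an \<open>L2\<close> limit; its pointwise meaning is the content of Fatou's theorem below.\<close>

lemma L2_limit_of_dilates: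
  obtains F where "F \<in> borel_measurable circle_borel" "F \<in> L2_space circle_lebesgue"
    "\<And>r. 0 < r \<Longrightarrow> r < 1 \<Longrightarrow> L2_norm circle_lebesgue (\<lambda>\<omega>. F \<omega> - dilate (fn a) r \<omega>) \<le> norm (a - dil r a)"
proof -
  have dilr: "(\<lambda>k. dil (rad k) a) \<longlonglongrightarrow> a" by (rule filterlim_compose[OF dil_tendsto filterlim_rad])
  have cont: "continuous_on (sphere 0 1) (dilate (fn a) s)" if "0 < s" "s < 1" for s
    by (rule continuous_on_dilate[OF fn_continuous that])
  have mX: "dilate (fn a) s \<in> borel_measurable circle_arc" if "0 < s" "s < 1" for s
    unfolding measurable_circle_arc by (rule circle_measurable_continuous[OF cont[OF that]])
  have X: "dilate (fn a) (rad k) \<in> L2_space circle_arc" for k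
    by (intro L2_space_continuous cont rad_01) auto
  have cauchy: "\<exists>N. \<forall>m\<ge>N. \<forall>n\<ge>N. L2_norm circle_arc (\<lambda>\<omega>. dilate (fn a) (rad m) \<omega> - dilate (fn a) (rad n) \<omega>) < e"
    if "e > 0" for e
  proof -
    have "Cauchy (\<lambda>k. dil (rad k) a)" using dilr LIMSEQ_imp_Cauchy by blast
    from metric_CauchyD[OF this that]
    obtain N where "\<And>m n. m \<ge> N \<Longrightarrow> n \<ge> N \<Longrightarrow> dist (dil (rad m) a) (dil (rad n) a) < e"
      by blast
    moreover have "L2_norm circle_arc (\<lambda>\<omega>. dilate (fn a) (rad m) \<omega> - dilate (fn a) (rad n) \<omega>) = dist (dil (rad m) a) (dil (rad n) a)" for m n
      using L2_norm_dilate_diff[OF rad_01[of m] rad_01[of n], of a a] mX[OF rad_01[of m]] mX[OF rad_01[of n]]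
      by (subst L2_norm_circle_arc[symmetric]) (auto simp: dist_norm)
    ultimately show ?thesis by metis
  qed
  obtain F where F: "F \<in> L2_space circle_arc"
    "(\<lambda>k. L2_norm circle_arc (\<lambda>\<omega>. F \<omega> - dilate (fn a) (rad k) \<omega>)) \<longlonglongrightarrow> 0"
    using L2_complete[of circle_arc "\<lambda>k. dilate (fn a) (rad k)", OF finite_measure_circle_arc(1) X cauchy] by blast
  have Fm: "F \<in> borel_measurable circle_arc" using F(1) by (simp add: L2_space_def)
  have FL: "F \<in> L2_space circle_lebesgue" by (rule L2_space_circle_arc[OF F(1)])
  have lim0: "(\<lambda>k. L2_norm circle_lebesgue (\<lambda>\<omega>. F \<omega> - dilate (fn a) (rad k) \<omega>)) \<longlonglongrightarrow> 0"
  proof -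
    have "L2_norm circle_lebesgue (\<lambda>\<omega>. F \<omega> - dilate (fn a) (rad k) \<omega>) = L2_norm circle_arc (\<lambda>\<omega>. F \<omega> - dilate (fn a) (rad k) \<omega>)" for k
      using Fm mX[OF rad_01] by (intro L2_norm_circle_arc) auto
    then show ?thesis using F(2) by simp
  qed
  have "L2_norm circle_lebesgue (\<lambda>\<omega>. F \<omega> - dilate (fn a) s \<omega>) \<le> norm (a - dil s a)" if s: "0 < s" "s < 1" for s
  proof (rule tendsto_le[OF sequentially_bot])
    show "(\<lambda>k. L2_norm circle_lebesgue (\<lambda>\<omega>. F \<omega> - dilate (fn a) (rad k) \<omega>) + norm (dil (rad k) a - dil s a))
        \<longlonglongrightarrow> norm (a - dil s a)"
      using tendsto_add[OF lim0 tendsto_norm[OF tendsto_diff[OF dilr tendsto_const[of "dil s a"]]]] by simp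
    show "(\<lambda>k. L2_norm circle_lebesgue (\<lambda>\<omega>. F \<omega> - dilate (fn a) s \<omega>)) \<longlonglongrightarrow> L2_norm circle_lebesgue (\<lambda>\<omega>. F \<omega> - dilate (fn a) s \<omega>)"
      by simp
    have L: "dilate (fn a) t \<in> L2_space circle_lebesgue" if "0 < t" "t < 1" for t
      by (intro L2_space_continuous cont that) auto
    show "\<forall>\<^sub>F k in sequentially. L2_norm circle_lebesgue (\<lambda>\<omega>. F \<omega> - dilate (fn a) s \<omega>) \<le>
        L2_norm circle_lebesgue (\<lambda>\<omega>. F \<omega> - dilate (fn a) (rad k) \<omega>) + norm (dil (rad k) a - dil s a)"
      using L2_norm_triangle_diff[OF FL L[OF rad_01] L[OF s]] L2_norm_dilate_diff[where a = a and b = a, OF rad_01 s]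
      by (intro always_eventually allI) simp
  qed
  then show ?thesis using that FL Fm measurable_circle_arc by blast
qed

text \<open>Fatou's theorem.  The primitive of \<open>f\<close> is differentiable along the circle at almost every
  point, and its difference quotients, hence \<open>f\<close> itself, converge there nontangentially.\<close>

theorem fatou_nontangential:
  obtains F where "F \<in> borel_measurable circle_borel" "F \<in> L2_space circle_lebesgue"
    "\<And>r. 0 < r \<Longrightarrow> r < 1 \<Longrightarrow> L2_norm circle_lebesgue (\<lambda>\<omega>. F \<omega> - dilate (fn a) r \<omega>) \<le> norm (a - dil r a)"
    "AE \<omega> in circle_lebesgue. (fn a \<longlongrightarrow> F \<omega>) (nontangential \<omega>)"
proof -
  obtain F where F: "F \<in> borel_measurable circle_borel" "F \<in> L2_space circle_lebesgue"
    "\<And>r. 0 < r \<Longrightarrow> r < 1 \<Longrightarrow> L2_norm circle_lebesgue (\<lambda>\<omega>. F \<omega> - dilate (fn a) r \<omega>) \<le> norm (a - dil r a)"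
    using L2_limit_of_dilates[of a] by blast
  \<comment> \<open>\<open>\<Psi>\<close> is the derivative that \<open>G\<close> should have: the \<open>\<psi> k\<close> are the derivatives of the \<open>Gk k\<close>
    and tend to \<open>\<Psi>\<close> in mean\<close>
  define G where "G t = prim a (cis t)" for t
  define Gk where "Gk k t = prim a (of_real (rad k) * cis t)" for k t
  define \<psi> where "\<psi> k t = fn a (of_real (rad k) * cis t) * (of_real (rad k) * (\<i> * cis t))" for k t
  define \<Psi> where "\<Psi> t = F (cis t) * (\<i> * cis t)" for t
  have inball: "cmod (of_real (rad k) * cis t) < 1" for k t using rad_01[of k] by (simp add: norm_mult)
  have cis_d: "(cis has_vector_derivative (\<i> * cis t)) (at t)" for t
    unfolding cis_conv_exp[abs_def] by (auto intro!: derivative_eq_intros has_vector_derivative_real_field)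
  have Fc [measurable]: "(\<lambda>t. F (cis t)) \<in> borel_measurable borel"
    using measurable_compose[OF cis_measurable F(1)] by simp
  have cc [measurable]: "cis \<in> borel_measurable borel"
    by (simp add: borel_measurable_continuous_onI continuous_on_cis continuous_on_id)
  have cont: "continuous_on (sphere 0 1) (dilate (fn a) s)" if "0 < s" "s < 1" for s
    by (rule continuous_on_dilate[OF fn_continuous that])
  have "AE t in lborel. t \<in> {0<..<2 * pi} \<longrightarrow> (G has_vector_derivative \<Psi> t) (at t)"
  proof (rule AE_differentiable_limit)
    show "\<Psi> \<in> borel_measurable borel" unfolding \<Psi>_def by measurable
    show "continuous_on UNIV (\<psi> k)" for k
      unfolding \<psi>_def
      by (intro continuous_intros continuous_on_compose2[OF fn_continuous]) (use inball in auto)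
    show "(Gk k has_vector_derivative \<psi> k t) (at t)" for k t
    proof -
      have "((\<lambda>t. of_real (rad k) * cis t) has_vector_derivative of_real (rad k) * (\<i> * cis t)) (at t)"
        by (rule has_vector_derivative_mult_right[OF cis_d])
      from field_vector_diff_chain_at[OF this prim_has_derivative[OF inball, of a]]
      show ?thesis by (simp add: Gk_def[abs_def] \<psi>_def o_def mult.commute)
    qed
    show "(\<lambda>k. Gk k t) \<longlonglongrightarrow> G t" for t
    proof -
      have "(\<lambda>k. of_real (rad k) * cis t) \<longlonglongrightarrow> of_real 1 * cis t"
        by (intro tendsto_intros rad_tendsto)
      then show ?thesis
        unfolding Gk_def G_def
        by (intro continuous_on_tendsto_compose[OF prim_continuous]) (use inball in \<open>auto intro!: always_eventually less_imp_le\<close>)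
    qed
    define D where "D k \<omega> = F \<omega> - of_real (rad k) * dilate (fn a) (rad k) \<omega>" for k \<omega>
    have Dm: "D k \<in> borel_measurable circle_borel" for k
      unfolding D_def using F(1) circle_measurable_continuous[OF cont[OF rad_01]] by measurable
    have L: "dilate (fn a) (rad k) \<in> L2_space circle_lebesgue" for k
      by (intro L2_space_continuous cont rad_01) auto
    have DL: "D k \<in> L2_space circle_lebesgue" for k
      unfolding D_def by (intro L2_space_diff L2_space_scale F L)
    have Dn: "L2_norm circle_lebesgue (D k) \<le> norm (a - dil (rad k) a) + (1 - rad k) * norm a" for k
    proof -
      have "D k = (\<lambda>\<omega>. (F \<omega> - dilate (fn a) (rad k) \<omega>) + of_real (1 - rad k) * dilate (fn a) (rad k) \<omega>)"
        by (simp add: D_def fun_eq_iff algebra_simps)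
      then have "L2_norm circle_lebesgue (D k) \<le> L2_norm circle_lebesgue (\<lambda>\<omega>. F \<omega> - dilate (fn a) (rad k) \<omega>)
          + L2_norm circle_lebesgue (\<lambda>\<omega>. of_real (1 - rad k) * dilate (fn a) (rad k) \<omega>)"
        using L2_norm_triangle[OF L2_space_diff[OF F(2) L] L2_space_scale[OF L]] by simp
      also have "\<dots> \<le> norm (a - dil (rad k) a) + (1 - rad k) * norm a"
        using F(3)[OF rad_01] norm_dil_le[OF rad_01] rad_01[of k] L2_norm_dilate[OF rad_01]
        by (intro add_mono) (auto simp: L2_norm_scale norm_of_real simp del: of_real_diff intro!: mult_left_mono)
      finally show ?thesis .
    qed
    have dist_eq: "cmod (\<Psi> t - \<psi> k t) = cmod (D k (cis t))" for k t
    proof -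
      have "\<Psi> t - \<psi> k t = D k (cis t) * (\<i> * cis t)"
        by (simp add: \<Psi>_def \<psi>_def D_def dilate_def algebra_simps)
      then show ?thesis by (simp add: norm_mult)
    qed
    have mean: "(\<integral>\<^sup>+t. ennreal (indicator {0..2 * pi} t * cmod (\<Psi> t - \<psi> k t)) \<partial>lborel)
        \<le> ennreal (2 * pi * (norm (a - dil (rad k) a) + (1 - rad k) * norm a))" for k
    proof -
      have cD: "(\<lambda>\<omega>. cmod (D k \<omega>)) \<in> borel_measurable circle_borel" using Dm by measurable
      have mt: "(\<lambda>t. D k (cis t)) \<in> borel_measurable lborel"
        using measurable_compose[OF cis_measurable Dm] .
      have Darc: "D k \<in> borel_measurable circle_arc" unfolding measurable_circle_arc by (rule Dm)
      have intD: "integrable circle_arc (\<lambda>\<omega>. cmod (D k \<omega>))"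
        using L2_integrable(1)[OF finite_measure_circle DL, of k] Darc
        unfolding circle_lebesgue_eq by (intro integrable_norm) (simp add: integrable_completion)
      then have int': "integrable lborel (\<lambda>t. indicator {0..<2 * pi} t / (2 * pi) * cmod (D k (cis t)))"
        using circle_arc_integral(2)[OF cD] by simp
      have "(\<integral>\<^sup>+t. ennreal (indicator {0..2 * pi} t * cmod (\<Psi> t - \<psi> k t)) \<partial>lborel)
          = (\<integral>\<^sup>+t. ennreal (2 * pi) * ennreal (indicator {0..<2 * pi} t / (2 * pi) * cmod (D k (cis t))) \<partial>lborel)"
      proof (rule nn_integral_cong_AE)
        show "AE t in lborel. ennreal (indicator {0..2 * pi} t * cmod (\<Psi> t - \<psi> k t)) =
            ennreal (2 * pi) * ennreal (indicator {0..<2 * pi} t / (2 * pi) * cmod (D k (cis t)))"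
          using AE_lborel_singleton[of "2 * pi"]
          by eventually_elim (auto simp: indicator_def dist_eq ennreal_mult[symmetric])
      qed
      also have "\<dots> = ennreal (2 * pi) * (\<integral>\<^sup>+t. ennreal (indicator {0..<2 * pi} t / (2 * pi) * cmod (D k (cis t))) \<partial>lborel)"
        by (rule nn_integral_cmult) (use mt in measurable)
      also have "(\<integral>\<^sup>+t. ennreal (indicator {0..<2 * pi} t / (2 * pi) * cmod (D k (cis t))) \<partial>lborel)
          = ennreal (\<integral>\<omega>. cmod (D k \<omega>) \<partial>circle_arc)"
        using circle_arc_integral(1)[OF cD] int' by (subst nn_integral_eq_integral) auto
      also have "(\<integral>\<omega>. cmod (D k \<omega>) \<partial>circle_arc) = (\<integral>\<omega>. cmod (D k \<omega>) \<partial>circle_lebesgue)"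
        unfolding circle_lebesgue_eq using Darc by (subst integral_completion) auto
      also have "ennreal (2 * pi) * ennreal (\<integral>\<omega>. cmod (D k \<omega>) \<partial>circle_lebesgue) =
          ennreal (2 * pi * (\<integral>\<omega>. cmod (D k \<omega>) \<partial>circle_lebesgue))"
        by (simp add: ennreal_mult)
      also have "\<dots> \<le> ennreal (2 * pi * (norm (a - dil (rad k) a) + (1 - rad k) * norm a))"
        using L2_integrable(2)[OF finite_measure_circle DL, of k] Dn[of k]
        by (intro ennreal_leI mult_left_mono) auto
      finally show ?thesis .
    qed
    have "(\<lambda>k. 2 * pi * (norm (a - dil (rad k) a) + (1 - rad k) * norm a)) \<longlonglongrightarrow> 2 * pi * (norm (a - a) + (1 - 1) * norm a)"
      by (intro tendsto_intros rad_tendsto filterlim_compose[OF dil_tendsto filterlim_rad])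
    from tendsto_ennrealI[OF this]
    have up: "(\<lambda>k. ennreal (2 * pi * (norm (a - dil (rad k) a) + (1 - rad k) * norm a))) \<longlonglongrightarrow> 0"
      by simp
    show "(\<lambda>k. \<integral>\<^sup>+t. ennreal (indicator {0..2 * pi} t * cmod (\<Psi> t - \<psi> k t)) \<partial>lborel) \<longlonglongrightarrow> 0"
      by (rule tendsto_sandwich[OF _ _ tendsto_const up]) (use mean in \<open>auto intro!: always_eventually\<close>)
  qed simp
  then have "AE t in lborel. t \<in> {0<..<2 * pi} \<longrightarrow> (fn a \<longlongrightarrow> F (cis t)) (nontangential (cis t))"
  proof eventually_elim
    case (elim t)
    show ?case
    proof
      assume t: "t \<in> {0<..<2 * pi}"
      define \<omega> where "\<omega> = cis t"
      have \<omega>: "cmod \<omega> = 1" by (simp add: \<omega>_def)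
      have Arg: "Arg2pi \<omega> = t" using t by (simp add: \<omega>_def Arg2pi_cis)
      have quot: "((\<lambda>s. (H s - H t) / of_real (s - t)) \<longlongrightarrow> H') (at t)"
        if "(H has_vector_derivative H') (at t)" for H :: "real \<Rightarrow> complex" and H'
      proof -
        have "((\<lambda>s. (1 / (s - t)) *\<^sub>R (H s - (H t + (s - t) *\<^sub>R H'))) \<longlongrightarrow> 0) (at t)"
        proof -
          from that have "((\<lambda>s. (H s - H t - (s - t) *\<^sub>R H') /\<^sub>R norm (s - t)) \<longlongrightarrow> 0) (at t)"
            unfolding has_vector_derivative_def has_derivative_at_within by simp
          then have "((\<lambda>s. norm ((H s - H t - (s - t) *\<^sub>R H') /\<^sub>R norm (s - t))) \<longlongrightarrow> 0) (at t)"
            by (rule tendsto_norm_zero)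
          moreover have "norm ((H s - H t - (s - t) *\<^sub>R H') /\<^sub>R norm (s - t)) = norm ((1 / (s - t)) *\<^sub>R (H s - (H t + (s - t) *\<^sub>R H')))" for s
            unfolding diff_diff_eq[symmetric] norm_scaleR by (simp add: inverse_eq_divide)
          ultimately show ?thesis by (simp only: tendsto_norm_zero_iff)
        qed
        from tendsto_add[OF this tendsto_const[of H']]
        have "((\<lambda>s. (1 / (s - t)) *\<^sub>R (H s - (H t + (s - t) *\<^sub>R H')) + H') \<longlongrightarrow> H') (at t)" by simp
        moreover have "\<forall>\<^sub>F s in at t. (1 / (s - t)) *\<^sub>R (H s - (H t + (s - t) *\<^sub>R H')) + H' = (H s - H t) / of_real (s - t)"
          unfolding eventually_at_filter
          by (rule always_eventually) (auto simp: scaleR_conv_of_real field_simps)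
        ultimately show ?thesis by (simp only: tendsto_cong)
      qed
      \<comment> \<open>dividing by the difference quotient of \<open>cis\<close> changes the parameter derivative into the derivative
        along the circle\<close>
      have A: "((\<lambda>s. ((G s - G t) / of_real (s - t)) / ((cis s - cis t) / of_real (s - t))) \<longlongrightarrow> \<Psi> t / (\<i> * cis t)) (at t)"
        by (intro tendsto_divide quot cis_d) (use elim t in auto)
      have B: "\<forall>\<^sub>F s in at t. ((G s - G t) / of_real (s - t)) / ((cis s - cis t) / of_real (s - t)) = (G s - G t) / (cis s - cis t)"
        unfolding eventually_at_filter by (rule always_eventually) auto
      have q: "((\<lambda>s. (G s - G t) / (cis s - cis t)) \<longlongrightarrow> F \<omega>) (at t)"
        using A unfolding tendsto_cong[OF B] by (simp add: \<Psi>_def \<omega>_def)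
      \<comment> \<open>\<open>Arg2pi\<close> is continuous off the positive real axis, where the parameters 0 and \<open>2 * pi\<close> are glued\<close>
      have "\<omega> \<notin> \<real>\<^sub>\<ge>\<^sub>0"
        using Arg t Arg2pi_eq_0[of \<omega>] by (auto simp: complex_nonneg_Reals_iff complex_is_Real_iff)
      then have "(Arg2pi \<longlongrightarrow> t) (at \<omega>)"
        using continuous_at_Arg2pi[of \<omega>] Arg by (simp add: continuous_at)
      then have "(Arg2pi \<longlongrightarrow> t) (at \<omega> within sphere 0 1)"
        by (rule tendsto_mono[rotated]) (simp add: at_le)
      moreover have "\<forall>\<^sub>F \<zeta> in at \<omega> within sphere 0 1. Arg2pi \<zeta> \<noteq> t"
        unfolding eventually_at_filter
        by (rule always_eventually) (metis \<omega>_def cis_Arg2pi dist_0_norm mem_sphere)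
      ultimately have "filterlim Arg2pi (at t) (at \<omega> within sphere 0 1)"
        by (simp add: filterlim_at)
      from filterlim_compose[OF q this]
      have "((\<lambda>\<zeta>. (G (Arg2pi \<zeta>) - G t) / (cis (Arg2pi \<zeta>) - cis t)) \<longlongrightarrow> F \<omega>) (at \<omega> within sphere 0 1)" .
      moreover have "\<forall>\<^sub>F \<zeta> in at \<omega> within sphere 0 1. (G (Arg2pi \<zeta>) - G t) / (cis (Arg2pi \<zeta>) - cis t) = (prim a \<zeta> - prim a \<omega>) / (\<zeta> - \<omega>)"
        unfolding eventually_at_filter by (rule always_eventually) (auto simp: G_def \<omega>_def cis_Arg2pi)
      ultimately have "((\<lambda>\<zeta>. (prim a \<zeta> - prim a \<omega>) / (\<zeta> - \<omega>)) \<longlongrightarrow> F \<omega>) (at \<omega> within sphere 0 1)"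
        by (simp add: tendsto_cong)
      from deriv_tendsto_nontangential[OF prim_continuous prim_holomorphic \<omega> this]
      have "(deriv (prim a) \<longlongrightarrow> F \<omega>) (nontangential \<omega>)" .
      then have "(fn a \<longlongrightarrow> F \<omega>) (nontangential \<omega>)"
        using tendsto_nontangential_cong[of "deriv (prim a)" "fn a"] DERIV_imp_deriv[OF prim_has_derivative] by blast
      then show "(fn a \<longlongrightarrow> F (cis t)) (nontangential (cis t))" by (simp add: \<omega>_def)
    qed
  qed
  from AE_circle[OF this] show ?thesis using that F by blast
qed

lemma circle_measurable_AE:
  fixes F G :: "complex \<Rightarrow> complex"
  assumes F: "F \<in> borel_measurable circle_lebesgue" and ae: "AE \<omega> in circle_lebesgue. F \<omega> = G \<omega>"
  shows "G \<in> borel_measurable circle_lebesgue"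
proof (rule measurableI)
  fix A :: "complex set" assume A: "A \<in> sets borel"
  have 1: "F -` A \<inter> space circle_lebesgue \<in> sets circle_lebesgue" using measurable_sets[OF F A] .
  have 2: "AE \<omega> in circle_lebesgue. \<omega> \<in> F -` A \<inter> space circle_lebesgue \<longleftrightarrow> \<omega> \<in> G -` A \<inter> space circle_lebesgue"
    using ae by eventually_elim simp
  show "G -` A \<inter> space circle_lebesgue \<in> sets circle_lebesgue"
    using completion.in_sets_AE[of "F -` A \<inter> space circle_lebesgue" "G -` A \<inter> space circle_lebesgue" circle_arc]
      1 2 unfolding circle_lebesgue_eq by blast
qed simp

text \<open>Boundary values of \<open>fn a\<close>, defined at every point of the circle and meaningful almost everywhere.\<close>

definition bv :: "ell2 \<Rightarrow> complex \<Rightarrow> complex" where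
  "bv a = boundary_value (fn a)"

lemma AE_circle_unit: "AE \<omega> in circle_lebesgue. cmod \<omega> = 1"
  by (rule AE_I2) simp

lemma bv_facts:
  shows bv_L2: "bv a \<in> L2_space circle_lebesgue"
    and bv_dilate: "\<And>r. 0 < r \<Longrightarrow> r < 1 \<Longrightarrow> L2_norm circle_lebesgue (\<lambda>\<omega>. bv a \<omega> - dilate (fn a) r \<omega>) \<le> norm (a - dil r a)"
    and bv_nontangential: "AE \<omega> in circle_lebesgue. (fn a \<longlongrightarrow> bv a \<omega>) (nontangential \<omega>)"
proof -
  obtain F where F: "F \<in> borel_measurable circle_borel" "F \<in> L2_space circle_lebesgue"
    "\<And>r. 0 < r \<Longrightarrow> r < 1 \<Longrightarrow> L2_norm circle_lebesgue (\<lambda>\<omega>. F \<omega> - dilate (fn a) r \<omega>) \<le> norm (a - dil r a)"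
    "AE \<omega> in circle_lebesgue. (fn a \<longlongrightarrow> F \<omega>) (nontangential \<omega>)"
    using fatou_nontangential[of a] by blast
  have eq: "AE \<omega> in circle_lebesgue. F \<omega> = bv a \<omega>"
    using F(4) AE_circle_unit by eventually_elim (simp add: bv_def boundary_valueI)
  have Fm: "F \<in> borel_measurable circle_lebesgue" using F(2) by (simp add: L2_space_def)
  have m: "bv a \<in> borel_measurable circle_lebesgue" by (rule circle_measurable_AE[OF Fm eq])
  show L: "bv a \<in> L2_space circle_lebesgue"
    by (rule L2_space_cong_AE[OF m _ F(2)]) (use eq in \<open>auto elim: eventually_mono\<close>)
  show "AE \<omega> in circle_lebesgue. (fn a \<longlongrightarrow> bv a \<omega>) (nontangential \<omega>)"
    using eq F(4) by eventually_elim simp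
  fix r :: real assume r: "0 < r" "r < 1"
  have D: "dilate (fn a) r \<in> L2_space circle_lebesgue"
    by (intro L2_space_continuous continuous_on_dilate[OF fn_continuous r]) auto
  have "L2_norm circle_lebesgue (\<lambda>\<omega>. bv a \<omega> - dilate (fn a) r \<omega>) = L2_norm circle_lebesgue (\<lambda>\<omega>. F \<omega> - dilate (fn a) r \<omega>)"
    using L2_space_diff[OF L D] L2_space_diff[OF F(2) D] eq
    by (intro L2_norm_cong_AE) (auto simp: L2_space_def elim: eventually_mono)
  then show "L2_norm circle_lebesgue (\<lambda>\<omega>. bv a \<omega> - dilate (fn a) r \<omega>) \<le> norm (a - dil r a)"
    using F(3)[OF r] by simp
qed

lemma norm_bv: "L2_norm circle_lebesgue (bv a) = norm a"
proof -
  have D: "dilate (fn a) (rad k) \<in> L2_space circle_lebesgue" for k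
    by (intro L2_space_continuous continuous_on_dilate[OF fn_continuous rad_01]) auto
  have dl: "(\<lambda>k. dil (rad k) a) \<longlonglongrightarrow> a" by (rule filterlim_compose[OF dil_tendsto filterlim_rad])
  have "(\<lambda>k. norm (a - dil (rad k) a)) \<longlonglongrightarrow> norm (a - a)"
    by (intro tendsto_intros dl)
  then have t0: "(\<lambda>k. norm (a - dil (rad k) a)) \<longlonglongrightarrow> 0" by simp
  have bd: "\<bar>L2_norm circle_lebesgue (bv a) - norm (dil (rad k) a)\<bar> \<le> norm (a - dil (rad k) a)" for k
    using L2_norm_triangle_minus[OF bv_L2[of a] D[of k]] bv_dilate[where a = a, OF rad_01[of k]] L2_norm_dilate[where a = a, OF rad_01[of k]]
    by linarith
  have "(\<lambda>k. L2_norm circle_lebesgue (bv a) - norm (dil (rad k) a)) \<longlonglongrightarrow> 0"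
    by (rule Lim_null_comparison[OF always_eventually t0]) (use bd in simp)
  from tendsto_diff[OF tendsto_const[of "L2_norm circle_lebesgue (bv a)"] this]
  have "(\<lambda>k. norm (dil (rad k) a)) \<longlonglongrightarrow> L2_norm circle_lebesgue (bv a)" by simp
  then show ?thesis using LIMSEQ_unique tendsto_norm[OF dl] by blast
qed

lemma bv_eqI:
  assumes "AE \<omega> in circle_lebesgue. (fn a \<longlongrightarrow> F \<omega>) (nontangential \<omega>)"
  shows "AE \<omega> in circle_lebesgue. bv a \<omega> = F \<omega>"
  using assms AE_circle_unit by eventually_elim (simp add: bv_def boundary_valueI)

lemma bv_add: "AE \<omega> in circle_lebesgue. bv (a + b) \<omega> = bv a \<omega> + bv b \<omega>"
proof (rule bv_eqI)
  show "AE \<omega> in circle_lebesgue. (fn (a + b) \<longlongrightarrow> bv a \<omega> + bv b \<omega>) (nontangential \<omega>)"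
    using bv_nontangential[of a] bv_nontangential[of b]
  proof eventually_elim
    case (elim \<omega>)
    from tendsto_add[OF elim] show ?case
      using tendsto_nontangential_cong[of "\<lambda>z. fn a z + fn b z" "fn (a + b)"] by (simp add: fn_add)
  qed
qed

lemma bv_cscale: "AE \<omega> in circle_lebesgue. bv (cscale c a) \<omega> = c * bv a \<omega>"
proof (rule bv_eqI)
  show "AE \<omega> in circle_lebesgue. (fn (cscale c a) \<longlongrightarrow> c * bv a \<omega>) (nontangential \<omega>)"
    using bv_nontangential[of a]
  proof eventually_elim
    case (elim \<omega>)
    from tendsto_mult_left[OF elim, of c] show ?case
      using tendsto_nontangential_cong[of "\<lambda>z. c * fn a z" "fn (cscale c a)"] by (simp add: fn_cscale)
  qed
qed

text \<open>By polarization from the norms; the scalar \<open>\<i>\<close> gives the imaginary part.\<close>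

lemma L2_inner_bv: "L2_inner circle_lebesgue (bv a) (bv b) = cinner a b"
proof -
  have re: "Re (L2_inner circle_lebesgue (bv a) (bv b)) = inner a b" for a b
  proof -
    have "L2_norm circle_lebesgue (bv (a + b)) = L2_norm circle_lebesgue (\<lambda>\<omega>. bv a \<omega> + bv b \<omega>)"
      using bv_add[of a b] bv_L2 L2_space_add[OF bv_L2[of a] bv_L2[of b]]
      by (intro L2_norm_cong_AE) (auto simp: L2_space_def)
    then have "(norm (a + b))\<^sup>2 = (norm a)\<^sup>2 + 2 * Re (L2_inner circle_lebesgue (bv a) (bv b)) + (norm b)\<^sup>2"
      using L2_norm_add_power2[OF bv_L2[of a] bv_L2[of b]] by (simp add: norm_bv)
    moreover have "(norm (a + b))\<^sup>2 = (norm a)\<^sup>2 + 2 * inner a b + (norm b)\<^sup>2"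
      by (simp add: power2_norm_eq_inner inner_commute algebra_simps)
    ultimately show ?thesis by simp
  qed
  have "L2_inner circle_lebesgue (bv (cscale \<i> a)) (bv b) = L2_inner circle_lebesgue (\<lambda>\<omega>. \<i> * bv a \<omega>) (bv b)"
    unfolding L2_inner_def
  proof (rule integral_cong_AE)
    show "AE \<omega> in circle_lebesgue. bv (cscale \<i> a) \<omega> * cnj (bv b \<omega>) = \<i> * bv a \<omega> * cnj (bv b \<omega>)"
      using bv_cscale[of \<i> a] by eventually_elim simp
    have [measurable]: "bv c \<in> borel_measurable circle_lebesgue" for c
      using bv_L2[of c] by (simp add: L2_space_def)
    show "(\<lambda>\<omega>. bv (cscale \<i> a) \<omega> * cnj (bv b \<omega>)) \<in> borel_measurable circle_lebesgue"
      "(\<lambda>\<omega>. \<i> * bv a \<omega> * cnj (bv b \<omega>)) \<in> borel_measurable circle_lebesgue" by measurable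
  qed
  then have "inner (cscale \<i> a) b = - Im (L2_inner circle_lebesgue (bv a) (bv b))"
    using re[of "cscale \<i> a" b] by (simp add: L2_inner_scale_left)
  then show ?thesis
    using re[of a b] by (simp add: complex_eq_iff Re_cinner inner_cscale_i)
qed

lemma hardy2_inner_fn:
  assumes "\<And>z. cmod z < 1 \<Longrightarrow> f z = fn a z" "\<And>z. cmod z < 1 \<Longrightarrow> g z = fn b z"
  shows "hardy2_inner f g = cinner a b"
proof -
  have "boundary_value f \<omega> = bv a \<omega>" "boundary_value g \<omega> = bv b \<omega>" for \<omega>
    unfolding bv_def by (rule boundary_value_cong; use assms in auto)+
  then show ?thesis by (simp add: hardy2_inner_def flip: L2_inner_bv L2_inner_def)
qed

lemma hardy2_norm_fn:
  assumes "\<And>z. cmod z < 1 \<Longrightarrow> f z = fn a z"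
  shows "hardy2_norm f = norm a"
proof -
  have "boundary_value f = bv a"
    unfolding bv_def by (rule ext, rule boundary_value_cong) (use assms in auto)
  then show ?thesis by (simp add: hardy2_norm_def norm_bv)
qed

section \<open>Multiplication, shifts and Szego kernels\<close>

text \<open>Multiplication by a function bounded by \<open>C\<close> increases the mean on each circle by a factor of at most \<open>C\<close>.\<close>

lemma bounded_multiplier:
  assumes h: "h holomorphic_on ball 0 1" and bd: "\<And>z. cmod z < 1 \<Longrightarrow> cmod (h z) \<le> C"
  shows "\<exists>b. (\<forall>z. cmod z < 1 \<longrightarrow> fn b z = h z * fn a z) \<and> norm b \<le> C * norm a"
proof -
  have C: "0 \<le> C" using order_trans[OF norm_ge_zero bd[of 0]] by simp
  have "\<exists>b. (\<forall>z\<in>ball 0 1. h z * fn a z = fn b z) \<and> norm b \<le> C * norm a"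
  proof (rule hardy2_bounded_imp_fn)
    show hol: "(\<lambda>z. h z * fn a z) holomorphic_on ball 0 1" by (intro holomorphic_intros h fn_holomorphic)
    fix r :: real assume r: "0 < r" "r < 1"
    let ?D = "dilate (\<lambda>z. h z * fn a z) r"
    have L: "?D \<in> L2_space circle_lebesgue" "dilate (fn a) r \<in> L2_space circle_lebesgue"
      by (intro L2_space_continuous continuous_on_dilate r holomorphic_on_imp_continuous_on[OF hol] fn_continuous; simp)+
    have "(\<integral>\<omega>. (cmod (?D \<omega>))\<^sup>2 \<partial>circle_lebesgue) \<le> (\<integral>\<omega>. (cmod (of_real C * dilate (fn a) r \<omega>))\<^sup>2 \<partial>circle_lebesgue)"
    proof (rule integral_mono)
      fix \<omega> assume "\<omega> \<in> space circle_lebesgue"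
      then have "cmod (of_real r * \<omega>) < 1" using r by (simp add: norm_mult)
      from bd[OF this] show "(cmod (?D \<omega>))\<^sup>2 \<le> (cmod (of_real C * dilate (fn a) r \<omega>))\<^sup>2"
        using C by (auto simp: dilate_def norm_mult intro!: power_mono mult_right_mono)
    qed (use L L2_space_scale[OF L(2), of "of_real C"] in \<open>auto simp: L2_space_def\<close>)
    then have "L2_norm circle_lebesgue ?D \<le> L2_norm circle_lebesgue (\<lambda>\<omega>. of_real C * dilate (fn a) r \<omega>)"
      by (simp add: L2_norm_def)
    also have "\<dots> \<le> C * norm a"
      using C norm_dil_le[OF r, of a] by (simp add: L2_norm_scale L2_norm_dilate[OF r] mult_left_mono)
    finally show "L2_norm circle_lebesgue ?D \<le> C * norm a" .
  qed
  then show ?thesis by (metis mem_ball_0)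
qed

text \<open>The Szego kernel at \<open>w\<close>, that is \<open>1 / (1 - cnj w * z)\<close>; for \<open>w\<close> outside the disc the value is a default.\<close>

lift_definition szego :: "complex \<Rightarrow> ell2" is "\<lambda>w n. if cmod w < 1 then cnj w ^ n else 0"
proof -
  fix w :: complex
  show "summable (\<lambda>n. (cmod (if cmod w < 1 then cnj w ^ n else 0))\<^sup>2)"
    using power_less_one_ell2[of "cnj w"] by (cases "cmod w < 1") simp_all
qed

lemma coef_szego: "cmod w < 1 \<Longrightarrow> coef (szego w) n = cnj w ^ n"
  by (simp add: szego.rep_eq)

lemma cinner_szego: "cmod w < 1 \<Longrightarrow> cinner a (szego w) = fn a w"
  by (simp add: cinner_def fn_def coef_szego)

lemma fn_szego:
  assumes "cmod w < 1" "cmod z < 1"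
  shows "fn (szego w) z = 1 / (1 - cnj w * z)"
proof -
  have "cmod (cnj w * z) < 1" using assms mult_strict_mono'[of "cmod w" 1 "cmod z" 1] by (simp add: norm_mult)
  then have "(\<Sum>n. (cnj w * z) ^ n) = 1 / (1 - cnj w * z)" by (rule suminf_geometric)
  then show ?thesis using assms by (simp add: fn_def coef_szego power_mult_distrib)
qed

lemma one_minus_cnj_mult_nonzero: "cmod w < 1 \<Longrightarrow> cmod z \<le> 1 \<Longrightarrow> 1 - cnj w * z \<noteq> 0"
proof
  assume "cmod w < 1" "cmod z \<le> 1" "1 - cnj w * z = 0"
  then have "cmod (cnj w * z) = 1" by (metis eq_iff_diff_eq_0 norm_one)
  moreover have "cmod w * cmod z \<le> cmod w" using \<open>cmod z \<le> 1\<close> by (simp add: mult_left_le)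
  ultimately show False using \<open>cmod w < 1\<close> by (simp add: norm_mult)
qed

lemma norm_szego_power2:
  assumes "cmod w < 1"
  shows "complex_of_real ((norm (szego w))\<^sup>2) = fn (szego w) w"
  using cinner_self[of "szego w"] cinner_szego[OF assms, of "szego w"] by simp

lemma norm_szego_pos:
  assumes "cmod w < 1"
  shows "0 < norm (szego w)"
proof -
  have "coef (szego w) 0 = 1" using assms by (simp add: coef_szego)
  then have "szego w \<noteq> 0" by auto
  then show ?thesis by simp
qed

lemma fn_szego_bounded:
  assumes "cmod w < 1" "cmod z < 1"
  shows "cmod (fn (szego w) z) \<le> 1 / (1 - cmod w)"
proof -
  have "cmod (cnj w * z) \<le> cmod w" using assms by (simp add: norm_mult mult_left_le)
  then have "1 - cmod w \<le> cmod (1 - cnj w * z)" using norm_triangle_ineq2[of 1 "cnj w * z"] by simp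
  then show ?thesis using assms by (simp add: fn_szego norm_divide frac_le)
qed

text \<open>Bounded boundary values force a bounded function: on the boundary multiplication by \<open>fn a\<close>
  is multiplication by \<open>bv a\<close>, which has norm at most \<open>C\<close>; apply it to a Szego kernel.\<close>

lemma bounded_by_boundary_values:
  assumes bd: "AE \<omega> in circle_lebesgue. cmod (bv a \<omega>) \<le> C" and C: "0 \<le> C" and w: "cmod w < 1"
  shows "cmod (fn a w) \<le> C"
proof -
  obtain b where b: "\<And>z. cmod z < 1 \<Longrightarrow> fn b z = fn (szego w) z * fn a z"
    using bounded_multiplier[OF fn_holomorphic fn_szego_bounded[OF w], of a] by blast
  have eq: "AE \<omega> in circle_lebesgue. bv b \<omega> = bv (szego w) \<omega> * bv a \<omega>"
  proof (rule bv_eqI)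
    show "AE \<omega> in circle_lebesgue. (fn b \<longlongrightarrow> bv (szego w) \<omega> * bv a \<omega>) (nontangential \<omega>)"
      using bv_nontangential[of a] bv_nontangential[of "szego w"]
    proof eventually_elim
      case (elim \<omega>)
      from tendsto_mult[OF elim(2,1)] show ?case
        using tendsto_nontangential_cong[of "\<lambda>z. fn (szego w) z * fn a z" "fn b"] by (simp add: b)
    qed
  qed
  have "(\<integral>\<omega>. (cmod (bv b \<omega>))\<^sup>2 \<partial>circle_lebesgue) \<le> (\<integral>\<omega>. (cmod (of_real C * bv (szego w) \<omega>))\<^sup>2 \<partial>circle_lebesgue)"
  proof (rule integral_mono_AE)
    show "AE \<omega> in circle_lebesgue. (cmod (bv b \<omega>))\<^sup>2 \<le> (cmod (of_real C * bv (szego w) \<omega>))\<^sup>2"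
      using eq bd
      by eventually_elim (use C in \<open>auto simp: norm_mult mult.commute[of C] intro!: power_mono mult_left_mono\<close>)
  qed (use bv_L2 L2_space_scale[OF bv_L2] in \<open>auto simp: L2_space_def\<close>)
  then have "L2_norm circle_lebesgue (bv b) \<le> L2_norm circle_lebesgue (\<lambda>\<omega>. of_real C * bv (szego w) \<omega>)"
    by (simp add: L2_norm_def)
  then have nb: "norm b \<le> C * norm (szego w)" using C by (simp add: norm_bv L2_norm_scale)
  have "cmod (fn a w) * (norm (szego w))\<^sup>2 = cmod (fn b w)"
    using b[OF w] norm_szego_power2[OF w] by (metis mult.commute norm_mult norm_of_real abs_of_nonneg zero_le_power2)
  also have "\<dots> \<le> norm b * norm (szego w)"
    using cmod_cinner_le[of b "szego w"] by (simp add: cinner_szego[OF w])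
  also have "\<dots> \<le> C * norm (szego w) * norm (szego w)" using nb by (intro mult_right_mono) auto
  finally show ?thesis using norm_szego_pos[OF w] by (simp add: power2_eq_square mult.assoc)
qed

text \<open>Multiplication by \<open>z\<close>, and below its left inverse and adjoint, the backward shift
  \<open>(f - f 0) / z\<close>.\<close>

lift_definition shift :: "ell2 \<Rightarrow> ell2" is "\<lambda>a n. case n of 0 \<Rightarrow> 0 | Suc k \<Rightarrow> a k"
proof -
  fix a :: "nat \<Rightarrow> complex"
  assume "summable (\<lambda>n. (cmod (a n))\<^sup>2)"
  then show "summable (\<lambda>n. (cmod (case n of 0 \<Rightarrow> 0 | Suc k \<Rightarrow> a k))\<^sup>2)"
    by (subst summable_Suc_iff[symmetric]) simp
qed

lift_definition bshift :: "ell2 \<Rightarrow> ell2" is "\<lambda>a n. a (Suc n)"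
proof -
  fix a :: "nat \<Rightarrow> complex"
  assume "summable (\<lambda>n. (cmod (a n))\<^sup>2)"
  then show "summable (\<lambda>n. (cmod (a (Suc n)))\<^sup>2)"
    using summable_Suc_iff[of "\<lambda>n. (cmod (a n))\<^sup>2"] by simp
qed

declare bshift.rep_eq [simp]

lemma coef_shift [simp]: "coef (shift a) 0 = 0" "coef (shift a) (Suc n) = coef a n"
  by (simp_all add: shift.rep_eq)

lemma cinner_split_head: "cinner a b = coef a 0 * cnj (coef b 0) + cinner (bshift a) (bshift b)"
  using suminf_split_head[OF summable_cinner[of a b]] by (simp add: cinner_def)

lemma cinner_bshift: "cinner (bshift a) b = cinner a (shift b)"
proof -
  have "bshift (shift b) = b" by (rule ell2_eqI) simp
  then show ?thesis using cinner_split_head[of a "shift b"] by simp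
qed

lemma fn_shift:
  assumes "cmod z < 1"
  shows "fn (shift a) z = z * fn a z"
proof -
  have "summable (\<lambda>n. coef (shift a) n * z ^ n)" using fn_sums[OF assms] by (rule sums_summable)
  from suminf_split_head[OF this] have "fn (shift a) z = (\<Sum>n. z * (coef a n * z ^ n))"
    by (simp add: fn_def mult.left_commute)
  then show ?thesis using suminf_mult[OF sums_summable[OF fn_sums[OF assms, of a]], of z] by (simp add: fn_def)
qed

lemma fn_bshift:
  assumes "cmod z < 1"
  shows "z * fn (bshift a) z = fn a z - fn a 0"
proof -
  have "a = cscale (coef a 0) (szego 0) + shift (bshift a)"
  proof (rule ell2_eqI)
    fix n show "coef a n = coef (cscale (coef a 0) (szego 0) + shift (bshift a)) n"
      by (cases n) (auto simp: coef_szego)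
  qed
  then have "fn a z = fn (cscale (coef a 0) (szego 0) + shift (bshift a)) z" by simp
  also have "\<dots> = coef a 0 + z * fn (bshift a) z"
    using assms by (simp add: fn_add fn_cscale fn_shift fn_szego)
  finally show ?thesis by (simp add: fn_0)
qed

lemma norm_bshift_power2: "(norm (bshift a))\<^sup>2 = (norm a)\<^sup>2 - (cmod (coef a 0))\<^sup>2"
proof -
  have "complex_of_real ((norm a)\<^sup>2) = complex_of_real ((cmod (coef a 0))\<^sup>2 + (norm (bshift a))\<^sup>2)"
    unfolding of_real_add complex_norm_square cinner_self[symmetric] by (rule cinner_split_head)
  then have "(norm a)\<^sup>2 = (cmod (coef a 0))\<^sup>2 + (norm (bshift a))\<^sup>2" by (simp only: of_real_eq_iff)
  then show ?thesis by simp
qed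

lemma norm_bshift_le: "norm (bshift a) \<le> norm a"
  by (rule power2_le_imp_le) (simp_all add: norm_bshift_power2)

lemma bshift_linear: "bshift (a + b) = bshift a + bshift b" "bshift (a - b) = bshift a - bshift b"
  "bshift (cscale c a) = cscale c (bshift a)"
  by (auto intro!: ell2_eqI)

lemma coef_bshift_iter: "coef ((bshift ^^ N) a) n = coef a (n + N)"
  by (induction N arbitrary: n) auto

text \<open>These are the norms of the tails of the Taylor series.\<close>

lemma bshift_iter_tendsto: "(\<lambda>N. norm ((bshift ^^ N) a)) \<longlonglongrightarrow> 0"
proof -
  have "(\<lambda>N. \<Sum>n. (cmod (coef a (n + N)))\<^sup>2) \<longlonglongrightarrow> 0" by (rule suminf_exist_split2[OF summable_coef])
  then have "(\<lambda>N. (norm ((bshift ^^ N) a))\<^sup>2) \<longlonglongrightarrow> 0" by (simp add: norm_ell2_power2 coef_bshift_iter)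
  from tendsto_real_sqrt[OF this] show ?thesis by simp
qed

section \<open>Model spaces\<close>

text \<open>The coefficients of an inner function.\<close>

definition inner_seq :: "ell2 \<Rightarrow> bool" where
  "inner_seq p \<longleftrightarrow> (AE \<omega> in circle_lebesgue. cmod (bv p \<omega>) = 1)"

lemma inner_function_fn:
  assumes "inner_function \<phi>"
  shows "\<exists>p. inner_seq p \<and> (\<forall>z. cmod z < 1 \<longrightarrow> \<phi> z = fn p z)"
proof -
  obtain p where p: "\<And>z. cmod z < 1 \<Longrightarrow> \<phi> z = fn p z"
    using assms hardy2_imp_fn[of \<phi>] by (auto simp: inner_function_def)
  have "boundary_value \<phi> \<omega> = bv p \<omega>" for \<omega>
    unfolding bv_def by (rule boundary_value_cong) (use p in auto)
  then show ?thesis using assms p by (auto simp: inner_function_def inner_seq_def)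
qed

definition mul :: "ell2 \<Rightarrow> ell2 \<Rightarrow> ell2" where
  "mul p a = (SOME b. \<forall>z. cmod z < 1 \<longrightarrow> fn b z = fn p z * fn a z)"

locale inner_fn =
  fixes p :: ell2
  assumes inner: "inner_seq p"
begin

lemma fn_le_1: "cmod w < 1 \<Longrightarrow> cmod (fn p w) \<le> 1"
  by (rule bounded_by_boundary_values) (use inner in \<open>auto simp: inner_seq_def elim: eventually_mono\<close>)

lemma fn_mul: "cmod z < 1 \<Longrightarrow> fn (mul p a) z = fn p z * fn a z"
  using someI_ex[of "\<lambda>b. \<forall>z. cmod z < 1 \<longrightarrow> fn b z = fn p z * fn a z"]
    bounded_multiplier[OF fn_holomorphic fn_le_1, of a] unfolding mul_def by blast

lemma mul_add: "mul p (a + b) = mul p a + mul p b"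
  by (rule fn_eq_imp_eq) (simp add: fn_mul fn_add algebra_simps)

lemma mul_cscale: "mul p (cscale c a) = cscale c (mul p a)"
  by (rule fn_eq_imp_eq) (simp add: fn_mul fn_cscale algebra_simps)

lemma mul_shift: "mul p (shift a) = shift (mul p a)"
  by (rule fn_eq_imp_eq) (simp add: fn_mul fn_shift algebra_simps)

lemma mul_szego_0: "mul p (szego 0) = p"
  by (rule fn_eq_imp_eq) (simp add: fn_mul fn_szego)

lemma bv_mul: "AE \<omega> in circle_lebesgue. bv (mul p a) \<omega> = bv p \<omega> * bv a \<omega>"
proof (rule bv_eqI)
  show "AE \<omega> in circle_lebesgue. (fn (mul p a) \<longlongrightarrow> bv p \<omega> * bv a \<omega>) (nontangential \<omega>)"
    using bv_nontangential[of a] bv_nontangential[of p]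
  proof eventually_elim
    case (elim \<omega>)
    from tendsto_mult[OF elim(2,1)] show ?case
      using tendsto_nontangential_cong[of "\<lambda>z. fn p z * fn a z" "fn (mul p a)"] by (simp add: fn_mul)
  qed
qed

lemma cinner_mul: "cinner (mul p a) (mul p b) = cinner a b"
proof -
  have [measurable]: "bv c \<in> borel_measurable circle_lebesgue" for c
    using bv_L2[of c] by (simp add: L2_space_def)
  have "L2_inner circle_lebesgue (bv (mul p a)) (bv (mul p b)) = L2_inner circle_lebesgue (bv a) (bv b)"
    unfolding L2_inner_def
  proof (rule integral_cong_AE)
    show "AE \<omega> in circle_lebesgue. bv (mul p a) \<omega> * cnj (bv (mul p b) \<omega>) = bv a \<omega> * cnj (bv b \<omega>)"
      using bv_mul[of a] bv_mul[of b] inner[unfolded inner_seq_def]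
    proof eventually_elim
      case (elim \<omega>)
      then have "bv p \<omega> * cnj (bv p \<omega>) = 1" using complex_norm_square[of "bv p \<omega>"] by simp
      moreover have "bv (mul p a) \<omega> * cnj (bv (mul p b) \<omega>) = (bv p \<omega> * cnj (bv p \<omega>)) * (bv a \<omega> * cnj (bv b \<omega>))"
        using elim by simp
      ultimately show ?case by simp
    qed
  qed measurable
  then show ?thesis by (simp add: L2_inner_bv)
qed

lemma norm_mul: "norm (mul p a) = norm a"
  using cinner_mul[of a a] unfolding cinner_self by (simp add: power2_eq_imp_eq del: of_real_power)

lemma norm_p: "norm p = 1"
proof -
  have "complex_of_real ((norm (szego 0))\<^sup>2) = 1" using norm_szego_power2[of 0] by (simp add: fn_szego)
  then have "(norm (szego 0))\<^sup>2 = 1\<^sup>2" by (simp only: of_real_eq_1_iff power_one)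
  then have "norm (szego 0) = 1" by (rule power2_eq_imp_eq) auto
  then show ?thesis using norm_mul[of "szego 0"] by (simp add: mul_szego_0)
qed

definition K :: "ell2 set" where "K = {a. \<forall>b. cinner a (mul p b) = 0}"

lemma K_add: "a \<in> K \<Longrightarrow> b \<in> K \<Longrightarrow> a + b \<in> K"
  by (simp add: K_def cinner_add_left)

lemma K_diff: "a \<in> K \<Longrightarrow> b \<in> K \<Longrightarrow> a - b \<in> K"
  by (simp add: K_def cinner_diff_left)

lemma K_cscale: "a \<in> K \<Longrightarrow> cscale c a \<in> K"
  by (simp add: K_def cinner_scale_left)

lemma K_0 [simp]: "0 \<in> K"
  by (simp add: K_def)

lemma subspace_K: "subspace K"
  by (rule subspaceI) (auto simp: K_add scaleR_eq_cscale K_cscale)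

lemma closed_K: "closed K"
proof -
  have "closed {a. cinner a (mul p b) = 0}" for b
    unfolding cinner_eq_0_iff_inner
  proof (rule closed_Collect_conj)
    have "inner (cscale \<i> a) c = inner a (cscale (- \<i>) c)" for a c
      by (simp add: cinner_scale_left cinner_scale_right flip: Re_cinner)
    then show "closed {a. inner (cscale \<i> a) (mul p b) = 0}"
      by (simp add: closed_Collect_eq continuous_intros)
    show "closed {a. inner a (mul p b) = 0}" by (intro closed_Collect_eq continuous_intros)
  qed
  moreover have "K = (\<Inter>b. {a. cinner a (mul p b) = 0})" by (auto simp: K_def)
  ultimately show ?thesis by auto
qed

lemma K_bshift: "a \<in> K \<Longrightarrow> bshift a \<in> K"
  by (simp add: K_def cinner_bshift mul_shift[symmetric])

text \<open>With \<open>p\<close> for the inner function itself: \<open>z\<close> times the backward shift of \<open>p\<close> is \<open>p - p 0\<close>, and multiplication by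
  \<open>p\<close> is isometric, so the inner product with \<open>p * b\<close> reduces to that of \<open>1\<close> with \<open>z * b\<close>.\<close>

lemma bshift_p_in_K: "bshift p \<in> K"
  unfolding K_def
proof safe
  fix b
  have "cinner (bshift p) (mul p b) = cinner (mul p (szego 0)) (mul p (shift b))"
    by (simp add: cinner_bshift mul_shift mul_szego_0)
  also have "\<dots> = cinner (szego 0) (shift b)" by (rule cinner_mul)
  also have "\<dots> = cnj (fn (shift b) 0)" using cinner_szego[of 0 "shift b"] cinner_commute[of "szego 0" "shift b"] by simp
  finally show "cinner (bshift p) (mul p b) = 0" by (simp add: fn_shift)
qed

text \<open>The orthogonal projection of the Szego kernel to \<open>K\<close>.\<close>

definition ker :: "complex \<Rightarrow> ell2" where
  "ker w = szego w - cscale (cnj (fn p w)) (mul p (szego w))"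

lemma ker_in_K:
  assumes "cmod w < 1"
  shows "ker w \<in> K"
  unfolding K_def
proof safe
  fix b
  have "cinner (ker w) (mul p b) = cinner (szego w) (mul p b) - cnj (fn p w) * cinner (szego w) b"
    by (simp add: ker_def cinner_diff_left cinner_scale_left cinner_mul)
  also have "\<dots> = cnj (fn (mul p b) w) - cnj (fn p w) * cnj (fn b w)"
    using cinner_szego[OF assms] cinner_commute by metis
  finally show "cinner (ker w) (mul p b) = 0" using assms by (simp add: fn_mul)
qed

lemma cinner_ker: "a \<in> K \<Longrightarrow> cmod w < 1 \<Longrightarrow> cinner a (ker w) = fn a w"
  by (simp add: ker_def cinner_diff_right cinner_scale_right cinner_szego K_def)

lemma fn_ker:
  assumes "cmod w < 1" "cmod z < 1"
  shows "fn (ker w) z = (1 - cnj (fn p w) * fn p z) / (1 - cnj w * z)"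
  using assms by (simp add: ker_def fn_diff fn_cscale fn_mul fn_szego diff_divide_distrib)

lemma model_space_eq:
  assumes \<phi>: "\<And>z. cmod z < 1 \<Longrightarrow> \<phi> z = fn p z"
  shows "f \<in> model_space \<phi> \<longleftrightarrow> (\<exists>a\<in>K. \<forall>z. cmod z < 1 \<longrightarrow> f z = fn a z)"
proof -
  have key: "hardy2_inner f (\<lambda>z. \<phi> z * g z) = cinner a (mul p b)"
    if "\<And>z. cmod z < 1 \<Longrightarrow> f z = fn a z" "\<And>z. cmod z < 1 \<Longrightarrow> g z = fn b z" for f g a b
    by (rule hardy2_inner_fn) (use that \<phi> fn_mul in auto)
  show ?thesis
  proof
    assume f: "f \<in> model_space \<phi>"
    then obtain a where a: "\<And>z. cmod z < 1 \<Longrightarrow> f z = fn a z"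
      using hardy2_imp_fn[of f] by (auto simp: model_space_def)
    have "cinner a (mul p b) = 0" for b
      using f fn_in_hardy2[of b] key[OF a, of "fn b" b] by (auto simp: model_space_def)
    then show "\<exists>a\<in>K. \<forall>z. cmod z < 1 \<longrightarrow> f z = fn a z" using a by (auto simp: K_def)
  next
    assume "\<exists>a\<in>K. \<forall>z. cmod z < 1 \<longrightarrow> f z = fn a z"
    then obtain a where a: "a \<in> K" "\<And>z. cmod z < 1 \<Longrightarrow> f z = fn a z" by blast
    have "hardy2_inner f (\<lambda>z. \<phi> z * g z) = 0" if g: "g \<in> hardy2" for g
    proof -
      obtain b where b: "\<And>z. cmod z < 1 \<Longrightarrow> g z = fn b z" using hardy2_imp_fn[OF g] by auto
      show ?thesis using key[OF a(2) b] a(1) by (simp add: K_def)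
    qed
    moreover have "f \<in> hardy2" using a(2) by (auto simp: hardy2_eq)
    ultimately show "f \<in> model_space \<phi>" by (simp add: model_space_def)
  qed
qed

lemma model_kernel_eq:
  assumes "\<And>z. cmod z < 1 \<Longrightarrow> \<phi> z = fn p z" "cmod w < 1" "cmod z < 1"
  shows "model_kernel \<phi> z w = fn (ker w) z"
  using assms by (simp add: model_kernel_def fn_ker)

end

section \<open>Functions with positive real part\<close>

definition pos_re :: "(complex \<Rightarrow> complex) \<Rightarrow> bool" where
  "pos_re y \<longleftrightarrow> y holomorphic_on ball 0 1 \<and> (\<forall>z. cmod z < 1 \<longrightarrow> 0 \<le> Re (y z))"

lemma pos_re_const: "0 \<le> Re c \<Longrightarrow> pos_re (\<lambda>_. c)"
  by (simp add: pos_re_def)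

lemma pos_re_add: "pos_re x \<Longrightarrow> pos_re y \<Longrightarrow> pos_re (\<lambda>z. x z + y z)"
  by (auto simp: pos_re_def intro!: holomorphic_intros)

lemma pos_re_scale: "pos_re y \<Longrightarrow> 0 \<le> c \<Longrightarrow> pos_re (\<lambda>z. of_real c * y z)"
  by (auto simp: pos_re_def intro!: holomorphic_intros)

text \<open>The value lies in the half plane onto which \<open>1 / (1 - u)\<close> maps the unit disc.\<close>

lemma pos_re_szego: "cmod w \<le> 1 \<Longrightarrow> pos_re (\<lambda>z. 1 / (1 - cnj w * z))"
proof -
  assume w: "cmod w \<le> 1"
  have lt: "cmod (cnj w * z) < 1" if "cmod z < 1" for z
  proof -
    have "cmod w * cmod z \<le> 1 * cmod z" using w by (intro mult_right_mono) auto
    then show ?thesis using that by (simp add: norm_mult)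
  qed
  have "0 \<le> Re (1 / (1 - u))" if "cmod u < 1" for u
  proof -
    have "Re u \<le> 1" using complex_Re_le_cmod[of u] that by simp
    then show ?thesis by (simp add: Re_divide')
  qed
  moreover have "1 - cnj w * z \<noteq> 0" if "cmod z < 1" for z using lt[OF that] by auto
  ultimately show ?thesis
    unfolding pos_re_def using lt by (auto intro!: holomorphic_intros)
qed

text \<open>Harnack's inequality: Schwarz's lemma for \<open>(Y - a) / (Y + cnj a)\<close> with \<open>Y = y + \<epsilon>\<close>, \<open>a = Y 0\<close>.\<close>

lemma pos_re_bound:
  assumes y: "pos_re y" and z: "cmod z < 1"
  shows "cmod (y z) \<le> cmod (y 0) * ((1 + cmod z) / (1 - cmod z))"
proof -
  let ?c = "(1 + cmod z) / (1 - cmod z)"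
  have eps: "cmod (y z) \<le> (cmod (y 0) + \<epsilon>) * ?c + \<epsilon>" if \<epsilon>: "0 < \<epsilon>" for \<epsilon>
  proof -
    define Y where "Y w = y w + of_real \<epsilon>" for w
    define a where "a = Y 0"
    have Y: "\<epsilon> \<le> Re (Y w)" if "cmod w < 1" for w using y that by (simp add: Y_def pos_re_def)
    have a: "0 < Re a" using Y[of 0] \<epsilon> by (simp add: a_def)
    have nz: "Y w + cnj a \<noteq> 0" if "cmod w < 1" for w
    proof
      assume "Y w + cnj a = 0"
      then have "Re (Y w) + Re a = 0" by (metis plus_complex.simps(1) complex_cnj(1) cnj.simps(1) zero_complex.simps(1))
      then show False using Y[OF that] a \<epsilon> by simp
    qed
    define q where "q w = (Y w - a) / (Y w + cnj a)" for w
    have "cmod (q z) \<le> cmod z"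
    proof (rule Schwarz_Lemma(1))
      show "q holomorphic_on ball 0 1"
        unfolding q_def Y_def using nz[unfolded Y_def] y
        by (intro holomorphic_intros) (auto simp: pos_re_def)
      show "q 0 = 0" by (simp add: q_def a_def)
      show "cmod (q w) < 1" if "cmod w < 1" for w
      proof -
        have "(cmod (Y w + cnj a))\<^sup>2 - (cmod (Y w - a))\<^sup>2 = 4 * Re (Y w) * Re a"
          unfolding cmod_power2 by (simp add: power2_eq_square algebra_simps)
        moreover have "0 < 4 * Re (Y w) * Re a" using Y[OF that] a \<epsilon> by simp
        ultimately have "(cmod (Y w - a))\<^sup>2 < (cmod (Y w + cnj a))\<^sup>2" by linarith
        then have "cmod (Y w - a) < cmod (Y w + cnj a)" by (rule power2_less_imp_less) simp
        then show ?thesis using nz[OF that] by (simp add: q_def norm_divide)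
      qed
    qed (rule z)
    have "Y z * (1 - q z) = a + q z * cnj a" using nz[OF z] by (simp add: q_def field_simps)
    then have "cmod (Y z) * cmod (1 - q z) = cmod (a + q z * cnj a)" by (metis norm_mult)
    also have "\<dots> \<le> cmod a + cmod (q z) * cmod a"
      using norm_triangle_ineq[of a "q z * cnj a"] by (simp add: norm_mult)
    also have "\<dots> \<le> cmod a * (1 + cmod z)"
      using mult_right_mono[OF \<open>cmod (q z) \<le> cmod z\<close>, of "cmod a"] by (simp add: algebra_simps)
    finally have 1: "cmod (Y z) * cmod (1 - q z) \<le> cmod a * (1 + cmod z)" .
    have "1 - cmod z \<le> cmod (1 - q z)" using norm_triangle_ineq2[of 1 "q z"] \<open>cmod (q z) \<le> cmod z\<close> by simp
    then have "cmod (Y z) * (1 - cmod z) \<le> cmod a * (1 + cmod z)"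
      using 1 mult_left_mono[of "1 - cmod z" "cmod (1 - q z)" "cmod (Y z)"] by simp
    then have "cmod (Y z) \<le> cmod a * ?c" using z by (simp add: field_simps)
    also have "\<dots> \<le> (cmod (y 0) + \<epsilon>) * ?c"
      using norm_triangle_ineq[of "y 0" "of_real \<epsilon>"] z \<epsilon>
      by (intro mult_right_mono) (auto simp: a_def Y_def)
    finally have "cmod (Y z) \<le> (cmod (y 0) + \<epsilon>) * ?c" .
    moreover have "cmod (y z) \<le> cmod (Y z) + \<epsilon>"
      using norm_triangle_ineq4[of "Y z" "of_real \<epsilon>"] \<epsilon> by (simp add: Y_def)
    ultimately show ?thesis by simp
  qed
  have "cmod (y z) \<le> (cmod (y 0) + 0) * ?c + 0"
  proof (rule tendsto_lowerbound)
    show "((\<lambda>\<epsilon>. (cmod (y 0) + \<epsilon>) * ?c + \<epsilon>) \<longlongrightarrow> (cmod (y 0) + 0) * ?c + 0) (at_right 0)"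
      by (intro tendsto_intros)
    show "\<forall>\<^sub>F \<epsilon> in at_right 0. cmod (y z) \<le> (cmod (y 0) + \<epsilon>) * ?c + \<epsilon>"
      using eventually_at_right_less[of "0::real"] by eventually_elim (rule eps)
  qed simp
  then show ?thesis by simp
qed

lemma pos_re_bound_cball:
  assumes "pos_re y" "cmod (y 0) \<le> R" "z \<in> cball 0 r" "r < 1"
  shows "cmod (y z) \<le> R * (2 / (1 - r))"
proof -
  have z: "cmod z \<le> r" "cmod z < 1" using assms by auto
  have R: "0 \<le> R" using order_trans[OF norm_ge_zero assms(2)] .
  have "cmod (y z) \<le> cmod (y 0) * ((1 + cmod z) / (1 - cmod z))" by (rule pos_re_bound[OF assms(1) z(2)])
  also have "\<dots> \<le> R * (2 / (1 - r))"
    using z assms R by (intro mult_mono frac_le) auto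
  finally show ?thesis .
qed

lemma pos_re_limit:
  assumes "g holomorphic_on ball 0 1" "\<And>n. pos_re (Y n)" "\<And>z. cmod z < 1 \<Longrightarrow> (\<lambda>n. Y n z) \<longlonglongrightarrow> g z"
  shows "pos_re g"
  unfolding pos_re_def
proof (intro conjI allI impI)
  fix z assume z: "cmod z < 1"
  show "0 \<le> Re (g z)"
    by (rule LIMSEQ_le_const[OF tendsto_Re[OF assms(3)[OF z]]]) (use assms(2) z in \<open>auto simp: pos_re_def\<close>)
qed (rule assms(1))

text \<open>Such factors are bounded below and grow with \<open>x\<close>, so they can divide unbounded functions.\<close>

lemma one_plus_pos_re:
  assumes "0 \<le> Re x" "0 \<le> \<epsilon>"
  shows "1 \<le> cmod (1 + of_real \<epsilon> * x)" "\<epsilon> * cmod x \<le> cmod (1 + of_real \<epsilon> * x)"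
proof -
  have e: "(cmod (1 + of_real \<epsilon> * x))\<^sup>2 = 1 + 2 * \<epsilon> * Re x + (\<epsilon> * cmod x)\<^sup>2"
    unfolding power_mult_distrib cmod_power2 by (simp add: power2_eq_square algebra_simps)
  have "0 \<le> 2 * \<epsilon> * Re x" using assms by simp
  then show "1 \<le> cmod (1 + of_real \<epsilon> * x)" "\<epsilon> * cmod x \<le> cmod (1 + of_real \<epsilon> * x)"
    using e by (auto intro!: power2_le_imp_le[of 1] power2_le_imp_le[of "\<epsilon> * cmod x"])
qed

lemma sum4: "(\<Sum>k<4. g k) = g 0 + g 1 + g 2 + g (3::nat)" for g :: "nat \<Rightarrow> 'a::comm_monoid_add"
  by (simp add: eval_nat_numeral add.assoc)

lemma i_power_simps: "\<i> ^ 2 = -1" "\<i> ^ 3 = -\<i>"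
  by (simp_all add: power3_eq_cube)

text \<open>By Herglotz' theorem every function with positive real part is, up to an imaginary constant, the Cauchy transform
  of a positive measure on the circle.  So these sets are, up to constant factors, the balls of radius \<open>R\<close> in the space of
  Cauchy transforms of complex measures.\<close>

definition cauchy_class :: "real \<Rightarrow> (complex \<Rightarrow> complex) set" where
  "cauchy_class R = {e. \<exists>y. (\<forall>k<4. pos_re (y k) \<and> cmod (y k 0) \<le> R) \<and>
    (\<forall>z. cmod z < 1 \<longrightarrow> e z = (\<Sum>k<4. \<i> ^ k * y k z))}"

lemma cauchy_class_E:
  assumes "e \<in> cauchy_class R"
  obtains y where "\<And>k. k < 4 \<Longrightarrow> pos_re (y k)" "\<And>k. k < 4 \<Longrightarrow> cmod (y k 0) \<le> R"
    "\<And>z. cmod z < 1 \<Longrightarrow> e z = (\<Sum>k<4. \<i> ^ k * y k z)"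
  using assms unfolding cauchy_class_def by blast

lemma cauchy_class_cong: "e \<in> cauchy_class R \<Longrightarrow> (\<And>z. cmod z < 1 \<Longrightarrow> e' z = e z) \<Longrightarrow> e' \<in> cauchy_class R"
  unfolding cauchy_class_def by auto

lemma cauchy_class_holomorphic: "e \<in> cauchy_class R \<Longrightarrow> e holomorphic_on ball 0 1"
proof (erule cauchy_class_E)
  fix y assume y: "\<And>k. k < 4 \<Longrightarrow> pos_re (y k)" "\<And>z. cmod z < 1 \<Longrightarrow> e z = (\<Sum>k<4. \<i> ^ k * y k z)"
  have "(\<lambda>z. \<Sum>k<4. \<i> ^ k * y k z) holomorphic_on ball 0 1"
    using y(1) by (intro holomorphic_intros) (auto simp: pos_re_def)
  then show ?thesis by (rule holomorphic_transform) (simp add: y(2))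
qed

lemma cauchy_class_mono: "e \<in> cauchy_class R \<Longrightarrow> R \<le> S \<Longrightarrow> e \<in> cauchy_class S"
  unfolding cauchy_class_def by (auto intro: order_trans)

lemma cauchy_class_0: "0 \<le> R \<Longrightarrow> (\<lambda>_. 0) \<in> cauchy_class R"
  unfolding cauchy_class_def by (auto intro!: exI[of _ "\<lambda>_ _. 0"] pos_re_const)

lemma cauchy_class_zero_radius: "e \<in> cauchy_class 0 \<Longrightarrow> cmod z < 1 \<Longrightarrow> e z = 0"
proof (erule cauchy_class_E)
  fix y assume z: "cmod z < 1" and y: "\<And>k. k < 4 \<Longrightarrow> pos_re (y k)" "\<And>k. k < 4 \<Longrightarrow> cmod (y k 0) \<le> 0"
    "\<And>z. cmod z < 1 \<Longrightarrow> e z = (\<Sum>k<4. \<i> ^ k * y k z)"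
  have "y k z = 0" if "k < 4" for k using pos_re_bound[OF y(1)[OF that] z] y(2)[OF that] by simp
  then show "e z = 0" using y(3)[OF z] by simp
qed

lemma cauchy_class_convex:
  assumes "e \<in> cauchy_class R" "f \<in> cauchy_class R" "0 \<le> s" "0 \<le> t" "s + t = 1"
  shows "(\<lambda>z. of_real s * e z + of_real t * f z) \<in> cauchy_class R"
proof -
  obtain x where x: "\<And>k. k < 4 \<Longrightarrow> pos_re (x k)" "\<And>k. k < 4 \<Longrightarrow> cmod (x k 0) \<le> R"
    "\<And>z. cmod z < 1 \<Longrightarrow> e z = (\<Sum>k<4. \<i> ^ k * x k z)" using cauchy_class_E[OF assms(1)] by blast
  obtain y where y: "\<And>k. k < 4 \<Longrightarrow> pos_re (y k)" "\<And>k. k < 4 \<Longrightarrow> cmod (y k 0) \<le> R"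
    "\<And>z. cmod z < 1 \<Longrightarrow> f z = (\<Sum>k<4. \<i> ^ k * y k z)" using cauchy_class_E[OF assms(2)] by blast
  have "cmod (of_real s * x k 0 + of_real t * y k 0) \<le> R" if "k < 4" for k
  proof -
    have "cmod (of_real s * x k 0 + of_real t * y k 0) \<le> s * R + t * R"
      using x(2)[OF that] y(2)[OF that] assms
      by (intro norm_triangle_le add_mono) (auto simp: norm_mult intro!: mult_left_mono)
    also have "\<dots> = R" using assms(5) by (simp flip: distrib_right)
    finally show ?thesis .
  qed
  then show ?thesis
    unfolding cauchy_class_def using x(1,3) y(1,3) assms(3,4)
    by (intro CollectI exI[of _ "\<lambda>k z. of_real s * x k z + of_real t * y k z"])
      (auto intro!: pos_re_add pos_re_scale simp: sum_distrib_left sum.distrib algebra_simps)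
qed

lemma cauchy_class_scale:
  assumes "e \<in> cauchy_class R" "0 \<le> c"
  shows "(\<lambda>z. of_real c * e z) \<in> cauchy_class (c * R)"
proof -
  obtain x where x: "\<And>k. k < 4 \<Longrightarrow> pos_re (x k)" "\<And>k. k < 4 \<Longrightarrow> cmod (x k 0) \<le> R"
    "\<And>z. cmod z < 1 \<Longrightarrow> e z = (\<Sum>k<4. \<i> ^ k * x k z)" using cauchy_class_E[OF assms(1)] by blast
  then show ?thesis
    unfolding cauchy_class_def using assms(2)
    by (intro CollectI exI[of _ "\<lambda>k z. of_real c * x k z"])
      (auto intro!: pos_re_scale mult_left_mono simp: norm_mult sum_distrib_left mult.left_commute)
qed

lemma cauchy_class_szego:
  assumes "cmod w \<le> 1" "0 \<le> R" "j < 4"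
  shows "(\<lambda>z. \<i> ^ j * (of_real R * (1 / (1 - cnj w * z)))) \<in> cauchy_class R"
  unfolding cauchy_class_def
proof (intro CollectI exI conjI allI impI)
  let ?y = "\<lambda>k z. if k = j then of_real R * (1 / (1 - cnj w * z)) else 0"
  show "pos_re (?y k)" for k
    using pos_re_scale[OF pos_re_szego[OF assms(1)] assms(2)] pos_re_const[of 0] by (cases "k = j") auto
  show "cmod (?y k 0) \<le> R" for k using assms(2) by auto
  show "\<i> ^ j * (of_real R * (1 / (1 - cnj w * z))) = (\<Sum>k<4. \<i> ^ k * ?y k z)" for z
    using assms(3) by (simp add: if_distrib[of "\<lambda>x. _ * x"] sum.delta cong: if_cong)
qed

text \<open>The Hardy space consists of such functions: split the boundary values into the positive and negative
  parts of their real and imaginary parts.\<close>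

lemma cauchy_integral_pos_re:
  fixes u :: "complex \<Rightarrow> real"
  assumes u: "(\<lambda>\<omega>. of_real (u \<omega>)) \<in> L2_space circle_lebesgue" and nn: "\<And>\<omega>. 0 \<le> u \<omega>"
  shows "pos_re (\<lambda>z. \<integral>\<omega>. of_real (u \<omega>) * (1 / (1 - cnj \<omega> * z)) \<partial>circle_lebesgue)" (is "pos_re ?y")
    and "cmod (\<integral>\<omega>. of_real (u \<omega>) * (1 / (1 - cnj \<omega> * 0)) \<partial>circle_lebesgue) \<le> L2_norm circle_lebesgue (\<lambda>\<omega>. of_real (u \<omega>))"
proof -
  define U where "U \<omega> = complex_of_real (u \<omega>)" for \<omega>
  have U: "U \<in> L2_space circle_lebesgue" using u by (simp add: U_def[abs_def])
  have intU: "integrable circle_lebesgue U" by (rule L2_integrable(1)[OF finite_measure_circle U])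
  have s: "(\<lambda>\<omega>. 1 / (1 - cnj z * \<omega>)) \<in> L2_space circle_lebesgue" if "cmod z < 1" for z
    by (intro L2_space_continuous continuous_intros) (use one_minus_cnj_mult_nonzero[OF that] in auto)
  have q: "(\<lambda>\<omega>. \<Sum>n<N. cnj z ^ n * \<omega> ^ n) \<in> L2_space circle_lebesgue" for N z
    by (intro L2_space_continuous continuous_intros) auto
  have y_eq: "?y z = L2_inner circle_lebesgue U (\<lambda>\<omega>. 1 / (1 - cnj z * \<omega>))" for z
    by (simp add: L2_inner_def U_def mult.commute)
  have sums: "(\<lambda>n. L2_inner circle_lebesgue U (\<lambda>\<omega>. \<omega> ^ n) * z ^ n) sums ?y z" if z: "cmod z < 1" for z
  proof -
    have mono: "(\<lambda>\<omega>. \<omega> ^ n) \<in> L2_space circle_lebesgue" for n by (intro L2_space_continuous continuous_intros) auto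
    have part: "(\<Sum>n<N. L2_inner circle_lebesgue U (\<lambda>\<omega>. \<omega> ^ n) * z ^ n)
        = L2_inner circle_lebesgue U (\<lambda>\<omega>. \<Sum>n<N. cnj z ^ n * \<omega> ^ n)" for N
    proof (induction N)
      case (Suc N)
      then show ?case
        using L2_inner_add_right[OF q[of z N] L2_space_scale[OF mono[of N], of "cnj z ^ N"] U]
        by (simp add: L2_inner_scale_right mult.commute[of _ "z ^ N"])
    qed (simp add: L2_inner_def)
    have bd: "L2_norm circle_lebesgue (\<lambda>\<omega>. (\<Sum>n<N. cnj z ^ n * \<omega> ^ n) - 1 / (1 - cnj z * \<omega>))
        \<le> cmod z ^ N / (1 - cmod z)" for N
    proof -
      have "cmod ((\<Sum>n<N. cnj z ^ n * \<omega> ^ n) - 1 / (1 - cnj z * \<omega>)) \<le> cmod z ^ N / (1 - cmod z)"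
        if "\<omega> \<in> space circle_lebesgue" for \<omega>
      proof -
        have w: "cmod \<omega> = 1" using that by simp
        have ne: "cnj z * \<omega> \<noteq> 1" using one_minus_cnj_mult_nonzero[OF z, of \<omega>] w by auto
        have "(\<Sum>n<N. cnj z ^ n * \<omega> ^ n) = (1 - (cnj z * \<omega>) ^ N) / (1 - cnj z * \<omega>)"
          using sum_gp_strict[of "cnj z * \<omega>" N] ne by (simp add: power_mult_distrib)
        then have "(\<Sum>n<N. cnj z ^ n * \<omega> ^ n) - 1 / (1 - cnj z * \<omega>) = - ((cnj z * \<omega>) ^ N) / (1 - cnj z * \<omega>)"
          by (simp add: diff_divide_distrib)
        also have "cmod \<dots> = cmod z ^ N / cmod (1 - cnj z * \<omega>)"
          using w by (simp add: norm_divide norm_power norm_mult)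
        also have "\<dots> \<le> cmod z ^ N / (1 - cmod z)"
        proof (rule divide_left_mono)
          show le: "1 - cmod z \<le> cmod (1 - cnj z * \<omega>)"
            using norm_triangle_ineq2[of 1 "cnj z * \<omega>"] w by (simp add: norm_mult)
          show "0 < cmod (1 - cnj z * \<omega>) * (1 - cmod z)"
            using le z by (intro mult_pos_pos) linarith+
        qed simp
        finally show ?thesis .
      qed
      then have "L2_norm circle_lebesgue (\<lambda>\<omega>. (\<Sum>n<N. cnj z ^ n * \<omega> ^ n) - 1 / (1 - cnj z * \<omega>))
          \<le> cmod z ^ N / (1 - cmod z) * sqrt (measure circle_lebesgue (space circle_lebesgue))"
        using z by (intro L2_norm_bounded L2_space_diff q s) auto
      then show ?thesis by simp
    qed
    have "(\<lambda>N. L2_inner circle_lebesgue U (\<lambda>\<omega>. \<Sum>n<N. cnj z ^ n * \<omega> ^ n) - ?y z) \<longlonglongrightarrow> 0"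
    proof (rule Lim_null_comparison[OF always_eventually])
      show "(\<lambda>N. L2_norm circle_lebesgue U * (cmod z ^ N / (1 - cmod z))) \<longlonglongrightarrow> 0"
        using z by (intro tendsto_mult_right_zero tendsto_divide_zero LIMSEQ_power_zero) simp
      show "\<forall>N. norm (L2_inner circle_lebesgue U (\<lambda>\<omega>. \<Sum>n<N. cnj z ^ n * \<omega> ^ n) - ?y z)
          \<le> L2_norm circle_lebesgue U * (cmod z ^ N / (1 - cmod z))"
      proof
        fix N
        have "L2_inner circle_lebesgue U (\<lambda>\<omega>. \<Sum>n<N. cnj z ^ n * \<omega> ^ n) - ?y z =
            L2_inner circle_lebesgue U (\<lambda>\<omega>. (\<Sum>n<N. cnj z ^ n * \<omega> ^ n) - 1 / (1 - cnj z * \<omega>))"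
          unfolding y_eq by (rule L2_inner_diff_right[OF q s[OF z] U, symmetric])
        then show "norm (L2_inner circle_lebesgue U (\<lambda>\<omega>. \<Sum>n<N. cnj z ^ n * \<omega> ^ n) - ?y z)
            \<le> L2_norm circle_lebesgue U * (cmod z ^ N / (1 - cmod z))"
          using L2_cauchy_schwarz[OF U L2_space_diff[OF q[of z N] s[OF z]]] mult_left_mono[OF bd L2_norm_nonneg]
          by (metis (no_types, lifting) order_trans)
      qed
    qed
    from LIM_zero_cancel[OF this] show ?thesis unfolding sums_def part .
  qed
  have hol: "?y holomorphic_on ball 0 1"
    by (rule power_series_holomorphic[where a = "\<lambda>n. L2_inner circle_lebesgue U (\<lambda>\<omega>. \<omega> ^ n)"]) (use sums in simp)
  show "pos_re ?y"
    unfolding pos_re_def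
  proof (intro conjI allI impI hol)
    fix z :: complex assume z: "cmod z < 1"
    have int: "integrable circle_lebesgue (\<lambda>\<omega>. of_real (u \<omega>) * (1 / (1 - cnj \<omega> * z)))"
      using L2_product_integrable[OF U s[OF z]] by (simp add: U_def mult.commute)
    have "Re (?y z) = (\<integral>\<omega>. Re (of_real (u \<omega>) * (1 / (1 - cnj \<omega> * z))) \<partial>circle_lebesgue)"
      using integral_Re[OF int] by simp
    also have "\<dots> \<ge> 0"
    proof (rule integral_nonneg_AE, rule AE_I2)
      fix \<omega> assume "\<omega> \<in> space circle_lebesgue"
      then have "0 \<le> Re (1 / (1 - cnj \<omega> * z))" using pos_re_szego[of \<omega>] z by (auto simp: pos_re_def)
      moreover have "Re (of_real r * x) = r * Re x" for r x by simp
      ultimately show "0 \<le> Re (of_real (u \<omega>) * (1 / (1 - cnj \<omega> * z)))"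
        using nn[of \<omega>] by (simp only: mult_nonneg_nonneg)
    qed
    finally show "0 \<le> Re (?y z)" .
  qed
  have "cmod (\<integral>\<omega>. U \<omega> \<partial>circle_lebesgue) \<le> L2_norm circle_lebesgue U"
    using order_trans[OF integral_norm_bound L2_integrable(2)[OF finite_measure_circle U]] by simp
  then show "cmod (\<integral>\<omega>. of_real (u \<omega>) * (1 / (1 - cnj \<omega> * 0)) \<partial>circle_lebesgue) \<le> L2_norm circle_lebesgue (\<lambda>\<omega>. of_real (u \<omega>))"
    by (simp add: U_def[abs_def])
qed

lemma bv_szego:
  assumes "cmod w < 1"
  shows "AE \<omega> in circle_lebesgue. bv (szego w) \<omega> = 1 / (1 - cnj w * \<omega>)"
proof (rule bv_eqI, use AE_circle_unit in eventually_elim)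
  fix \<omega> assume \<omega>: "cmod \<omega> = 1"
  have "((\<lambda>z. 1 / (1 - cnj w * z)) \<longlongrightarrow> 1 / (1 - cnj w * \<omega>)) (nontangential \<omega>)"
    unfolding tendsto_nontangential_iff
    using one_minus_cnj_mult_nonzero[OF assms, of \<omega>] \<omega> by (intro allI impI tendsto_intros) auto
  then show "(fn (szego w) \<longlongrightarrow> 1 / (1 - cnj w * \<omega>)) (nontangential \<omega>)"
    using tendsto_nontangential_cong[of "\<lambda>z. 1 / (1 - cnj w * z)" "fn (szego w)"] assms by (simp add: fn_szego)
qed

lemma hardy_in_cauchy_class: "fn a \<in> cauchy_class (norm a)"
proof -
  \<comment> \<open>the four functions \<open>u k\<close> are the positive and negative parts of the real and imaginary parts\<close>
  define u where "u k \<omega> = max 0 (Re (bv a \<omega> * (- \<i>) ^ k))" for k :: nat and \<omega>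
  have [measurable]: "bv a \<in> borel_measurable circle_lebesgue" using bv_L2[of a] by (simp add: L2_space_def)
  have dom: "u k \<omega> \<le> cmod (bv a \<omega>)" for k \<omega>
    using complex_Re_le_cmod[of "bv a \<omega> * (- \<i>) ^ k"] by (simp add: u_def norm_mult norm_power)
  have nn: "0 \<le> u k \<omega>" for k \<omega> by (simp add: u_def)
  have meas: "u k \<in> borel_measurable circle_lebesgue" for k unfolding u_def by measurable
  have sq: "(u k \<omega>)\<^sup>2 \<le> (cmod (bv a \<omega>))\<^sup>2" for k \<omega> using dom nn by (intro power_mono) auto
  have intb: "integrable circle_lebesgue (\<lambda>\<omega>. (cmod (bv a \<omega>))\<^sup>2)" using bv_L2 by (simp add: L2_space_def)
  have intu: "integrable circle_lebesgue (\<lambda>\<omega>. (u k \<omega>)\<^sup>2)" for k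
    by (rule Bochner_Integration.integrable_bound[OF intb]) (use sq meas in \<open>auto intro!: AE_I2\<close>)
  have uL: "(\<lambda>\<omega>. complex_of_real (u k \<omega>)) \<in> L2_space circle_lebesgue" for k
    using intu meas by (auto simp: L2_space_def)
  have un: "L2_norm circle_lebesgue (\<lambda>\<omega>. complex_of_real (u k \<omega>)) \<le> norm a" for k
  proof -
    have "(\<integral>\<omega>. (u k \<omega>)\<^sup>2 \<partial>circle_lebesgue) \<le> (\<integral>\<omega>. (cmod (bv a \<omega>))\<^sup>2 \<partial>circle_lebesgue)"
      by (rule integral_mono[OF intu intb]) (rule sq)
    then have "L2_norm circle_lebesgue (\<lambda>\<omega>. complex_of_real (u k \<omega>)) \<le> L2_norm circle_lebesgue (bv a)"
      by (simp add: L2_norm_def)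
    then show ?thesis by (simp add: norm_bv)
  qed
  define y where "y k z = (\<integral>\<omega>. of_real (u k \<omega>) * (1 / (1 - cnj \<omega> * z)) \<partial>circle_lebesgue)" for k z
  have split: "(\<Sum>k<4. \<i> ^ k * of_real (u k \<omega>)) = bv a \<omega>" for \<omega>
    by (simp add: sum4 u_def i_power_simps complex_eq_iff max_def)
  have rep: "fn a z = (\<Sum>k<4. \<i> ^ k * y k z)" if z: "cmod z < 1" for z
  proof -
    have s: "(\<lambda>\<omega>. 1 / (1 - cnj z * \<omega>)) \<in> L2_space circle_lebesgue"
      by (intro L2_space_continuous continuous_intros) (use one_minus_cnj_mult_nonzero[OF z] in auto)
    have int: "integrable circle_lebesgue (\<lambda>\<omega>. of_real (u k \<omega>) * (1 / (1 - cnj \<omega> * z)))" for k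
      using L2_product_integrable[OF uL s] by (simp add: mult.commute)
    have [measurable]: "bv (szego z) \<in> borel_measurable circle_lebesgue" "(\<lambda>\<omega>. 1 / (1 - cnj z * \<omega>)) \<in> borel_measurable circle_lebesgue"
      using bv_L2[of "szego z"] s by (simp_all add: L2_space_def)
    have "fn a z = L2_inner circle_lebesgue (bv a) (bv (szego z))" by (simp add: L2_inner_bv cinner_szego z)
    also have "\<dots> = (\<integral>\<omega>. bv a \<omega> * cnj (1 / (1 - cnj z * \<omega>)) \<partial>circle_lebesgue)"
      unfolding L2_inner_def
    proof (rule integral_cong_AE)
      show "AE \<omega> in circle_lebesgue. bv a \<omega> * cnj (bv (szego z) \<omega>) = bv a \<omega> * cnj (1 / (1 - cnj z * \<omega>))"
        using bv_szego[OF z] by eventually_elim simp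
    qed measurable
    also have "\<dots> = (\<integral>\<omega>. (\<Sum>k<4. \<i> ^ k * (of_real (u k \<omega>) * (1 / (1 - cnj \<omega> * z)))) \<partial>circle_lebesgue)"
      by (rule Bochner_Integration.integral_cong)
        (simp_all flip: split add: sum_distrib_right mult.assoc sum_divide_distrib mult.commute[of z])
    also have "\<dots> = (\<Sum>k<4. \<i> ^ k * y k z)"
      unfolding y_def
      by (subst Bochner_Integration.integral_sum[OF integrable_mult_right[OF int]]) (simp only: integral_mult_right_zero)
    finally show ?thesis .
  qed
  have "cmod (y k 0) \<le> norm a" for k
    unfolding y_def by (rule order_trans[OF cauchy_integral_pos_re(2)[OF uL nn] un])
  moreover have "pos_re (y k)" for k
    unfolding y_def[abs_def] by (rule cauchy_integral_pos_re(1)[OF uL nn])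
  ultimately show ?thesis
    unfolding cauchy_class_def using rep by blast
qed

section \<open>Quotients by an inner function\<close>

text \<open>The class plays the role of the Smirnov class: its functions are bounded functions divided by
  products of the outer functions \<open>1 / (1 + y k)\<close>.\<close>

definition smirnov :: "(complex \<Rightarrow> complex) \<Rightarrow> bool" where
  "smirnov v \<longleftrightarrow> v holomorphic_on ball 0 1 \<and>
    (\<exists>(y :: nat \<Rightarrow> complex \<Rightarrow> complex) C. (\<forall>k<4. pos_re (y k)) \<and> (\<forall>z. cmod z < 1 \<longrightarrow> cmod (v z) \<le> C * (\<Prod>k<4. cmod (1 + y k z))))"

lemma sum_le_prod4:
  assumes y: "\<And>k. k < 4 \<Longrightarrow> 0 \<le> Re (y k)"
  shows "cmod (\<Sum>k<4. \<i> ^ k * y k) \<le> 4 * (\<Prod>k<4. cmod (1 + y (k::nat)))"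
proof -
  have one: "1 \<le> cmod (1 + y k)" "cmod (y k) \<le> cmod (1 + y k)" if "k < 4" for k
    using one_plus_pos_re[OF y[OF that], of 1] by auto
  have "cmod (y k) \<le> (\<Prod>k<4. cmod (1 + y k))" if "k < 4" for k
  proof -
    have "cmod (y k) * 1 \<le> cmod (1 + y k) * (\<Prod>j\<in>{..<4} - {k}. cmod (1 + y j))"
      using one that by (intro mult_mono prod_ge_1) auto
    also have "\<dots> = (\<Prod>j<4. cmod (1 + y j))"
      using that by (subst prod.remove[of "{..<4}" k]) auto
    finally show ?thesis by simp
  qed
  then have "cmod (\<Sum>k<4. \<i> ^ k * y k) \<le> (\<Sum>k<(4::nat). (\<Prod>k<4. cmod (1 + y k)))"
    by (intro sum_norm_le) (auto simp: norm_mult norm_power)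
  then show ?thesis by simp
qed

lemma smirnov_hardy: "smirnov (fn a)"
proof -
  obtain y where y: "\<And>k. k < 4 \<Longrightarrow> pos_re (y k)" "\<And>k. k < 4 \<Longrightarrow> cmod (y k 0) \<le> norm a"
    "\<And>z. cmod z < 1 \<Longrightarrow> fn a z = (\<Sum>k<4. \<i> ^ k * y k z)"
    by (rule cauchy_class_E[OF hardy_in_cauchy_class[of a]], rule that)
  have "cmod (fn a z) \<le> 4 * (\<Prod>k<4. cmod (1 + y k z))" if "cmod z < 1" for z
    using sum_le_prod4[of "\<lambda>k. y k z"] y that by (auto simp: pos_re_def)
  then show ?thesis unfolding smirnov_def using y(1) by (intro conjI fn_holomorphic exI[of _ y] exI[of _ 4]) auto
qed

lemma bounded_imp_fn:
  assumes "h holomorphic_on ball 0 1" "\<And>z. cmod z < 1 \<Longrightarrow> cmod (h z) \<le> C"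
  shows "\<exists>b. (\<forall>z. cmod z < 1 \<longrightarrow> fn b z = h z) \<and> norm b \<le> C"
proof -
  have "(norm (szego 0))\<^sup>2 = 1\<^sup>2"
    using norm_szego_power2[of 0] by (simp add: fn_szego flip: of_real_power)
  then have "norm (szego 0) = 1" by (rule power2_eq_imp_eq) auto
  then show ?thesis using bounded_multiplier[OF assms, of "szego 0"] by (auto simp: fn_szego)
qed

lemma divide_le_divide_cross: "0 < R \<Longrightarrow> 0 < E \<Longrightarrow> X * E \<le> C * R \<Longrightarrow> X / R \<le> C / E" for X :: real
  by (simp add: field_simps)

text \<open>Regularization: \<open>v / \<Prod>(1 + \<epsilon> (1 + y\<^sub>k))\<close> is bounded, is dominated by \<open>v\<close> and
  converges to \<open>v\<close> as \<open>\<epsilon>\<close> tends to 0.\<close>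

definition reg :: "(nat \<Rightarrow> complex \<Rightarrow> complex) \<Rightarrow> real \<Rightarrow> complex \<Rightarrow> complex" where
  "reg y \<epsilon> z = (\<Prod>k<4. 1 + of_real \<epsilon> * (1 + y k z))"

lemma reg_facts:
  assumes y: "\<And>k. k < 4 \<Longrightarrow> pos_re (y k)" and \<epsilon>: "0 < \<epsilon>"
  shows "cmod z < 1 \<Longrightarrow> 1 \<le> cmod (reg y \<epsilon> z)"
    "cmod z < 1 \<Longrightarrow> \<epsilon> ^ 4 * (\<Prod>k<4. cmod (1 + y k z)) \<le> cmod (reg y \<epsilon> z)"
    "(\<lambda>z. 1 / reg y \<epsilon> z) holomorphic_on ball 0 1"
proof -
  have pos: "1 \<le> cmod (1 + of_real \<epsilon> * (1 + y k z))" "\<epsilon> * cmod (1 + y k z) \<le> cmod (1 + of_real \<epsilon> * (1 + y k z))"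
    if "k < 4" "cmod z < 1" for k z
    using one_plus_pos_re[of "1 + y k z" \<epsilon>] y[OF that(1)] that(2) \<epsilon> by (auto simp: pos_re_def)
  have ge1: "1 \<le> cmod (reg y \<epsilon> z)" if "cmod z < 1" for z
    unfolding reg_def prod_norm[symmetric] using pos that by (intro prod_ge_1) auto
  show "cmod z < 1 \<Longrightarrow> 1 \<le> cmod (reg y \<epsilon> z)" by (rule ge1)
  have "\<epsilon> ^ 4 * (\<Prod>k<4. cmod (1 + y k z)) = (\<Prod>k<4. \<epsilon> * cmod (1 + y k z))"
    by (simp add: prod.distrib)
  also have "cmod z < 1 \<Longrightarrow> \<dots> \<le> cmod (reg y \<epsilon> z)"
    unfolding reg_def prod_norm[symmetric] using pos \<epsilon> by (intro prod_mono) auto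
  finally show "cmod z < 1 \<Longrightarrow> \<epsilon> ^ 4 * (\<Prod>k<4. cmod (1 + y k z)) \<le> cmod (reg y \<epsilon> z)" .
  have "reg y \<epsilon> holomorphic_on ball 0 1"
    unfolding reg_def using y by (intro holomorphic_intros) (auto simp: pos_re_def)
  moreover have "reg y \<epsilon> z \<noteq> 0" if "z \<in> ball 0 1" for z using ge1[of z] that by auto
  ultimately show "(\<lambda>z. 1 / reg y \<epsilon> z) holomorphic_on ball 0 1" by (intro holomorphic_intros)
qed

lemma reg_tendsto: "(\<lambda>n. v / reg y (1 / Suc n) z) \<longlonglongrightarrow> v"
proof -
  have "(\<lambda>n. v / (\<Prod>k<4. 1 + of_real (1 / Suc n) * (1 + y k z))) \<longlonglongrightarrow> v / (\<Prod>k<(4::nat). 1 + of_real 0 * (1 + y k z))"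
    by (intro tendsto_divide tendsto_const tendsto_prod tendsto_add tendsto_mult tendsto_of_real LIMSEQ_Suc[OF lim_1_over_n]) auto
  then show ?thesis by (simp add: reg_def)
qed

context inner_fn
begin

text \<open>Division by \<open>p\<close> does not change the modulus of the boundary values.\<close>

lemma bounded_quotient:
  assumes "\<And>z. cmod z < 1 \<Longrightarrow> cmod (fn p z * fn c z) \<le> C" "cmod w < 1"
  shows "cmod (fn c w) \<le> C"
proof (rule bounded_by_boundary_values)
  show C: "0 \<le> C" using order_trans[OF norm_ge_zero assms(1)[of 0]] by simp
  show "AE \<omega> in circle_lebesgue. cmod (bv c \<omega>) \<le> C"
    using bv_nontangential[of "mul p c"] bv_mul[of c] inner[unfolded inner_seq_def] AE_circle_unit
  proof eventually_elim
    case (elim \<omega>)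
    have "cmod (bv (mul p c) \<omega>) \<le> C"
    proof (rule tendsto_upperbound[OF tendsto_norm[OF elim(1)]])
      show "\<forall>\<^sub>F z in nontangential \<omega>. cmod (fn (mul p c) z) \<le> C"
        unfolding nontangential_def eventually_Sup
        by (auto simp: eventually_at_filter fn_mul intro!: always_eventually assms(1))
    qed (use nontangential_nontrivial elim in auto)
    then show ?case using elim by (simp add: norm_mult)
  qed
qed (rule assms(2))

text \<open>The regularizations of \<open>v\<close> are bounded, hence in the Hardy space.  Multiplied by \<open>p\<close> they are dominated by \<open>f\<close>,
  and multiplication by \<open>p\<close> preserves the norm; thus their norms are bounded by that of \<open>f\<close>, uniformly in the
  regularization.\<close>

lemma smirnov_quotient_hardy:
  assumes v: "smirnov v" and f: "\<And>z. cmod z < 1 \<Longrightarrow> fn p z * v z = fn f z"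
  shows "\<exists>b. (\<forall>z. cmod z < 1 \<longrightarrow> v z = fn b z) \<and> f = mul p b"
proof -
  obtain y :: "nat \<Rightarrow> complex \<Rightarrow> complex" and C where y: "\<And>k. k < 4 \<Longrightarrow> pos_re (y k)" "\<And>z. cmod z < 1 \<Longrightarrow> cmod (v z) \<le> C * (\<Prod>k<4. cmod (1 + y k z))"
    and hv: "v holomorphic_on ball 0 1"
    using v unfolding smirnov_def by blast
  have C: "0 \<le> C"
  proof (rule ccontr)
    assume "\<not> 0 \<le> C"
    moreover have "0 < (\<Prod>k<4. cmod (1 + y k 0))"
    proof (rule prod_pos)
      fix k :: nat assume "k \<in> {..<4}"
      then have "1 \<le> cmod (1 + y k 0)"
        using one_plus_pos_re(1)[of "y k 0" 1] y(1)[of k] by (auto simp: pos_re_def)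
      then show "0 < cmod (1 + y k 0)" by linarith
    qed
    ultimately have "C * (\<Prod>k<4. cmod (1 + y k 0)) < 0" by (simp add: mult_neg_pos)
    then show False using order_trans[OF norm_ge_zero y(2)[of 0]] by simp
  qed
  define w where "w n z = v z / reg y (1 / Suc n) z" for n :: nat and z
  have holw: "w n holomorphic_on ball 0 1" for n
    using holomorphic_on_mult[OF hv reg_facts(3)[where y = y, OF y(1), of "1 / real (Suc n)"]] by (simp add: w_def[abs_def])
  have "\<exists>b. (\<forall>z. cmod z < 1 \<longrightarrow> fn b z = w n z) \<and> norm b \<le> norm f" for n
  proof -
    define \<epsilon> where "\<epsilon> = 1 / real (Suc n)"
    have \<epsilon>: "0 < \<epsilon>" by (simp add: \<epsilon>_def)
    have "cmod (w n z) \<le> C / \<epsilon> ^ 4" if z: "cmod z < 1" for z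
    proof -
      have "cmod (v z) * \<epsilon> ^ 4 \<le> C * (\<epsilon> ^ 4 * (\<Prod>k<4. cmod (1 + y k z)))"
        using mult_right_mono[OF y(2)[OF z], of "\<epsilon> ^ 4"] \<epsilon> by (simp add: mult.assoc mult.commute mult.left_commute)
      also have "\<dots> \<le> C * cmod (reg y \<epsilon> z)" by (rule mult_left_mono[OF reg_facts(2)[where y = y, OF y(1) \<epsilon> z] C]) simp_all
      finally have "cmod (v z) * \<epsilon> ^ 4 \<le> C * cmod (reg y \<epsilon> z)" .
      moreover have "0 < cmod (reg y \<epsilon> z)" using reg_facts(1)[where y = y, OF y(1) \<epsilon> z] by linarith
      moreover have "w n z = v z / reg y \<epsilon> z" by (simp add: w_def \<epsilon>_def)
      ultimately show ?thesis using \<epsilon> by (simp only: norm_divide) (rule divide_le_divide_cross; simp)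
    qed
    then obtain b where b: "\<And>z. cmod z < 1 \<Longrightarrow> fn b z = w n z" using bounded_imp_fn[OF holw] by blast
    have le1: "cmod (1 / reg y \<epsilon> z) \<le> 1" if "cmod z < 1" for z
      using reg_facts(1)[where y = y, OF y(1) \<epsilon> that] by (simp add: norm_divide divide_le_eq)
    obtain c where c: "\<And>z. cmod z < 1 \<Longrightarrow> fn c z = 1 / reg y \<epsilon> z * fn f z" "norm c \<le> 1 * norm f"
      using bounded_multiplier[OF reg_facts(3)[where y = y, OF y(1) \<epsilon>] le1, of f] by blast
    have "mul p b = c"
      by (rule fn_eq_imp_eq) (simp add: fn_mul b c f[symmetric] w_def \<epsilon>_def)
    then have "norm b \<le> norm f" using c(2) norm_mul[of b] by simp
    then show ?thesis using b by blast
  qed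
  then obtain b where b: "\<And>n z. cmod z < 1 \<Longrightarrow> fn (b n) z = w n z" "\<And>n. norm (b n) \<le> norm f" by metis
  have "\<exists>a. (\<forall>z\<in>ball 0 1. v z = fn a z) \<and> norm a \<le> norm f"
  proof (rule hardy2_bounded_imp_fn[OF hv])
    fix r :: real assume r: "0 < r" "r < 1"
    show "L2_norm circle_lebesgue (dilate v r) \<le> norm f"
    proof (rule L2_norm_le_liminf(2))
      show "dilate (fn (b n)) r \<in> L2_space circle_lebesgue" for n
        by (intro L2_space_continuous continuous_on_dilate fn_continuous r) auto
      show "dilate v r \<in> borel_measurable circle_lebesgue"
        using L2_space_continuous[of circle_lebesgue, OF _ continuous_on_dilate[OF holomorphic_on_imp_continuous_on[OF hv] r]]
        by (simp add: L2_space_def)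
      show "AE \<omega> in circle_lebesgue. (\<lambda>n. dilate (fn (b n)) r \<omega>) \<longlonglongrightarrow> dilate v r \<omega>"
      proof (rule AE_I2)
        fix \<omega> assume "\<omega> \<in> space circle_lebesgue"
        then have "cmod (of_real r * \<omega>) < 1" using r by (simp add: norm_mult)
        then show "(\<lambda>n. dilate (fn (b n)) r \<omega>) \<longlonglongrightarrow> dilate v r \<omega>"
          unfolding dilate_def using reg_tendsto[of "v (of_real r * \<omega>)" y "of_real r * \<omega>"] by (simp add: b w_def)
      qed
      show "L2_norm circle_lebesgue (dilate (fn (b n)) r) \<le> norm f" for n
        using norm_dil_le[OF r, of "b n"] b(2)[of n] by (simp add: L2_norm_dilate[OF r])
    qed
  qed
  then obtain a where a: "\<And>z. cmod z < 1 \<Longrightarrow> v z = fn a z" by auto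
  have "f = mul p a" by (rule fn_eq_imp_eq) (simp add: fn_mul f[symmetric] a)
  then show ?thesis using a by blast
qed

text \<open>The quantitative form of membership in the class: the bound depends only on the functions
  \<open>Y\<^sub>k\<close> that represent the product, not on the witnesses for \<open>v\<close>.\<close>

lemma smirnov_quotient_bound:
  assumes v: "smirnov v" and Y: "\<And>k. k < 4 \<Longrightarrow> pos_re (Y k)"
    and eq: "\<And>z. cmod z < 1 \<Longrightarrow> fn p z * v z = (\<Sum>k<4. \<i> ^ k * Y k z)" and z: "cmod z < 1"
  shows "cmod (v z) \<le> 4 * (\<Prod>k<4. cmod (1 + Y k z))"
proof -
  obtain y :: "nat \<Rightarrow> complex \<Rightarrow> complex" and C where y: "\<And>k. k < 4 \<Longrightarrow> pos_re (y k)" "\<And>z. cmod z < 1 \<Longrightarrow> cmod (v z) \<le> C * (\<Prod>k<4. cmod (1 + y k z))"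
    and hv: "v holomorphic_on ball 0 1"
    using v unfolding smirnov_def by blast
  define Q where "Q z = (\<Prod>k<4. 1 + Y k z)" for z
  have Q1: "1 \<le> cmod (Q z)" if "cmod z < 1" for z
    unfolding Q_def prod_norm[symmetric]
    using one_plus_pos_re(1)[of "Y _ z" 1] Y that by (intro prod_ge_1) (auto simp: pos_re_def)
  have Q0: "Q z \<noteq> 0" if "cmod z < 1" for z using Q1[OF that] by auto
  have holQ: "Q holomorphic_on ball 0 1"
    unfolding Q_def using Y by (intro holomorphic_intros) (auto simp: pos_re_def)
  have bound: "cmod (v z / reg y (1 / Suc n) z) \<le> 4 * cmod (Q z)" for n
  proof -
    define \<epsilon> where "\<epsilon> = 1 / real (Suc n)"
    have \<epsilon>: "0 < \<epsilon>" by (simp add: \<epsilon>_def)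
    \<comment> \<open>\<open>h\<close> is bounded by a constant that depends on \<open>n\<close>; multiplied by \<open>p\<close> it is bounded by 4, and the
      factor \<open>p\<close> is removed by \<open>bounded_quotient\<close>\<close>
    define h where "h z = v z * (1 / reg y \<epsilon> z) / Q z" for z
    have holh: "h holomorphic_on ball 0 1"
      unfolding h_def using Q0 by (intro holomorphic_intros hv holQ reg_facts(3)[where y = y, OF y(1) \<epsilon>]) auto
    have hb: "cmod (h x) \<le> \<bar>C\<bar> / \<epsilon> ^ 4" if x: "cmod x < 1" for x
    proof -
      have "cmod (v x) * \<epsilon> ^ 4 \<le> \<bar>C\<bar> * (\<epsilon> ^ 4 * (\<Prod>k<4. cmod (1 + y k x)))"
      proof -
        have "cmod (v x) \<le> \<bar>C\<bar> * (\<Prod>k<4. cmod (1 + y k x))"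
          using y(2)[OF x] mult_right_mono[OF abs_ge_self[of C] prod_nonneg[of "{..<4}" "\<lambda>k. cmod (1 + y k x)"]]
          by (meson norm_ge_zero order_trans)
        from mult_right_mono[OF this, of "\<epsilon> ^ 4"] show ?thesis
          using \<epsilon> by (simp add: mult.assoc mult.commute mult.left_commute)
      qed
      also have "\<dots> \<le> \<bar>C\<bar> * cmod (reg y \<epsilon> x)" by (rule mult_left_mono[OF reg_facts(2)[where y = y, OF y(1) \<epsilon> x]]) simp_all
      finally have "cmod (v x) * \<epsilon> ^ 4 \<le> \<bar>C\<bar> * cmod (reg y \<epsilon> x)" .
      moreover have "0 < cmod (reg y \<epsilon> x)" using reg_facts(1)[where y = y, OF y(1) \<epsilon> x] by linarith
      moreover have "v x * (1 / reg y \<epsilon> x) = v x / reg y \<epsilon> x" by simp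
      ultimately have "cmod (v x * (1 / reg y \<epsilon> x)) \<le> \<bar>C\<bar> / \<epsilon> ^ 4"
        using \<epsilon> by (simp only: norm_divide) (rule divide_le_divide_cross; simp)
      moreover have "cmod (h x) \<le> cmod (v x * (1 / reg y \<epsilon> x))"
      proof -
        have "r / q \<le> r" if "0 \<le> r" "1 \<le> q" for r q :: real
          using that mult_left_mono[of 1 q r] by (simp add: divide_le_eq)
        then show ?thesis unfolding h_def norm_divide[of _ "Q x"] using Q1[OF x] by simp
      qed
      ultimately show ?thesis by linarith
    qed
    obtain c where c: "\<And>z. cmod z < 1 \<Longrightarrow> fn c z = h z" using bounded_imp_fn[OF holh hb] by blast
    have "cmod (fn p x * fn c x) \<le> 4" if x: "cmod x < 1" for x
    proof -
      have "fn p x * fn c x = (fn p x * v x) / (reg y \<epsilon> x * Q x)" using c[OF x] by (simp add: h_def)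
      also have "cmod \<dots> = cmod (\<Sum>k<4. \<i> ^ k * Y k x) / (cmod (reg y \<epsilon> x) * cmod (Q x))"
        by (simp add: eq[OF x] norm_divide norm_mult)
      also have "\<dots> \<le> 4"
      proof -
        have "cmod (\<Sum>k<4. \<i> ^ k * Y k x) \<le> 4 * cmod (Q x)"
          unfolding Q_def prod_norm[symmetric] using Y x by (intro sum_le_prod4) (auto simp: pos_re_def)
        also have "\<dots> \<le> 4 * (cmod (reg y \<epsilon> x) * cmod (Q x))"
          using mult_right_mono[OF reg_facts(1)[where y = y, OF y(1) \<epsilon> x], of "cmod (Q x)"] by simp
        moreover have "0 < cmod (reg y \<epsilon> x) * cmod (Q x)"
          using reg_facts(1)[where y = y, OF y(1) \<epsilon> x] Q1[OF x] by (intro mult_pos_pos) linarith+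
        ultimately show ?thesis by (simp add: pos_divide_le_eq)
      qed
      finally show ?thesis .
    qed
    from bounded_quotient[OF this z] have "cmod (h z) \<le> 4" using c[OF z] by simp
    moreover have "h z * Q z = v z / reg y (1 / Suc n) z" using Q0[OF z] by (simp add: h_def \<epsilon>_def)
    then have "cmod (v z / reg y (1 / Suc n) z) = cmod (h z) * cmod (Q z)" by (metis norm_mult)
    ultimately show ?thesis by (simp add: mult_right_mono)
  qed
  have "cmod (v z) \<le> 4 * cmod (Q z)"
    by (rule LIMSEQ_le_const2[OF tendsto_norm[OF reg_tendsto[of "v z" y z]]]) (use bound in auto)
  then show ?thesis by (simp add: Q_def prod_norm)
qed

end

section \<open>Compactness\<close>

lemma compact_subset_cball:
  fixes C :: "complex set"
  assumes "compact C" "C \<subseteq> ball 0 1"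
  shows "\<exists>r<1. C \<subseteq> cball 0 r"
proof (cases "C = {}")
  case True
  then show ?thesis by (intro exI[of _ 0]) auto
next
  case False
  then obtain x where x: "x \<in> C" "\<And>y. y \<in> C \<Longrightarrow> cmod y \<le> cmod x"
    using continuous_attains_sup[OF assms(1) False continuous_on_norm_id] by auto
  then show ?thesis using assms(2) by (intro exI[of _ "cmod x"]) auto
qed

text \<open>A common subsequence for finitely many normal families, by repeated application of Montel's theorem.\<close>

lemma montel_family:
  fixes Y :: "nat \<Rightarrow> nat \<Rightarrow> complex \<Rightarrow> complex"
  assumes hol: "\<And>k n. k < K \<Longrightarrow> Y k n holomorphic_on ball 0 1"
    and bd: "\<And>k r. k < K \<Longrightarrow> r < 1 \<Longrightarrow> \<exists>B. \<forall>n. \<forall>z\<in>cball 0 r. cmod (Y k n z) \<le> B"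
  shows "\<exists>(s :: nat \<Rightarrow> nat) g. strict_mono s \<and> (\<forall>k<K. g k holomorphic_on ball 0 1 \<and>
    (\<forall>z. cmod z < 1 \<longrightarrow> (\<lambda>n. Y k (s n) z) \<longlonglongrightarrow> g k z) \<and>
    uniform_limit (cball 0 (1/2)) (\<lambda>n. Y k (s n)) (g k) sequentially)"
  using assms
proof (induction K)
  case 0
  then show ?case by (intro exI[of _ id]) (auto simp: strict_mono_def)
next
  case (Suc K)
  from Suc.IH[OF Suc.prems(1)[OF less_SucI] Suc.prems(2)[OF less_SucI]]
  obtain s :: "nat \<Rightarrow> nat" and g where s: "strict_mono s"
    and g: "\<And>k. k < K \<Longrightarrow> g k holomorphic_on ball 0 1"
      "\<And>k z. k < K \<Longrightarrow> cmod z < 1 \<Longrightarrow> (\<lambda>n. Y k (s n) z) \<longlonglongrightarrow> g k z"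
      "\<And>k. k < K \<Longrightarrow> uniform_limit (cball 0 (1/2)) (\<lambda>n. Y k (s n)) (g k) sequentially"
    by blast
  obtain h r where h: "h holomorphic_on ball 0 1" and r: "strict_mono (r :: nat \<Rightarrow> nat)"
    and hp: "\<And>z. z \<in> ball 0 1 \<Longrightarrow> ((\<lambda>n. Y K (s (r n)) z) \<longlongrightarrow> h z) sequentially"
    and hu: "\<And>C. compact C \<Longrightarrow> C \<subseteq> ball 0 1 \<Longrightarrow> uniform_limit C ((\<lambda>n. Y K (s n)) \<circ> r) h sequentially"
  proof (rule Montel[of "ball 0 1" "range (\<lambda>n. Y K (s n))" "\<lambda>n. Y K (s n)"])
    show "h holomorphic_on ball 0 1" if "h \<in> range (\<lambda>n. Y K (s n))" for h
      using that Suc.prems(1)[of K] by auto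
    show "\<exists>B. \<forall>h\<in>range (\<lambda>n. Y K (s n)). \<forall>z\<in>C. cmod (h z) \<le> B"
      if "compact C" "C \<subseteq> ball 0 1" for C :: "complex set"
    proof -
      obtain q where q: "q < 1" "C \<subseteq> cball 0 q" using compact_subset_cball[OF \<open>compact C\<close> \<open>C \<subseteq> _\<close>] by blast
      obtain B where "\<forall>n. \<forall>z\<in>cball 0 q. cmod (Y K n z) \<le> B" using Suc.prems(2)[of K q] q by auto
      then show ?thesis using q(2) by (intro exI[of _ B]) blast
    qed
  qed auto
  have sub: "filterlim r sequentially sequentially" using r by (rule filterlim_subseq)
  show ?case
  proof (intro exI conjI allI impI)
    show "strict_mono (s \<circ> r)" using s r by (rule strict_mono_o)
    fix k assume "k < Suc K"
    then consider "k = K" | "k < K" by linarith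
    then have "(if k = K then h else g k) holomorphic_on ball 0 1 \<and>
      (\<forall>z. cmod z < 1 \<longrightarrow> (\<lambda>n. Y k ((s \<circ> r) n) z) \<longlonglongrightarrow> (if k = K then h else g k) z) \<and>
      uniform_limit (cball 0 (1/2)) (\<lambda>n. Y k ((s \<circ> r) n)) (if k = K then h else g k) sequentially"
    proof cases
      case 1
      moreover have "cball (0::complex) (1/2) \<subseteq> ball 0 1" by auto
      ultimately show ?thesis using h hp hu[of "cball 0 (1/2)"] by (simp add: o_def)
    next
      case 2
      then have "uniform_limit (cball 0 (1/2)) (\<lambda>n. Y k (s (r n))) (g k) sequentially"
        using filterlim_compose[OF g(3)[OF 2] sub] by simp
      then show ?thesis
        using 2 g(1) filterlim_compose[OF g(2)[OF 2] sub] by (simp add: o_def)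
    qed
    then show "(\<lambda>k. if k = K then h else g k) k holomorphic_on ball 0 1"
      "uniform_limit (cball 0 (1/2)) (\<lambda>n. Y k ((s \<circ> r) n)) ((\<lambda>k. if k = K then h else g k) k) sequentially"
      "\<And>z. cmod z < 1 \<Longrightarrow> (\<lambda>n. Y k ((s \<circ> r) n) z) \<longlonglongrightarrow> (\<lambda>k. if k = K then h else g k) k z"
      by auto
  qed
qed

text \<open>All functions holomorphic in the disc are embedded in the Hilbert space of sequences by shrinking the disc:
  \<open>tau e\<close> represents \<open>e (z / 2)\<close>, and locally uniform convergence becomes convergence in norm.\<close>

definition tau :: "(complex \<Rightarrow> complex) \<Rightarrow> ell2" where
  "tau e = (SOME b. \<forall>z. cmod z < 1 \<longrightarrow> fn b z = e (z / 2))"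

lemma tau_exists:
  assumes e: "e holomorphic_on ball 0 1" and C: "\<And>z. z \<in> cball 0 (1/2) \<Longrightarrow> cmod (e z) \<le> C"
  shows "\<exists>b. (\<forall>z. cmod z < 1 \<longrightarrow> fn b z = e (z / 2)) \<and> norm b \<le> C"
proof (rule bounded_imp_fn)
  show "(\<lambda>z. e (z / 2)) holomorphic_on ball 0 1"
  proof -
    have "(\<lambda>z::complex. z / 2) ` ball 0 1 \<subseteq> ball 0 1" by (auto simp: norm_divide)
    moreover have "(\<lambda>z::complex. z / 2) holomorphic_on ball 0 1" by (intro holomorphic_intros) auto
    ultimately show ?thesis
      using holomorphic_on_compose_gen[of "\<lambda>z. z / 2" "ball 0 1" e "ball 0 1"] e by (simp add: o_def)
  qed
  show "cmod (e (z / 2)) \<le> C" if "cmod z < 1" for z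
    using C[of "z / 2"] that by (auto simp: norm_divide)
qed

lemma holomorphic_bounded_half:
  assumes "e holomorphic_on ball 0 1"
  shows "\<exists>C. \<forall>z\<in>cball 0 (1/2). cmod (e z) \<le> (C :: real)"
proof -
  have "continuous_on (cball 0 (1/2)) e"
    using holomorphic_on_imp_continuous_on[OF assms] by (rule continuous_on_subset) auto
  from compact_imp_bounded[OF compact_continuous_image[OF this compact_cball]]
  show ?thesis unfolding bounded_iff by auto
qed

lemma tau_eqI: "(\<And>z. cmod z < 1 \<Longrightarrow> fn b z = e (z / 2)) \<Longrightarrow> tau e = b"
  unfolding tau_def by (rule some_equality) (auto intro: fn_eq_imp_eq)

lemma fn_tau:
  assumes "e holomorphic_on ball 0 1" "cmod z < 1"
  shows "fn (tau e) z = e (z / 2)"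
proof -
  obtain C :: real where "\<And>z. z \<in> cball 0 (1/2) \<Longrightarrow> cmod (e z) \<le> C"
    using holomorphic_bounded_half[OF assms(1)] by blast
  from tau_exists[OF assms(1) this] obtain b where "\<And>z. cmod z < 1 \<Longrightarrow> fn b z = e (z / 2)" by blast
  then show ?thesis using tau_eqI[of b e] assms(2) by simp
qed

lemma norm_tau_le:
  assumes "e holomorphic_on ball 0 1" "\<And>z. z \<in> cball 0 (1/2) \<Longrightarrow> cmod (e z) \<le> C"
  shows "norm (tau e) \<le> C"
  using tau_exists[OF assms] tau_eqI by metis

lemma tau_cong: "(\<And>z. cmod z < 1 \<Longrightarrow> e z = f z) \<Longrightarrow> tau e = tau f"
proof -
  assume *: "\<And>z. cmod z < 1 \<Longrightarrow> e z = f z"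
  have "e (z / 2) = f (z / 2)" if "cmod z < 1" for z using *[of "z / 2"] that by (simp add: norm_divide)
  then show ?thesis unfolding tau_def by (simp cong: conj_cong imp_cong)
qed

lemma tau_linear:
  assumes "e holomorphic_on ball 0 1" "f holomorphic_on ball 0 1"
  shows "tau (\<lambda>z. a * e z + b * f z) = cscale a (tau e) + cscale b (tau f)"
  by (rule tau_eqI) (simp add: fn_add fn_cscale fn_tau assms)

lemma tau_scale: "e holomorphic_on ball 0 1 \<Longrightarrow> tau (\<lambda>z. a * e z) = cscale a (tau e)"
  using tau_linear[of e e a 0] by (simp add: cscale_simps)

lemma tau_fn: "tau (fn a) = dil (1/2) a"
  by (rule tau_eqI) (simp add: fn_dil)

lemma tau_zero: "tau (\<lambda>_. 0) = 0"
  by (rule tau_eqI) simp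

lemma tau_inject:
  assumes "e holomorphic_on ball 0 1" "f holomorphic_on ball 0 1" "tau e = tau f" "cmod z < 1"
  shows "e z = f z"
proof -
  have half: "e w = f w" if "w \<in> ball 0 (1/2)" for w
    using fn_tau[OF assms(1), of "2 * w"] fn_tau[OF assms(2), of "2 * w"] assms(3) that by (simp add: norm_mult)
  show ?thesis
    by (rule analytic_continuation_open[of "ball 0 (1/2)" "ball 0 1" e f]) (use assms half in auto)
qed

lemma tau_tendsto:
  assumes "\<And>n. e n holomorphic_on ball 0 1" "f holomorphic_on ball 0 1"
    and ul: "uniform_limit (cball 0 (1/2)) e f sequentially"
  shows "(\<lambda>n. tau (e n)) \<longlonglongrightarrow> tau f"
proof (rule metric_LIMSEQ_I)
  fix \<epsilon> :: real assume \<epsilon>: "0 < \<epsilon>"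
  then have "0 < \<epsilon> / 2" by simp
  from uniform_limitD[OF ul this] obtain N where N: "\<And>n z. n \<ge> N \<Longrightarrow> z \<in> cball 0 (1/2) \<Longrightarrow> dist (e n z) (f z) < \<epsilon> / 2"
    unfolding eventually_sequentially by blast
  have "dist (tau (e n)) (tau f) < \<epsilon>" if n: "n \<ge> N" for n
  proof -
    have "tau (e n) - tau f = tau (\<lambda>z. 1 * e n z + (- 1) * f z)"
      unfolding tau_linear[OF assms(1,2)] by (intro ell2_eqI) simp
    also have "norm \<dots> \<le> \<epsilon> / 2"
      by (intro norm_tau_le holomorphic_intros assms) (use N[OF n] in \<open>auto simp: dist_norm intro: less_imp_le\<close>)
    finally show ?thesis using \<epsilon> by (simp add: dist_norm)
  qed
  then show "\<exists>no. \<forall>n\<ge>no. dist (tau (e n)) (tau f) < \<epsilon>" by blast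
qed

text \<open>The sequence \<open>v\<close> is carried along so that the quotients by \<open>p\<close> converge on the same subsequence.\<close>

lemma cauchy_class_subsequence:
  assumes y: "\<And>n k. k < 4 \<Longrightarrow> pos_re (y k n)" "\<And>n k. k < 4 \<Longrightarrow> cmod (y k n 0) \<le> R"
    and v: "\<And>n. v n holomorphic_on ball 0 1"
      "\<And>r. r < 1 \<Longrightarrow> \<exists>B. \<forall>n. \<forall>z\<in>cball 0 r. cmod (v n z) \<le> B"
  shows "\<exists>(s :: nat \<Rightarrow> nat) g w. strict_mono s \<and>
    (\<forall>k<4. pos_re (g k) \<and> cmod (g k 0) \<le> R \<and> (\<forall>z. cmod z < 1 \<longrightarrow> (\<lambda>n. y k (s n) z) \<longlonglongrightarrow> g k z)) \<and>
    w holomorphic_on ball 0 1 \<and> (\<forall>z. cmod z < 1 \<longrightarrow> (\<lambda>n. v (s n) z) \<longlonglongrightarrow> w z) \<and>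
    (\<lambda>n. tau (\<lambda>z. \<Sum>k<4. \<i> ^ k * y k (s n) z)) \<longlonglongrightarrow> tau (\<lambda>z. \<Sum>k<4. \<i> ^ k * g k z)"
proof -
  define Y where "Y k = (if k < 4 then y k else v)" for k :: nat
  have "Y k n holomorphic_on ball 0 1" for k n using y(1) v(1) by (simp add: Y_def pos_re_def)
  moreover have "\<exists>B. \<forall>n. \<forall>z\<in>cball 0 r. cmod (Y k n z) \<le> B" if "r < 1" for k r
  proof (cases "k < 4")
    case True
    then show ?thesis
      using pos_re_bound_cball[OF y(1)[OF True] y(2)[OF True] _ that]
      by (intro exI[of _ "R * (2 / (1 - r))"]) (auto simp: Y_def)
  next
    case False
    then show ?thesis using v(2)[OF that] by (simp add: Y_def)
  qed
  ultimately obtain s :: "nat \<Rightarrow> nat" and g where s: "strict_mono s"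
    and g: "\<And>k. k < 5 \<Longrightarrow> g k holomorphic_on ball 0 1"
      "\<And>k z. k < 5 \<Longrightarrow> cmod z < 1 \<Longrightarrow> (\<lambda>n. Y k (s n) z) \<longlonglongrightarrow> g k z"
      "\<And>k. k < 5 \<Longrightarrow> uniform_limit (cball 0 (1/2)) (\<lambda>n. Y k (s n)) (g k) sequentially"
    using montel_family[of 5 Y] by blast
  have g4: "pos_re (g k)" "cmod (g k 0) \<le> R" "\<And>z. cmod z < 1 \<Longrightarrow> (\<lambda>n. y k (s n) z) \<longlonglongrightarrow> g k z"
    "uniform_limit (cball 0 (1/2)) (\<lambda>n. y k (s n)) (g k) sequentially" "g k holomorphic_on ball 0 1" if "k < 4" for k
  proof -
    have k: "k < 5" "Y k = y k" using that by (auto simp: Y_def)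
    show lim: "\<And>z. cmod z < 1 \<Longrightarrow> (\<lambda>n. y k (s n) z) \<longlonglongrightarrow> g k z" using g(2)[OF k(1)] k(2) by simp
    show "pos_re (g k)" by (rule pos_re_limit[OF g(1)[OF k(1)] y(1)[OF that] lim])
    show "cmod (g k 0) \<le> R"
      by (rule LIMSEQ_le_const2[OF tendsto_norm[OF lim[of 0]]]) (use y(2)[OF that] in auto)
    show "uniform_limit (cball 0 (1/2)) (\<lambda>n. y k (s n)) (g k) sequentially" using g(3)[OF k(1)] k(2) by simp
    show "g k holomorphic_on ball 0 1" by (rule g(1)[OF k(1)])
  qed
  have "(\<lambda>n. tau (\<lambda>z. \<Sum>k<4. \<i> ^ k * y k (s n) z)) \<longlonglongrightarrow> tau (\<lambda>z. \<Sum>k<4. \<i> ^ k * g k z)"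
  proof (rule tau_tendsto)
    show "(\<lambda>z. \<Sum>k<4. \<i> ^ k * y k (s n) z) holomorphic_on ball 0 1" for n
      using y(1) by (intro holomorphic_intros) (auto simp: pos_re_def)
    show "(\<lambda>z. \<Sum>k<4. \<i> ^ k * g k z) holomorphic_on ball 0 1"
      using g4(5) by (intro holomorphic_intros) auto
    have bl: "bounded_linear (\<lambda>x. \<i> ^ k * x)" for k :: nat by (rule bounded_linear_mult_right)
    show "uniform_limit (cball 0 (1/2)) (\<lambda>n z. \<Sum>k<4. \<i> ^ k * y k (s n) z) (\<lambda>z. \<Sum>k<4. \<i> ^ k * g k z) sequentially"
      unfolding sum4 by (intro uniform_limit_add bounded_linear.uniform_limit[OF bl] g4(4)) auto
  qed
  moreover have "(\<lambda>n. v (s n) z) \<longlonglongrightarrow> g 4 z" if "cmod z < 1" for z using g(2)[of 4, OF _ that] by (simp add: Y_def)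
  ultimately show ?thesis
    using s g4 g(1)[of 4] by (intro exI[of _ s] exI[of _ g] exI[of _ "g 4"]) auto
qed

lemma compact_tau_cauchy_class: "compact (tau ` cauchy_class R)"
  unfolding compact_eq_seq_compact_metric seq_compact_def
proof (intro allI impI)
  fix f :: "nat \<Rightarrow> ell2" assume "\<forall>n. f n \<in> tau ` cauchy_class R"
  then have "\<forall>n. \<exists>e. e \<in> cauchy_class R \<and> f n = tau e" by blast
  from choice[OF this] obtain e where e: "\<And>n. e n \<in> cauchy_class R" "\<And>n. f n = tau (e n)" by blast
  have "\<forall>n. \<exists>y. (\<forall>k<4. pos_re (y k) \<and> cmod (y k 0) \<le> R) \<and> (\<forall>z. cmod z < 1 \<longrightarrow> e n z = (\<Sum>k<4. \<i> ^ k * y k z))"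
    using e(1) by (simp add: cauchy_class_def)
  from choice[OF this] obtain y where y: "\<And>n k. k < 4 \<Longrightarrow> pos_re (y n k)" "\<And>n k. k < 4 \<Longrightarrow> cmod (y n k 0) \<le> R"
    "\<And>n z. cmod z < 1 \<Longrightarrow> e n z = (\<Sum>k<4. \<i> ^ k * y n k z)" by blast
  have f: "f n = tau (\<lambda>z. \<Sum>k<4. \<i> ^ k * y n k z)" for n unfolding e(2) by (rule tau_cong) (rule y(3))
  have "\<exists>(s :: nat \<Rightarrow> nat) g w. strict_mono s \<and>
    (\<forall>k<4. pos_re (g k) \<and> cmod (g k 0) \<le> R \<and> (\<forall>z. cmod z < 1 \<longrightarrow> (\<lambda>n. y (s n) k z) \<longlonglongrightarrow> g k z)) \<and>
    w holomorphic_on ball 0 1 \<and> (\<forall>z. cmod z < 1 \<longrightarrow> (\<lambda>n. 0) \<longlonglongrightarrow> w z) \<and>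
    (\<lambda>n. tau (\<lambda>z. \<Sum>k<4. \<i> ^ k * y (s n) k z)) \<longlonglongrightarrow> tau (\<lambda>z. \<Sum>k<4. \<i> ^ k * g k z)"
    by (rule cauchy_class_subsequence[of "\<lambda>k n. y n k" R "\<lambda>_ _. 0"]) (use y(1,2) in \<open>auto intro: exI[of _ 0]\<close>)
  then obtain s :: "nat \<Rightarrow> nat" and g where sg: "strict_mono s" "\<And>k. k < 4 \<Longrightarrow> pos_re (g k) \<and> cmod (g k 0) \<le> R"
    "(\<lambda>n. tau (\<lambda>z. \<Sum>k<4. \<i> ^ k * y (s n) k z)) \<longlonglongrightarrow> tau (\<lambda>z. \<Sum>k<4. \<i> ^ k * g k z)"
    by blast
  have "(\<lambda>z. \<Sum>k<4. \<i> ^ k * g k z) \<in> cauchy_class R" using sg(2) unfolding cauchy_class_def by blast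
  then show "\<exists>l\<in>tau ` cauchy_class R. \<exists>r. strict_mono r \<and> (f \<circ> r) \<longlonglongrightarrow> l"
    using sg(1,3) by (intro bexI[of _ "tau (\<lambda>z. \<Sum>k<4. \<i> ^ k * g k z)"] exI[of _ s]) (auto simp: f o_def)
qed

text \<open>Elements of the polar set will be the building blocks of functions in the disc algebra: they are
  bounded functions when dilated, because the Cauchy class contains the Szego kernels up to the circle (\<open>polar_bound\<close>).\<close>

definition polar :: "real \<Rightarrow> ell2 set" where
  "polar R = {u. \<forall>e\<in>cauchy_class R. inner (tau e) u \<le> 1}"

text \<open>The image of the Cauchy class is compact and convex and contains 0; a separating functional is rescaled.\<close>

lemma polar_separation:
  assumes e: "e \<in> cauchy_class S" "e \<notin> cauchy_class R" and R: "0 \<le> R"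
  shows "\<exists>u\<in>polar R. 1 < inner (tau e) u"
proof -
  have "convex (tau ` cauchy_class R)"
  proof (rule convexI)
    fix x y :: ell2 and s t :: real
    assume xy: "x \<in> tau ` cauchy_class R" "y \<in> tau ` cauchy_class R" and st: "0 \<le> s" "0 \<le> t" "s + t = 1"
    then obtain f g where fg: "f \<in> cauchy_class R" "g \<in> cauchy_class R" "x = tau f" "y = tau g" by blast
    have "s *\<^sub>R x + t *\<^sub>R y = tau (\<lambda>z. of_real s * f z + of_real t * g z)"
      by (simp add: tau_linear[OF cauchy_class_holomorphic[OF fg(1)] cauchy_class_holomorphic[OF fg(2)]] fg scaleR_eq_cscale)
    then show "s *\<^sub>R x + t *\<^sub>R y \<in> tau ` cauchy_class R" using cauchy_class_convex[OF fg(1,2) st] by blast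
  qed
  moreover have "closed (tau ` cauchy_class R)" by (rule compact_imp_closed[OF compact_tau_cauchy_class])
  moreover have z: "0 \<in> tau ` cauchy_class R" using cauchy_class_0[OF R] tau_zero by (metis image_eqI)
  moreover have "tau e \<notin> tau ` cauchy_class R"
  proof
    assume "tau e \<in> tau ` cauchy_class R"
    then obtain f where f: "f \<in> cauchy_class R" "tau e = tau f" by blast
    have "e \<in> cauchy_class R"
      by (rule cauchy_class_cong[OF f(1)]) (rule tau_inject[OF cauchy_class_holomorphic[OF e(1)] cauchy_class_holomorphic[OF f(1)] f(2)])
    then show False using e(2) by simp
  qed
  ultimately obtain u s where us: "\<And>y. y \<in> tau ` cauchy_class R \<Longrightarrow> inner y u \<le> s" "s < inner (tau e) u"
    using hilbert_separation[of "tau ` cauchy_class R" "tau e"] by blast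
  have s: "0 \<le> s" using us(1)[OF z] by simp
  define c where "c = 2 / (s + inner (tau e) u)"
  have c: "0 < c" "c * s \<le> 1" "1 < c * inner (tau e) u" using s us(2) by (auto simp: c_def field_simps)
  have "c *\<^sub>R u \<in> polar R"
    unfolding polar_def
  proof (intro CollectI ballI)
    fix f assume "f \<in> cauchy_class R"
    then have "c * inner (tau f) u \<le> c * s" using us(1) c(1) by (intro mult_left_mono) auto
    then show "inner (tau f) (c *\<^sub>R u) \<le> 1" using c(2) by simp
  qed
  moreover have "1 < inner (tau e) (c *\<^sub>R u)" using c by simp
  ultimately show ?thesis by blast
qed

text \<open>Test with the kernels \<open>R / (1 - cnj w * z)\<close> times the powers of \<open>\<i>\<close>.\<close>

lemma polar_bound:
  assumes u: "u \<in> polar R" and R: "0 < R" and w: "cmod w \<le> 1"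
  shows "cmod (fn u (w / 2)) \<le> 2 / R"
proof -
  define q where "q = cnj (fn u (w / 2))"
  have w2: "cmod (w / 2) < 1" using w by (simp add: norm_divide)
  have key: "Re (\<i> ^ j * of_real R * q) \<le> 1" if j: "j < 4" for j
  proof -
    let ?e = "\<lambda>z. \<i> ^ j * (of_real R * (1 / (1 - cnj w * z)))"
    have "tau ?e = cscale (\<i> ^ j * of_real R) (szego (w / 2))"
      by (rule tau_eqI) (simp add: fn_cscale fn_szego[OF w2])
    moreover have "inner (tau ?e) u \<le> 1"
      using u cauchy_class_szego[OF w less_imp_le[OF R] j] unfolding polar_def by blast
    ultimately show ?thesis
      using cinner_szego[OF w2, of u] cinner_commute[of "szego (w / 2)" u]
      by (simp add: cinner_scale_left q_def flip: Re_cinner del: times_complex.sel)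
  qed
  have "R * Re q \<le> 1" "- (R * Im q) \<le> 1" "- (R * Re q) \<le> 1" "R * Im q \<le> 1"
    using key[of 0] key[of 1] key[of 2] key[of 3] by (simp_all add: i_power_simps)
  then have "\<bar>Re q\<bar> \<le> 1 / R" "\<bar>Im q\<bar> \<le> 1 / R" using R by (auto simp: abs_le_iff field_simps)
  then have "cmod q \<le> 2 / R" using cmod_le[of q] by simp
  then show ?thesis by (simp add: q_def)
qed

lemma polar_small:
  assumes u: "u \<in> polar R" and R: "0 < R"
  shows "\<bar>inner (dil (1/2) a) u\<bar> \<le> norm a / R"
proof -
  have up: "inner (dil (1/2) b) u \<le> norm b / R" for b
  proof (cases "b = 0")
    case True
    have "dil (1/2) 0 = 0" by (intro ell2_eqI) (simp add: coef_dil)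
    then show ?thesis using True by simp
  next
    case False
    then have nb: "0 < norm b" by simp
    have "(\<lambda>z. of_real (R / norm b) * fn b z) \<in> cauchy_class (R / norm b * norm b)"
      by (rule cauchy_class_scale[OF hardy_in_cauchy_class]) (use R nb in simp)
    then have "inner (tau (\<lambda>z. of_real (R / norm b) * fn b z)) u \<le> 1"
      using u nb unfolding polar_def by simp
    then have "R / norm b * inner (dil (1/2) b) u \<le> 1"
      unfolding tau_scale[OF fn_holomorphic] tau_fn scaleR_eq_cscale[symmetric] by simp
    then show ?thesis using R nb by (simp add: field_simps)
  qed
  have "dil (1/2) (- a) = - dil (1/2) a" by (intro ell2_eqI) (simp add: coef_dil)
  then show ?thesis using up[of a] up[of "- a"] by (simp add: abs_le_iff)
qed

section \<open>A Hahn--Banach theorem\<close>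

text \<open>If a linear functional is dominated by the supremum of countably many coordinates that form a null sequence at each
  point, then it is an absolutely convergent combination of the coordinates.  The coefficients
  are chosen one at a time; that each can be chosen is the one-dimensional step of the Hahn--Banach
  theorem.\<close>

lemma dominated_by_null_coordinates:
  fixes x :: "nat \<Rightarrow> 'a::real_vector \<Rightarrow> real" and l :: "'a \<Rightarrow> real"
  assumes x: "\<And>n. linear (x n)" and l: "linear l" and null: "\<And>a. (\<lambda>n. x n a) \<longlonglongrightarrow> 0"
    and dom: "\<And>a. \<exists>n. \<bar>l a\<bar> \<le> \<bar>x n a\<bar>"
  shows "\<exists>t. (\<forall>N. (\<Sum>n<N. \<bar>t n\<bar>) \<le> 1) \<and> (\<forall>a. (\<lambda>N. \<Sum>n<N. t n * x n a) \<longlonglongrightarrow> l a)"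
proof -
  \<comment> \<open>\<open>D n a s C\<close>: in the sequence space with the supremum norm, the element with coordinates \<open>x m a\<close> plus
    the combination \<open>s\<close> of the first \<open>n\<close> unit vectors has norm at most \<open>C\<close>; \<open>P n t\<close>: the functional \<open>l\<close>,
    extended by the values \<open>t i\<close> at these unit vectors, has norm at most 1\<close>
  define D where "D n a s C \<longleftrightarrow> (\<forall>m. \<bar>x m a + (if m < n then s m else 0)\<bar> \<le> C)" for n a s C
  define P where "P n t \<longleftrightarrow> (\<forall>a s C. D n a s C \<longrightarrow> l a + (\<Sum>i<n. t i * s i) \<le> C)" for n and t :: "nat \<Rightarrow> real"
  have P0: "P 0 t" for t
    unfolding P_def D_def using dom by (auto simp: abs_le_iff) (meson abs_ge_self abs_le_iff order_trans)
  have step: "\<exists>t'. P (Suc n) t' \<and> (\<forall>i<n. t' i = t i)" if P: "P n t" for n t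
  proof -
    \<comment> \<open>\<open>B\<close> is the set of lower bounds for the value at the next unit vector; by \<open>le\<close> they do not exceed
      the upper bounds\<close>
    define B where "B = {l a + (\<Sum>i<n. t i * s i) - C | a s C. D (Suc n) a s C \<and> s n = - 1}"
    have le: "b \<le> C - (l a + (\<Sum>i<n. t i * s i))" if "b \<in> B" "D (Suc n) a s C" "s n = 1" for a s C b
    proof -
      note bB = that(1)
      obtain a' s' C' where b: "b = l a' + (\<Sum>i<n. t i * s' i) - C'" "D (Suc n) a' s' C'" "s' n = - 1"
        using bB unfolding B_def by blast
      have "D n (a + a') (\<lambda>i. s i + s' i) (C + C')"
        unfolding D_def
      proof
        fix m
        have "\<bar>x m a + (if m < Suc n then s m else 0)\<bar> + \<bar>x m a' + (if m < Suc n then s' m else 0)\<bar> \<le> C + C'"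
          using that(2) b(2) unfolding D_def by (intro add_mono) auto
        then show "\<bar>x m (a + a') + (if m < n then s m + s' m else 0)\<bar> \<le> C + C'"
          using that(3) b(3) by (cases "m = n") (auto simp: linear_add[OF x] less_Suc_eq)
      qed
      then have "l (a + a') + (\<Sum>i<n. t i * (s i + s' i)) \<le> C + C'" using P unfolding P_def by blast
      then show ?thesis using b(1) by (simp add: linear_add[OF l] distrib_left sum.distrib)
    qed
    have D0: "D (Suc n) 0 (\<lambda>i. if i = n then c else 0) \<bar>c\<bar>" for c
      unfolding D_def by (auto simp: linear_0[OF x])
    have "l 0 + (\<Sum>i<n. t i * (if i = n then - 1 else 0)) - \<bar>- 1\<bar> \<in> B"
      unfolding B_def
      by (intro CollectI exI[of _ 0] exI[of _ "\<lambda>i. if i = n then - 1 else 0"] exI[of _ "\<bar>- 1\<bar>"] conjI refl D0) simp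
    then have Bne: "B \<noteq> {}" by blast
    have bdd: "bdd_above B"
      by (rule bdd_aboveI[of _ "1 - (l 0 + (\<Sum>i<n. t i * (if i = n then 1 else 0)))"])
        (use le[OF _ D0[of 1]] in auto)
    define \<theta> where "\<theta> = Sup B"
    have up: "l a + (\<Sum>i<n. t i * s i) + \<theta> \<le> C" if "D (Suc n) a s C" "s n = 1" for a s C
    proof -
      have "\<theta> \<le> C - (l a + (\<Sum>i<n. t i * s i))"
        unfolding \<theta>_def by (rule cSup_least[OF Bne]) (rule le[OF _ that])
      then show ?thesis by simp
    qed
    have lo: "l a + (\<Sum>i<n. t i * s i) - \<theta> \<le> C" if "D (Suc n) a s C" "s n = - 1" for a s C
    proof -
      have "l a + (\<Sum>i<n. t i * s i) - C \<le> \<theta>"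
        unfolding \<theta>_def by (rule cSup_upper[OF _ bdd]) (use that in \<open>auto simp: B_def\<close>)
      then show ?thesis by simp
    qed
    have "P (Suc n) (t(n := \<theta>))"
      unfolding P_def
    proof (intro allI impI)
      fix a s C assume D: "D (Suc n) a s C"
      have eq: "(\<Sum>i<Suc n. (t(n := \<theta>)) i * s i) = (\<Sum>i<n. t i * s i) + \<theta> * s n" by simp
      show "l a + (\<Sum>i<Suc n. (t(n := \<theta>)) i * s i) \<le> C"
      proof (cases "s n = 0")
        case True
        then have "D n a s C" using D unfolding D_def by (metis less_Suc_eq)
        then show ?thesis using P True unfolding P_def eq by simp
      next
        case False
        define c where "c = 1 / \<bar>s n\<bar>"
        have c: "0 < c" "c * \<bar>s n\<bar> = 1" using False by (auto simp: c_def)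
        have scaled: "D (Suc n) (c *\<^sub>R a) (\<lambda>i. c * s i) (c * C)"
          unfolding D_def
        proof
          fix m
          have "\<bar>x m (c *\<^sub>R a) + (if m < Suc n then c * s m else 0)\<bar> = c * \<bar>x m a + (if m < Suc n then s m else 0)\<bar>"
            using c(1) abs_mult[of c "x m a + (if m < Suc n then s m else 0)"]
            by (simp add: linear_scale[OF x] distrib_left split: if_splits)
          also have "\<dots> \<le> c * C" using D c(1) unfolding D_def by (intro mult_left_mono) auto
          finally show "\<bar>x m (c *\<^sub>R a) + (if m < Suc n then c * s m else 0)\<bar> \<le> c * C" .
        qed
        have "l (c *\<^sub>R a) + (\<Sum>i<n. t i * (c * s i)) + \<theta> * (c * s n) \<le> c * C"
        proof (cases "0 < s n")
          case True
          then have cs: "c * s n = 1" using c(2) by simp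
          show ?thesis using up[OF scaled cs] cs by simp
        next
          case neg: False
          then have cs: "c * s n = - 1" using c(2) False by simp
          show ?thesis using lo[OF scaled cs] cs by simp
        qed
        moreover have "l (c *\<^sub>R a) + (\<Sum>i<n. t i * (c * s i)) + \<theta> * (c * s n) = c * (l a + (\<Sum>i<n. t i * s i) + \<theta> * s n)"
          by (simp add: linear_scale[OF l] distrib_left sum_distrib_left mult.left_commute)
        ultimately show ?thesis using c(1) unfolding eq by simp
      qed
    qed
    then show ?thesis by (intro exI[of _ "t(n := \<theta>)"]) auto
  qed
  have "\<exists>f. \<forall>n. P n (f n) \<and> (\<forall>i<n. f (Suc n) i = f n i)"
    by (rule dependent_nat_choice) (use P0 step in blast)+
  then obtain f where f: "\<And>n. P n (f n)" "\<And>n i. i < n \<Longrightarrow> f (Suc n) i = f n i" by blast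
  define t where "t i = f (Suc i) i" for i
  have tf: "f n i = t i" if "i < n" for n i
    using that
  proof (induction n)
    case (Suc n)
    then show ?case using f(2)[of i n] by (cases "i = n") (auto simp: t_def)
  qed simp
  have Pt: "l a + (\<Sum>i<n. t i * s i) \<le> C" if "D n a s C" for n a s C
    using f(1)[of n] that tf unfolding P_def by simp
  have "(\<Sum>n<N. \<bar>t n\<bar>) \<le> 1" for N
  proof -
    \<comment> \<open>testing with the signs of the \<open>t i\<close> bounds their absolute sum\<close>
    have "D N 0 (\<lambda>i. sgn (t i)) 1" unfolding D_def by (auto simp: linear_0[OF x] abs_sgn_eq)
    from Pt[OF this] show ?thesis by (simp add: linear_0[OF l] abs_sgn)
  qed
  moreover have "(\<lambda>N. \<Sum>n<N. t n * x n a) \<longlonglongrightarrow> l a" for a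
  proof (rule LIMSEQ_I)
    fix \<epsilon> :: real assume \<epsilon>: "0 < \<epsilon>"
    then obtain N0 where N0: "\<And>n. n \<ge> N0 \<Longrightarrow> \<bar>x n a\<bar> < \<epsilon> / 2"
      using LIMSEQ_D[OF null[of a], of "\<epsilon> / 2"] by auto
    have "norm ((\<Sum>n<N. t n * x n a) - l a) < \<epsilon>" if "N \<ge> N0" for N
    proof -
      \<comment> \<open>subtracting the first \<open>N\<close> coordinates leaves a null sequence of small supremum\<close>
      have half: "l b + (\<Sum>i<N. t i * (- x i b)) \<le> \<epsilon> / 2" if "\<And>n. \<bar>x n b\<bar> = \<bar>x n a\<bar>" for b
      proof (rule Pt)
        show "D N b (\<lambda>i. - x i b) (\<epsilon> / 2)"
          unfolding D_def using N0 that \<open>N \<ge> N0\<close> \<epsilon> by (auto simp: not_less intro: less_imp_le)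
      qed
      show ?thesis
        using half[of a] half[of "- a"] \<epsilon>
        by (simp add: linear_neg[OF x] linear_neg[OF l] sum_negf abs_less_iff)
    qed
    then show "\<exists>no. \<forall>N\<ge>no. norm ((\<Sum>n<N. t n * x n a) - l a) < \<epsilon>" by blast
  qed
  ultimately show ?thesis by blast
qed

section \<open>Density of the disc algebra functions in a model space\<close>

instance ell2 :: banach ..

lemma inner_cscale_left: "inner (cscale c a) b = inner a (cscale (cnj c) b)"
  by (simp add: cinner_scale_left cinner_scale_right flip: Re_cinner del: times_complex.sel)

lemma bounded_linear_cinner_left: "bounded_linear (\<lambda>a. cinner a c)"
  by (rule bounded_linear_intro[of _ "norm c"])
    (auto simp: cinner_add_left scaleR_eq_cscale cinner_scale_left scaleR_conv_of_real cmod_cinner_le)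

lemma dil_linear: "dil (1/2) (a + b) = dil (1/2) a + dil (1/2) b" "dil (1/2) (c *\<^sub>R a) = c *\<^sub>R dil (1/2) a"
  by (auto intro!: ell2_eqI simp: coef_dil algebra_simps)

lemma inner_dil: "inner (dil (1/2) a) b = inner a (dil (1/2) b)"
  by (simp add: cinner_def coef_dil mult.left_commute mult.commute mult.assoc flip: Re_cinner)

lemma fn_half_bound:
  assumes "cmod w \<le> 1 / 2"
  shows "cmod (fn a w) \<le> 2 * norm a"
proof -
  have w: "cmod w < 1" using assms by simp
  have "cmod (fn a w) \<le> (\<Sum>n. cmod (coef a n * w ^ n))"
    unfolding fn_def by (rule summable_norm[OF summable_coef_power[OF w]])
  also have "\<dots> \<le> (\<Sum>n. norm a * (1/2) ^ n)"
  proof (rule suminf_le[OF _ summable_coef_power[OF w]])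
    show "cmod (coef a n * w ^ n) \<le> norm a * (1/2) ^ n" for n
      using cmod_coef_le[of a n] power_mono[OF assms norm_ge_zero, of n]
      unfolding norm_mult norm_power by (intro mult_mono) auto
  qed (auto intro!: summable_mult summable_geometric)
  also have "\<dots> = 2 * norm a"
    by (subst suminf_mult) (auto simp: suminf_geometric intro!: summable_geometric)
  finally show ?thesis .
qed

context inner_fn
begin

lemma mul_scaleR: "mul p (c *\<^sub>R b) = c *\<^sub>R mul p b"
  by (simp add: scaleR_eq_cscale mul_cscale)

text \<open>The coset of \<open>fn a\<close> modulo \<open>p\<close> times functions of Smirnov type.  The larger class of multiples is used because
  the intersections with the Cauchy classes are then compact.\<close>

definition coset :: "ell2 \<Rightarrow> (complex \<Rightarrow> complex) set" where
  "coset a = {e. \<exists>v. smirnov v \<and> (\<forall>z. cmod z < 1 \<longrightarrow> e z = fn a z + fn p z * v z)}"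

text \<open>The bound for Smirnov quotients is uniform along a sequence in the Cauchy class, so the quotients form a normal
  family, and it passes to the limit, which is therefore of Smirnov type again.\<close>

lemma compact_tau_coset: "compact (tau ` (cauchy_class R \<inter> coset a))"
  unfolding compact_eq_seq_compact_metric seq_compact_def
proof (intro allI impI)
  fix f :: "nat \<Rightarrow> ell2" assume "\<forall>n. f n \<in> tau ` (cauchy_class R \<inter> coset a)"
  then have "\<forall>n. \<exists>e. e \<in> cauchy_class R \<and> e \<in> coset a \<and> f n = tau e" by blast
  from choice[OF this] obtain e where e: "\<And>n. e n \<in> cauchy_class R" "\<And>n. e n \<in> coset a" "\<And>n. f n = tau (e n)" by blast
  have "\<forall>n. \<exists>y. (\<forall>k<4. pos_re (y k) \<and> cmod (y k 0) \<le> R) \<and> (\<forall>z. cmod z < 1 \<longrightarrow> e n z = (\<Sum>k<4. \<i> ^ k * y k z))"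
    using e(1) by (simp add: cauchy_class_def)
  from choice[OF this] obtain y where y: "\<And>n k. k < 4 \<Longrightarrow> pos_re (y n k)" "\<And>n k. k < 4 \<Longrightarrow> cmod (y n k 0) \<le> R"
    "\<And>n z. cmod z < 1 \<Longrightarrow> e n z = (\<Sum>k<4. \<i> ^ k * y n k z)" by blast
  have "\<forall>n. \<exists>v. smirnov v \<and> (\<forall>z. cmod z < 1 \<longrightarrow> e n z = fn a z + fn p z * v z)"
    using e(2) by (simp add: coset_def)
  from choice[OF this] obtain v where v: "\<And>n. smirnov (v n)" "\<And>n z. cmod z < 1 \<Longrightarrow> e n z = fn a z + fn p z * v n z" by blast
  obtain x where x: "\<And>k. k < 4 \<Longrightarrow> pos_re (x k)" "\<And>k. k < 4 \<Longrightarrow> cmod (x k 0) \<le> norm (- a)"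
    "\<And>z. cmod z < 1 \<Longrightarrow> fn (- a) z = (\<Sum>k<4. \<i> ^ k * x k z)"
    by (rule cauchy_class_E[OF hardy_in_cauchy_class[of "- a"]], rule that)
  have neg: "fn (- a) z = - fn a z" if "cmod z < 1" for z using fn_diff[OF that, of 0 a] by simp
  have pos: "pos_re (\<lambda>z. y n k z + x k z)" if "k < 4" for n k
    by (rule pos_re_add[OF y(1)[OF that] x(1)[OF that]])
  have prod: "fn p z * v n z = (\<Sum>k<4. \<i> ^ k * (y n k z + x k z))" if "cmod z < 1" for n z
  proof -
    have "fn p z * v n z = e n z + fn (- a) z" using v(2)[OF that, of n] neg[OF that] by simp
    also have "\<dots> = (\<Sum>k<4. \<i> ^ k * y n k z) + (\<Sum>k<4. \<i> ^ k * x k z)"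
      using y(3)[OF that, of n] x(3)[OF that] by simp
    finally show ?thesis by (simp add: distrib_left sum.distrib)
  qed
  have vb: "cmod (v n z) \<le> 4 * (\<Prod>k<4. cmod (1 + (y n k z + x k z)))" if "cmod z < 1" for n z
    by (rule smirnov_quotient_bound[OF v(1), where Y = "\<lambda>k z. y n k z + x k z"]) (use pos prod that in auto)
  have f: "f n = tau (\<lambda>z. \<Sum>k<4. \<i> ^ k * y n k z)" for n unfolding e(3) by (rule tau_cong) (rule y(3))
  have "\<exists>(s :: nat \<Rightarrow> nat) g w. strict_mono s \<and>
    (\<forall>k<4. pos_re (g k) \<and> cmod (g k 0) \<le> R \<and> (\<forall>z. cmod z < 1 \<longrightarrow> (\<lambda>n. y (s n) k z) \<longlonglongrightarrow> g k z)) \<and>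
    w holomorphic_on ball 0 1 \<and> (\<forall>z. cmod z < 1 \<longrightarrow> (\<lambda>n. v (s n) z) \<longlonglongrightarrow> w z) \<and>
    (\<lambda>n. tau (\<lambda>z. \<Sum>k<4. \<i> ^ k * y (s n) k z)) \<longlonglongrightarrow> tau (\<lambda>z. \<Sum>k<4. \<i> ^ k * g k z)"
  proof (rule cauchy_class_subsequence)
    show "v n holomorphic_on ball 0 1" for n using v(1)[of n] by (simp add: smirnov_def)
    fix r :: real assume r: "r < 1"
    define M where "M = (R + norm a) * (2 / (1 - r))"
    have "cmod (v n z) \<le> 4 * (1 + M) ^ 4" if z: "z \<in> cball 0 r" for n z
    proof -
      have z1: "cmod z < 1" using z r by auto
      have "cmod (1 + (y n k z + x k z)) \<le> 1 + M" if k: "k < 4" for k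
      proof -
        have "cmod (y n k z) \<le> R * (2 / (1 - r))" by (rule pos_re_bound_cball[OF y(1)[OF k] y(2)[OF k] z r])
        moreover have "cmod (x k z) \<le> norm (- a) * (2 / (1 - r))" by (rule pos_re_bound_cball[OF x(1)[OF k] x(2)[OF k] z r])
        ultimately have "cmod (y n k z) + cmod (x k z) \<le> M" by (simp add: M_def distrib_right add_divide_distrib)
        then show ?thesis
          using norm_triangle_ineq[of 1 "y n k z + x k z"] norm_triangle_ineq[of "y n k z" "x k z"] by simp
      qed
      then have "(\<Prod>k<(4::nat). cmod (1 + (y n k z + x k z))) \<le> (\<Prod>k<(4::nat). 1 + M)"
        by (intro prod_mono) auto
      then show ?thesis using vb[OF z1, of n] by simp
    qed
    then show "\<exists>B. \<forall>n. \<forall>z\<in>cball 0 r. cmod (v n z) \<le> B" by blast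
  qed (use y in auto)
  then obtain s :: "nat \<Rightarrow> nat" and g w where s: "strict_mono s"
    and g: "\<And>k. k < 4 \<Longrightarrow> pos_re (g k)" "\<And>k. k < 4 \<Longrightarrow> cmod (g k 0) \<le> R"
      "\<And>k z. k < 4 \<Longrightarrow> cmod z < 1 \<Longrightarrow> (\<lambda>n. y (s n) k z) \<longlonglongrightarrow> g k z"
    and w: "w holomorphic_on ball 0 1" "\<And>z. cmod z < 1 \<Longrightarrow> (\<lambda>n. v (s n) z) \<longlonglongrightarrow> w z"
    and lim: "(\<lambda>n. tau (\<lambda>z. \<Sum>k<4. \<i> ^ k * y (s n) k z)) \<longlonglongrightarrow> tau (\<lambda>z. \<Sum>k<4. \<i> ^ k * g k z)"
    by blast
  let ?e = "\<lambda>z. \<Sum>k<4. \<i> ^ k * g k z"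
  have "?e \<in> cauchy_class R" using g(1,2) unfolding cauchy_class_def by blast
  moreover have "?e \<in> coset a"
  proof -
    have "cmod (w z) \<le> 4 * (\<Prod>k<4. cmod (1 + (g k z + x k z)))" if z: "cmod z < 1" for z
    proof (rule LIMSEQ_le[OF tendsto_norm[OF w(2)[OF z]]])
      show "(\<lambda>n. 4 * (\<Prod>k<4. cmod (1 + (y (s n) k z + x k z)))) \<longlonglongrightarrow> 4 * (\<Prod>k<4. cmod (1 + (g k z + x k z)))"
        by (intro tendsto_intros g(3)[OF _ z]) auto
    qed (use vb[OF z] in auto)
    then have "smirnov w"
      unfolding smirnov_def using w(1) pos_re_add[OF g(1) x(1)]
      by (intro conjI exI[of _ "\<lambda>k z. g k z + x k z"] exI[of _ 4]) auto
    moreover have "?e z = fn a z + fn p z * w z" if z: "cmod z < 1" for z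
    proof (rule LIMSEQ_unique)
      show "(\<lambda>n. e (s n) z) \<longlonglongrightarrow> ?e z"
        unfolding y(3)[OF z] by (intro tendsto_intros g(3)[OF _ z]) auto
      show "(\<lambda>n. e (s n) z) \<longlonglongrightarrow> fn a z + fn p z * w z"
        unfolding v(2)[OF z] by (intro tendsto_intros w(2)[OF z])
    qed
    ultimately show ?thesis unfolding coset_def by blast
  qed
  ultimately show "\<exists>l\<in>tau ` (cauchy_class R \<inter> coset a). \<exists>r. strict_mono r \<and> (f \<circ> r) \<longlonglongrightarrow> l"
    using s lim by (intro bexI[of _ "tau ?e"] exI[of _ s]) (auto simp: f o_def)
qed

text \<open>Otherwise \<open>fn a\<close> would be a multiple of \<open>p\<close> in the Hardy space, but \<open>K\<close> is orthogonal to these.\<close>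

lemma zero_not_in_coset:
  assumes "a \<in> K" "a \<noteq> 0" "e \<in> coset a"
  shows "\<exists>z. cmod z < 1 \<and> e z \<noteq> 0"
proof (rule ccontr)
  assume "\<not> ?thesis"
  then have e0: "e z = 0" if "cmod z < 1" for z using that by blast
  obtain v where v: "smirnov v" "\<And>z. cmod z < 1 \<Longrightarrow> e z = fn a z + fn p z * v z"
    using assms(3) unfolding coset_def by blast
  have eq: "fn p z * (- v z) = fn a z" if "cmod z < 1" for z
  proof -
    have "fn a z + fn p z * v z = 0" using v(2)[OF that] e0[OF that] by simp
    then show ?thesis by (simp add: add_eq_0_iff2)
  qed
  have "smirnov (\<lambda>z. - v z)" using v(1) unfolding smirnov_def by (auto intro: holomorphic_on_minus)
  from smirnov_quotient_hardy[OF this eq] obtain b where "a = mul p b" by blast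
  then have "cinner a a = 0" using assms(1) unfolding K_def by blast
  then show False using assms(2) by (simp add: cinner_self)
qed

lemma hardy_in_coset: "fn (a + mul p b) \<in> coset a"
  unfolding coset_def using smirnov_hardy[of b] by (auto simp: fn_add fn_mul)

text \<open>The construction in the proof of the Krein--Smulian theorem.  Compactness allows the balls of radius \<open>k\<close>
  to be treated one after another: the part of the coset in the ball of radius \<open>k + 1\<close> that is
  not yet separated from 0 lies outside the ball of radius \<open>k\<close>, so it is separated from 0 by finitely many
  elements of the polar of that ball, which are of size \<open>1 / k\<close>.\<close>

lemma krein_smulian_sets:
  assumes "a \<in> K" "a \<noteq> 0"
  shows "\<exists>S :: nat \<Rightarrow> ell2 set. (\<forall>k. finite (S k) \<and> (\<forall>e\<in>cauchy_class (real k) \<inter> coset a. \<exists>u\<in>S k. 1 < inner (tau e) u)) \<and>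
    (\<forall>k. S k \<subseteq> S (Suc k) \<and> S (Suc k) \<subseteq> S k \<union> polar (real k))"
proof -
  let ?P = "\<lambda>k S. finite S \<and> (\<forall>e\<in>cauchy_class (real k) \<inter> coset a. \<exists>u\<in>S. 1 < inner (tau e) u)"
  let ?Q = "\<lambda>k S S'. S \<subseteq> S' \<and> S' \<subseteq> S \<union> polar (real k)"
  have "\<exists>S. \<forall>k. ?P k (S k) \<and> ?Q k (S k) (S (Suc k))"
  proof (rule dependent_nat_choice)
    show "\<exists>S. ?P 0 S"
      using zero_not_in_coset[OF assms] cauchy_class_zero_radius by (intro exI[of _ "{}"]) auto
  next
    fix S k assume S: "?P k S"
    define C where "C = tau ` (cauchy_class (real (Suc k)) \<inter> coset a) \<inter> (\<Inter>u\<in>S. {x. inner x u \<le> 1})"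
    have "closed (\<Inter>u\<in>S. {x. inner x u \<le> 1})"
      by (intro closed_INT ballI closed_Collect_le continuous_intros)
    then have compC: "compact C" unfolding C_def by (intro compact_Int_closed compact_tau_coset)
    have cover: "C \<subseteq> (\<Union>u\<in>polar (real k). {x. 1 < inner x u})"
    proof
      fix x assume "x \<in> C"
      then obtain e where e: "e \<in> cauchy_class (real (Suc k))" "e \<in> coset a" "x = tau e" "\<And>u. u \<in> S \<Longrightarrow> inner x u \<le> 1"
        unfolding C_def by auto
      have "e \<notin> cauchy_class (real k)"
      proof
        assume "e \<in> cauchy_class (real k)"
        then obtain u where "u \<in> S" "1 < inner (tau e) u" using S e(2) by blast
        then show False using e(3,4) by fastforce
      qed
      from polar_separation[OF e(1) this] show "x \<in> (\<Union>u\<in>polar (real k). {x. 1 < inner x u})"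
        using e(3) by auto
    qed
    have op: "open {x. 1 < inner x u}" for u :: ell2 by (intro open_Collect_less continuous_intros)
    obtain F where F: "F \<subseteq> polar (real k)" "finite F" "C \<subseteq> (\<Union>u\<in>F. {x. 1 < inner x u})"
      using compactE_image[OF compC op cover] by blast
    have "\<exists>u\<in>S \<union> F. 1 < inner (tau e) u" if e: "e \<in> cauchy_class (real (Suc k)) \<inter> coset a" for e
    proof (cases "\<exists>u\<in>S. 1 < inner (tau e) u")
      case False
      then have "tau e \<in> C" using e unfolding C_def by (auto simp: not_less)
      then show ?thesis using F(3) by blast
    qed blast
    then have "?P (Suc k) (S \<union> F)" using S F(2) by blast
    then show "\<exists>S'. ?P (Suc k) S' \<and> ?Q k S S'" using F(1) by (intro exI[of _ "S \<union> F"]) blast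
  qed
  then show ?thesis by blast
qed

definition in_disc_algebra :: "ell2 \<Rightarrow> bool" where
  "in_disc_algebra a \<longleftrightarrow> (\<exists>g. continuous_on (cball 0 1) g \<and> (\<forall>z. cmod z < 1 \<longrightarrow> g z = fn a z))"

text \<open>The functional that takes \<open>s * a + p * b\<close> to \<open>s\<close> is dominated by the countably many functionals given by the
  separating elements of \<open>krein_smulian_sets\<close>, which form a null sequence.  So it is an absolutely convergent combination
  of them and is represented by a function \<open>G\<close>.  It vanishes on multiples of \<open>p\<close>, whence \<open>G\<close> is in \<open>K\<close>, and its
  series converges uniformly on the closed disc because the separating elements, dilated, are uniformly bounded.\<close>

lemma not_orthogonal_to_disc_algebra:
  assumes a: "a \<in> K" "a \<noteq> 0"
  shows "\<exists>G\<in>K. in_disc_algebra G \<and> inner a G \<noteq> 0"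
proof -
  obtain S :: "nat \<Rightarrow> ell2 set" where S: "\<And>k. finite (S k)"
    "\<And>k e. e \<in> cauchy_class (real k) \<Longrightarrow> e \<in> coset a \<Longrightarrow> \<exists>u\<in>S k. 1 < inner (tau e) u"
    "\<And>k. S k \<subseteq> S (Suc k)" "\<And>k. S (Suc k) \<subseteq> S k \<union> polar (real k)"
    using krein_smulian_sets[OF a] by blast
  have S_mono: "S i \<subseteq> S j" if "i \<le> j" for i j by (rule lift_Suc_mono_le[of S, OF S(3) that])
  define I where "I = (\<Union>k. S k)"
  have cI: "countable I" unfolding I_def using S(1) by (auto intro: countable_finite)
  have late: "\<exists>j\<ge>k. u \<in> polar (real j)" if u: "u \<in> I" "u \<notin> S k" for u k
  proof -
    obtain m where m: "u \<in> S m" using u(1) unfolding I_def by blast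
    then show ?thesis
    proof (induction m)
      case 0
      have "S 0 \<subseteq> S k" by (rule S_mono) simp
      then show ?case using 0 u(2) by blast
    next
      case (Suc m)
      show ?case
      proof (cases "u \<in> S m")
        case False
        then have "u \<in> polar (real m)" using Suc.prems S(4)[of m] by blast
        moreover have "m \<ge> k"
        proof (rule ccontr)
          assume "\<not> m \<ge> k"
          then have "S (Suc m) \<subseteq> S k" by (intro S_mono) simp
          then show False using Suc.prems u(2) by blast
        qed
        ultimately show ?thesis by blast
      qed (rule Suc.IH)
    qed
  qed
  define u where "u n = (if n \<in> to_nat_on I ` I then from_nat_into I n else 0)" for n
  have uI: "u n \<in> I \<and> to_nat_on I (u n) = n" if "u n \<noteq> 0" for n
    using that cI by (auto simp: u_def split: if_splits)
  have Iu: "u (to_nat_on I x) = x" if "x \<in> I" for x using that cI by (simp add: u_def)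
  \<comment> \<open>only the finitely many elements of \<open>S 1\<close> need not belong to some \<open>polar j\<close> with \<open>j \<ge> 1\<close>\<close>
  define M where "M = 2 + (\<Sum>x\<in>S 1. 2 * norm x)"
  have M0: "0 \<le> M" unfolding M_def by (intro add_nonneg_nonneg sum_nonneg) auto
  have ub: "cmod (fn (u n) (z / 2)) \<le> M" if z: "cmod z \<le> 1" for n z
  proof (cases "u n \<in> S 1 \<or> u n = 0")
    case True
    have "cmod (fn (u n) (z / 2)) \<le> 2 * norm (u n)" by (rule fn_half_bound) (use z in \<open>simp add: norm_divide\<close>)
    also have "\<dots> \<le> M"
      using True member_le_sum[of "u n" "S 1" "\<lambda>x. 2 * norm x"] S(1)[of 1] M0 by (auto simp: M_def)
    finally show ?thesis .
  next
    case False
    then obtain j where j: "j \<ge> 1" "u n \<in> polar (real j)" using late[of "u n" 1] uI[of n] by auto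
    have "cmod (fn (u n) (z / 2)) \<le> 2 / real j" by (rule polar_bound[OF j(2)]) (use j z in auto)
    also have "\<dots> \<le> 2" using j(1) by (simp add: divide_le_eq)
    also have "\<dots> \<le> M" unfolding M_def using sum_nonneg[of "S 1" "\<lambda>x. 2 * norm x"] by simp
    finally show ?thesis .
  qed
  define h where "h tb = fst tb *\<^sub>R a + mul p (snd tb)" for tb :: "real \<times> ell2"
  have h_lin: "h (x + y) = h x + h y" "h (c *\<^sub>R x) = c *\<^sub>R h x" for x y c
    by (simp_all add: h_def mul_add mul_scaleR scaleR_left_distrib scaleR_right_distrib mult.commute)
  define x where "x n tb = inner (dil (1/2) (h tb)) (u n)" for n tb
  have x_lin: "linear (x n)" for n
    by (rule linearI) (simp_all add: x_def h_lin dil_linear inner_add_left)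
  have l_lin: "linear (fst :: real \<times> ell2 \<Rightarrow> real)" by (rule linearI) auto
  have null: "(\<lambda>n. x n tb) \<longlonglongrightarrow> 0" for tb
  proof (rule LIMSEQ_I)
    fix \<epsilon> :: real assume \<epsilon>: "0 < \<epsilon>"
    obtain k :: nat where "norm (h tb) / \<epsilon> < real k" using reals_Archimedean2 by blast
    then have k: "norm (h tb) / real (Suc k) < \<epsilon>"
      using \<epsilon> by (simp add: field_simps)
    have "finite (to_nat_on I ` S (Suc k))" using S(1) by blast
    then obtain N where N: "\<And>n. n \<in> to_nat_on I ` S (Suc k) \<Longrightarrow> n < N"
      unfolding finite_nat_set_iff_bounded by blast
    have "norm (x n tb - 0) < \<epsilon>" if n: "n \<ge> N" for n
    proof (cases "u n = 0")
      case False
      have "u n \<notin> S (Suc k)"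
      proof
        assume "u n \<in> S (Suc k)"
        then have "n \<in> to_nat_on I ` S (Suc k)" using uI[OF False] by (metis image_eqI)
        then show False using N n by fastforce
      qed
      then obtain j where j: "j \<ge> Suc k" "u n \<in> polar (real j)" using late uI[OF False] by blast
      have "\<bar>x n tb\<bar> \<le> norm (h tb) / real j"
        unfolding x_def by (rule polar_small[OF j(2)]) (use j in auto)
      also have "\<dots> \<le> norm (h tb) / real (Suc k)" using j(1) by (intro divide_left_mono) auto
      finally show ?thesis using k by simp
    qed (use \<epsilon> in \<open>simp add: x_def\<close>)
    then show "\<exists>no. \<forall>n\<ge>no. norm (x n tb - 0) < \<epsilon>" by blast
  qed
  have dom: "\<exists>n. \<bar>fst tb\<bar> \<le> \<bar>x n tb\<bar>" for tb
  proof (cases "fst tb = 0")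
    case False
    define b where "b = (1 / fst tb) *\<^sub>R snd tb"
    have h_eq: "h tb = fst tb *\<^sub>R (a + mul p b)"
      using False by (simp add: h_def b_def scaleR_right_distrib scaleR_eq_cscale mul_cscale cscale_simps)
    obtain k :: nat where "norm (a + mul p b) < real k" using reals_Archimedean2 by blast
    then have "fn (a + mul p b) \<in> cauchy_class (real k)" using cauchy_class_mono[OF hardy_in_cauchy_class] by simp
    from S(2)[OF this hardy_in_coset] obtain w where w: "w \<in> S k" "1 < inner (dil (1/2) (a + mul p b)) w"
      unfolding tau_fn by blast
    have "w \<in> I" using w(1) unfolding I_def by blast
    then have "x (to_nat_on I w) tb = fst tb * inner (dil (1/2) (a + mul p b)) w"
      by (simp add: x_def Iu h_eq dil_linear)
    then have "\<bar>x (to_nat_on I w) tb\<bar> = \<bar>fst tb\<bar> * inner (dil (1/2) (a + mul p b)) w"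
      using w(2) by (simp add: abs_mult)
    moreover have "\<bar>fst tb\<bar> * 1 \<le> \<bar>fst tb\<bar> * inner (dil (1/2) (a + mul p b)) w"
      using w(2) by (intro mult_left_mono) auto
    ultimately show ?thesis by (intro exI[of _ "to_nat_on I w"]) simp
  qed auto
  obtain t where t: "\<And>N. (\<Sum>n<N. \<bar>t n\<bar>) \<le> 1" "\<And>tb. (\<lambda>N. \<Sum>n<N. t n * x n tb) \<longlonglongrightarrow> fst tb"
    using dominated_by_null_coordinates[OF x_lin l_lin null dom] by blast
  have t_sum: "summable (\<lambda>n. \<bar>t n\<bar>)"
    by (rule bounded_imp_summable[where B = 1]) (use t(1) in \<open>auto simp: lessThan_Suc_atMost[symmetric] simp del: sum.lessThan_Suc\<close>)
  have dn: "norm (dil (1/2) (u n)) \<le> M" for n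
  proof -
    have "\<exists>b. (\<forall>z. cmod z < 1 \<longrightarrow> fn b z = fn (dil (1/2) (u n)) z) \<and> norm b \<le> M"
      by (rule bounded_imp_fn[OF fn_holomorphic]) (use ub in \<open>simp add: fn_dil\<close>)
    then show ?thesis using fn_eq_imp_eq by metis
  qed
  have sumG: "summable (\<lambda>n. t n *\<^sub>R dil (1/2) (u n))"
  proof (rule summable_norm_cancel, rule summable_comparison_test'[OF summable_mult2[OF t_sum, of M]])
    show "norm (norm (t n *\<^sub>R dil (1/2) (u n))) \<le> \<bar>t n\<bar> * M" for n
      using dn[of n] by (simp add: mult_left_mono)
  qed
  define G where "G = (\<Sum>n. t n *\<^sub>R dil (1/2) (u n))"
  have innerG: "inner (h tb) G = fst tb" for tb
  proof -
    have "(\<lambda>n. inner (h tb) (t n *\<^sub>R dil (1/2) (u n))) sums inner (h tb) G"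
      unfolding G_def by (rule bounded_linear.sums[OF bounded_linear_inner_right summable_sums[OF sumG]])
    then have "(\<lambda>N. \<Sum>n<N. t n * x n tb) \<longlonglongrightarrow> inner (h tb) G"
      by (simp add: sums_def x_def inner_dil)
    then show ?thesis using t(2) LIMSEQ_unique by blast
  qed
  have orth: "inner (mul p b) G = 0" for b using innerG[of "(0, b)"] by (simp add: h_def)
  have "cinner G (mul p b) = 0" for b
    using orth[of b] orth[of "cscale (- \<i>) b"]
    by (simp add: cinner_eq_0_iff_inner inner_cscale_left mul_cscale inner_commute)
  then have GK: "G \<in> K" by (simp add: K_def)
  have "mul p 0 = 0" using mul_cscale[of 0 0] by (simp add: cscale_simps)
  then have aG: "inner a G = 1" using innerG[of "(1, 0)"] by (simp add: h_def)
  define g where "g z = (\<Sum>n. of_real (t n) * fn (u n) (z / 2))" for z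
  have "continuous_on (cball 0 1) g"
  proof (rule uniform_limit_theorem)
    show "uniform_limit (cball 0 1) (\<lambda>N z. \<Sum>n<N. of_real (t n) * fn (u n) (z / 2)) g sequentially"
      unfolding g_def
    proof (rule Weierstrass_m_test[OF _ summable_mult2[OF t_sum, of M]])
      show "norm (of_real (t n) * fn (u n) (z / 2)) \<le> \<bar>t n\<bar> * M" if "z \<in> cball 0 1" for n and z :: complex
        using ub[of z n] that by (simp add: norm_mult mult_left_mono)
    qed
    show "\<forall>\<^sub>F N in sequentially. continuous_on (cball 0 1) (\<lambda>z. \<Sum>n<N. of_real (t n) * fn (u n) (z / 2))"
    proof (intro always_eventually allI continuous_on_sum continuous_on_mult continuous_on_const)
      show "continuous_on (cball 0 1) (\<lambda>z. fn (u n) (z / 2))" for n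
        by (rule continuous_on_compose2[OF fn_continuous]) (auto intro!: continuous_intros simp: norm_divide)
    qed
  qed auto
  moreover have "g z = fn G z" if z: "cmod z < 1" for z
  proof -
    have "(\<lambda>n. cinner (t n *\<^sub>R dil (1/2) (u n)) (szego z)) sums cinner G (szego z)"
      unfolding G_def by (rule bounded_linear.sums[OF bounded_linear_cinner_left summable_sums[OF sumG]])
    then show ?thesis
      by (simp add: g_def sums_iff cinner_szego[OF z] scaleR_eq_cscale fn_cscale[OF z] fn_dil)
  qed
  ultimately have "in_disc_algebra G" unfolding in_disc_algebra_def by blast
  then show ?thesis using GK aG by force
qed

lemma subspace_disc_algebra: "subspace {a \<in> K. in_disc_algebra a}"
proof (rule subspaceI)
  show "0 \<in> {a \<in> K. in_disc_algebra a}" by (auto simp: in_disc_algebra_def intro: exI[of _ "\<lambda>_. 0"])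
next
  fix a b assume "a \<in> {a \<in> K. in_disc_algebra a}" "b \<in> {a \<in> K. in_disc_algebra a}"
  then obtain f g where "a \<in> K" "b \<in> K" "continuous_on (cball 0 1) f" "continuous_on (cball 0 1) g"
    "\<And>z. cmod z < 1 \<Longrightarrow> f z = fn a z" "\<And>z. cmod z < 1 \<Longrightarrow> g z = fn b z"
    unfolding in_disc_algebra_def by blast
  then show "a + b \<in> {a \<in> K. in_disc_algebra a}"
    unfolding in_disc_algebra_def
    by (auto simp: K_add fn_add intro!: exI[of _ "\<lambda>z. f z + g z"] continuous_intros)
next
  fix c :: real and a assume "a \<in> {a \<in> K. in_disc_algebra a}"
  then obtain f where "a \<in> K" "continuous_on (cball 0 1) f" "\<And>z. cmod z < 1 \<Longrightarrow> f z = fn a z"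
    unfolding in_disc_algebra_def by blast
  then show "c *\<^sub>R a \<in> {a \<in> K. in_disc_algebra a}"
    unfolding in_disc_algebra_def
    by (auto simp: K_cscale scaleR_eq_cscale fn_cscale intro!: exI[of _ "\<lambda>z. of_real c * f z"] continuous_intros)
qed

text \<open>Aleksandrov's theorem.\<close>

theorem disc_algebra_dense: "K \<subseteq> closure {a \<in> K. in_disc_algebra a}"
proof (rule dense_if_no_orthogonal[OF _ _ subspace_K closed_K])
  show "subspace {a \<in> K. in_disc_algebra a}" by (rule subspace_disc_algebra)
next
  fix a assume "a \<in> K" "\<And>b. b \<in> {a \<in> K. in_disc_algebra a} \<Longrightarrow> inner a b = 0"
  then show "a = 0" using not_orthogonal_to_disc_algebra[of a] by blast
qed auto

end

section \<open>Radial limits in the mean\<close>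

lemma bshift_shift: "bshift (shift a) = a"
  by (rule ell2_eqI) simp

lemma shift_inject: "shift a = shift b \<Longrightarrow> a = b"
  by (metis bshift_shift)

locale circle_measure =
  fixes \<mu> :: "complex measure"
  assumes circle: "is_circle_measure \<mu>"
begin

lemma finite [simp]: "finite_measure \<mu>"
  using circle by (simp add: is_circle_measure_def)

lemma space [simp]: "space \<mu> = sphere 0 1"
  by (rule space_circle_measure[OF circle])

lemma continuous_L2: "continuous_on (sphere 0 1) F \<Longrightarrow> F \<in> L2_space \<mu>"
  using circle by (intro L2_space_continuous) auto

lemma dilate_L2: "0 < r \<Longrightarrow> r < 1 \<Longrightarrow> dilate (fn a) r \<in> L2_space \<mu>"
  by (intro continuous_L2 continuous_on_dilate fn_continuous)

lemma cnj_measurable: "cnj \<in> borel_measurable \<mu>"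
  unfolding measurable_circle_measure[OF circle]
  by (intro circle_measurable_continuous continuous_intros)

lemma L2_const: "(\<lambda>_. c) \<in> L2_space \<mu>"
  by (intro continuous_L2 continuous_intros)

definition total :: real where "total = sqrt (measure \<mu> (sphere 0 1))"

lemma total_nonneg [simp]: "0 \<le> total" by (simp add: total_def)

lemma L2_norm_le: "F \<in> L2_space \<mu> \<Longrightarrow> 0 \<le> B \<Longrightarrow> (\<And>\<omega>. cmod \<omega> = 1 \<Longrightarrow> cmod (F \<omega>) \<le> B) \<Longrightarrow> L2_norm \<mu> F \<le> B * total"
  using L2_norm_bounded[of \<mu> F B] by (simp add: total_def)

lemma L2_cnj_mult:
  assumes "F \<in> L2_space \<mu>"
  shows "(\<lambda>\<omega>. cnj \<omega> * F \<omega>) \<in> L2_space \<mu>" "L2_norm \<mu> (\<lambda>\<omega>. cnj \<omega> * F \<omega>) = L2_norm \<mu> F"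
proof -
  show "(\<lambda>\<omega>. cnj \<omega> * F \<omega>) \<in> L2_space \<mu>"
    by (rule L2_space_mult_unimodular[OF assms cnj_measurable]) simp
  show "L2_norm \<mu> (\<lambda>\<omega>. cnj \<omega> * F \<omega>) = L2_norm \<mu> F"
    by (rule L2_norm_cong) (simp add: norm_mult)
qed

text \<open>The notion of extension for a function given by its coefficients.\<close>

definition ext :: "ell2 \<Rightarrow> (complex \<Rightarrow> complex) \<Rightarrow> bool" where
  "ext a F \<longleftrightarrow> F \<in> L2_space \<mu> \<and> ((\<lambda>r. L2_norm \<mu> (\<lambda>\<omega>. F \<omega> - dilate (fn a) r \<omega>)) \<longlongrightarrow> 0) (at_left 1)"

lemma is_extension_iff:
  assumes "\<And>z. cmod z < 1 \<Longrightarrow> f z = fn a z"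
  shows "is_extension \<mu> f F \<longleftrightarrow> ext a F"
proof -
  have eq: "dilate f r \<omega> = dilate (fn a) r \<omega>" if "0 < r" "r < 1" "\<omega> \<in> space \<mu>" for r \<omega>
    using that assms by (simp add: dilate_def norm_mult)
  have "\<forall>\<^sub>F r in at_left 1. dilate f r \<in> L2_space \<mu>"
    using eventually_at_left_1
  proof eventually_elim
    case (elim r)
    have m: "dilate f r \<in> borel_measurable \<mu>"
      using dilate_L2[of r a] elim measurable_cong[of \<mu> "dilate f r" "dilate (fn a) r" borel] eq by (auto simp: L2_space_def)
    show ?case
      by (rule L2_space_cong_AE[OF m _ dilate_L2[of r a]]) (use elim eq in \<open>auto intro!: AE_I2\<close>)
  qed
  moreover have "((\<lambda>r. L2_norm \<mu> (\<lambda>\<omega>. F \<omega> - dilate f r \<omega>)) \<longlongrightarrow> 0) (at_left 1) \<longleftrightarrow>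
      ((\<lambda>r. L2_norm \<mu> (\<lambda>\<omega>. F \<omega> - dilate (fn a) r \<omega>)) \<longlongrightarrow> 0) (at_left 1)"
  proof (rule tendsto_cong)
    show "\<forall>\<^sub>F r in at_left 1. L2_norm \<mu> (\<lambda>\<omega>. F \<omega> - dilate f r \<omega>) = L2_norm \<mu> (\<lambda>\<omega>. F \<omega> - dilate (fn a) r \<omega>)"
      using eventually_at_left_1 by eventually_elim (intro L2_norm_cong, simp add: eq)
  qed
  ultimately show ?thesis by (simp add: is_extension_def ext_def)
qed

lemma ext_norm_tendsto:
  assumes "ext a F"
  shows "((\<lambda>r. L2_norm \<mu> (dilate (fn a) r)) \<longlongrightarrow> L2_norm \<mu> F) (at_left 1)"
proof -
  have F: "F \<in> L2_space \<mu>" and lim: "((\<lambda>r. L2_norm \<mu> (\<lambda>\<omega>. F \<omega> - dilate (fn a) r \<omega>)) \<longlongrightarrow> 0) (at_left 1)"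
    using assms by (auto simp: ext_def)
  have "((\<lambda>r. L2_norm \<mu> F - L2_norm \<mu> (dilate (fn a) r)) \<longlongrightarrow> 0) (at_left 1)"
  proof (rule Lim_null_comparison[OF _ lim])
    show "\<forall>\<^sub>F r in at_left 1. norm (L2_norm \<mu> F - L2_norm \<mu> (dilate (fn a) r)) \<le> L2_norm \<mu> (\<lambda>\<omega>. F \<omega> - dilate (fn a) r \<omega>)"
      using eventually_at_left_1 by eventually_elim (use L2_norm_triangle_minus[OF F dilate_L2] in auto)
  qed
  from tendsto_diff[OF tendsto_const[of "L2_norm \<mu> F"] this] show ?thesis by simp
qed

lemma ext_add:
  assumes a: "ext a F" and b: "ext b G"
  shows "ext (a + b) (\<lambda>\<omega>. F \<omega> + G \<omega>)"
  unfolding ext_def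
proof
  have FG: "F \<in> L2_space \<mu>" "G \<in> L2_space \<mu>" using a b by (auto simp: ext_def)
  then show "(\<lambda>\<omega>. F \<omega> + G \<omega>) \<in> L2_space \<mu>" by (rule L2_space_add)
  have lim: "((\<lambda>r. L2_norm \<mu> (\<lambda>\<omega>. F \<omega> - dilate (fn a) r \<omega>) + L2_norm \<mu> (\<lambda>\<omega>. G \<omega> - dilate (fn b) r \<omega>)) \<longlongrightarrow> 0) (at_left 1)"
    using a b tendsto_add[of _ 0 _ _ 0] by (fastforce simp: ext_def)
  show "((\<lambda>r. L2_norm \<mu> (\<lambda>\<omega>. F \<omega> + G \<omega> - dilate (fn (a + b)) r \<omega>)) \<longlongrightarrow> 0) (at_left 1)"
  proof (rule Lim_null_comparison[OF _ lim])
    show "\<forall>\<^sub>F r in at_left 1. norm (L2_norm \<mu> (\<lambda>\<omega>. F \<omega> + G \<omega> - dilate (fn (a + b)) r \<omega>))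
        \<le> L2_norm \<mu> (\<lambda>\<omega>. F \<omega> - dilate (fn a) r \<omega>) + L2_norm \<mu> (\<lambda>\<omega>. G \<omega> - dilate (fn b) r \<omega>)"
      using eventually_at_left_1
    proof eventually_elim
      case (elim r)
      have "L2_norm \<mu> (\<lambda>\<omega>. F \<omega> + G \<omega> - dilate (fn (a + b)) r \<omega>) =
          L2_norm \<mu> (\<lambda>\<omega>. (F \<omega> - dilate (fn a) r \<omega>) + (G \<omega> - dilate (fn b) r \<omega>))"
        by (rule L2_norm_cong) (use elim in \<open>simp add: dilate_def fn_add norm_mult algebra_simps\<close>)
      also have "\<dots> \<le> L2_norm \<mu> (\<lambda>\<omega>. F \<omega> - dilate (fn a) r \<omega>) + L2_norm \<mu> (\<lambda>\<omega>. G \<omega> - dilate (fn b) r \<omega>)"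
        using elim by (intro L2_norm_triangle L2_space_diff FG dilate_L2) auto
      finally show ?case by simp
    qed
  qed
qed

lemma ext_cscale:
  assumes a: "ext a F"
  shows "ext (cscale c a) (\<lambda>\<omega>. c * F \<omega>)"
  unfolding ext_def
proof
  show "(\<lambda>\<omega>. c * F \<omega>) \<in> L2_space \<mu>" using a by (simp add: ext_def L2_space_scale)
  have lim: "((\<lambda>r. cmod c * L2_norm \<mu> (\<lambda>\<omega>. F \<omega> - dilate (fn a) r \<omega>)) \<longlongrightarrow> 0) (at_left 1)"
    using a tendsto_mult_right_zero by (fastforce simp: ext_def)
  show "((\<lambda>r. L2_norm \<mu> (\<lambda>\<omega>. c * F \<omega> - dilate (fn (cscale c a)) r \<omega>)) \<longlongrightarrow> 0) (at_left 1)"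
  proof (rule Lim_null_comparison[OF _ lim])
    show "\<forall>\<^sub>F r in at_left 1. norm (L2_norm \<mu> (\<lambda>\<omega>. c * F \<omega> - dilate (fn (cscale c a)) r \<omega>))
        \<le> cmod c * L2_norm \<mu> (\<lambda>\<omega>. F \<omega> - dilate (fn a) r \<omega>)"
      using eventually_at_left_1
    proof eventually_elim
      case (elim r)
      have "L2_norm \<mu> (\<lambda>\<omega>. c * F \<omega> - dilate (fn (cscale c a)) r \<omega>) = L2_norm \<mu> (\<lambda>\<omega>. c * (F \<omega> - dilate (fn a) r \<omega>))"
        by (rule L2_norm_cong) (use elim in \<open>simp add: dilate_def fn_cscale norm_mult algebra_simps\<close>)
      then show ?case by (simp add: L2_norm_scale)
    qed
  qed
qed

lemma ext_diff: "ext a F \<Longrightarrow> ext b G \<Longrightarrow> ext (a - b) (\<lambda>\<omega>. F \<omega> - G \<omega>)"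
proof -
  assume "ext a F" "ext b G"
  from ext_add[OF this(1) ext_cscale[OF this(2), of "-1"]]
  have "ext (a + cscale (-1) b) (\<lambda>\<omega>. F \<omega> - G \<omega>)" by simp
  moreover have "a + cscale (-1) b = a - b" by (rule ell2_eqI) simp
  ultimately show ?thesis by simp
qed

text \<open>The dilates of the zero function vanish, so that extensions are unique almost everywhere.\<close>

lemma ext_zero_norm:
  assumes "ext 0 F"
  shows "L2_norm \<mu> F = 0"
proof -
  have "L2_norm \<mu> (dilate (fn 0) r) = 0" for r by (simp add: dilate_def L2_norm_def)
  then have "((\<lambda>r::real. 0) \<longlongrightarrow> L2_norm \<mu> F) (at_left 1)" using ext_norm_tendsto[OF assms] by simp
  then show ?thesis by (simp add: tendsto_const_iff)
qed

lemma ext_unique: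
  assumes "ext a F" "ext a G"
  shows "L2_norm \<mu> (\<lambda>\<omega>. F \<omega> - G \<omega>) = 0" "AE \<omega> in \<mu>. F \<omega> = G \<omega>"
proof -
  have "ext 0 (\<lambda>\<omega>. F \<omega> - G \<omega>)" using ext_diff[OF assms] by simp
  then show 0: "L2_norm \<mu> (\<lambda>\<omega>. F \<omega> - G \<omega>) = 0" by (rule ext_zero_norm)
  have "(\<lambda>\<omega>. F \<omega> - G \<omega>) \<in> L2_space \<mu>" using assms by (auto simp: ext_def intro: L2_space_diff)
  from L2_norm_eq_0_AE[OF this 0] show "AE \<omega> in \<mu>. F \<omega> = G \<omega>" by simp
qed

text \<open>On the circle of radius \<open>r\<close> the backward shift divides by \<open>r * \<omega>\<close> instead of \<open>\<omega>\<close>; the correction factor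
  \<open>1 / r - 1\<close> tends to 0 and multiplies a bounded quantity.\<close>

lemma ext_bshift:
  assumes a: "ext a F"
  shows "ext (bshift a) (\<lambda>\<omega>. cnj \<omega> * (F \<omega> - coef a 0))"
  unfolding ext_def
proof
  have F: "F \<in> L2_space \<mu>" using a by (simp add: ext_def)
  show FL: "(\<lambda>\<omega>. cnj \<omega> * (F \<omega> - coef a 0)) \<in> L2_space \<mu>" by (intro L2_cnj_mult L2_space_diff F L2_const)
  let ?g = "\<lambda>r. L2_norm \<mu> (\<lambda>\<omega>. F \<omega> - dilate (fn a) r \<omega>)
      + (1 / r - 1) * (L2_norm \<mu> (dilate (fn a) r) + L2_norm \<mu> (\<lambda>_. coef a 0))"
  have "(?g \<longlongrightarrow> 0 + (1 / 1 - 1) * (L2_norm \<mu> F + L2_norm \<mu> (\<lambda>_. coef a 0))) (at_left 1)"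
    using a by (intro tendsto_intros ext_norm_tendsto) (auto simp: ext_def)
  then have lim: "(?g \<longlongrightarrow> 0) (at_left 1)" by simp
  show "((\<lambda>r. L2_norm \<mu> (\<lambda>\<omega>. cnj \<omega> * (F \<omega> - coef a 0) - dilate (fn (bshift a)) r \<omega>)) \<longlongrightarrow> 0) (at_left 1)"
  proof (rule Lim_null_comparison[OF _ lim])
    show "\<forall>\<^sub>F r in at_left 1. norm (L2_norm \<mu> (\<lambda>\<omega>. cnj \<omega> * (F \<omega> - coef a 0) - dilate (fn (bshift a)) r \<omega>)) \<le> ?g r"
      using eventually_at_left_1
    proof eventually_elim
      case (elim r)
      then have r: "0 < r" "r < 1" by auto
      note D = dilate_L2[OF r, of a]
      have R: "(\<lambda>\<omega>. of_real (1 / r - 1) * (coef a 0 - dilate (fn a) r \<omega>)) \<in> L2_space \<mu>"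
        by (intro L2_space_scale L2_space_diff L2_const D)
      have "L2_norm \<mu> (\<lambda>\<omega>. cnj \<omega> * (F \<omega> - coef a 0) - dilate (fn (bshift a)) r \<omega>) =
          L2_norm \<mu> (\<lambda>\<omega>. cnj \<omega> * ((F \<omega> - dilate (fn a) r \<omega>) + of_real (1 / r - 1) * (coef a 0 - dilate (fn a) r \<omega>)))"
      proof (rule L2_norm_cong)
        fix \<omega> assume "\<omega> \<in> space \<mu>"
        then have \<omega>: "cmod \<omega> = 1" by simp
        then have inv: "cnj \<omega> * \<omega> = 1" using complex_norm_square[of \<omega>] by (simp add: mult.commute)
        have "of_real r * \<omega> * fn (bshift a) (of_real r * \<omega>) = fn a (of_real r * \<omega>) - coef a 0"
          using fn_bshift[of "of_real r * \<omega>" a] r \<omega> by (simp add: norm_mult fn_0)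
        then have "cnj \<omega> * (of_real r * \<omega> * fn (bshift a) (of_real r * \<omega>)) = cnj \<omega> * (fn a (of_real r * \<omega>) - coef a 0)"
          by simp
        moreover have "cnj \<omega> * (of_real r * \<omega> * fn (bshift a) (of_real r * \<omega>)) = of_real r * ((cnj \<omega> * \<omega>) * fn (bshift a) (of_real r * \<omega>))"
          by (simp add: mult.left_commute mult.assoc)
        ultimately have "of_real r * fn (bshift a) (of_real r * \<omega>) = cnj \<omega> * (fn a (of_real r * \<omega>) - coef a 0)"
          using inv by simp
        then have "fn (bshift a) (of_real r * \<omega>) = cnj \<omega> * (fn a (of_real r * \<omega>) - coef a 0) / of_real r"
          using r by (simp add: field_simps)
        moreover have "x * (u - c) - x * (v - c) / of_real r = x * ((u - v) + of_real (1 / r - 1) * (c - v))" for x u v c :: complex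
          using r by (simp add: field_simps)
        ultimately have split: "cnj \<omega> * (F \<omega> - coef a 0) - fn (bshift a) (of_real r * \<omega>) =
            cnj \<omega> * ((F \<omega> - fn a (of_real r * \<omega>)) + of_real (1 / r - 1) * (coef a 0 - fn a (of_real r * \<omega>)))"
          by simp
        then show "cmod (cnj \<omega> * (F \<omega> - coef a 0) - dilate (fn (bshift a)) r \<omega>) =
            cmod (cnj \<omega> * ((F \<omega> - dilate (fn a) r \<omega>) + of_real (1 / r - 1) * (coef a 0 - dilate (fn a) r \<omega>)))"
          using split by (simp add: dilate_def mult.commute)
      qed
      also have "\<dots> = L2_norm \<mu> (\<lambda>\<omega>. (F \<omega> - dilate (fn a) r \<omega>) + of_real (1 / r - 1) * (coef a 0 - dilate (fn a) r \<omega>))"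
        by (intro L2_cnj_mult L2_space_add L2_space_diff F D R)
      also have "\<dots> \<le> L2_norm \<mu> (\<lambda>\<omega>. F \<omega> - dilate (fn a) r \<omega>) + L2_norm \<mu> (\<lambda>\<omega>. of_real (1 / r - 1) * (coef a 0 - dilate (fn a) r \<omega>))"
        by (intro L2_norm_triangle L2_space_diff F D R)
      also have "L2_norm \<mu> (\<lambda>\<omega>. of_real (1 / r - 1) * (coef a 0 - dilate (fn a) r \<omega>)) =
          (1 / r - 1) * L2_norm \<mu> (\<lambda>\<omega>. coef a 0 - dilate (fn a) r \<omega>)"
        unfolding L2_norm_scale norm_of_real using r by simp
      also have "\<dots> \<le> (1 / r - 1) * (L2_norm \<mu> (dilate (fn a) r) + L2_norm \<mu> (\<lambda>_. coef a 0))"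
      proof (rule mult_left_mono)
        have "L2_norm \<mu> (\<lambda>\<omega>. coef a 0 - dilate (fn a) r \<omega>) \<le> L2_norm \<mu> (\<lambda>_. coef a 0) + L2_norm \<mu> (\<lambda>\<omega>. (- 1) * dilate (fn a) r \<omega>)"
          using L2_norm_triangle[OF L2_const L2_space_scale[OF D, of "- 1"], of "coef a 0"] by simp
        then show "L2_norm \<mu> (\<lambda>\<omega>. coef a 0 - dilate (fn a) r \<omega>) \<le> L2_norm \<mu> (dilate (fn a) r) + L2_norm \<mu> (\<lambda>_. coef a 0)"
          unfolding L2_norm_scale by simp
      qed (use r in simp)
      finally show ?case by simp
    qed
  qed
qed

text \<open>If \<open>F N\<close> represents the \<open>N\<close>-fold backward shift of \<open>a\<close>, then \<open>F 0\<close> is the Taylor polynomial of degree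
  less than \<open>N\<close> plus \<open>\<omega>^N * F N\<close>, so that the Taylor polynomials converge to \<open>F 0\<close> in mean;
  summation by parts gives the Abel means.\<close>

lemma ext_if_remainders_vanish:
  fixes F :: "nat \<Rightarrow> complex \<Rightarrow> complex"
  assumes F: "\<And>N. F N \<in> L2_space \<mu>" and step: "\<And>N. F (Suc N) = (\<lambda>\<omega>. cnj \<omega> * (F N \<omega> - coef a N))"
    and bd: "\<And>N. L2_norm \<mu> (F N) \<le> norm ((bshift ^^ N) a)"
  shows "ext a (F 0)"
  unfolding ext_def
proof
  show "F 0 \<in> L2_space \<mu>" by (rule F)
  define T where "T N \<omega> = \<omega> ^ N * F N \<omega>" for N \<omega>
  define \<tau> where "\<tau> N = norm ((bshift ^^ N) a)" for N
  have \<tau>B: "\<tau> N \<le> norm a" for N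
    unfolding \<tau>_def by (induction N) (auto intro: order_trans[OF norm_bshift_le])
  have \<tau>0: "0 \<le> \<tau> N" for N by (simp add: \<tau>_def)
  have mpow: "(\<lambda>\<omega>. \<omega> ^ N) \<in> borel_measurable \<mu>" for N
    unfolding measurable_circle_measure[OF circle] by (intro circle_measurable_continuous continuous_intros)
  have T: "T N \<in> L2_space \<mu>" for N
    unfolding T_def by (rule L2_space_mult_unimodular[OF F mpow]) (simp add: norm_power)
  have Tn: "L2_norm \<mu> (T N) \<le> \<tau> N" for N
  proof -
    have "L2_norm \<mu> (T N) = L2_norm \<mu> (F N)" by (rule L2_norm_cong) (simp add: T_def norm_mult norm_power)
    then show ?thesis using bd[of N] by (simp add: \<tau>_def)
  qed
  have Tdiff: "T N \<omega> - T (Suc N) \<omega> = coef a N * \<omega> ^ N" if "cmod \<omega> = 1" for N \<omega>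
  proof -
    have "cnj \<omega> * \<omega> = 1" using complex_norm_square[of \<omega>] that by (simp add: mult.commute)
    moreover have "T (Suc N) \<omega> = \<omega> ^ N * ((cnj \<omega> * \<omega>) * (F N \<omega> - coef a N))"
      by (simp add: T_def step mult.assoc mult.left_commute)
    ultimately have "T (Suc N) \<omega> = \<omega> ^ N * (F N \<omega> - coef a N)" by simp
    then show ?thesis by (simp add: T_def algebra_simps)
  qed
  define P where "P r M \<omega> = (\<Sum>n<M. of_real r ^ n * coef a n * \<omega> ^ n)" for r :: real and M \<omega>
  define A where "A r M \<omega> = (\<Sum>n<M. of_real (r ^ n) * T (Suc n) \<omega>)" for r :: real and M \<omega>
  have A: "A r M \<in> L2_space \<mu> \<and> L2_norm \<mu> (A r M) \<le> (\<Sum>n<M. r ^ n * \<tau> (Suc n))" if r: "0 < r" for r M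
  proof (induction M)
    case 0
    then show ?case by (simp add: A_def L2_norm_def)
  next
    case (Suc M)
    have S: "(\<lambda>\<omega>. of_real (r ^ M) * T (Suc M) \<omega>) \<in> L2_space \<mu>" by (rule L2_space_scale[OF T])
    have eq: "A r (Suc M) = (\<lambda>\<omega>. A r M \<omega> + of_real (r ^ M) * T (Suc M) \<omega>)" by (simp add: A_def fun_eq_iff)
    have "L2_norm \<mu> (\<lambda>\<omega>. of_real (r ^ M) * T (Suc M) \<omega>) \<le> r ^ M * \<tau> (Suc M)"
      unfolding L2_norm_scale norm_of_real using r Tn[of "Suc M"] by (simp add: mult_left_mono)
    then show ?case
      unfolding eq using Suc L2_space_add[OF _ S] L2_norm_triangle[OF _ S, of "A r M"] by fastforce
  qed
  \<comment> \<open>summation by parts for the Abel means of the telescoping sequence \<open>T\<close>\<close>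
  have R: "F 0 \<omega> - P r M \<omega> = of_real (r ^ M) * T M \<omega> + of_real (1 - r) * A r M \<omega>" if "cmod \<omega> = 1" for r M \<omega>
  proof (induction M)
    case 0
    then show ?case by (simp add: P_def A_def T_def)
  next
    case (Suc M)
    have "F 0 \<omega> - P r (Suc M) \<omega> = (F 0 \<omega> - P r M \<omega>) - of_real r ^ M * (T M \<omega> - T (Suc M) \<omega>)"
      using Tdiff[OF that, of M] by (simp add: P_def mult.assoc)
    then show ?case unfolding Suc by (simp add: A_def algebra_simps)
  qed
  have PL: "P r M \<in> L2_space \<mu>" for r M
    unfolding P_def by (intro continuous_L2 continuous_intros)
  \<comment> \<open>split the Abel sum at the index from which on the remainders are at most \<open>\<delta>\<close>\<close>
  have key: "L2_norm \<mu> (\<lambda>\<omega>. F 0 \<omega> - dilate (fn a) r \<omega>) \<le> (1 - r) * (real N * norm a) + \<delta>"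
    if r: "0 < r" "r < 1" and \<delta>: "0 \<le> \<delta>" "\<And>n. n \<ge> N \<Longrightarrow> \<tau> (Suc n) \<le> \<delta>" for r N \<delta>
  proof -
    have sm: "summable (\<lambda>n. cmod (coef a n * of_real r ^ n))" by (rule summable_coef_power) (use r in simp)
    define E where "E M = (\<Sum>n. cmod (coef a (n + M) * of_real r ^ (n + M)))" for M
    have E0: "E \<longlonglongrightarrow> 0" unfolding E_def by (rule suminf_exist_split2[OF sm])
    have tail: "cmod (P r M \<omega> - dilate (fn a) r \<omega>) \<le> E M" if \<omega>: "cmod \<omega> = 1" for M \<omega>
    proof -
      have s: "summable (\<lambda>n. of_real r ^ n * coef a n * \<omega> ^ n)"
        by (rule summable_norm_cancel) (use sm in \<open>simp add: norm_mult norm_power \<omega> mult.commute\<close>)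
      have "dilate (fn a) r \<omega> = (\<Sum>n. of_real r ^ (n + M) * coef a (n + M) * \<omega> ^ (n + M)) + P r M \<omega>"
        unfolding dilate_fn_eq[OF r] P_def by (rule suminf_split_initial_segment[OF s])
      then have "cmod (P r M \<omega> - dilate (fn a) r \<omega>) = cmod (\<Sum>n. of_real r ^ (n + M) * coef a (n + M) * \<omega> ^ (n + M))"
        by simp
      also have "\<dots> \<le> (\<Sum>n. cmod (of_real r ^ (n + M) * coef a (n + M) * \<omega> ^ (n + M)))"
        by (rule summable_norm) (use summable_ignore_initial_segment[OF sm, of M] in \<open>simp add: norm_mult norm_power \<omega> mult.commute\<close>)
      also have "\<dots> = E M" unfolding E_def by (simp add: norm_mult norm_power \<omega> mult.commute)
      finally show ?thesis .
    qed
    have EM: "0 \<le> E M" for M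
      unfolding E_def by (rule suminf_nonneg[OF summable_ignore_initial_segment[OF sm]]) simp
    have sumA: "(1 - r) * (\<Sum>n<M. r ^ n * \<tau> (Suc n)) \<le> (1 - r) * (real N * norm a) + \<delta>" for M
    proof -
      have "(\<Sum>n<M. r ^ n * \<tau> (Suc n)) \<le> (\<Sum>n<M. (if n < N then norm a else 0) + r ^ n * \<delta>)"
      proof (rule sum_mono)
        fix n
        show "r ^ n * \<tau> (Suc n) \<le> (if n < N then norm a else 0) + r ^ n * \<delta>"
        proof (cases "n < N")
          case True
          have "r ^ n * \<tau> (Suc n) \<le> 1 * norm a"
            using r \<tau>B \<tau>0 power_le_one[of r n] by (intro mult_mono) auto
          also have "\<dots> \<le> norm a + r ^ n * \<delta>" using r \<delta>(1) by simp
          finally show ?thesis using True by simp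
        next
          case False
          then show ?thesis using \<delta>(2)[of n] r by (simp add: mult_left_mono)
        qed
      qed
      also have "\<dots> = (\<Sum>n<M. if n < N then norm a else 0) + (\<Sum>n<M. r ^ n) * \<delta>"
        by (simp add: sum.distrib sum_distrib_right)
      also have "(\<Sum>n<M. if n < N then norm a else 0) \<le> real N * norm a"
      proof -
        have "(\<Sum>n<M. if n < N then norm a else 0) = (\<Sum>n\<in>{..<M} \<inter> {..<N}. norm a)"
          using sum.inter_restrict[of "{..<M}" "\<lambda>_. norm a" "{..<N}"] by (simp only: finite_lessThan lessThan_iff)
        also have "\<dots> = real (card ({..<M} \<inter> {..<N})) * norm a" by simp
        also have "\<dots> \<le> real N * norm a"
          using card_mono[of "{..<N}" "{..<M} \<inter> {..<N}"] by (intro mult_right_mono) auto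
        finally show ?thesis .
      qed
      finally have "(1 - r) * (\<Sum>n<M. r ^ n * \<tau> (Suc n)) \<le> (1 - r) * (real N * norm a + (\<Sum>n<M. r ^ n) * \<delta>)"
        using r by (intro mult_left_mono) auto
      also have "\<dots> = (1 - r) * (real N * norm a) + (1 - r ^ M) * \<delta>"
        unfolding distrib_left one_diff_power_eq by (simp only: mult.assoc)
      also have "\<dots> \<le> (1 - r) * (real N * norm a) + \<delta>"
        using r \<delta>(1) by (simp add: left_diff_distrib)
      finally show ?thesis .
    qed
    show ?thesis
    proof (rule tendsto_lowerbound)
      show "(\<lambda>M. E M * total + (r ^ M * norm a + ((1 - r) * (real N * norm a) + \<delta>)))
          \<longlonglongrightarrow> (1 - r) * (real N * norm a) + \<delta>"
        using r by (auto intro!: tendsto_eq_intros E0 LIMSEQ_realpow_zero)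
      show "\<forall>\<^sub>F M in sequentially. L2_norm \<mu> (\<lambda>\<omega>. F 0 \<omega> - dilate (fn a) r \<omega>)
          \<le> E M * total + (r ^ M * norm a + ((1 - r) * (real N * norm a) + \<delta>))"
      proof (intro always_eventually allI)
        fix M
        have "L2_norm \<mu> (\<lambda>\<omega>. F 0 \<omega> - dilate (fn a) r \<omega>) \<le> L2_norm \<mu> (\<lambda>\<omega>. F 0 \<omega> - P r M \<omega>) + L2_norm \<mu> (\<lambda>\<omega>. P r M \<omega> - dilate (fn a) r \<omega>)"
          by (rule L2_norm_triangle_diff[OF F PL dilate_L2[OF r]])
        also have "L2_norm \<mu> (\<lambda>\<omega>. P r M \<omega> - dilate (fn a) r \<omega>) \<le> E M * total"
          by (rule L2_norm_le[OF L2_space_diff[OF PL dilate_L2[OF r]] EM tail])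
        also have "L2_norm \<mu> (\<lambda>\<omega>. F 0 \<omega> - P r M \<omega>) = L2_norm \<mu> (\<lambda>\<omega>. of_real (r ^ M) * T M \<omega> + of_real (1 - r) * A r M \<omega>)"
          by (rule L2_norm_cong) (use R in simp)
        also have "\<dots> \<le> L2_norm \<mu> (\<lambda>\<omega>. of_real (r ^ M) * T M \<omega>) + L2_norm \<mu> (\<lambda>\<omega>. of_real (1 - r) * A r M \<omega>)"
          using A[OF r(1)] by (intro L2_norm_triangle L2_space_scale T) auto
        also have "\<dots> = r ^ M * L2_norm \<mu> (T M) + (1 - r) * L2_norm \<mu> (A r M)"
          unfolding L2_norm_scale norm_of_real using r by simp
        also have "\<dots> \<le> r ^ M * norm a + ((1 - r) * (real N * norm a) + \<delta>)"
        proof (rule add_mono)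
          show "r ^ M * L2_norm \<mu> (T M) \<le> r ^ M * norm a"
            using r order_trans[OF Tn \<tau>B] by (intro mult_left_mono) auto
          have "(1 - r) * L2_norm \<mu> (A r M) \<le> (1 - r) * (\<Sum>n<M. r ^ n * \<tau> (Suc n))"
            using r A[OF r(1)] by (intro mult_left_mono) auto
          then show "(1 - r) * L2_norm \<mu> (A r M) \<le> (1 - r) * (real N * norm a) + \<delta>" using sumA by (rule order_trans)
        qed
        finally show "L2_norm \<mu> (\<lambda>\<omega>. F 0 \<omega> - dilate (fn a) r \<omega>)
          \<le> E M * total + (r ^ M * norm a + ((1 - r) * (real N * norm a) + \<delta>))" by simp
      qed
    qed simp
  qed
  show "((\<lambda>r. L2_norm \<mu> (\<lambda>\<omega>. F 0 \<omega> - dilate (fn a) r \<omega>)) \<longlongrightarrow> 0) (at_left 1)"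
  proof (rule tendstoI)
    fix \<epsilon> :: real assume \<epsilon>: "0 < \<epsilon>"
    have "(\<lambda>N. \<tau> (Suc N)) \<longlonglongrightarrow> 0" unfolding \<tau>_def by (rule LIMSEQ_Suc[OF bshift_iter_tendsto])
    then obtain N where N: "\<And>n. n \<ge> N \<Longrightarrow> \<tau> (Suc n) \<le> \<epsilon> / 2"
      using LIMSEQ_D[of "\<lambda>N. \<tau> (Suc N)" 0 "\<epsilon> / 2"] \<epsilon> \<tau>0 by (auto intro: less_imp_le)
    have "((\<lambda>r. (1 - r) * (real N * norm a) + \<epsilon> / 2) \<longlongrightarrow> (1 - 1) * (real N * norm a) + \<epsilon> / 2) (at_left 1)"
      by (intro tendsto_intros)
    then have "\<forall>\<^sub>F r in at_left 1. (1 - r) * (real N * norm a) + \<epsilon> / 2 < \<epsilon>"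
      by (rule order_tendstoD(2)) (use \<epsilon> in simp)
    with eventually_at_left_1 show "\<forall>\<^sub>F r in at_left 1. dist (L2_norm \<mu> (\<lambda>\<omega>. F 0 \<omega> - dilate (fn a) r \<omega>)) 0 < \<epsilon>"
    proof eventually_elim
      case (elim r)
      then show ?case using key[of r "\<epsilon> / 2" N] N \<epsilon> by simp
    qed
  qed
qed

text \<open>Pairs that are approximated in both norms at once.  If the extension map preserves norms on the subspace \<open>D\<close>, they
  form the graph of its continuous extension to the closure of \<open>D\<close>.\<close>

definition graph_closure :: "ell2 set \<Rightarrow> ell2 \<Rightarrow> (complex \<Rightarrow> complex) \<Rightarrow> bool" where
  "graph_closure D a F \<longleftrightarrow> F \<in> L2_space \<mu> \<and>
    (\<forall>\<epsilon>>0. \<exists>b\<in>D. \<exists>H. ext b H \<and> norm (a - b) < \<epsilon> \<and> L2_norm \<mu> (\<lambda>\<omega>. F \<omega> - H \<omega>) < \<epsilon>)"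

text \<open>The closure of the graph inherits norm preservation and invariance under the backward shift, so that the Taylor remainders
  of \<open>F\<close> have the norms of the iterated backward shifts of \<open>a\<close>, which tend to 0.\<close>

theorem ext_of_closure:
  assumes iso: "\<And>b H. b \<in> D \<Longrightarrow> ext b H \<Longrightarrow> L2_norm \<mu> H = norm b"
    and inv: "\<And>b H. b \<in> D \<Longrightarrow> ext b H \<Longrightarrow> graph_closure D (bshift b) (\<lambda>\<omega>. cnj \<omega> * (H \<omega> - coef b 0))"
    and a: "graph_closure D a F"
  shows "ext a F" "L2_norm \<mu> F = norm a"
proof -
  have norm_eq: "L2_norm \<mu> F = norm a" if a: "graph_closure D a F" for a F
  proof (rule ccontr)
    assume "L2_norm \<mu> F \<noteq> norm a"
    define \<epsilon> where "\<epsilon> = \<bar>L2_norm \<mu> F - norm a\<bar> / 2"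
    have \<epsilon>: "0 < \<epsilon>" using \<open>L2_norm \<mu> F \<noteq> norm a\<close> by (simp add: \<epsilon>_def)
    obtain b H where b: "b \<in> D" "ext b H" "norm (a - b) < \<epsilon>" "L2_norm \<mu> (\<lambda>\<omega>. F \<omega> - H \<omega>) < \<epsilon>"
      using a \<epsilon> unfolding graph_closure_def by blast
    have "\<bar>L2_norm \<mu> F - L2_norm \<mu> H\<bar> < \<epsilon>"
      using L2_norm_triangle_minus[of F \<mu> H] a b(2,4) by (simp add: graph_closure_def ext_def)
    moreover have "\<bar>norm a - norm b\<bar> < \<epsilon>" using norm_triangle_ineq3[of a b] b(3) by simp
    ultimately have "\<bar>L2_norm \<mu> F - norm a\<bar> < 2 * \<epsilon>" using iso[OF b(1,2)] by linarith
    then show False by (simp add: \<epsilon>_def)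
  qed
  then show "L2_norm \<mu> F = norm a" using a .
  have closed_shift: "graph_closure D (bshift a) (\<lambda>\<omega>. cnj \<omega> * (F \<omega> - coef a 0))" if a: "graph_closure D a F" for a F
    unfolding graph_closure_def
  proof (intro conjI allI impI)
    have F: "F \<in> L2_space \<mu>" using a by (simp add: graph_closure_def)
    show FL: "(\<lambda>\<omega>. cnj \<omega> * (F \<omega> - coef a 0)) \<in> L2_space \<mu>" by (intro L2_cnj_mult L2_space_diff F L2_const)
    fix \<epsilon> :: real assume \<epsilon>: "0 < \<epsilon>"
    define \<delta> where "\<delta> = \<epsilon> / (2 * (1 + total))"
    have tp: "0 < 2 * (1 + total)" by (simp add: add_pos_nonneg)
    have \<delta>: "0 < \<delta>" "\<delta> * (1 + total) = \<epsilon> / 2" using \<epsilon> tp by (auto simp: \<delta>_def field_simps)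
    moreover have "0 \<le> \<delta> * total" using \<delta>(1) by simp
    ultimately have \<delta>2: "\<delta> \<le> \<epsilon> / 2" unfolding distrib_left by linarith
    obtain b H where b: "b \<in> D" "ext b H" "norm (a - b) < \<delta>" "L2_norm \<mu> (\<lambda>\<omega>. F \<omega> - H \<omega>) < \<delta>"
      using a \<delta>(1) unfolding graph_closure_def by blast
    have H: "H \<in> L2_space \<mu>" using b(2) by (simp add: ext_def)
    obtain b' H' where b': "b' \<in> D" "ext b' H'" "norm (bshift b - b') < \<epsilon> / 2"
      "L2_norm \<mu> (\<lambda>\<omega>. cnj \<omega> * (H \<omega> - coef b 0) - H' \<omega>) < \<epsilon> / 2"
      using inv[OF b(1,2)] half_gt_zero[OF \<epsilon>] unfolding graph_closure_def by blast
    have H': "H' \<in> L2_space \<mu>" using b'(2) by (simp add: ext_def)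
    have "norm (bshift a - b') \<le> norm (bshift (a - b)) + norm (bshift b - b')"
      using norm_triangle_ineq[of "bshift a - bshift b" "bshift b - b'"] by (simp add: bshift_linear)
    also have "\<dots> < \<epsilon>" using norm_bshift_le[of "a - b"] b(3) b'(3) \<delta>2 by linarith
    finally have 1: "norm (bshift a - b') < \<epsilon>" .
    have HL: "(\<lambda>\<omega>. cnj \<omega> * (H \<omega> - coef b 0)) \<in> L2_space \<mu>" by (intro L2_cnj_mult L2_space_diff H L2_const)
    have c: "cmod (coef a 0 - coef b 0) < \<delta>" using cmod_coef_le[of "a - b" 0] b(3) by simp
    have "L2_norm \<mu> (\<lambda>\<omega>. cnj \<omega> * (F \<omega> - coef a 0) - cnj \<omega> * (H \<omega> - coef b 0)) =
        L2_norm \<mu> (\<lambda>\<omega>. cnj \<omega> * ((F \<omega> - H \<omega>) + (coef b 0 - coef a 0)))"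
      by (rule L2_norm_cong) (simp add: algebra_simps)
    also have "\<dots> = L2_norm \<mu> (\<lambda>\<omega>. (F \<omega> - H \<omega>) + (coef b 0 - coef a 0))"
      by (intro L2_cnj_mult L2_space_add L2_space_diff F H L2_const)
    also have "\<dots> \<le> L2_norm \<mu> (\<lambda>\<omega>. F \<omega> - H \<omega>) + L2_norm \<mu> (\<lambda>_. coef b 0 - coef a 0)"
      by (intro L2_norm_triangle L2_space_diff F H L2_const)
    also have "L2_norm \<mu> (\<lambda>_. coef b 0 - coef a 0) \<le> \<delta> * total"
      by (rule L2_norm_le[OF L2_const]) (use \<delta> c in \<open>auto simp: norm_minus_commute intro: less_imp_le\<close>)
    also have "L2_norm \<mu> (\<lambda>\<omega>. F \<omega> - H \<omega>) + \<delta> * total < \<epsilon> / 2"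
      using b(4) \<delta>(2) by (simp add: distrib_left)
    finally have "L2_norm \<mu> (\<lambda>\<omega>. cnj \<omega> * (F \<omega> - coef a 0) - cnj \<omega> * (H \<omega> - coef b 0)) < \<epsilon> / 2" by simp
    then have 2: "L2_norm \<mu> (\<lambda>\<omega>. cnj \<omega> * (F \<omega> - coef a 0) - H' \<omega>) < \<epsilon>"
      using L2_norm_triangle_diff[OF FL HL H'] b'(4) by linarith
    show "\<exists>b\<in>D. \<exists>H. ext b H \<and> norm (bshift a - b) < \<epsilon> \<and> L2_norm \<mu> (\<lambda>\<omega>. cnj \<omega> * (F \<omega> - coef a 0) - H \<omega>) < \<epsilon>"
      using b'(1,2) 1 2 by blast
  qed
  define FF where "FF N = rec_nat F (\<lambda>N G \<omega>. cnj \<omega> * (G \<omega> - coef a N)) N" for N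
  have FF: "FF 0 = F" "FF (Suc N) = (\<lambda>\<omega>. cnj \<omega> * (FF N \<omega> - coef a N))" for N by (simp_all add: FF_def)
  have cl: "graph_closure D ((bshift ^^ N) a) (FF N)" for N
  proof (induction N)
    case (Suc N)
    from closed_shift[OF this] show ?case by (simp add: FF coef_bshift_iter)
  qed (simp add: FF a)
  have "ext a (FF 0)"
  proof (rule ext_if_remainders_vanish)
    show "FF N \<in> L2_space \<mu>" for N using cl[of N] by (simp add: graph_closure_def)
    show "L2_norm \<mu> (FF N) \<le> norm ((bshift ^^ N) a)" for N using norm_eq[OF cl[of N]] by simp
  qed (rule FF(2))
  then show "ext a F" by (simp add: FF)
qed

text \<open>An isometry maps Cauchy sequences to Cauchy sequences, and \<open>L2(\<mu>)\<close> is complete.\<close>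

lemma graph_closure_exists:
  assumes D: "subspace D" and ex: "\<And>b. b \<in> D \<Longrightarrow> \<exists>H. ext b H"
    and iso: "\<And>b H. b \<in> D \<Longrightarrow> ext b H \<Longrightarrow> L2_norm \<mu> H = norm b" and a: "a \<in> closure D"
  shows "\<exists>F. graph_closure D a F"
proof -
  obtain b where b: "\<And>n. b n \<in> D" "b \<longlonglongrightarrow> a" using a unfolding closure_sequential by blast
  have "\<forall>n. \<exists>H. ext (b n) H" using ex b(1) by blast
  from choice[OF this] obtain H where H: "\<And>n. ext (b n) (H n)" by blast
  have HL: "H n \<in> L2_space \<mu>" for n using H[of n] by (simp add: ext_def)
  have dist: "L2_norm \<mu> (\<lambda>\<omega>. H m \<omega> - H n \<omega>) = dist (b m) (b n)" for m n
    using iso[OF subspace_diff[OF D b(1) b(1)] ext_diff[OF H H]] by (simp add: dist_norm)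
  have "\<exists>N. \<forall>m\<ge>N. \<forall>n\<ge>N. L2_norm \<mu> (\<lambda>\<omega>. H m \<omega> - H n \<omega>) < e" if "0 < e" for e
    unfolding dist using metric_CauchyD[OF LIMSEQ_imp_Cauchy[OF b(2)] that] by blast
  from L2_complete[OF finite HL this] obtain F where F: "F \<in> L2_space \<mu>"
    "(\<lambda>n. L2_norm \<mu> (\<lambda>\<omega>. F \<omega> - H n \<omega>)) \<longlonglongrightarrow> 0" by blast
  have "graph_closure D a F"
    unfolding graph_closure_def
  proof (intro conjI allI impI F(1))
    fix \<epsilon> :: real assume \<epsilon>: "0 < \<epsilon>"
    have "\<forall>\<^sub>F n in sequentially. L2_norm \<mu> (\<lambda>\<omega>. F \<omega> - H n \<omega>) < \<epsilon>" using order_tendstoD(2)[OF F(2) \<epsilon>] .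
    moreover have "\<forall>\<^sub>F n in sequentially. dist (b n) a < \<epsilon>" using tendstoD[OF b(2) \<epsilon>] .
    ultimately have "\<forall>\<^sub>F n in sequentially. L2_norm \<mu> (\<lambda>\<omega>. F \<omega> - H n \<omega>) < \<epsilon> \<and> dist (b n) a < \<epsilon>"
      by eventually_elim simp
    then obtain n where "L2_norm \<mu> (\<lambda>\<omega>. F \<omega> - H n \<omega>) < \<epsilon>" "dist (b n) a < \<epsilon>"
      using eventually_happens'[OF sequentially_bot] by blast
    then show "\<exists>b\<in>D. \<exists>H. ext b H \<and> norm (a - b) < \<epsilon> \<and> L2_norm \<mu> (\<lambda>\<omega>. F \<omega> - H \<omega>) < \<epsilon>"
      using b(1) H by (intro bexI[of _ "b n"] exI[of _ "H n"]) (auto simp: dist_norm norm_minus_commute)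
  qed
  then show ?thesis by blast
qed

end

context circle_measure
begin

lemma graph_closure_self: "b \<in> D \<Longrightarrow> ext b H \<Longrightarrow> graph_closure D b H"
  unfolding graph_closure_def by (auto simp: ext_def L2_norm_def intro!: bexI[of _ b] exI[of _ H])

lemma graph_closure_cong_AE:
  assumes "graph_closure D a F" "G \<in> L2_space \<mu>" "AE \<omega> in \<mu>. F \<omega> = G \<omega>"
  shows "graph_closure D a G"
proof -
  have F: "F \<in> L2_space \<mu>" using assms(1) by (simp add: graph_closure_def)
  have "L2_norm \<mu> (\<lambda>\<omega>. G \<omega> - H \<omega>) = L2_norm \<mu> (\<lambda>\<omega>. F \<omega> - H \<omega>)" if "ext b H" for b H
  proof (rule L2_norm_cong_AE)
    have H: "H \<in> L2_space \<mu>" using that by (simp add: ext_def)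
    show "(\<lambda>\<omega>. G \<omega> - H \<omega>) \<in> borel_measurable \<mu>" "(\<lambda>\<omega>. F \<omega> - H \<omega>) \<in> borel_measurable \<mu>"
      using L2_space_diff[OF assms(2) H] L2_space_diff[OF F H] by (auto simp: L2_space_def)
    show "AE \<omega> in \<mu>. G \<omega> - H \<omega> = F \<omega> - H \<omega>" using assms(3) by eventually_elim simp
  qed
  then show ?thesis using assms(1,2) unfolding graph_closure_def by metis
qed

lemma graph_closure_add:
  assumes D: "subspace D" and a: "graph_closure D a F" and b: "graph_closure D b G"
  shows "graph_closure D (a + b) (\<lambda>\<omega>. F \<omega> + G \<omega>)"
  unfolding graph_closure_def
proof (intro conjI allI impI)
  have F: "F \<in> L2_space \<mu>" and G: "G \<in> L2_space \<mu>" using a b by (simp_all add: graph_closure_def)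
  then show "(\<lambda>\<omega>. F \<omega> + G \<omega>) \<in> L2_space \<mu>" by (rule L2_space_add)
  fix \<epsilon> :: real assume "0 < \<epsilon>"
  then have e: "0 < \<epsilon> / 2" by simp
  obtain x X where x: "x \<in> D" "ext x X" "norm (a - x) < \<epsilon> / 2" "L2_norm \<mu> (\<lambda>\<omega>. F \<omega> - X \<omega>) < \<epsilon> / 2"
    using a e unfolding graph_closure_def by blast
  obtain y Y where y: "y \<in> D" "ext y Y" "norm (b - y) < \<epsilon> / 2" "L2_norm \<mu> (\<lambda>\<omega>. G \<omega> - Y \<omega>) < \<epsilon> / 2"
    using b e unfolding graph_closure_def by blast
  have XY: "X \<in> L2_space \<mu>" "Y \<in> L2_space \<mu>" using x(2) y(2) by (simp_all add: ext_def)
  have "norm (a + b - (x + y)) < \<epsilon>"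
    using norm_triangle_ineq[of "a - x" "b - y"] x(3) y(3) by (simp add: algebra_simps)
  moreover have "L2_norm \<mu> (\<lambda>\<omega>. F \<omega> + G \<omega> - (X \<omega> + Y \<omega>)) < \<epsilon>"
  proof -
    have "L2_norm \<mu> (\<lambda>\<omega>. F \<omega> + G \<omega> - (X \<omega> + Y \<omega>)) = L2_norm \<mu> (\<lambda>\<omega>. (F \<omega> - X \<omega>) + (G \<omega> - Y \<omega>))"
      by (rule L2_norm_cong) (simp add: algebra_simps)
    also have "\<dots> \<le> L2_norm \<mu> (\<lambda>\<omega>. F \<omega> - X \<omega>) + L2_norm \<mu> (\<lambda>\<omega>. G \<omega> - Y \<omega>)"
      by (intro L2_norm_triangle L2_space_diff F G XY)
    finally show ?thesis using x(4) y(4) by linarith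
  qed
  ultimately show "\<exists>b'\<in>D. \<exists>H. ext b' H \<and> norm (a + b - b') < \<epsilon> \<and> L2_norm \<mu> (\<lambda>\<omega>. F \<omega> + G \<omega> - H \<omega>) < \<epsilon>"
    using subspace_add[OF D x(1) y(1)] ext_add[OF x(2) y(2)]
    by (intro bexI[of _ "x + y"] exI[of _ "\<lambda>\<omega>. X \<omega> + Y \<omega>"]) auto
qed

lemma graph_closure_cscale:
  assumes D: "\<And>b. b \<in> D \<Longrightarrow> cscale c b \<in> D" and a: "graph_closure D a F"
  shows "graph_closure D (cscale c a) (\<lambda>\<omega>. c * F \<omega>)"
  unfolding graph_closure_def
proof (intro conjI allI impI)
  show "(\<lambda>\<omega>. c * F \<omega>) \<in> L2_space \<mu>" using a by (simp add: graph_closure_def L2_space_scale)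
  fix \<epsilon> :: real assume e: "0 < \<epsilon>"
  have c: "0 < 1 + cmod c" by (simp add: add_pos_nonneg)
  define \<delta> where "\<delta> = \<epsilon> / (1 + cmod c)"
  have \<delta>: "0 < \<delta>" "cmod c * \<delta> < \<epsilon>" using e c by (auto simp: \<delta>_def field_simps)
  obtain x X where x: "x \<in> D" "ext x X" "norm (a - x) < \<delta>" "L2_norm \<mu> (\<lambda>\<omega>. F \<omega> - X \<omega>) < \<delta>"
    using a \<delta>(1) unfolding graph_closure_def by blast
  have "norm (cscale c a - cscale c x) = cmod c * norm (a - x)"
    by (simp add: norm_cscale flip: cscale_simps)
  also have "\<dots> \<le> cmod c * \<delta>" using x(3) by (intro mult_left_mono) auto
  finally have 1: "norm (cscale c a - cscale c x) < \<epsilon>" using \<delta>(2) by linarith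
  have "L2_norm \<mu> (\<lambda>\<omega>. c * F \<omega> - c * X \<omega>) = cmod c * L2_norm \<mu> (\<lambda>\<omega>. F \<omega> - X \<omega>)"
    unfolding L2_norm_scale[symmetric] by (simp add: right_diff_distrib)
  also have "\<dots> \<le> cmod c * \<delta>" using x(4) by (intro mult_left_mono) auto
  finally have 2: "L2_norm \<mu> (\<lambda>\<omega>. c * F \<omega> - c * X \<omega>) < \<epsilon>" using \<delta>(2) by linarith
  show "\<exists>b\<in>D. \<exists>H. ext b H \<and> norm (cscale c a - b) < \<epsilon> \<and> L2_norm \<mu> (\<lambda>\<omega>. c * F \<omega> - H \<omega>) < \<epsilon>"
    using D[OF x(1)] ext_cscale[OF x(2), of c] 1 2
    by (intro bexI[of _ "cscale c x"] exI[of _ "\<lambda>\<omega>. c * X \<omega>"]) auto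
qed

text \<open>Uniform continuity gives uniform convergence of the dilates.\<close>

lemma ext_disc_algebra:
  assumes g: "continuous_on (cball 0 1) g" and a: "\<And>z. cmod z < 1 \<Longrightarrow> g z = fn a z"
  shows "ext a g"
  unfolding ext_def
proof
  have sub: "sphere 0 1 \<subseteq> (cball 0 1 :: complex set)" by auto
  show gL: "g \<in> L2_space \<mu>" by (rule continuous_L2[OF continuous_on_subset[OF g sub]])
  show "((\<lambda>r. L2_norm \<mu> (\<lambda>\<omega>. g \<omega> - dilate (fn a) r \<omega>)) \<longlongrightarrow> 0) (at_left 1)"
  proof (rule tendstoI)
    fix e :: real assume e: "0 < e"
    have t: "0 < 1 + total" by (simp add: add_pos_nonneg)
    define e' where "e' = e / (1 + total)"
    have e': "0 < e'" "e' * total < e" using e t by (auto simp: e'_def field_simps)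
    have "uniformly_continuous_on (cball 0 1) g" by (rule compact_uniformly_continuous[OF g]) simp
    then obtain d where d: "0 < d"
      "\<And>x y. x \<in> cball 0 1 \<Longrightarrow> y \<in> cball 0 1 \<Longrightarrow> dist y x < d \<Longrightarrow> dist (g y) (g x) < e'"
      using e'(1) unfolding uniformly_continuous_on_def by meson
    have "\<forall>\<^sub>F r in at_left 1. 1 - d < r"
      using d(1) eventually_at_left_real[of "1 - d" 1] by (auto elim: eventually_mono)
    then show "\<forall>\<^sub>F r in at_left 1. dist (L2_norm \<mu> (\<lambda>\<omega>. g \<omega> - dilate (fn a) r \<omega>)) 0 < e"
      using eventually_at_left_1
    proof eventually_elim
      case (elim r)
      have "L2_norm \<mu> (\<lambda>\<omega>. g \<omega> - dilate (fn a) r \<omega>) \<le> e' * total"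
      proof (rule L2_norm_le)
        show "(\<lambda>\<omega>. g \<omega> - dilate (fn a) r \<omega>) \<in> L2_space \<mu>" using elim by (intro L2_space_diff gL dilate_L2) auto
        fix \<omega> :: complex assume \<omega>: "cmod \<omega> = 1"
        have "\<omega> - of_real r * \<omega> = of_real (1 - r) * \<omega>" by (simp add: algebra_simps)
        then have "cmod (\<omega> - of_real r * \<omega>) = \<bar>1 - r\<bar> * cmod \<omega>" by (simp only: norm_mult norm_of_real)
        then have "dist \<omega> (of_real r * \<omega>) < d" using elim \<omega> by (simp add: dist_norm)
        then have "dist (g \<omega>) (g (of_real r * \<omega>)) < e'" using d(2)[of "of_real r * \<omega>" \<omega>] elim \<omega> by (simp add: norm_mult)
        then show "cmod (g \<omega> - dilate (fn a) r \<omega>) \<le> e'"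
          using a[of "of_real r * \<omega>"] elim \<omega> by (simp add: dilate_def norm_mult dist_norm)
      qed (use e' in simp)
      then show ?case using e'(2) by simp
    qed
  qed
qed

definition extendable :: "ell2 \<Rightarrow> bool" where "extendable a \<longleftrightarrow> (\<exists>F. ext a F)"

definition extension :: "ell2 \<Rightarrow> complex \<Rightarrow> complex" where "extension a = (SOME F. ext a F)"

lemma ext_extension: "extendable a \<Longrightarrow> ext a (extension a)"
  unfolding extendable_def extension_def by (rule someI_ex[where P = "ext a"])

lemma extendable_add: "extendable a \<Longrightarrow> extendable b \<Longrightarrow> extendable (a + b)"
  unfolding extendable_def using ext_add by blast

lemma extendable_diff: "extendable a \<Longrightarrow> extendable b \<Longrightarrow> extendable (a - b)"
  unfolding extendable_def using ext_diff by blast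

lemma extendable_cscale: "extendable a \<Longrightarrow> extendable (cscale c a)"
  unfolding extendable_def using ext_cscale by blast

lemma extendable_bshift: "extendable a \<Longrightarrow> extendable (bshift a)"
  unfolding extendable_def using ext_bshift by blast

lemma L2_inner_cong_AE:
  assumes L: "F \<in> L2_space \<mu>" "F' \<in> L2_space \<mu>" "G \<in> L2_space \<mu>" "G' \<in> L2_space \<mu>"
    and eq: "AE \<omega> in \<mu>. F \<omega> = F' \<omega>" "AE \<omega> in \<mu>. G \<omega> = G' \<omega>"
  shows "L2_inner \<mu> F G = L2_inner \<mu> F' G'"
  unfolding L2_inner_def
proof (rule integral_cong_AE)
  show "(\<lambda>\<omega>. F \<omega> * cnj (G \<omega>)) \<in> borel_measurable \<mu>" "(\<lambda>\<omega>. F' \<omega> * cnj (G' \<omega>)) \<in> borel_measurable \<mu>"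
    by (intro borel_measurable_integrable L2_product_integrable L)+
  show "AE \<omega> in \<mu>. F \<omega> * cnj (G \<omega>) = F' \<omega> * cnj (G' \<omega>)" using eq by eventually_elim simp
qed

text \<open>The inner product of extensions, which does not depend on their choice (\<open>gram_eq\<close>).\<close>

definition gram :: "ell2 \<Rightarrow> ell2 \<Rightarrow> complex" where
  "gram a b = L2_inner \<mu> (extension a) (extension b)"

lemma gram_eq:
  assumes "ext a F" "ext b G"
  shows "gram a b = L2_inner \<mu> F G"
proof -
  have e: "ext a (extension a)" "ext b (extension b)"
    using assms by (auto intro!: ext_extension simp: extendable_def)
  show ?thesis
    unfolding gram_def
    by (rule L2_inner_cong_AE) (use assms e ext_unique(2)[OF e(1) assms(1)] ext_unique(2)[OF e(2) assms(2)] in \<open>auto simp: ext_def\<close>)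
qed

lemma gram_self: "ext a F \<Longrightarrow> gram a a = of_real ((L2_norm \<mu> F)\<^sup>2)"
  by (simp only: gram_eq L2_inner_self)

text \<open>The theorem for reproducing measures amounts to showing that this form vanishes on the kernels and the
  backward shift of \<open>p\<close>.\<close>

definition defect :: "ell2 \<Rightarrow> ell2 \<Rightarrow> complex" where
  "defect a b = gram a b - cinner a b"

lemma defect_commute: "defect b a = cnj (defect a b)"
  unfolding defect_def gram_def
  by (simp add: L2_inner_commute[of \<mu> "extension b"] cinner_commute[of b a])

lemma defect_cscale_left:
  assumes "extendable a" "extendable b"
  shows "defect (cscale c a) b = c * defect a b"
  using gram_eq[OF ext_cscale[OF ext_extension[OF assms(1)], of c] ext_extension[OF assms(2)]]
  by (simp add: defect_def gram_def L2_inner_scale_left cinner_scale_left right_diff_distrib)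

lemma defect_add_left:
  assumes "extendable a" "extendable b" "extendable c"
  shows "defect (a + b) c = defect a c + defect b c"
proof -
  note e = assms[THEN ext_extension]
  show ?thesis
    using gram_eq[OF ext_add[OF e(1,2)] e(3)] e
    by (simp add: defect_def gram_def L2_inner_add_left ext_def cinner_add_left)
qed

lemma defect_cscale_right: "extendable a \<Longrightarrow> extendable b \<Longrightarrow> defect a (cscale c b) = cnj c * defect a b"
  by (metis defect_commute defect_cscale_left complex_cnj_mult)

lemma defect_add_right: "extendable a \<Longrightarrow> extendable b \<Longrightarrow> extendable c \<Longrightarrow> defect a (b + c) = defect a b + defect a c"
  by (metis defect_commute defect_add_left complex_cnj_add)

lemma minus_eq_cscale: "a - b = a + cscale (-1) b"
  by (rule ell2_eqI) simp

lemma defect_diff_left: "extendable a \<Longrightarrow> extendable b \<Longrightarrow> extendable c \<Longrightarrow> defect (a - b) c = defect a c - defect b c"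
  unfolding minus_eq_cscale by (simp add: defect_add_left defect_cscale_left extendable_cscale)

lemma defect_diff_right: "extendable a \<Longrightarrow> extendable b \<Longrightarrow> extendable c \<Longrightarrow> defect a (b - c) = defect a b - defect a c"
  unfolding minus_eq_cscale by (simp add: defect_add_right defect_cscale_right extendable_cscale)

lemma defect_self: "ext a F \<Longrightarrow> defect a a = of_real ((L2_norm \<mu> F)\<^sup>2 - (norm a)\<^sup>2)"
  by (simp only: defect_def gram_self cinner_self of_real_diff)

lemma norm_eq_if_defect_0: "ext a F \<Longrightarrow> defect a a = 0 \<Longrightarrow> L2_norm \<mu> F = norm a"
  unfolding defect_self of_real_eq_0_iff by (rule power2_eq_imp_eq) (simp_all add: L2_norm_nonneg)

lemma subspace_extendable: "subspace {a. extendable a}"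
proof (rule subspaceI)
  show "0 \<in> {a. extendable a}"
    by (auto simp: extendable_def ext_def dilate_def L2_norm_def intro!: exI[of _ "\<lambda>_. 0"] L2_const)
qed (auto simp: scaleR_eq_cscale extendable_add extendable_cscale)

lemma subspace_defect_0:
  assumes "extendable b"
  shows "subspace {a. extendable a \<and> defect a b = t * cinner a b}"
proof (rule subspaceI)
  have "extendable 0" using subspace_0[OF subspace_extendable] by simp
  moreover from this have "defect 0 b = 0" using defect_cscale_left[of 0 b 0] assms by (simp add: cscale_simps)
  ultimately show "0 \<in> {a. extendable a \<and> defect a b = t * cinner a b}" by simp
qed (use assms in \<open>auto simp: scaleR_eq_cscale extendable_add extendable_cscale defect_add_left
      defect_cscale_left cinner_add_left cinner_scale_left distrib_left\<close>)

text \<open>Multiplication by \<open>\<omega>\<close> is unitary on \<open>L2(\<mu>)\<close>, and the shift is isometric on the Hardy space.\<close>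

lemma defect_bshift:
  assumes a: "extendable a" "coef a 0 = 0" and b: "extendable b" "coef b 0 = 0"
  shows "defect (bshift a) (bshift b) = defect a b"
proof -
  note e = ext_extension[OF a(1)] ext_extension[OF b(1)]
  have "gram (bshift a) (bshift b) = L2_inner \<mu> (\<lambda>\<omega>. cnj \<omega> * extension a \<omega>) (\<lambda>\<omega>. cnj \<omega> * extension b \<omega>)"
    using gram_eq[OF ext_bshift[OF e(1)] ext_bshift[OF e(2)]] a(2) b(2) by simp
  also have "\<dots> = gram a b"
    unfolding gram_def L2_inner_def
  proof (rule Bochner_Integration.integral_cong[OF refl])
    fix \<omega> assume "\<omega> \<in> space \<mu>"
    then have "cnj \<omega> * \<omega> = 1" using complex_norm_square[of \<omega>] by (simp add: mult.commute)
    then show "cnj \<omega> * extension a \<omega> * cnj (cnj \<omega> * extension b \<omega>) = extension a \<omega> * cnj (extension b \<omega>)"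
      by (metis complex_cnj_cnj complex_cnj_mult mult.assoc mult.commute mult_1)
  qed
  finally show ?thesis using cinner_split_head[of a b] a(2) by (simp add: defect_def)
qed

end

text \<open>The quotient \<open>(g z - g 0) / z\<close> is continuous off 0, and near 0 the power series takes over.\<close>

lemma (in inner_fn) bshift_disc_algebra:
  assumes "in_disc_algebra a"
  shows "in_disc_algebra (bshift a)"
proof -
  obtain g where g: "continuous_on (cball 0 1) g" "\<And>z. cmod z < 1 \<Longrightarrow> g z = fn a z"
    using assms unfolding in_disc_algebra_def by blast
  define h where "h z = (if cmod z < 1 then fn (bshift a) z else (g z - fn a 0) / z)" for z
  have eq: "h z = (g z - fn a 0) / z" if "z \<noteq> 0" for z
    using fn_bshift[of z a] g(2)[of z] that by (auto simp: h_def field_simps)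
  have 1: "continuous_on (cball 0 1 - {0}) h"
  proof (rule continuous_on_eq)
    show "continuous_on (cball 0 1 - {0}) (\<lambda>z. (g z - fn a 0) / z)"
      by (intro continuous_intros continuous_on_subset[OF g(1)]) auto
  qed (simp add: eq)
  have 2: "continuous_on (ball 0 1) h"
    by (rule continuous_on_eq[OF fn_continuous[of "bshift a"]]) (simp add: h_def)
  have u: "(cball 0 1 - {0}) \<union> ball 0 1 = (cball 0 1 :: complex set)" by auto
  have "continuous_on ((cball 0 1 - {0}) \<union> ball 0 1) h"
  proof (rule continuous_on_Un_local_open[OF _ _ 1 2])
    show "openin (top_of_set ((cball 0 1 - {0}) \<union> ball 0 1)) (cball 0 1 - {0::complex})"
      unfolding u by (rule openin_delete) simp
    show "openin (top_of_set ((cball 0 1 - {0}) \<union> ball 0 1)) (ball 0 (1::real) :: complex set)"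
      unfolding u by (rule open_subset) auto
  qed
  then have "continuous_on (cball 0 1) h" unfolding u .
  moreover have "\<forall>z. cmod z < 1 \<longrightarrow> h z = fn (bshift a) z" by (simp add: h_def)
  ultimately show ?thesis unfolding in_disc_algebra_def by blast
qed

text \<open>The span of the kernels is invariant under the backward shift only up to multiples of \<open>bshift p\<close>.\<close>

lemma (in inner_fn) bshift_ker:
  assumes z: "cmod z < 1"
  shows "bshift (ker z) = cscale (cnj z) (ker z) - cscale (cnj (fn p z)) (bshift p)"
proof (rule shift_inject, rule fn_eq_imp_eq)
  fix w :: complex assume w: "cmod w < 1"
  have nz: "1 - cnj z * w \<noteq> 0"
  proof
    assume "1 - cnj z * w = 0"
    then have "cmod (cnj z * w) = 1" by (metis eq_iff_diff_eq_0 norm_one)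
    moreover have "cmod (cnj z * w) < 1" using z w mult_strict_mono'[of "cmod z" 1 "cmod w" 1] by (simp add: norm_mult)
    ultimately show False by simp
  qed
  have "fn (shift (bshift (ker z))) w = fn (ker z) w - fn (ker z) 0"
    by (simp add: fn_shift w fn_bshift)
  moreover have "fn (shift (cscale (cnj z) (ker z) - cscale (cnj (fn p z)) (bshift p))) w =
      w * cnj z * fn (ker z) w - cnj (fn p z) * (fn p w - fn p 0)"
    unfolding fn_bshift[OF w, of p, symmetric] using w by (simp add: fn_shift fn_diff fn_cscale algebra_simps)
  moreover have "fn (ker z) w - fn (ker z) 0 = w * cnj z * fn (ker z) w - cnj (fn p z) * (fn p w - fn p 0)"
  proof -
    have "fn (ker z) w * (1 - cnj z * w) = 1 - cnj (fn p z) * fn p w" using nz by (simp add: fn_ker[OF z w])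
    moreover have "fn (ker z) 0 = 1 - cnj (fn p z) * fn p 0" using fn_ker[OF z, of 0] by simp
    ultimately show ?thesis by (simp add: algebra_simps)
  qed
  ultimately show "fn (shift (bshift (ker z))) w =
      fn (shift (cscale (cnj z) (ker z) - cscale (cnj (fn p z)) (bshift p))) w" by simp
qed

locale inner_circle = inner_fn p + circle_measure \<mu> for p \<mu>
begin

definition isometric :: bool where
  "isometric \<longleftrightarrow> (\<forall>a\<in>K. \<exists>F. ext a F \<and> L2_norm \<mu> F = norm a)"

lemma isometricI:
  assumes D: "subspace D" "K \<subseteq> closure D" and ex: "\<And>b. b \<in> D \<Longrightarrow> extendable b"
    and iso: "\<And>b H. b \<in> D \<Longrightarrow> ext b H \<Longrightarrow> L2_norm \<mu> H = norm b"
    and inv: "\<And>b H. b \<in> D \<Longrightarrow> ext b H \<Longrightarrow> graph_closure D (bshift b) (\<lambda>\<omega>. cnj \<omega> * (H \<omega> - coef b 0))"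
  shows isometric
  unfolding isometric_def
proof
  fix a assume "a \<in> K"
  then have "a \<in> closure D" using D(2) by blast
  from graph_closure_exists[OF D(1) ex[unfolded extendable_def] iso this] obtain F where F: "graph_closure D a F" ..
  have "ext a F" "L2_norm \<mu> F = norm a" by (rule ext_of_closure[where D = D, OF _ _ F]; use iso inv in blast)+
  then show "\<exists>F. ext a F \<and> L2_norm \<mu> F = norm a" by blast
qed

lemma isometric_extendable: "isometric \<Longrightarrow> a \<in> K \<Longrightarrow> extendable a"
  unfolding isometric_def extendable_def by blast

lemma isometric_norm:
  assumes "isometric" "a \<in> K" "ext a F"
  shows "L2_norm \<mu> F = norm a"
proof -
  obtain G where G: "ext a G" "L2_norm \<mu> G = norm a" using assms(1,2) unfolding isometric_def by blast
  have "L2_norm \<mu> F = L2_norm \<mu> G"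
    by (rule L2_norm_cong_AE[OF _ _ ext_unique(2)[OF assms(3) G(1)]]) (use assms(3) G(1) in \<open>auto simp: ext_def L2_space_def\<close>)
  then show ?thesis using G(2) by simp
qed

abbreviation K_disc :: "ell2 set" where "K_disc \<equiv> {a \<in> K. in_disc_algebra a}"

lemma K_disc_inv: "b \<in> K_disc \<Longrightarrow> ext b H \<Longrightarrow> graph_closure K_disc (bshift b) (\<lambda>\<omega>. cnj \<omega> * (H \<omega> - coef b 0))"
  by (rule graph_closure_self[OF _ ext_bshift]) (simp_all add: K_bshift bshift_disc_algebra)

lemma K_disc_extendable: "b \<in> K_disc \<Longrightarrow> extendable b"
  unfolding extendable_def in_disc_algebra_def using ext_disc_algebra by blast

lemma isometric_if_disc_algebra:
  assumes "\<And>a g. a \<in> K \<Longrightarrow> continuous_on (cball 0 1) g \<Longrightarrow> (\<And>z. cmod z < 1 \<Longrightarrow> g z = fn a z) \<Longrightarrow> L2_norm \<mu> g = norm a"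
  shows isometric
proof (rule isometricI[OF subspace_disc_algebra disc_algebra_dense])
  fix b H assume b: "b \<in> K_disc" "ext b H"
  then obtain g where g: "continuous_on (cball 0 1) g" "\<And>z. cmod z < 1 \<Longrightarrow> g z = fn b z"
    unfolding in_disc_algebra_def by blast
  note e = ext_disc_algebra[OF g]
  have "L2_norm \<mu> H = L2_norm \<mu> g"
    by (rule L2_norm_cong_AE[OF _ _ ext_unique(2)[OF b(2) e]]) (use b(2) e in \<open>auto simp: ext_def L2_space_def\<close>)
  then show "L2_norm \<mu> H = norm b" using assms[of b g] g b(1) by simp
qed (use K_disc_inv K_disc_extendable in auto)

text \<open>Polarization.\<close>

lemma isometric_defect:
  assumes iso: isometric and a: "a \<in> K" and b: "b \<in> K"
  shows "defect a b = 0"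
proof -
  have self: "defect c c = 0" if "c \<in> K" for c
    using defect_self[OF ext_extension[OF isometric_extendable[OF iso that]]]
      isometric_norm[OF iso that ext_extension[OF isometric_extendable[OF iso that]]] by simp
  have re: "Re (defect a b) = 0" if "a \<in> K" "b \<in> K" for a b
  proof -
    note e = isometric_extendable[OF iso that(1)] isometric_extendable[OF iso that(2)]
    have "0 = defect a a + defect a b + defect b a + defect b b"
      using self[OF K_add[OF that]] e by (simp add: defect_add_left defect_add_right extendable_add ac_simps)
    then have "Re (defect a b + cnj (defect a b)) = Re 0"
      unfolding self[OF that(1)] self[OF that(2)] defect_commute[of b a] by simp
    then show ?thesis by simp
  qed
  have "Re (defect (cscale (- \<i>) a) b) = 0" by (rule re[OF K_cscale[OF a] b])
  then have "Im (defect a b) = 0"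
    using isometric_extendable[OF iso] a b by (simp add: defect_cscale_left)
  with re[OF a b] show ?thesis by (simp add: complex_eq_iff)
qed

end

section \<open>Measures that reproduce the kernel\<close>

lemma shift_eq_0I:
  assumes "\<And>w. cmod w < 1 \<Longrightarrow> fn (shift a) w = 0"
  shows "a = 0"
  by (rule shift_inject, rule fn_eq_imp_eq) (use assms in \<open>simp add: fn_shift[of _ 0]\<close>)

locale reproducing = inner_circle +
  assumes extendable_ker: "cmod z < 1 \<Longrightarrow> extendable (ker z)"
    and defect_ker: "cmod z < 1 \<Longrightarrow> cmod w < 1 \<Longrightarrow> defect (ker z) (ker w) = 0"
begin

abbreviation q :: ell2 where "q \<equiv> bshift p"

definition n :: real where "n = 1 - (cmod (fn p 0))\<^sup>2"

lemma norm_q: "(norm q)\<^sup>2 = n"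
  by (simp add: norm_bshift_power2 norm_p n_def fn_0)

text \<open>Solve \<open>bshift_ker\<close> for \<open>bshift p\<close> at a point where \<open>fn p\<close> does not vanish.\<close>

lemma extendable_q: "extendable q"
proof -
  obtain z where z: "cmod z < 1" "fn p z \<noteq> 0"
  proof (rule ccontr)
    assume "\<not> thesis"
    then have "\<And>z. cmod z < 1 \<Longrightarrow> fn p z = fn 0 z" using that by auto
    then have "p = 0" by (rule fn_eq_imp_eq)
    then show False using norm_p by simp
  qed
  have "cscale (cnj (fn p z)) q = cscale (cnj z) (ker z) - bshift (ker z)"
    using bshift_ker[OF z(1)] by simp
  then have "q = cscale (1 / cnj (fn p z)) (cscale (cnj z) (ker z) - bshift (ker z))"
    using z(2) by (metis complex_cnj_zero_iff cscale_simps(1,6) nonzero_divide_eq_eq)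
  then show ?thesis
    using extendable_cscale[OF extendable_diff[OF extendable_cscale[OF extendable_ker[OF z(1)]] extendable_bshift[OF extendable_ker[OF z(1)]]]]
    by metis
qed

text \<open>The point \<open>0\<close> is left out because the relations below determine \<open>w * defect q (ker w)\<close> only.\<close>

definition kernels :: "ell2 set" where
  "kernels = {cscale c (ker w) | c w. cmod w < 1 \<and> w \<noteq> 0}"

definition K0 :: "ell2 set" where "K0 = span kernels"

lemma subspace_K0: "subspace K0" by (simp add: K0_def subspace_span)

lemma kernels_K0: "kernels \<subseteq> K0" by (simp add: K0_def span_superset)

lemma K0_induct: "a \<in> K0 \<Longrightarrow> subspace S \<Longrightarrow> kernels \<subseteq> S \<Longrightarrow> a \<in> S"
  unfolding K0_def using span_minimal by blast

lemma K0_extendable: "a \<in> K0 \<Longrightarrow> extendable a"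
  using K0_induct[OF _ subspace_extendable] extendable_ker extendable_cscale by (force simp: kernels_def)

lemma K0_K: "K0 \<subseteq> K"
  using K0_induct[OF _ subspace_K] by (force simp: kernels_def K_cscale ker_in_K)

lemma K0_cscale:
  assumes "a \<in> K0"
  shows "cscale c a \<in> K0"
proof -
  have "a \<in> {a. cscale c a \<in> K0}"
  proof (rule K0_induct[OF assms])
    show "subspace {a. cscale c a \<in> K0}"
    proof (rule subspaceI)
      fix r :: real and x assume "x \<in> {a. cscale c a \<in> K0}"
      then have "r *\<^sub>R cscale c x \<in> K0" using subspace_scale[OF subspace_K0] by simp
      then show "r *\<^sub>R x \<in> {a. cscale c a \<in> K0}" by (simp add: scaleR_eq_cscale cscale_simps mult.commute)
    qed (auto simp: cscale_simps subspace_0[OF subspace_K0] subspace_add[OF subspace_K0])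
    have "cscale c x \<in> kernels" if "x \<in> kernels" for x
      using that unfolding kernels_def by (auto simp: cscale_simps) blast
    then show "kernels \<subseteq> {a. cscale c a \<in> K0}" using kernels_K0 by blast
  qed
  then show ?thesis by simp
qed

text \<open>A function that vanishes off 0 vanishes.\<close>

lemma K0_dense: "K \<subseteq> closure K0"
proof (rule dense_if_no_orthogonal[OF subspace_K0 K0_K subspace_K closed_K])
  fix a assume a: "a \<in> K" and orth: "\<And>b. b \<in> K0 \<Longrightarrow> inner a b = 0"
  have "fn (shift a) w = 0" if w: "cmod w < 1" for w
  proof (cases "w = 0")
    case False
    have "cscale c (ker w) \<in> K0" for c using kernels_K0 w False by (auto simp: kernels_def)
    then have z: "inner a (cscale c (ker w)) = 0" for c by (rule orth)
    have "Re (cinner a (cscale 1 (ker w))) = 0" "Re (cinner a (cscale \<i> (ker w))) = 0"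
      unfolding Re_cinner by (rule z)+
    then have "cinner a (ker w) = 0" by (simp add: cinner_scale_right complex_eq_iff)
    then show ?thesis using cinner_ker[OF a w] w by (simp add: fn_shift)
  qed (simp add: fn_shift)
  then show "a = 0" by (rule shift_eq_0I)
qed

text \<open>The defect is sesquilinear and vanishes on pairs of kernels.\<close>

lemma defect_K0:
  assumes a: "a \<in> K0" and b: "b \<in> K0"
  shows "defect a b = 0"
proof -
  have 1: "defect a (ker w) = 0" if "cmod w < 1" for w
  proof -
    have "a \<in> {a. extendable a \<and> defect a (ker w) = 0 * cinner a (ker w)}"
      by (rule K0_induct[OF a subspace_defect_0[OF extendable_ker[OF that]]])
        (auto simp: kernels_def that extendable_cscale extendable_ker defect_cscale_left defect_ker)
    then show ?thesis by simp
  qed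
  then have "defect (ker w) a = 0" if "cmod w < 1" for w
    using defect_commute[of "ker w" a] that by simp
  then have "b \<in> {b. extendable b \<and> defect b a = 0 * cinner b a}"
    by (intro K0_induct[OF b subspace_defect_0[OF K0_extendable[OF a]]])
      (auto simp: kernels_def extendable_cscale extendable_ker defect_cscale_left K0_extendable[OF a])
  then show ?thesis using defect_commute[of b a] by simp
qed

definition D :: "complex \<Rightarrow> complex" where "D z = (fn p z - fn p 0) / of_real n"

text \<open>The combinations \<open>v z\<close> of \<open>ker z\<close> and \<open>ker 0\<close> vanish at 0.  Their backward shifts are
  \<open>cnj z * ker z - cnj (D z) * q\<close>, and their defects with each other are those of the \<open>v z\<close>, which are 0.\<close>

lemma defect_relation:
  assumes n: "n \<noteq> 0" and z: "cmod z < 1" and w: "cmod w < 1"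
  shows "cnj (z * defect q (ker z)) * D w + w * defect q (ker w) * cnj (D z) = cnj (D z) * D w * defect q q"
proof -
  define c where "c z = fn (ker z) 0 / of_real n" for z
  define v where "v z = ker z - cscale (c z) (ker 0)" for z
  have n0: "cnj (fn p 0) * fn p 0 = of_real (1 - n)"
    unfolding n_def using complex_norm_square[of "fn p 0"] by (simp add: mult.commute)
  have ker0: "fn (ker z) 0 = 1 - cnj (fn p z) * fn p 0" if "cmod z < 1" for z using fn_ker[OF that, of 0] by simp
  have v0: "coef (v z) 0 = 0" if "cmod z < 1" for z
    using n ker0[of 0] n0 by (simp add: v_def c_def flip: fn_0)
  have ev: "extendable (v z)" if "cmod z < 1" for z
    unfolding v_def using that by (intro extendable_diff extendable_cscale extendable_ker) auto
  have bv: "bshift (v z) = cscale (cnj z) (ker z) - cscale (cnj (D z)) q" if z: "cmod z < 1" for z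
  proof -
    have D: "cnj (D z) = cnj (fn p z) - c z * cnj (fn p 0)"
    proof -
      have "cnj (fn p z) * of_real n = cnj (fn p z) - cnj (fn p z) * fn p 0 * cnj (fn p 0)"
        using arg_cong[OF n0, of "\<lambda>x. cnj (fn p z) * x"] by (simp add: algebra_simps)
      then have "cnj (fn p z) - cnj (fn p 0) = cnj (fn p z) * of_real n - (1 - cnj (fn p z) * fn p 0) * cnj (fn p 0)"
        by (simp add: algebra_simps)
      then have "cnj (D z) = (cnj (fn p z) * of_real n - (1 - cnj (fn p z) * fn p 0) * cnj (fn p 0)) / of_real n"
        by (simp only: D_def complex_cnj_divide complex_cnj_diff complex_cnj_complex_of_real)
      moreover have "(u * of_real n - v * y) / of_real n = u - v / of_real n * y" for u v y :: complex
        using n by (simp add: diff_divide_distrib)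
      ultimately show ?thesis unfolding c_def ker0[OF z] by simp
    qed
    have step: "coef (ker z) (Suc i) = cnj z * coef (ker z) i - cnj (fn p z) * coef p (Suc i)" if "cmod z < 1" for z i
      using arg_cong[OF bshift_ker[OF that], of "\<lambda>x. coef x i"] by simp
    show ?thesis
      unfolding v_def bshift_linear D by (rule ell2_eqI) (simp add: step[OF z] step[of 0] algebra_simps)
  qed
  have "defect (v z) (v w) = 0"
    unfolding v_def using z w
    by (simp add: defect_diff_left defect_diff_right defect_cscale_left defect_cscale_right
        extendable_diff extendable_cscale extendable_ker defect_ker)
  then have "0 = defect (bshift (v z)) (bshift (v w))" using defect_bshift ev v0 z w by simp
  also have "\<dots> = - (cnj z * D w * defect (ker z) q) - cnj (D z) * (w * defect q (ker w)) + cnj (D z) * D w * defect q q"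
    unfolding bv[OF z] bv[OF w] using z w
    by (simp add: defect_diff_left defect_diff_right defect_cscale_left defect_cscale_right
        extendable_diff extendable_cscale extendable_ker extendable_q defect_ker algebra_simps)
  finally show ?thesis unfolding defect_commute[of "ker z"] by (simp add: algebra_simps)
qed

text \<open>The relations force \<open>w * defect q (ker w) = \<theta> * D w\<close> with \<open>2 * Re \<theta> = defect q q\<close>.  Since \<open>D w\<close> is
  \<open>w * fn q w / n\<close>, the inner products of extensions with \<open>U\<close> are those in \<open>K\<close> times
  \<open>\<sigma> = 1 + \<theta> / n\<close>, while \<open>(L2_norm \<mu> U)^2 = n * (2 * Re \<sigma> - 1)\<close>.  By the
  Cauchy--Schwarz inequality \<open>(cmod \<sigma>)^2 \<le> 2 * Re \<sigma> - 1\<close>, that is, \<open>(cmod (\<sigma> - 1))^2 \<le> 0\<close>.\<close>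

lemma defect_q:
  assumes n: "n \<noteq> 0"
  shows "defect q q = 0" "\<And>h. h \<in> K0 \<Longrightarrow> defect q h = 0"
proof -
  have npos: "0 < n" using norm_q n zero_le_power2[of "norm q"] by linarith
  have "\<exists>x. cmod x < 1 \<and> D x \<noteq> 0"
  proof (rule ccontr)
    assume no: "\<nexists>x. cmod x < 1 \<and> D x \<noteq> 0"
    have "fn (shift q) w = 0" if w: "cmod w < 1" for w
    proof -
      have "D w = 0" using no w by blast
      then show ?thesis using w n fn_bshift[OF w, of p] by (simp add: fn_shift D_def)
    qed
    then have "q = 0" by (rule shift_eq_0I)
    then show False using norm_q n by simp
  qed
  then obtain x where x: "cmod x < 1" "D x \<noteq> 0" by blast
  define s where "s w = w * defect q (ker w)" for w
  define \<theta> where "\<theta> = defect q q - cnj (s x / D x)"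
  have s: "s w = \<theta> * D w" if "cmod w < 1" for w
    using defect_relation[OF n x(1) that] x(2) by (simp add: s_def \<theta>_def field_simps)
  have "s x / D x = \<theta>" using s[OF x(1)] x(2) by simp
  with \<theta>_def have "\<theta> = defect q q - cnj \<theta>" by simp
  then have Q: "defect q q = of_real (2 * Re \<theta>)" by (simp add: complex_eq_iff)
  have sesq: "defect h q = cnj (\<theta> / of_real n) * cinner h q" if "h \<in> K0" for h
  proof -
    have "h \<in> {h. extendable h \<and> defect h q = cnj (\<theta> / of_real n) * cinner h q}"
    proof (rule K0_induct[OF that subspace_defect_0[OF extendable_q]], rule subsetI)
      fix y assume "y \<in> kernels"
      then obtain c w where y: "y = cscale c (ker w)" and w: "cmod w < 1" "w \<noteq> 0" by (auto simp: kernels_def)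
      have "w * defect q (ker w) = \<theta> * D w" using s[OF w(1)] by (simp add: s_def)
      also have "D w = w * fn q w / of_real n" using fn_bshift[OF w(1), of p] by (simp add: D_def)
      finally have "w * defect q (ker w) = w * (\<theta> / of_real n * fn q w)" by simp
      then have "defect q (ker w) = \<theta> / of_real n * cinner q (ker w)"
        unfolding cinner_ker[OF bshift_p_in_K w(1)] mult_cancel_left using w(2) by blast
      then have "defect (ker w) q = cnj (\<theta> / of_real n) * cinner (ker w) q"
        by (metis complex_cnj_mult defect_commute cinner_commute)
      then show "y \<in> {h. extendable h \<and> defect h q = cnj (\<theta> / of_real n) * cinner h q}"
        using w by (simp add: y extendable_cscale extendable_ker extendable_q defect_cscale_left cinner_scale_left)
    qed
    then show ?thesis by simp
  qed
  define \<sigma> where "\<sigma> = 1 + \<theta> / of_real n"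
  define U where "U = extension q"
  have U: "ext q U" unfolding U_def by (rule ext_extension[OF extendable_q])
  have gram: "cmod \<sigma> * cmod (cinner h q) \<le> L2_norm \<mu> U * norm h" if h: "h \<in> K0" for h
  proof -
    note e = ext_extension[OF K0_extendable[OF h]]
    have "gram h q = cnj \<sigma> * cinner h q" using sesq[OF h] by (simp add: defect_def \<sigma>_def algebra_simps)
    then have "cmod \<sigma> * cmod (cinner h q) = cmod (L2_inner \<mu> (extension h) U)"
      unfolding gram_def U_def by (simp only: norm_mult complex_mod_cnj)
    also have "\<dots> \<le> L2_norm \<mu> (extension h) * L2_norm \<mu> U"
      using e U by (intro L2_cauchy_schwarz) (auto simp: ext_def)
    also have "L2_norm \<mu> (extension h) = norm h" by (rule norm_eq_if_defect_0[OF e defect_K0[OF h h]])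
    finally show ?thesis by (simp add: mult.commute)
  qed
  \<comment> \<open>the Cauchy--Schwarz bound extends from \<open>K0\<close> to \<open>h = q\<close> by density\<close>
  have bound: "cmod \<sigma> * cmod (cinner q q) \<le> L2_norm \<mu> U * norm q"
  proof -
    have "q \<in> closure K0" using K0_dense bshift_p_in_K by blast
    then obtain h where h: "\<And>i. h i \<in> K0" "h \<longlonglongrightarrow> q" unfolding closure_sequential by blast
    show ?thesis
    proof (rule LIMSEQ_le)
      show "(\<lambda>i. cmod \<sigma> * cmod (cinner (h i) q)) \<longlonglongrightarrow> cmod \<sigma> * cmod (cinner q q)"
        by (intro tendsto_mult tendsto_const tendsto_norm bounded_linear.tendsto[OF bounded_linear_cinner_left h(2)])
      show "(\<lambda>i. L2_norm \<mu> U * norm (h i)) \<longlonglongrightarrow> L2_norm \<mu> U * norm q"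
        by (intro tendsto_mult tendsto_const tendsto_norm h(2))
    qed (use gram h(1) in auto)
  qed
  have "cmod (cinner q q) = n" unfolding cinner_self norm_q using npos by simp
  then have "(cmod \<sigma> * n)\<^sup>2 \<le> (L2_norm \<mu> U * norm q)\<^sup>2" using bound npos by (intro power_mono) auto
  then have "(cmod \<sigma>)\<^sup>2 * n * n \<le> (L2_norm \<mu> U)\<^sup>2 * n"
    unfolding power_mult_distrib norm_q by (simp add: power2_eq_square mult.assoc)
  then have le: "(cmod \<sigma>)\<^sup>2 * n \<le> (L2_norm \<mu> U)\<^sup>2" using npos by simp
  have "(L2_norm \<mu> U)\<^sup>2 - n = 2 * Re \<theta>" using Q unfolding defect_self[OF U] norm_q of_real_eq_iff .
  moreover have "Re \<theta> = n * (Re \<sigma> - 1)" using npos by (simp add: \<sigma>_def)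
  ultimately have "(cmod \<sigma>)\<^sup>2 * n \<le> (2 * Re \<sigma> - 1) * n" using le by (simp add: algebra_simps)
  then have "(cmod \<sigma>)\<^sup>2 \<le> 2 * Re \<sigma> - 1" using npos by simp
  then have "(Re \<sigma> - 1)\<^sup>2 + (Im \<sigma>)\<^sup>2 \<le> 0" unfolding cmod_power2 by (simp add: power2_diff)
  then have "\<sigma> = 1" by (simp add: complex_eq_iff sum_power2_le_zero_iff)
  then have \<theta>: "\<theta> = 0" using n by (simp add: \<sigma>_def)
  show "defect q q = 0" using Q by (simp add: \<theta>)
  show "defect q h = 0" if "h \<in> K0" for h using sesq[OF that] defect_commute[of q h] by (simp add: \<theta>)
qed

text \<open>If \<open>n = 0\<close> then \<open>fn p\<close> is constant and \<open>q = 0\<close>; otherwise the defect of \<open>q - h\<close> vanishes for all \<open>h\<close> in \<open>K0\<close>, so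
  approximation of \<open>q\<close> from \<open>K0\<close> carries over to the extensions.\<close>

lemma graph_closure_q:
  assumes U: "ext q U"
  shows "graph_closure K0 q U"
proof (cases "n = 0")
  case True
  then have "q = 0" using norm_q by simp
  then have "ext 0 U" using U by simp
  have "L2_norm \<mu> (\<lambda>\<omega>. U \<omega> - 0) = 0" using ext_zero_norm[OF \<open>ext 0 U\<close>] by simp
  moreover have "ext 0 (\<lambda>_. 0)" using ext_diff[OF \<open>ext 0 U\<close> \<open>ext 0 U\<close>] by simp
  ultimately show ?thesis
    unfolding graph_closure_def \<open>q = 0\<close> using \<open>ext 0 U\<close> subspace_0[OF subspace_K0]
    by (auto simp: ext_def[of 0 U] intro!: bexI[of _ 0] exI[of _ "\<lambda>_. 0"])
next
  case False
  show ?thesis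
    unfolding graph_closure_def
  proof (intro conjI allI impI)
    show "U \<in> L2_space \<mu>" using U by (simp add: ext_def)
    fix \<epsilon> :: real assume e: "0 < \<epsilon>"
    have "q \<in> closure K0" using K0_dense bshift_p_in_K by blast
    then obtain h where h: "h \<in> K0" "dist h q < \<epsilon>" using e unfolding closure_approachable by blast
    note H = ext_extension[OF K0_extendable[OF h(1)]]
    have "defect (q - h) (q - h) = 0"
      using K0_extendable[OF h(1)] extendable_q defect_q[OF False] h(1) defect_K0[OF h(1) h(1)]
      by (simp add: defect_diff_left defect_diff_right extendable_diff defect_commute[of h q])
    from norm_eq_if_defect_0[OF ext_diff[OF U H] this]
    have "L2_norm \<mu> (\<lambda>\<omega>. U \<omega> - extension h \<omega>) = norm (q - h)" .
    then show "\<exists>b\<in>K0. \<exists>H. ext b H \<and> norm (q - b) < \<epsilon> \<and> L2_norm \<mu> (\<lambda>\<omega>. U \<omega> - H \<omega>) < \<epsilon>"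
      using h H by (intro bexI[of _ h] exI[of _ "extension h"]) (auto simp: dist_norm norm_minus_commute)
  qed
qed

lemma K0_bshift:
  assumes "b \<in> K0"
  shows "\<exists>h\<in>K0. \<exists>\<gamma>. bshift b = h + cscale \<gamma> q"
proof -
  have "b \<in> {b. \<exists>h\<in>K0. \<exists>\<gamma>. bshift b = h + cscale \<gamma> q}"
  proof (rule K0_induct[OF assms])
    show "subspace {b. \<exists>h\<in>K0. \<exists>\<gamma>. bshift b = h + cscale \<gamma> q}"
    proof (rule subspaceI)
      show "0 \<in> {b. \<exists>h\<in>K0. \<exists>\<gamma>. bshift b = h + cscale \<gamma> q}"
        using subspace_0[OF subspace_K0] by (auto intro!: bexI[of _ 0] exI[of _ 0] ell2_eqI)
    next
      fix x y assume "x \<in> {b. \<exists>h\<in>K0. \<exists>\<gamma>. bshift b = h + cscale \<gamma> q}" "y \<in> {b. \<exists>h\<in>K0. \<exists>\<gamma>. bshift b = h + cscale \<gamma> q}"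
      then obtain h \<gamma> h' \<gamma>' where "h \<in> K0" "bshift x = h + cscale \<gamma> q" "h' \<in> K0" "bshift y = h' + cscale \<gamma>' q" by blast
      then have "bshift (x + y) = (h + h') + cscale (\<gamma> + \<gamma>') q" "h + h' \<in> K0"
        by (auto intro!: ell2_eqI simp: bshift_linear algebra_simps subspace_add[OF subspace_K0])
      then show "x + y \<in> {b. \<exists>h\<in>K0. \<exists>\<gamma>. bshift b = h + cscale \<gamma> q}" by blast
    next
      fix r :: real and x assume "x \<in> {b. \<exists>h\<in>K0. \<exists>\<gamma>. bshift b = h + cscale \<gamma> q}"
      then obtain h \<gamma> where "h \<in> K0" "bshift x = h + cscale \<gamma> q" by blast
      then have "bshift (r *\<^sub>R x) = cscale (of_real r) h + cscale (of_real r * \<gamma>) q" "cscale (of_real r) h \<in> K0"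
        by (simp_all add: scaleR_eq_cscale bshift_linear cscale_simps K0_cscale)
      then show "r *\<^sub>R x \<in> {b. \<exists>h\<in>K0. \<exists>\<gamma>. bshift b = h + cscale \<gamma> q}" by blast
    qed
    show "kernels \<subseteq> {b. \<exists>h\<in>K0. \<exists>\<gamma>. bshift b = h + cscale \<gamma> q}"
    proof
      fix y assume "y \<in> kernels"
      then obtain c w where y: "y = cscale c (ker w)" and w: "cmod w < 1" "w \<noteq> 0" by (auto simp: kernels_def)
      have "bshift y = cscale (c * cnj w) (ker w) + cscale (- (c * cnj (fn p w))) q"
        unfolding y bshift_linear bshift_ker[OF w(1)] by (rule ell2_eqI) (simp add: algebra_simps)
      moreover have "cscale (c * cnj w) (ker w) \<in> K0" using kernels_K0 w by (auto simp: kernels_def)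
      ultimately show "y \<in> {b. \<exists>h\<in>K0. \<exists>\<gamma>. bshift b = h + cscale \<gamma> q}" by blast
    qed
  qed
  then show ?thesis by simp
qed

text \<open>The backward shift of an element of \<open>K0\<close> is an element of \<open>K0\<close> plus a multiple of \<open>q\<close>, and both are in the domain
  of the closure of the extension map.\<close>

theorem isometric_if_reproducing: isometric
proof (rule isometricI[OF subspace_K0 K0_dense K0_extendable])
  fix b H assume b: "b \<in> K0" "ext b H"
  show "L2_norm \<mu> H = norm b" by (rule norm_eq_if_defect_0[OF b(2) defect_K0[OF b(1) b(1)]])
  obtain h \<gamma> where h: "h \<in> K0" "bshift b = h + cscale \<gamma> q" using K0_bshift[OF b(1)] by blast
  define U where "U = extension q"
  have U: "ext q U" unfolding U_def by (rule ext_extension[OF extendable_q])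
  note X = ext_extension[OF K0_extendable[OF h(1)]]
  have cl: "graph_closure K0 (bshift b) (\<lambda>\<omega>. extension h \<omega> + \<gamma> * U \<omega>)"
    unfolding h(2) by (rule graph_closure_add[OF subspace_K0 graph_closure_self[OF h(1) X] graph_closure_cscale[OF K0_cscale graph_closure_q[OF U]]])
  have e: "ext (bshift b) (\<lambda>\<omega>. extension h \<omega> + \<gamma> * U \<omega>)"
    unfolding h(2) by (rule ext_add[OF X ext_cscale[OF U]])
  note e' = ext_bshift[OF b(2)]
  show "graph_closure K0 (bshift b) (\<lambda>\<omega>. cnj \<omega> * (H \<omega> - coef b 0))"
    by (rule graph_closure_cong_AE[OF cl _ ext_unique(2)[OF e e']]) (use e' in \<open>simp add: ext_def\<close>)
qed

end

section \<open>The two sets of measures and the isometric extension\<close>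

context inner_circle
begin

lemma kernel_extension_iff:
  assumes \<phi>: "\<And>z. cmod z < 1 \<Longrightarrow> \<phi> z = fn p z" and z: "cmod z < 1"
  shows "is_extension \<mu> (\<lambda>w. model_kernel \<phi> w z) F \<longleftrightarrow> ext (ker z) F"
  by (rule is_extension_iff) (rule model_kernel_eq[OF \<phi> z])

lemma reproducing_measures_iff:
  assumes \<phi>: "\<And>z. cmod z < 1 \<Longrightarrow> \<phi> z = fn p z"
  shows "\<mu> \<in> reproducing_measures (model_kernel \<phi>) \<longleftrightarrow> isometric"
proof
  assume "\<mu> \<in> reproducing_measures (model_kernel \<phi>)"
  then obtain G where G: "\<And>z. z \<in> ball 0 1 \<Longrightarrow> is_extension \<mu> (\<lambda>w. model_kernel \<phi> w z) (G z)"
    "\<And>z w. z \<in> ball 0 1 \<Longrightarrow> w \<in> ball 0 1 \<Longrightarrow> model_kernel \<phi> w z = (\<integral>\<zeta>. G z \<zeta> * cnj (G w \<zeta>) \<partial>\<mu>)"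
    unfolding reproducing_measures_def by blast
  have e: "ext (ker z) (G z)" if "cmod z < 1" for z
    using G(1)[of z] kernel_extension_iff[OF \<phi> that] that by simp
  interpret reproducing p \<mu>
  proof
    fix z :: complex assume z: "cmod z < 1"
    show "extendable (ker z)" using e[OF z] by (auto simp: extendable_def)
    fix w :: complex assume w: "cmod w < 1"
    have "gram (ker z) (ker w) = model_kernel \<phi> w z"
      using G(2)[of z w] z w by (simp add: gram_eq[OF e[OF z] e[OF w]] L2_inner_def)
    also have "\<dots> = cinner (ker z) (ker w)"
      using model_kernel_eq[OF \<phi> z w] cinner_ker[OF ker_in_K[OF z] w] by simp
    finally show "defect (ker z) (ker w) = 0" by (simp add: defect_def)
  qed
  show isometric by (rule isometric_if_reproducing)
next
  assume iso: isometric
  have e: "ext (ker z) (extension (ker z))" if "cmod z < 1" for z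
    by (rule ext_extension[OF isometric_extendable[OF iso ker_in_K[OF that]]])
  have "model_kernel \<phi> w z = (\<integral>\<zeta>. extension (ker z) \<zeta> * cnj (extension (ker w) \<zeta>) \<partial>\<mu>)"
    if z: "cmod z < 1" and w: "cmod w < 1" for z w
  proof -
    have "model_kernel \<phi> w z = cinner (ker z) (ker w)"
      using model_kernel_eq[OF \<phi> z w] cinner_ker[OF ker_in_K[OF z] w] by simp
    also have "\<dots> = gram (ker z) (ker w)"
      using isometric_defect[OF iso ker_in_K[OF z] ker_in_K[OF w]] by (simp add: defect_def)
    finally show ?thesis by (simp add: gram_def L2_inner_def)
  qed
  then show "\<mu> \<in> reproducing_measures (model_kernel \<phi>)"
    unfolding reproducing_measures_def using circle e kernel_extension_iff[OF \<phi>]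
    by (auto intro!: exI[of _ "\<lambda>z. extension (ker z)"])
qed

lemma model_spaceI:
  assumes "\<And>z. cmod z < 1 \<Longrightarrow> \<phi> z = fn p z" "a \<in> K" "\<And>z. cmod z < 1 \<Longrightarrow> f z = fn a z"
  shows "f \<in> model_space \<phi>"
  using model_space_eq[OF assms(1)] assms(2,3) by blast

lemma model_disc_algebra_fn:
  assumes "\<And>z. cmod z < 1 \<Longrightarrow> \<phi> z = fn p z" "g \<in> model_disc_algebra \<phi>"
  shows "\<exists>a\<in>K. continuous_on (cball 0 1) g \<and> (\<forall>z. cmod z < 1 \<longrightarrow> g z = fn a z)"
  using assms(2) model_space_eq[OF assms(1)] by (auto simp: model_disc_algebra_def disc_algebra_def)

lemma isometric_measures_iff:
  assumes \<phi>: "\<And>z. cmod z < 1 \<Longrightarrow> \<phi> z = fn p z"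
  shows "\<mu> \<in> isometric_measures \<phi> \<longleftrightarrow> isometric"
proof
  assume \<mu>: "\<mu> \<in> isometric_measures \<phi>"
  show isometric
  proof (rule isometric_if_disc_algebra)
    fix a g assume a: "a \<in> K" and g: "continuous_on (cball 0 1) g" "\<And>z. cmod z < 1 \<Longrightarrow> g z = fn a z"
    have "g holomorphic_on ball 0 1"
      using fn_holomorphic[of a] by (rule holomorphic_transform) (simp add: g(2))
    then have "g \<in> model_disc_algebra \<phi>"
      using a g model_space_eq[OF \<phi>, of g] by (auto simp: model_disc_algebra_def disc_algebra_def)
    then have "(L2_norm \<mu> g)\<^sup>2 = (norm a)\<^sup>2"
      using \<mu> hardy2_norm_fn[of g a] g(2) by (simp add: isometric_measures_def L2_norm_power2)
    then show "L2_norm \<mu> g = norm a" by (rule power2_eq_imp_eq) (simp_all add: L2_norm_nonneg)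
  qed
next
  assume iso: isometric
  have "(\<integral>\<omega>. (cmod (g \<omega>))\<^sup>2 \<partial>\<mu>) = (hardy2_norm g)\<^sup>2" if gA: "g \<in> model_disc_algebra \<phi>" for g
  proof -
    obtain a where a: "a \<in> K" "continuous_on (cball 0 1) g" "\<And>z. cmod z < 1 \<Longrightarrow> g z = fn a z"
      using model_disc_algebra_fn[OF \<phi> gA] by blast
    have "L2_norm \<mu> g = norm a" by (rule isometric_norm[OF iso a(1) ext_disc_algebra[OF a(2,3)]])
    then show ?thesis using hardy2_norm_fn[of g a] a(3) by (simp flip: L2_norm_power2)
  qed
  then show "\<mu> \<in> isometric_measures \<phi>" by (simp add: isometric_measures_def circle)
qed

text \<open>The isometry is the extension map itself; uniqueness of extensions makes it linear.\<close>

lemma exists_isometric_extension: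
  assumes \<phi>: "\<And>z. cmod z < 1 \<Longrightarrow> \<phi> z = fn p z" and iso: isometric
  shows "\<exists>\<Phi>. is_isometric_extension \<phi> \<mu> \<Phi>"
proof -
  have "\<forall>f. \<exists>a. f \<in> model_space \<phi> \<longrightarrow> a \<in> K \<and> (\<forall>z. cmod z < 1 \<longrightarrow> f z = fn a z)"
    using model_space_eq[OF \<phi>] by blast
  from choice[OF this] obtain A where A: "\<And>f. f \<in> model_space \<phi> \<Longrightarrow> A f \<in> K"
    "\<And>f z. f \<in> model_space \<phi> \<Longrightarrow> cmod z < 1 \<Longrightarrow> f z = fn (A f) z" by blast
  define \<Phi> where "\<Phi> f = extension (A f)" for f
  have e: "ext a (\<Phi> f)" if "f \<in> model_space \<phi>" "\<And>z. cmod z < 1 \<Longrightarrow> f z = fn a z" for f a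
  proof -
    have "A f = a" by (rule fn_eq_imp_eq) (use A(2)[OF that(1)] that(2) in auto)
    then show ?thesis
      unfolding \<Phi>_def using ext_extension[OF isometric_extendable[OF iso A(1)[OF that(1)]]] by simp
  qed
  note eA = e[OF _ A(2)]
  have 1: "\<Phi> f \<in> L2_space \<mu> \<and> L2_norm \<mu> (\<Phi> f) = hardy2_norm f" if f: "f \<in> model_space \<phi>" for f
    using eA[OF f f] isometric_norm[OF iso A(1)[OF f] eA[OF f f]] hardy2_norm_fn[OF A(2)[OF f]]
    by (simp add: ext_def)
  have 2: "AE \<omega> in \<mu>. \<Phi> (\<lambda>z. a * f z + b * g z) \<omega> = a * \<Phi> f \<omega> + b * \<Phi> g \<omega>"
    if f: "f \<in> model_space \<phi>" and g: "g \<in> model_space \<phi>" for f g a b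
  proof -
    let ?c = "cscale a (A f) + cscale b (A g)"
    have c: "a * f z + b * g z = fn ?c z" if "cmod z < 1" for z
      using that A(2)[OF f that] A(2)[OF g that] by (simp add: fn_add fn_cscale)
    have cK: "?c \<in> K" using A(1) f g by (simp add: K_add K_cscale)
    have "(\<lambda>z. a * f z + b * g z) \<in> model_space \<phi>" by (intro model_spaceI[OF \<phi> cK c])
    from ext_unique(2)[OF e[OF this c] ext_add[OF ext_cscale[OF eA[OF f f]] ext_cscale[OF eA[OF g g]]]]
    show ?thesis .
  qed
  have 3: "AE \<omega> in \<mu>. \<Phi> g \<omega> = g \<omega>" if gA: "g \<in> model_disc_algebra \<phi>" for g
  proof -
    have g: "g \<in> model_space \<phi>" using gA by (simp add: model_disc_algebra_def)
    obtain a where a: "a \<in> K" "continuous_on (cball 0 1) g" "\<And>z. cmod z < 1 \<Longrightarrow> g z = fn a z"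
      using model_disc_algebra_fn[OF \<phi> gA] by blast
    show ?thesis by (rule ext_unique(2)[OF e[OF g a(3)] ext_disc_algebra[OF a(2,3)]])
  qed
  show ?thesis unfolding is_isometric_extension_def using 1 2 3 by blast
qed

text \<open>An isometric extension is determined by its values on the dense disc algebra part, so its graph lies in the closure
  of the graph of the extension map.\<close>

lemma isometric_extension_dilate:
  assumes \<phi>: "\<And>z. cmod z < 1 \<Longrightarrow> \<phi> z = fn p z" and iso: isometric
    and \<Phi>: "is_isometric_extension \<phi> \<mu> \<Phi>" and f: "f \<in> model_space \<phi>"
  shows "((\<lambda>r. L2_norm \<mu> (\<lambda>\<omega>. \<Phi> f \<omega> - dilate f r \<omega>)) \<longlongrightarrow> 0) (at_left 1)"
proof -
  obtain a where a: "a \<in> K" "\<And>z. cmod z < 1 \<Longrightarrow> f z = fn a z" using f model_space_eq[OF \<phi>] by blast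
  have L2: "\<Phi> h \<in> L2_space \<mu>" "L2_norm \<mu> (\<Phi> h) = hardy2_norm h" if "h \<in> model_space \<phi>" for h
    using \<Phi> that by (auto simp: is_isometric_extension_def)
  have cl: "graph_closure K_disc a (\<Phi> f)"
    unfolding graph_closure_def
  proof (intro conjI allI impI L2(1)[OF f])
    fix \<epsilon> :: real assume e: "0 < \<epsilon>"
    have "a \<in> closure K_disc" using disc_algebra_dense a(1) by blast
    then obtain b where b: "b \<in> K" "in_disc_algebra b" "dist b a < \<epsilon>" using e unfolding closure_approachable by blast
    then obtain g where g: "continuous_on (cball 0 1) g" "\<And>z. cmod z < 1 \<Longrightarrow> g z = fn b z"
      unfolding in_disc_algebra_def by blast
    have "g holomorphic_on ball 0 1"
      using fn_holomorphic[of b] by (rule holomorphic_transform) (simp add: g(2))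
    moreover have gM: "g \<in> model_space \<phi>" by (rule model_spaceI[OF \<phi> b(1) g(2)])
    ultimately have gA: "g \<in> model_disc_algebra \<phi>" using g(1) by (simp add: model_disc_algebra_def disc_algebra_def)
    define h where "h = (\<lambda>z. 1 * f z + (- 1) * g z)"
    have h: "h z = fn (a - b) z" if "cmod z < 1" for z using that a(2) g(2) by (simp add: h_def fn_diff)
    have hM: "h \<in> model_space \<phi>" by (rule model_spaceI[OF \<phi> K_diff[OF a(1) b(1)] h])
    have "AE \<omega> in \<mu>. \<Phi> h \<omega> = 1 * \<Phi> f \<omega> + (- 1) * \<Phi> g \<omega>"
      using \<Phi> f gM unfolding is_isometric_extension_def h_def by blast
    moreover have "AE \<omega> in \<mu>. \<Phi> g \<omega> = g \<omega>" using \<Phi> gA unfolding is_isometric_extension_def by blast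
    ultimately have eq: "AE \<omega> in \<mu>. \<Phi> f \<omega> - g \<omega> = \<Phi> h \<omega>" by eventually_elim simp
    note eg = ext_disc_algebra[OF g]
    have "(\<lambda>\<omega>. \<Phi> f \<omega> - g \<omega>) \<in> L2_space \<mu>" using eg by (intro L2_space_diff L2(1) f) (simp add: ext_def)
    then have "L2_norm \<mu> (\<lambda>\<omega>. \<Phi> f \<omega> - g \<omega>) = L2_norm \<mu> (\<Phi> h)"
      using L2(1)[OF hM] by (intro L2_norm_cong_AE eq) (auto simp: L2_space_def)
    also have "\<dots> = norm (a - b)" unfolding L2(2)[OF hM] by (rule hardy2_norm_fn[OF h])
    finally show "\<exists>b\<in>K_disc. \<exists>H. ext b H \<and> norm (a - b) < \<epsilon> \<and> L2_norm \<mu> (\<lambda>\<omega>. \<Phi> f \<omega> - H \<omega>) < \<epsilon>"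
      using b eg by (intro bexI[of _ b] exI[of _ g]) (auto simp: dist_norm norm_minus_commute)
  qed
  have "ext a (\<Phi> f)"
    by (rule ext_of_closure(1)[OF _ K_disc_inv cl]) (use isometric_norm[OF iso] in auto)
  then have "is_extension \<mu> f (\<Phi> f)" using is_extension_iff[of f a] a(2) by blast
  then show ?thesis by (simp add: is_extension_def)
qed

end

theorem theorem3p8:
  fixes \<phi> :: "complex \<Rightarrow> complex"
  assumes "inner_function \<phi>"
  shows "reproducing_measures (model_kernel \<phi>) = isometric_measures \<phi> \<and>
    (\<forall>\<mu>\<in>isometric_measures \<phi>.
       (\<exists>\<Phi>. is_isometric_extension \<phi> \<mu> \<Phi>) \<and>
       (\<forall>\<Phi>. is_isometric_extension \<phi> \<mu> \<Phi> \<longrightarrow>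
          (\<forall>f\<in>model_space \<phi>.
             ((\<lambda>r. L2_norm \<mu> (\<lambda>\<omega>. \<Phi> f \<omega> - dilate f r \<omega>)) \<longlongrightarrow> 0) (at_left 1))))"
proof -
  obtain p where p: "inner_seq p" and \<phi>: "\<And>z. cmod z < 1 \<Longrightarrow> \<phi> z = fn p z"
    using inner_function_fn[OF assms] by blast
  have loc: "inner_circle p \<mu>" if "is_circle_measure \<mu>" for \<mu>
    using p that by (simp add: inner_circle_def inner_fn_def circle_measure_def)
  have circle: "is_circle_measure \<mu>"
    if "\<mu> \<in> reproducing_measures (model_kernel \<phi>) \<or> \<mu> \<in> isometric_measures \<phi>" for \<mu>
    using that by (auto simp: reproducing_measures_def isometric_measures_def)
  have "reproducing_measures (model_kernel \<phi>) = isometric_measures \<phi>"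
    using inner_circle.reproducing_measures_iff[OF loc \<phi>] inner_circle.isometric_measures_iff[OF loc \<phi>] circle
    by blast
  moreover have "(\<exists>\<Phi>. is_isometric_extension \<phi> \<mu> \<Phi>) \<and>
       (\<forall>\<Phi>. is_isometric_extension \<phi> \<mu> \<Phi> \<longrightarrow>
          (\<forall>f\<in>model_space \<phi>.
             ((\<lambda>r. L2_norm \<mu> (\<lambda>\<omega>. \<Phi> f \<omega> - dilate f r \<omega>)) \<longlongrightarrow> 0) (at_left 1)))"
    if \<mu>: "\<mu> \<in> isometric_measures \<phi>" for \<mu>
  proof -
    interpret inner_circle p \<mu> using \<mu> circle by (intro loc) blast
    have iso: isometric using isometric_measures_iff[OF \<phi>] \<mu> by blast
    show ?thesis using exists_isometric_extension[OF \<phi> iso] isometric_extension_dilate[OF \<phi> iso] by blast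
  qed
  ultimately show ?thesis by blast
qed

end
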